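(* Let $A$ be a noetherian integral domain and $0\neq I\subseteq A$ an ideal. Then the following are equivalent. (1) The blow-up $\tilde{X}$ of $X=\operatorname{Spec} A$ along $I$ is affine. (2) The extended ideal $IA_{\mathrm{nor}}$ in the normalization $A_{\mathrm{nor}}$ of $A$ is invertible. (3) There is an integral ring extension $A\subseteq B$ with $B$ an integral domain such that the extended ideal $IB$ is invertible. (4) There is a finite ring extension $A\subseteq R$ with $R$ an integral domain such that the extended ideal $IR$ is invertible.
   Context: The blow-up of $\operatorname{Spec} A$ along $I$ is $\tilde{X}=\operatorname{Proj}\bigoplus_{n\geq 0}I^n$. The normalization $A_{\mathrm{nor}}$ is the integral closure of $A$ in its field of fractions. An ideal $J$ of an integral domain is invertible if it is finitely generated and locally generated by a non-zero-divisor (equivalently $JJ'=$ the ring for some fractional ideal $J'$). In (3), $B$ is not assumed noetherian. *)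

theory Defs
  imports "HOL-Algebra.Algebra" "HOL-Analysis.Abstract_Topology"
begin

section \<open>Localization of a commutative ring at a multiplicative subset\<close>

text \<open>The fraction \<open>a/s\<close> is the set of all pairs \<open>(b, t)\<close> with \<open>u (t a) = u (s b)\<close> for some
  \<open>u \<in> S\<close>.\<close>

definition fraction :: "('a, 'm) ring_scheme \<Rightarrow> 'a set \<Rightarrow> 'a \<Rightarrow> 'a \<Rightarrow> ('a \<times> 'a) set" where
  "fraction R S a s =
     {(b, t). b \<in> carrier R \<and> t \<in> S \<and>
        (\<exists>u\<in>S. u \<otimes>\<^bsub>R\<^esub> (t \<otimes>\<^bsub>R\<^esub> a) = u \<otimes>\<^bsub>R\<^esub> (s \<otimes>\<^bsub>R\<^esub> b))}"

text \<open>The unions in the operations run over all representatives; all of them contribute the same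
  class.\<close>

definition localization :: "('a, 'm) ring_scheme \<Rightarrow> 'a set \<Rightarrow> ('a \<times> 'a) set ring" where
  "localization R S =
     \<lparr> carrier = {fraction R S a s | a s. a \<in> carrier R \<and> s \<in> S},
       monoid.mult = (\<lambda>x y. \<Union>(a, s)\<in>x. \<Union>(b, t)\<in>y. fraction R S (a \<otimes>\<^bsub>R\<^esub> b) (s \<otimes>\<^bsub>R\<^esub> t)),
       one = fraction R S \<one>\<^bsub>R\<^esub> \<one>\<^bsub>R\<^esub>,
       ring.zero = fraction R S \<zero>\<^bsub>R\<^esub> \<one>\<^bsub>R\<^esub>,
       ring.add = (\<lambda>x y. \<Union>(a, s)\<in>x. \<Union>(b, t)\<in>y.
                fraction R S ((t \<otimes>\<^bsub>R\<^esub> a) \<oplus>\<^bsub>R\<^esub> (s \<otimes>\<^bsub>R\<^esub> b)) (s \<otimes>\<^bsub>R\<^esub> t)) \<rparr>"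

definition fraction_field :: "('a, 'm) ring_scheme \<Rightarrow> ('a \<times> 'a) set ring" where
  "fraction_field A = localization A (carrier A - {\<zero>\<^bsub>A\<^esub>})"

definition to_fraction_field :: "('a, 'm) ring_scheme \<Rightarrow> 'a \<Rightarrow> ('a \<times> 'a) set" where
  "to_fraction_field A a = fraction A (carrier A - {\<zero>\<^bsub>A\<^esub>}) a \<one>\<^bsub>A\<^esub>"


section \<open>Ring extensions, normalization, extended and invertible ideals\<close>

text \<open>An extension \<open>A \<subseteq> B\<close> is given by an injective ring homomorphism, so that \<open>B\<close> may live on
  another type.\<close>

definition ring_extension ::
    "('a, 'm) ring_scheme \<Rightarrow> ('b, 'n) ring_scheme \<Rightarrow> ('a \<Rightarrow> 'b) \<Rightarrow> bool" where
  "ring_extension A B \<phi> \<longleftrightarrow> ring_hom_ring A B \<phi> \<and> inj_on \<phi> (carrier A)"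

definition integral_element ::
    "('a, 'm) ring_scheme \<Rightarrow> ('b, 'n) ring_scheme \<Rightarrow> ('a \<Rightarrow> 'b) \<Rightarrow> 'b \<Rightarrow> bool" where
  "integral_element A B \<phi> b \<longleftrightarrow>
     (\<exists>(n::nat). \<exists>c \<in> {..<n} \<rightarrow> carrier A.
        b [^]\<^bsub>B\<^esub> n \<oplus>\<^bsub>B\<^esub> (\<Oplus>\<^bsub>B\<^esub>i\<in>{..<n}. \<phi> (c i) \<otimes>\<^bsub>B\<^esub> b [^]\<^bsub>B\<^esub> i) = \<zero>\<^bsub>B\<^esub>)"

definition integral_extension ::
    "('a, 'm) ring_scheme \<Rightarrow> ('b, 'n) ring_scheme \<Rightarrow> ('a \<Rightarrow> 'b) \<Rightarrow> bool" where
  "integral_extension A B \<phi> \<longleftrightarrow>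
     ring_extension A B \<phi> \<and> (\<forall>b\<in>carrier B. integral_element A B \<phi> b)"

text \<open>Finite means finitely generated as a module over the base ring.\<close>

definition finite_extension ::
    "('a, 'm) ring_scheme \<Rightarrow> ('b, 'n) ring_scheme \<Rightarrow> ('a \<Rightarrow> 'b) \<Rightarrow> bool" where
  "finite_extension A B \<phi> \<longleftrightarrow>
     ring_extension A B \<phi> \<and>
     (\<exists>E \<subseteq> carrier B. finite E \<and>
        (\<forall>b\<in>carrier B. \<exists>c \<in> E \<rightarrow> carrier A. b = (\<Oplus>\<^bsub>B\<^esub>e\<in>E. \<phi> (c e) \<otimes>\<^bsub>B\<^esub> e)))"

definition normalization :: "('a, 'm) ring_scheme \<Rightarrow> ('a \<times> 'a) set ring" where
  "normalization A =
     (fraction_field A)\<lparr>carrier :=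
        {x \<in> carrier (fraction_field A).
           integral_element A (fraction_field A) (to_fraction_field A) x}\<rparr>"

definition extended_ideal :: "('b, 'n) ring_scheme \<Rightarrow> ('a \<Rightarrow> 'b) \<Rightarrow> 'a set \<Rightarrow> 'b set" where
  "extended_ideal B \<phi> I = Idl\<^bsub>B\<^esub> (\<phi> ` I)"

definition nonzerodivisor :: "('a, 'm) ring_scheme \<Rightarrow> 'a \<Rightarrow> bool" where
  "nonzerodivisor R g \<longleftrightarrow>
     g \<in> carrier R \<and> (\<forall>x\<in>carrier R. g \<otimes>\<^bsub>R\<^esub> x = \<zero>\<^bsub>R\<^esub> \<longrightarrow> x = \<zero>\<^bsub>R\<^esub>)"

text \<open>Locally generated by a non-zero-divisor: so is the extension of the ideal to the local ring
  at every prime ideal.\<close>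

definition invertible_ideal :: "('a, 'm) ring_scheme \<Rightarrow> 'a set \<Rightarrow> bool" where
  "invertible_ideal R J \<longleftrightarrow>
     ideal J R \<and>
     (\<exists>E \<subseteq> carrier R. finite E \<and> J = Idl\<^bsub>R\<^esub> E) \<and>
     (\<forall>P. primeideal P R \<longrightarrow>
        (let L = localization R (carrier R - P) in
           \<exists>g. nonzerodivisor L g \<and>
             extended_ideal L (\<lambda>a. fraction R (carrier R - P) a \<one>\<^bsub>R\<^esub>) J = PIdl\<^bsub>L\<^esub> g))"


section \<open>Ringed spaces\<close>

record ('x, 's) ringed_space =
  space_topology :: "'x topology"
  sections :: "'x set \<Rightarrow> 's ring"
  restriction :: "'x set \<Rightarrow> 'x set \<Rightarrow> 's \<Rightarrow> 's"

text \<open>Isomorphisms of ringed spaces induce ring isomorphisms on stalks. Hence, between locally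
  ringed spaces, they are the same as isomorphisms of locally ringed spaces.\<close>

definition ringed_space_iso ::
    "('x, 's) ringed_space \<Rightarrow> ('y, 't) ringed_space \<Rightarrow>
     ('x \<Rightarrow> 'y) \<Rightarrow> ('y set \<Rightarrow> 't \<Rightarrow> 's) \<Rightarrow> bool" where
  "ringed_space_iso M N f F \<longleftrightarrow>
     homeomorphic_map (space_topology M) (space_topology N) f \<and>
     (\<forall>V. openin (space_topology N) V \<longrightarrow>
        F V \<in> ring_iso (sections N V) (sections M (f -` V \<inter> topspace (space_topology M)))) \<and>
     (\<forall>V W. openin (space_topology N) V \<and> openin (space_topology N) W \<and> W \<subseteq> V \<longrightarrow>
        (\<forall>s \<in> carrier (sections N V).
           F W (restriction N V W s) =
             restriction M (f -` V \<inter> topspace (space_topology M))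
               (f -` W \<inter> topspace (space_topology M)) (F V s)))"

definition isomorphic_ringed_spaces ::
    "('x, 's) ringed_space \<Rightarrow> ('y, 't) ringed_space \<Rightarrow> bool" where
  "isomorphic_ringed_spaces M N \<longleftrightarrow> (\<exists>f F. ringed_space_iso M N f F)"

text \<open>The sheaf, with restriction of functions, whose sections over \<open>U\<close> are the families
  \<open>(s p)\<close>, \<open>p \<in> U\<close>, with \<open>s p\<close> in the ring \<open>L p\<close>, that locally belong to \<open>C\<close>.\<close>

definition local_family_space ::
    "'x topology \<Rightarrow> ('x \<Rightarrow> 's ring) \<Rightarrow> ('x set \<Rightarrow> ('x \<Rightarrow> 's) set) \<Rightarrow>
     ('x, 'x \<Rightarrow> 's) ringed_space" where
  "local_family_space T L C =
     \<lparr> space_topology = T,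
       sections = (\<lambda>U.
         \<lparr> carrier = {s \<in> (\<Pi>\<^sub>E p\<in>U. carrier (L p)).
             \<forall>p\<in>U. \<exists>V. openin T V \<and> p \<in> V \<and> V \<subseteq> U \<and> restrict s V \<in> C V},
           monoid.mult = (\<lambda>s t. \<lambda>p\<in>U. s p \<otimes>\<^bsub>L p\<^esub> t p),
           one = (\<lambda>p\<in>U. \<one>\<^bsub>L p\<^esub>),
           ring.zero = (\<lambda>p\<in>U. \<zero>\<^bsub>L p\<^esub>),
           ring.add = (\<lambda>s t. \<lambda>p\<in>U. s p \<oplus>\<^bsub>L p\<^esub> t p) \<rparr>),
       restriction = (\<lambda>U V s. restrict s V) \<rparr>"


section \<open>The spectrum of a commutative ring\<close>

definition prime_spectrum :: "('a, 'm) ring_scheme \<Rightarrow> 'a set set" where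
  "prime_spectrum R = {P. primeideal P R}"

definition zariski_open :: "('a, 'm) ring_scheme \<Rightarrow> 'a set set \<Rightarrow> bool" where
  "zariski_open R U \<longleftrightarrow>
     (\<exists>E \<subseteq> carrier R. U = prime_spectrum R - {P \<in> prime_spectrum R. E \<subseteq> P})"

definition zariski_topology :: "('a, 'm) ring_scheme \<Rightarrow> 'a set topology" where
  "zariski_topology R = topology (zariski_open R)"

lemma istopology_zariski_open: "istopology (zariski_open R)"
  unfolding istopology_def
proof (intro conjI allI impI)
  fix U V
  assume "zariski_open R U" "zariski_open R V"
  then obtain E F where E: "E \<subseteq> carrier R" "U = prime_spectrum R - {P \<in> prime_spectrum R. E \<subseteq> P}"
    and F: "F \<subseteq> carrier R" "V = prime_spectrum R - {P \<in> prime_spectrum R. F \<subseteq> P}"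
    unfolding zariski_open_def by blast
  define G where "G = {e \<otimes>\<^bsub>R\<^esub> f | e f. e \<in> E \<and> f \<in> F}"
  have iff: "G \<subseteq> P \<longleftrightarrow> E \<subseteq> P \<or> F \<subseteq> P" if "P \<in> prime_spectrum R" for P
  proof -
    interpret P: primeideal P R
      using that by (simp add: prime_spectrum_def)
    show ?thesis
    proof
      assume G: "G \<subseteq> P"
      show "E \<subseteq> P \<or> F \<subseteq> P"
      proof (rule ccontr)
        assume "\<not> (E \<subseteq> P \<or> F \<subseteq> P)"
        then obtain e f where "e \<in> E" "e \<notin> P" "f \<in> F" "f \<notin> P" by blast
        moreover have "e \<otimes>\<^bsub>R\<^esub> f \<in> P"
          using G \<open>e \<in> E\<close> \<open>f \<in> F\<close> by (auto simp: G_def)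
        ultimately show False
          using P.I_prime E(1) F(1) by blast
      qed
    next
      assume "E \<subseteq> P \<or> F \<subseteq> P"
      then have "e \<otimes>\<^bsub>R\<^esub> f \<in> P" if "e \<in> E" "f \<in> F" for e f
        using that E(1) F(1) P.I_l_closed[of f e] P.I_r_closed[of e f] by (meson subsetD)
      then show "G \<subseteq> P"
        by (auto simp: G_def)
    qed
  qed
  have "G \<subseteq> carrier R" if "P \<in> prime_spectrum R" for P
  proof -
    interpret P: primeideal P R
      using that by (simp add: prime_spectrum_def)
    show ?thesis using E(1) F(1) by (auto simp: G_def)
  qed
  moreover have "U \<inter> V = prime_spectrum R - {P \<in> prime_spectrum R. G \<subseteq> P}"
    using iff E(2) F(2) by auto
  ultimately have "\<exists>H\<subseteq>carrier R. U \<inter> V = prime_spectrum R - {P \<in> prime_spectrum R. H \<subseteq> P}"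
    by (cases "prime_spectrum R = {}") blast+
  then show "zariski_open R (U \<inter> V)"
    unfolding zariski_open_def .
next
  fix K
  assume K: "\<forall>U\<in>K. zariski_open R U"
  define E where "E = \<Union>{E. E \<subseteq> carrier R \<and> prime_spectrum R - {P \<in> prime_spectrum R. E \<subseteq> P} \<in> K}"
  have "E \<subseteq> carrier R" by (auto simp: E_def)
  moreover have "\<Union>K = prime_spectrum R - {P \<in> prime_spectrum R. E \<subseteq> P}"
  proof (intro equalityI subsetI)
    fix P assume "P \<in> \<Union>K"
    then obtain U where U: "U \<in> K" "P \<in> U" by blast
    with K obtain D where "D \<subseteq> carrier R" "U = prime_spectrum R - {P \<in> prime_spectrum R. D \<subseteq> P}"
      unfolding zariski_open_def by blast
    with U show "P \<in> prime_spectrum R - {P \<in> prime_spectrum R. E \<subseteq> P}"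
      by (auto simp: E_def)
  next
    fix P assume "P \<in> prime_spectrum R - {P \<in> prime_spectrum R. E \<subseteq> P}"
    then obtain D where "P \<in> prime_spectrum R" "\<not> D \<subseteq> P"
      "prime_spectrum R - {P \<in> prime_spectrum R. D \<subseteq> P} \<in> K"
      unfolding E_def by auto
    then show "P \<in> \<Union>K" by blast
  qed
  ultimately show "zariski_open R (\<Union>K)"
    unfolding zariski_open_def by blast
qed

lemma openin_zariski_topology: "openin (zariski_topology R) U \<longleftrightarrow> zariski_open R U"
  by (simp add: zariski_topology_def topology_inverse' istopology_zariski_open)

definition Spec :: "('a, 'm) ring_scheme \<Rightarrow> ('a set, 'a set \<Rightarrow> ('a \<times> 'a) set) ringed_space" where
  "Spec R = local_family_space (zariski_topology R)
     (\<lambda>p. localization R (carrier R - p))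
     (\<lambda>V. {\<lambda>p\<in>V. fraction R (carrier R - p) a f | a f.
             a \<in> carrier R \<and> f \<in> carrier R \<and> (\<forall>p\<in>V. f \<notin> p)})"

text \<open>A ring with spectrum \<open>M\<close> is isomorphic to the ring of global sections of \<open>M\<close>. So it is no
  restriction that \<open>R\<close> ranges over the rings on the type of the sections.\<close>

definition is_affine :: "('x, 's) ringed_space \<Rightarrow> bool" where
  "is_affine M \<longleftrightarrow> (\<exists>R :: 's ring. cring R \<and> isomorphic_ringed_spaces M (Spec R))"


section \<open>Proj of a graded ring\<close>

text \<open>The grading of \<open>S\<close> is given by its homogeneous parts \<open>G 0\<close>, \<open>G 1\<close>, \<dots>\<close>

definition homogeneous_prime :: "('a, 'm) ring_scheme \<Rightarrow> (nat \<Rightarrow> 'a set) \<Rightarrow> 'a set \<Rightarrow> bool" where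
  "homogeneous_prime S G P \<longleftrightarrow> primeideal P S \<and> P = Idl\<^bsub>S\<^esub> (P \<inter> (\<Union>n. G n))"

definition irrelevant_ideal :: "('a, 'm) ring_scheme \<Rightarrow> (nat \<Rightarrow> 'a set) \<Rightarrow> 'a set" where
  "irrelevant_ideal S G = Idl\<^bsub>S\<^esub> (\<Union>n\<in>{0<..}. G n)"

definition proj_points :: "('a, 'm) ring_scheme \<Rightarrow> (nat \<Rightarrow> 'a set) \<Rightarrow> 'a set set" where
  "proj_points S G = {P. homogeneous_prime S G P \<and> \<not> irrelevant_ideal S G \<subseteq> P}"

text \<open>The degree zero part of the localization at the homogeneous elements outside \<open>P\<close>.\<close>

definition homogeneous_localization ::
    "('a, 'm) ring_scheme \<Rightarrow> (nat \<Rightarrow> 'a set) \<Rightarrow> 'a set \<Rightarrow> ('a \<times> 'a) set ring" where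
  "homogeneous_localization S G P =
     (let T = (\<Union>n. G n) - P in
       (localization S T)\<lparr>carrier := {fraction S T a f | n a f. a \<in> G n \<and> f \<in> G n - P}\<rparr>)"

definition Proj ::
    "('a, 'm) ring_scheme \<Rightarrow> (nat \<Rightarrow> 'a set) \<Rightarrow>
     ('a set, 'a set \<Rightarrow> ('a \<times> 'a) set) ringed_space" where
  "Proj S G = local_family_space
     (subtopology (zariski_topology S) (proj_points S G))
     (homogeneous_localization S G)
     (\<lambda>V. {\<lambda>p\<in>V. fraction S ((\<Union>n. G n) - p) a f | n a f.
             a \<in> G n \<and> f \<in> G n \<and> (\<forall>p\<in>V. f \<notin> p)})"


section \<open>The blow-up\<close>

abbreviation ideal_power :: "('a, 'm) ring_scheme \<Rightarrow> 'a set \<Rightarrow> nat \<Rightarrow> 'a set" where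
  "ideal_power A I n \<equiv> I [^]\<^bsub>ideals_set A\<^esub> n"

text \<open>The direct sum of the powers of \<open>I\<close>, as the ring of polynomials with \<open>n\<close>-th coefficient in
  the \<open>n\<close>-th power of \<open>I\<close>.\<close>

definition rees_algebra :: "('a, 'm) ring_scheme \<Rightarrow> 'a set \<Rightarrow> (nat \<Rightarrow> 'a) ring" where
  "rees_algebra A I =
     \<lparr> carrier = {p \<in> carrier (UP A). \<forall>n. up_ring.coeff (UP A) p n \<in> ideal_power A I n},
       monoid.mult = (\<otimes>\<^bsub>UP A\<^esub>), one = \<one>\<^bsub>UP A\<^esub>, ring.zero = \<zero>\<^bsub>UP A\<^esub>, ring.add = (\<oplus>\<^bsub>UP A\<^esub>) \<rparr>"

definition rees_part :: "('a, 'm) ring_scheme \<Rightarrow> 'a set \<Rightarrow> nat \<Rightarrow> (nat \<Rightarrow> 'a) set" where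
  "rees_part A I n = (\<lambda>x. up_ring.monom (UP A) x n) ` ideal_power A I n"

definition blow_up ::
    "('a, 'm) ring_scheme \<Rightarrow> 'a set \<Rightarrow>
     ((nat \<Rightarrow> 'a) set, (nat \<Rightarrow> 'a) set \<Rightarrow> ((nat \<Rightarrow> 'a) \<times> (nat \<Rightarrow> 'a)) set) ringed_space" where
  "blow_up A I = Proj (rees_algebra A I) (rees_part A I)"

end

(* Let K be a field containing A. All conditions are compared with the following one: the ideal
   generated in K by I (I^m : I^(m+1)) contains 1 for some m. Cleared of denominators, this is
   conductor_condition, a statement about A alone, and so independent of K.

   Let B be integral over A with IB invertible. Then 1 is a sum of products a_i x_i with a_i in I
   and x_i I contained in B. For f = sum a_i t^i there is a polynomial v over K such that f v = s is
   in A[t], but not in m[t], for a given maximal ideal m, and z v is integral over A[t] for z in I.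
   As I is finitely generated, v s^N I^(N+1) is contained in I^N[t] for large N. Hence the
   coefficients of v s^N lie in (I^N : I^(N+1)), those of f v s^N = s^(N+1) in
   I (I^N : I^(N+1)), and one of the latter lies outside m.

   Conversely, R = (I^m : I^m) is then a finite extension in which I becomes invertible, and the
   local ring of the blow-up at P, as a subring of K, is the one of R at the prime ideal of all z
   with z I^m t^m contained in P. So the blow-up is isomorphic to Spec R.

   If the blow-up is isomorphic to Spec D, then the sections defined by the elements of D are
   elements of K which, for every nonzero a in I, lie in A[I/a]. Hence they are integral over A. As
   I is locally generated by one element on the blow-up, D generates an integral extension of A in
   which I becomes invertible. *)
theory Submission
  imports Defs
begin

section \<open>Commutative rings\<close>

text \<open>The obstacle is that an invertible \<open>IB\<close> is principal only locally, while
  \<open>B\<close> need be neither finite over \<open>A\<close> nor noetherian. The variable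
  \<open>t\<close> removes the first difficulty: with g = sum x_(n-i) t^i the product h = f g lies
  in \<open>B[t]\<close> and has a coefficient \<open>1\<close>, and z h = f (z g) for z in
  \<open>I\<close>; so \<open>f\<close> generates \<open>I\<close> up to the factor
  \<open>h\<close>. Such an \<open>h\<close> can be cancelled modulo every extended ideal (McCoy),
  and this turns a monic equation of \<open>h\<close> into h w = s with s in \<open>A[t]\<close>
  outside a given prime; then v = g w. The exponent N comes from integrality: the elements z v are
  fractions with denominator \<open>f\<close>, and their products need only a bounded power of it.

  The exponents m and m+1 fit together because I (I^m : I^(m+1)) is contained in R = (I^m : I^m), so
  that (I^m : I^(m+1)) consists of inverses of \<open>I\<close> over \<open>R\<close>.

  Points of the blow-up are described by a prime \<open>q\<close> of a subring of \<open>K\<close>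
  and an element \<open>y\<close> taking the place of \<open>t\<close>: y = 1/a gives the chart
  where \<open>a\<close> generates \<open>I\<close>, and y in (R : I) gives the inverse of the map
  to Spec R.\<close>

lemma (in cring) exists_maximal_ideal:
  assumes J: "ideal J R" and "\<one> \<notin> J"
  shows "\<exists>M. maximalideal M R \<and> J \<subseteq> M"
proof -
  define \<A> where "\<A> = {I. ideal I R \<and> J \<subseteq> I \<and> \<one> \<notin> I}"
  have "\<exists>M\<in>\<A>. \<forall>Z\<in>\<A>. M \<subseteq> Z \<longrightarrow> Z = M"
  proof (rule subset_Zorn_nonempty)
    show "\<A> \<noteq> {}" using assms by (auto simp: \<A>_def)
  next
    fix C assume C: "C \<noteq> {}" "subset.chain \<A> C"
    have "subset.chain {I. ideal I R} C"
      using C(2) by (auto simp: pred_on.chain_def \<A>_def)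
    then have "ideal (\<Union>C) R"
      using chain_Union_is_ideal[of C] C(1) by auto
    moreover obtain I where "I \<in> C" using C(1) by blast
    then have "J \<subseteq> \<Union>C" using C(2) by (auto simp: pred_on.chain_def \<A>_def)
    moreover have "\<one> \<notin> \<Union>C"
      using C(2) by (auto simp: pred_on.chain_def \<A>_def)
    ultimately show "\<Union>C \<in> \<A>" by (simp add: \<A>_def)
  qed
  then obtain M where M: "M \<in> \<A>" and max: "\<And>Z. Z \<in> \<A> \<Longrightarrow> M \<subseteq> Z \<Longrightarrow> Z = M" by blast
  have "maximalideal M R"
  proof (rule maximalidealI)
    show "ideal M R" "carrier R \<noteq> M" using M by (auto simp: \<A>_def)
  next
    fix I assume I: "ideal I R" "M \<subseteq> I" "I \<subseteq> carrier R"
    show "I = M \<or> I = carrier R"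
    proof (cases "\<one> \<in> I")
      case True
      then show ?thesis using ideal.one_imp_carrier[OF I(1)] by simp
    next
      case False
      then show ?thesis using max[of I] I M by (auto simp: \<A>_def)
    qed
  qed
  then show ?thesis using M by (auto simp: \<A>_def)
qed

lemma (in cring) exists_prime_ideal:
  assumes "ideal J R" and "\<one> \<notin> J"
  shows "\<exists>P. primeideal P R \<and> J \<subseteq> P"
  using exists_maximal_ideal[OF assms] maximalideal_prime by blast

lemma (in cring) idealI_cring:
  assumes "I \<subseteq> carrier R" "\<zero> \<in> I"
    and "\<And>x y. x \<in> I \<Longrightarrow> y \<in> I \<Longrightarrow> x \<oplus> y \<in> I"
    and "\<And>a x. a \<in> carrier R \<Longrightarrow> x \<in> I \<Longrightarrow> a \<otimes> x \<in> I"
  shows "ideal I R"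
proof (rule idealI)
  show "ring R" by (rule ring_axioms)
  show "subgroup I (add_monoid R)"
  proof (rule add.subgroupI)
    fix a assume a: "a \<in> I"
    then have "\<ominus> a = (\<ominus> \<one>) \<otimes> a" using assms(1) by (simp add: l_minus subsetD)
    then show "\<ominus> a \<in> I" using assms(4)[of "\<ominus> \<one>" a] a by simp
  qed (use assms in auto)
next
  fix a x assume "a \<in> I" "x \<in> carrier R"
  then show "x \<otimes> a \<in> I" "a \<otimes> x \<in> I" using assms(1) assms(4)[of x a] m_comm[of a x] by auto
qed

lemma primeideal_one_notin: "primeideal P R \<Longrightarrow> \<one>\<^bsub>R\<^esub> \<notin> P"
  by (metis ideal.one_imp_carrier primeideal.I_notcarr primeideal.axioms(1))

lemma (in field) nonzero_inv:
  assumes "x \<in> carrier R" "x \<noteq> \<zero>"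
  shows "inv x \<in> carrier R" "x \<otimes> inv x = \<one>" "inv x \<otimes> x = \<one>" "inv x \<noteq> \<zero>"
proof -
  have U: "x \<in> Units R" using assms by (simp add: field_Units)
  then show *: "inv x \<in> carrier R" "x \<otimes> inv x = \<one>" "inv x \<otimes> x = \<one>" by simp_all
  then show "inv x \<noteq> \<zero>" using assms by auto
qed

lemma (in field) inv_mult_field:
  assumes "x \<in> carrier R" "y \<in> carrier R" "x \<noteq> \<zero>" "y \<noteq> \<zero>"
  shows "inv (x \<otimes> y) = inv x \<otimes> inv y"
proof (rule comm_inv_char)
  have "x \<otimes> y \<otimes> (inv x \<otimes> inv y) = (x \<otimes> inv x) \<otimes> (y \<otimes> inv y)"
    using assms nonzero_inv by (simp add: m_ac)
  then show "x \<otimes> y \<otimes> (inv x \<otimes> inv y) = \<one>" using assms nonzero_inv by simp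
qed (use assms nonzero_inv in auto)

lemma (in field) mult_inv_cancel:
  assumes "x \<in> carrier R" "y \<in> carrier R" "y \<noteq> \<zero>"
  shows "y \<otimes> (x \<otimes> inv y) = x" "(x \<otimes> inv y) \<otimes> y = x" "inv y \<otimes> (x \<otimes> y) = x" "inv y \<otimes> (y \<otimes> x) = x"
    "(x \<otimes> y) \<otimes> inv y = x" "y \<otimes> (inv y \<otimes> x) = x"
proof -
  have "y \<otimes> (x \<otimes> inv y) = x \<otimes> (y \<otimes> inv y)" using assms nonzero_inv by (simp add: m_ac)
  then show *: "y \<otimes> (x \<otimes> inv y) = x" using assms nonzero_inv by simp
  then show "(x \<otimes> inv y) \<otimes> y = x" "inv y \<otimes> (x \<otimes> y) = x" "inv y \<otimes> (y \<otimes> x) = x"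
    "(x \<otimes> y) \<otimes> inv y = x" "y \<otimes> (inv y \<otimes> x) = x"
    using assms nonzero_inv by (simp_all add: m_ac)
qed

lemma (in field) frac_eq_iff:
  assumes "a \<in> carrier R" "b \<in> carrier R" "c \<in> carrier R" "d \<in> carrier R" "b \<noteq> \<zero>" "d \<noteq> \<zero>"
  shows "a \<otimes> inv b = c \<otimes> inv d \<longleftrightarrow> a \<otimes> d = c \<otimes> b"
proof
  assume eq: "a \<otimes> inv b = c \<otimes> inv d"
  have "a \<otimes> d = (a \<otimes> inv b) \<otimes> b \<otimes> d" using assms mult_inv_cancel(2)[of a b] by simp
  also have "\<dots> = (c \<otimes> inv d) \<otimes> d \<otimes> b" unfolding eq using assms nonzero_inv by (simp add: m_ac)
  finally show "a \<otimes> d = c \<otimes> b" using assms mult_inv_cancel(2)[of c d] by simp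
next
  assume eq: "a \<otimes> d = c \<otimes> b"
  have "a \<otimes> inv b = (a \<otimes> d) \<otimes> inv d \<otimes> inv b" using assms nonzero_inv mult_inv_cancel(5)[of a d] by simp
  also have "\<dots> = (c \<otimes> b) \<otimes> inv b \<otimes> inv d" unfolding eq using assms nonzero_inv by (simp add: m_ac)
  finally show "a \<otimes> inv b = c \<otimes> inv d" using assms mult_inv_cancel(5)[of c b] by simp
qed

section \<open>Localization\<close>

locale mult_subset = cring R for R (structure) + fixes S
  assumes S_carrier: "S \<subseteq> carrier R" and one_in_S: "\<one> \<in> S"
    and mult_in_S: "\<And>s t. s \<in> S \<Longrightarrow> t \<in> S \<Longrightarrow> s \<otimes> t \<in> S"
begin

lemma S_closed [simp]: "s \<in> S \<Longrightarrow> s \<in> carrier R"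
  using S_carrier by blast

declare one_in_S [simp] mult_in_S [simp]

text \<open>Transitivity of the relation behind \<open>fraction\<close>. The middle denominator
  \<open>t\<close> joins the multiplier, since elements of \<open>S\<close> cannot be cancelled in
  general.\<close>

lemma fraction_trans:
  assumes "a \<in> carrier R" "b \<in> carrier R" "c \<in> carrier R" "s \<in> S" "t \<in> S" "r \<in> S" "u \<in> S" "v \<in> S"
    and 1: "u \<otimes> (t \<otimes> a) = u \<otimes> (s \<otimes> b)" and 2: "v \<otimes> (r \<otimes> b) = v \<otimes> (t \<otimes> c)"
  shows "(u \<otimes> v \<otimes> t) \<otimes> (r \<otimes> a) = (u \<otimes> v \<otimes> t) \<otimes> (s \<otimes> c)"
proof -
  have "(u \<otimes> v \<otimes> t) \<otimes> (r \<otimes> a) = (v \<otimes> r) \<otimes> (u \<otimes> (t \<otimes> a))"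
    using assms(1-8) by (simp add: m_ac)
  also have "\<dots> = (u \<otimes> s) \<otimes> (v \<otimes> (r \<otimes> b))"
    using assms(1-8) unfolding 1 by (simp add: m_ac)
  also have "\<dots> = (u \<otimes> v \<otimes> t) \<otimes> (s \<otimes> c)"
    using assms(1-8) unfolding 2 by (simp add: m_ac)
  finally show ?thesis .
qed

lemma fraction_eq_iff:
  assumes "a \<in> carrier R" "b \<in> carrier R" "s \<in> S" "t \<in> S"
  shows "fraction R S a s = fraction R S b t \<longleftrightarrow> (\<exists>u\<in>S. u \<otimes> (t \<otimes> a) = u \<otimes> (s \<otimes> b))"
proof
  assume eq: "fraction R S a s = fraction R S b t"
  have "(b, t) \<in> fraction R S b t" using assms by (auto simp: fraction_def)
  then have "(b, t) \<in> fraction R S a s" by (simp add: eq)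
  then show "\<exists>u\<in>S. u \<otimes> (t \<otimes> a) = u \<otimes> (s \<otimes> b)" by (auto simp: fraction_def)
next
  assume "\<exists>u\<in>S. u \<otimes> (t \<otimes> a) = u \<otimes> (s \<otimes> b)"
  then obtain u where u: "u \<in> S" "u \<otimes> (t \<otimes> a) = u \<otimes> (s \<otimes> b)" by blast
  show "fraction R S a s = fraction R S b t"
  proof (intro equalityI subsetI)
    fix x assume "x \<in> fraction R S a s"
    then obtain c r v where x: "x = (c, r)" "c \<in> carrier R" "r \<in> S" "v \<in> S" "v \<otimes> (r \<otimes> a) = v \<otimes> (s \<otimes> c)"
      by (auto simp: fraction_def)
    have "(u \<otimes> v \<otimes> s) \<otimes> (r \<otimes> b) = (u \<otimes> v \<otimes> s) \<otimes> (t \<otimes> c)"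
      by (rule fraction_trans[of b a c]) (use assms u x in auto)
    then show "x \<in> fraction R S b t" using x u assms by (auto simp: fraction_def intro!: bexI[of _ "u \<otimes> v \<otimes> s"])
  next
    fix x assume "x \<in> fraction R S b t"
    then obtain c r v where x: "x = (c, r)" "c \<in> carrier R" "r \<in> S" "v \<in> S" "v \<otimes> (r \<otimes> b) = v \<otimes> (t \<otimes> c)"
      by (auto simp: fraction_def)
    have "(u \<otimes> v \<otimes> t) \<otimes> (r \<otimes> a) = (u \<otimes> v \<otimes> t) \<otimes> (s \<otimes> c)"
      by (rule fraction_trans[of a b c]) (use assms u x in auto)
    then show "x \<in> fraction R S a s" using x u assms by (auto simp: fraction_def intro!: bexI[of _ "u \<otimes> v \<otimes> t"])
  qed
qed

lemma fraction_eqI: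
  assumes "a \<in> carrier R" "b \<in> carrier R" "s \<in> S" "t \<in> S" "t \<otimes> a = s \<otimes> b"
  shows "fraction R S a s = fraction R S b t"
  using assms fraction_eq_iff[of a b s t] one_in_S by auto

lemma mem_fraction_iff:
  assumes "a \<in> carrier R" "s \<in> S"
  shows "(b, t) \<in> fraction R S a s \<longleftrightarrow> b \<in> carrier R \<and> t \<in> S \<and> fraction R S a s = fraction R S b t"
  using assms fraction_eq_iff[of a b s t] by (auto simp: fraction_def)

lemma fraction_self: "a \<in> carrier R \<Longrightarrow> s \<in> S \<Longrightarrow> (a, s) \<in> fraction R S a s"
  by (simp add: mem_fraction_iff)

text \<open>The operations of \<open>localization\<close> are unions over all representatives. Such
  a union is a single class once the value does not depend on the representatives; that the index
  sets are nonempty is \<open>fraction_self\<close>.\<close>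

lemma fraction_UN:
  assumes "a \<in> carrier R" "b \<in> carrier R" "s \<in> S" "t \<in> S"
    and "\<And>a' s' b' t'. a' \<in> carrier R \<Longrightarrow> b' \<in> carrier R \<Longrightarrow> s' \<in> S \<Longrightarrow> t' \<in> S \<Longrightarrow>
      fraction R S a s = fraction R S a' s' \<Longrightarrow> fraction R S b t = fraction R S b' t' \<Longrightarrow>
      F a' s' b' t' = Z"
  shows "(\<Union>(a', s')\<in>fraction R S a s. \<Union>(b', t')\<in>fraction R S b t. F a' s' b' t') = Z"
proof -
  have inner: "(\<Union>(b', t')\<in>fraction R S b t. F a' s' b' t') = Z" if "(a', s') \<in> fraction R S a s" for a' s'
  proof -
    have "F a' s' b' t' = Z" if "(b', t') \<in> fraction R S b t" for b' t'
      using that \<open>(a', s') \<in> fraction R S a s\<close> assms by (simp add: mem_fraction_iff)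
    moreover have "(b, t) \<in> fraction R S b t" using assms fraction_self by simp
    ultimately show ?thesis by auto
  qed
  have "(\<Union>(a', s')\<in>fraction R S a s. \<Union>(b', t')\<in>fraction R S b t. F a' s' b' t')
      = (\<Union>p\<in>fraction R S a s. Z)"
  proof (rule SUP_cong[OF refl])
    fix p assume p: "p \<in> fraction R S a s"
    obtain a' s' where "p = (a', s')" by fastforce
    with inner p
    show "(case p of (a', s') \<Rightarrow> \<Union>(b', t')\<in>fraction R S b t. F a' s' b' t') = Z" by simp
  qed
  also have "\<dots> = Z"
    using fraction_self[OF assms(1,3)] by auto
  finally show ?thesis .
qed

abbreviation "L \<equiv> localization R S"

lemma mult_fraction:
  assumes "a \<in> carrier R" "b \<in> carrier R" "s \<in> S" "t \<in> S"
  shows "fraction R S a s \<otimes>\<^bsub>L\<^esub> fraction R S b t = fraction R S (a \<otimes> b) (s \<otimes> t)"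
  unfolding localization_def monoid.simps
proof (rule fraction_UN)
  fix a' s' b' t'
  assume *: "a' \<in> carrier R" "b' \<in> carrier R" "s' \<in> S" "t' \<in> S"
    "fraction R S a s = fraction R S a' s'" "fraction R S b t = fraction R S b' t'"
  then obtain u v where u: "u \<in> S" "u \<otimes> (s' \<otimes> a) = u \<otimes> (s \<otimes> a')"
    and v: "v \<in> S" "v \<otimes> (t' \<otimes> b) = v \<otimes> (t \<otimes> b')"
    using assms by (auto simp: fraction_eq_iff)
  have "(u \<otimes> v) \<otimes> ((s \<otimes> t) \<otimes> (a' \<otimes> b')) = (u \<otimes> (s \<otimes> a')) \<otimes> (v \<otimes> (t \<otimes> b'))"
    using assms * u(1) v(1) by (simp add: m_ac)
  also have "\<dots> = (u \<otimes> (s' \<otimes> a)) \<otimes> (v \<otimes> (t' \<otimes> b))" by (simp add: u v)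
  also have "\<dots> = (u \<otimes> v) \<otimes> ((s' \<otimes> t') \<otimes> (a \<otimes> b))"
    using assms * u(1) v(1) by (simp add: m_ac)
  finally show "fraction R S (a' \<otimes> b') (s' \<otimes> t') = fraction R S (a \<otimes> b) (s \<otimes> t)"
    using assms * u v by (auto simp: fraction_eq_iff intro!: bexI[of _ "u \<otimes> v"])
qed (use assms in auto)

lemma add_fraction:
  assumes "a \<in> carrier R" "b \<in> carrier R" "s \<in> S" "t \<in> S"
  shows "fraction R S a s \<oplus>\<^bsub>L\<^esub> fraction R S b t = fraction R S ((t \<otimes> a) \<oplus> (s \<otimes> b)) (s \<otimes> t)"
  unfolding localization_def ring.simps
proof (rule fraction_UN)
  fix a' s' b' t'
  assume *: "a' \<in> carrier R" "b' \<in> carrier R" "s' \<in> S" "t' \<in> S"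
    "fraction R S a s = fraction R S a' s'" "fraction R S b t = fraction R S b' t'"
  then obtain u v where u: "u \<in> S" "u \<otimes> (s' \<otimes> a) = u \<otimes> (s \<otimes> a')"
    and v: "v \<in> S" "v \<otimes> (t' \<otimes> b) = v \<otimes> (t \<otimes> b')"
    using assms by (auto simp: fraction_eq_iff)
  have "(u \<otimes> v) \<otimes> ((s \<otimes> t) \<otimes> (t' \<otimes> a' \<oplus> s' \<otimes> b')) =
      (v \<otimes> t \<otimes> t') \<otimes> (u \<otimes> (s \<otimes> a')) \<oplus> (u \<otimes> s \<otimes> s') \<otimes> (v \<otimes> (t \<otimes> b'))"
    using assms * u(1) v(1) by (simp add: m_ac r_distr l_distr)
  also have "\<dots> = (v \<otimes> t \<otimes> t') \<otimes> (u \<otimes> (s' \<otimes> a)) \<oplus> (u \<otimes> s \<otimes> s') \<otimes> (v \<otimes> (t' \<otimes> b))"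
    by (simp add: u v)
  also have "\<dots> = (u \<otimes> v) \<otimes> ((s' \<otimes> t') \<otimes> (t \<otimes> a \<oplus> s \<otimes> b))"
    using assms * u(1) v(1) by (simp add: m_ac r_distr l_distr)
  finally show "fraction R S (t' \<otimes> a' \<oplus> s' \<otimes> b') (s' \<otimes> t') = fraction R S (t \<otimes> a \<oplus> s \<otimes> b) (s \<otimes> t)"
    using assms * u v by (auto simp: fraction_eq_iff intro!: bexI[of _ "u \<otimes> v"])
qed (use assms in auto)

lemma carrier_localization: "carrier L = {fraction R S a s | a s. a \<in> carrier R \<and> s \<in> S}"
  by (simp add: localization_def)

lemma fraction_closed [simp]: "a \<in> carrier R \<Longrightarrow> s \<in> S \<Longrightarrow> fraction R S a s \<in> carrier L"
  by (auto simp: carrier_localization)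

lemma one_localization: "\<one>\<^bsub>L\<^esub> = fraction R S \<one> \<one>"
  by (simp add: localization_def)

lemma zero_localization: "\<zero>\<^bsub>L\<^esub> = fraction R S \<zero> \<one>"
  by (simp add: localization_def)

lemma localization_cases:
  assumes "x \<in> carrier L"
  obtains a s where "a \<in> carrier R" "s \<in> S" "x = fraction R S a s"
  using assms by (auto simp: carrier_localization)

lemma cring_localization: "cring L"
proof (rule cringI)
  show "abelian_group L"
  proof (rule abelian_groupI)
    fix x y z assume "x \<in> carrier L" "y \<in> carrier L" "z \<in> carrier L"
    then show "x \<oplus>\<^bsub>L\<^esub> y \<oplus>\<^bsub>L\<^esub> z = x \<oplus>\<^bsub>L\<^esub> (y \<oplus>\<^bsub>L\<^esub> z)"
      by (elim localization_cases) (auto simp: add_fraction m_ac r_distr l_distr a_ac)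
  next
    fix x y assume "x \<in> carrier L" "y \<in> carrier L"
    then show "x \<oplus>\<^bsub>L\<^esub> y = y \<oplus>\<^bsub>L\<^esub> x" "x \<oplus>\<^bsub>L\<^esub> y \<in> carrier L"
      by (elim localization_cases, auto simp: add_fraction m_ac r_distr l_distr a_ac)+
  next
    fix x assume "x \<in> carrier L"
    then show "\<zero>\<^bsub>L\<^esub> \<oplus>\<^bsub>L\<^esub> x = x"
      by (elim localization_cases) (auto simp: add_fraction zero_localization)
    show "\<exists>y\<in>carrier L. y \<oplus>\<^bsub>L\<^esub> x = \<zero>\<^bsub>L\<^esub>"
      using \<open>x \<in> carrier L\<close>
    proof (elim localization_cases)
      fix a s assume "a \<in> carrier R" "s \<in> S" "x = fraction R S a s"
      then show ?thesis
        by (intro bexI[of _ "fraction R S (\<ominus> a) s"])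
          (simp_all add: add_fraction zero_localization, rule fraction_eqI, simp_all add: r_minus l_neg)
    qed
  qed (auto simp: zero_localization)
next
  show "comm_monoid L"
  proof (rule comm_monoidI)
    fix x y z assume "x \<in> carrier L" "y \<in> carrier L" "z \<in> carrier L"
    then show "x \<otimes>\<^bsub>L\<^esub> y \<otimes>\<^bsub>L\<^esub> z = x \<otimes>\<^bsub>L\<^esub> (y \<otimes>\<^bsub>L\<^esub> z)"
      by (elim localization_cases) (auto simp: mult_fraction m_ac)
  next
    fix x y assume "x \<in> carrier L" "y \<in> carrier L"
    then show "x \<otimes>\<^bsub>L\<^esub> y = y \<otimes>\<^bsub>L\<^esub> x" "x \<otimes>\<^bsub>L\<^esub> y \<in> carrier L"
      by (elim localization_cases, auto simp: mult_fraction m_ac)+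
  next
    fix x assume "x \<in> carrier L"
    then show "\<one>\<^bsub>L\<^esub> \<otimes>\<^bsub>L\<^esub> x = x"
      by (elim localization_cases) (auto simp: mult_fraction one_localization)
  qed (auto simp: one_localization)
next
  fix x y z assume "x \<in> carrier L" "y \<in> carrier L" "z \<in> carrier L"
  then show "(x \<oplus>\<^bsub>L\<^esub> y) \<otimes>\<^bsub>L\<^esub> z = x \<otimes>\<^bsub>L\<^esub> z \<oplus>\<^bsub>L\<^esub> y \<otimes>\<^bsub>L\<^esub> z"
    by (elim localization_cases, simp add: mult_fraction add_fraction, intro fraction_eqI)
      (simp_all add: m_ac r_distr l_distr)
qed

lemma fraction_hom: "(\<lambda>a. fraction R S a \<one>) \<in> ring_hom R L"
  by (rule ring_hom_memI) (auto simp: mult_fraction add_fraction one_localization)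

end

text \<open>The map on fractions induced by \<open>h\<close>, read off from an arbitrary
  representative. It makes the stalks of the blow-up and those of the spectrum of a subring of
  \<open>K\<close> comparable inside the one field \<open>K\<close>.\<close>

definition fraction_eval :: "('a, 'm) ring_scheme \<Rightarrow> ('b, 'n) ring_scheme \<Rightarrow> ('a \<Rightarrow> 'b) \<Rightarrow> ('a \<times> 'a) set \<Rightarrow> 'b" where
  "fraction_eval R K h Z = (let p = SOME p. p \<in> Z in h (fst p) \<otimes>\<^bsub>K\<^esub> inv\<^bsub>K\<^esub> h (snd p))"

locale mult_subset_hom = mult_subset R S + K: field K for R (structure) and S and K (structure) +
  fixes h assumes h_hom: "h \<in> ring_hom R K"
    and h_nonzero: "\<And>s. s \<in> S \<Longrightarrow> h s \<noteq> \<zero>\<^bsub>K\<^esub>"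
begin

lemma h_closed [simp]: "a \<in> carrier R \<Longrightarrow> h a \<in> carrier K"
  using ring_hom_closed[OF h_hom] .

lemma fraction_eval:
  assumes "a \<in> carrier R" "s \<in> S"
  shows "fraction_eval R K h (fraction R S a s) = h a \<otimes>\<^bsub>K\<^esub> inv\<^bsub>K\<^esub> h s"
proof -
  define p where "p = (SOME p. p \<in> fraction R S a s)"
  have "p \<in> fraction R S a s"
    unfolding p_def using fraction_self[OF assms] by (rule someI)
  then obtain b t u where p: "p = (b, t)" "b \<in> carrier R" "t \<in> S" "u \<in> S" "u \<otimes> (t \<otimes> a) = u \<otimes> (s \<otimes> b)"
    by (auto simp: fraction_def)
  have "h u \<otimes>\<^bsub>K\<^esub> (h t \<otimes>\<^bsub>K\<^esub> h a) = h u \<otimes>\<^bsub>K\<^esub> (h s \<otimes>\<^bsub>K\<^esub> h b)"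
    using arg_cong[OF p(5), of h] assms p(2-4) by (simp add: ring_hom_mult[OF h_hom])
  then have "h t \<otimes>\<^bsub>K\<^esub> h a = h s \<otimes>\<^bsub>K\<^esub> h b"
    using assms p h_nonzero by (simp add: K.m_lcancel)
  then have "h b \<otimes>\<^bsub>K\<^esub> inv\<^bsub>K\<^esub> h t = h a \<otimes>\<^bsub>K\<^esub> inv\<^bsub>K\<^esub> h s"
    using assms p h_nonzero by (simp add: K.frac_eq_iff K.m_comm)
  then show ?thesis unfolding fraction_eval_def Let_def p_def[symmetric] by (simp add: p)
qed

lemma fraction_eval_hom: "fraction_eval R K h \<in> ring_hom (localization R S) K"
proof -
  have U: "h s \<in> Units K" if "s \<in> S" for s
    using that h_nonzero by (auto simp: K.field_Units)
  show ?thesis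
  proof (rule ring_hom_memI)
    fix x assume "x \<in> carrier L"
    then show "fraction_eval R K h x \<in> carrier K"
      by (elim localization_cases) (auto simp: fraction_eval U)
  next
    fix x y assume "x \<in> carrier L" "y \<in> carrier L"
    then obtain a s b t where *: "a \<in> carrier R" "s \<in> S" "x = fraction R S a s"
       "b \<in> carrier R" "t \<in> S" "y = fraction R S b t"
      by (elim localization_cases) auto
    show "fraction_eval R K h (x \<otimes>\<^bsub>L\<^esub> y) = fraction_eval R K h x \<otimes>\<^bsub>K\<^esub> fraction_eval R K h y"
      using * U h_nonzero by (simp add: mult_fraction fraction_eval K.inv_mult_field ring_hom_mult[OF h_hom] K.m_ac)
    have c: "h t \<otimes>\<^bsub>K\<^esub> (z \<otimes>\<^bsub>K\<^esub> inv\<^bsub>K\<^esub> h t) = z" if "z \<in> carrier K" "t \<in> S" for z t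
      using that h_nonzero by (simp add: K.mult_inv_cancel)
    have "(h t \<otimes>\<^bsub>K\<^esub> h a \<oplus>\<^bsub>K\<^esub> h s \<otimes>\<^bsub>K\<^esub> h b) \<otimes>\<^bsub>K\<^esub> (inv\<^bsub>K\<^esub> h s \<otimes>\<^bsub>K\<^esub> inv\<^bsub>K\<^esub> h t)
        = h a \<otimes>\<^bsub>K\<^esub> inv\<^bsub>K\<^esub> h s \<oplus>\<^bsub>K\<^esub> h b \<otimes>\<^bsub>K\<^esub> inv\<^bsub>K\<^esub> h t"
      using * U c[of "h a \<otimes>\<^bsub>K\<^esub> inv\<^bsub>K\<^esub> h s" t] c[of "h b \<otimes>\<^bsub>K\<^esub> inv\<^bsub>K\<^esub> h t" s]
      by (simp add: K.l_distr K.r_distr K.m_ac)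
    then show "fraction_eval R K h (x \<oplus>\<^bsub>L\<^esub> y) = fraction_eval R K h x \<oplus>\<^bsub>K\<^esub> fraction_eval R K h y"
      using * U h_nonzero by (simp add: add_fraction fraction_eval K.inv_mult_field ring_hom_mult[OF h_hom] ring_hom_add[OF h_hom])
  next
    show "fraction_eval R K h \<one>\<^bsub>L\<^esub> = \<one>\<^bsub>K\<^esub>"
      by (simp add: one_localization fraction_eval ring_hom_one[OF h_hom])
  qed
qed

end


section \<open>Integral elements\<close>

text \<open>\<open>monic_values R N u d\<close> consists of the values at \<open>u\<close> of the monic polynomials of degree \<open>d\<close>
  with lower coefficients in \<open>N\<close>, in Horner form; \<open>low_values R N u d\<close> of the values of the
  polynomials of degree less than \<open>d\<close>.\<close>

primrec monic_values :: "('a, 'm) ring_scheme \<Rightarrow> 'a set \<Rightarrow> 'a \<Rightarrow> nat \<Rightarrow> 'a set" where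
  "monic_values R N u 0 = {\<one>\<^bsub>R\<^esub>}"
| "monic_values R N u (Suc d) = {c \<oplus>\<^bsub>R\<^esub> u \<otimes>\<^bsub>R\<^esub> t | c t. c \<in> N \<and> t \<in> monic_values R N u d}"

primrec low_values :: "('a, 'm) ring_scheme \<Rightarrow> 'a set \<Rightarrow> 'a \<Rightarrow> nat \<Rightarrow> 'a set" where
  "low_values R N u 0 = {\<zero>\<^bsub>R\<^esub>}"
| "low_values R N u (Suc d) = {c \<oplus>\<^bsub>R\<^esub> u \<otimes>\<^bsub>R\<^esub> t | c t. c \<in> N \<and> t \<in> low_values R N u d}"

text \<open>For a subring \<open>N\<close> this is ordinary integrality. Later \<open>N\<close> is
  also an ideal; then the lower coefficients of the monic equation are only required to lie in the
  ideal itself, not in its powers. The Horner form lets an induction on the equation peel off the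
  constant coefficient.\<close>

definition integral_over :: "('a, 'm) ring_scheme \<Rightarrow> 'a set \<Rightarrow> 'a \<Rightarrow> bool" where
  "integral_over R N u \<longleftrightarrow> u \<in> carrier R \<and> (\<exists>d. \<zero>\<^bsub>R\<^esub> \<in> monic_values R N u d)"

text \<open>The finite module criterion: multiplication by \<open>u\<close> carries the span of
  \<open>E\<close> into \<open>N\<close> times it. A nonempty set of nonzero generators makes the
  module nonzero, hence faithful in a domain.\<close>

definition module_stable :: "('a, 'm) ring_scheme \<Rightarrow> 'a set \<Rightarrow> 'a \<Rightarrow> bool" where
  "module_stable R N u \<longleftrightarrow> u \<in> carrier R \<and>
     (\<exists>E. finite E \<and> E \<noteq> {} \<and> E \<subseteq> carrier R - {\<zero>\<^bsub>R\<^esub>} \<and> (\<forall>e\<in>E. u \<otimes>\<^bsub>R\<^esub> e \<in> ideal_prod R N E))"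

text \<open>One notion for ideals of a subring \<open>A\<close>, for fractional ideals and for sets
  of polynomials with coefficients in them. Negatives are obtained from
  \<open>submod_neg\<close>.\<close>

definition submod :: "('a, 'm) ring_scheme \<Rightarrow> 'a set \<Rightarrow> 'a set \<Rightarrow> bool" where
  "submod R A N \<longleftrightarrow> N \<subseteq> carrier R \<and> \<zero>\<^bsub>R\<^esub> \<in> N \<and> (\<forall>x\<in>N. \<forall>y\<in>N. x \<oplus>\<^bsub>R\<^esub> y \<in> N) \<and>
     (\<forall>a\<in>A. \<forall>x\<in>N. a \<otimes>\<^bsub>R\<^esub> x \<in> N)"

lemma submodD:
  assumes "submod R A N"
  shows "N \<subseteq> carrier R" "\<zero>\<^bsub>R\<^esub> \<in> N" "\<And>x y. x \<in> N \<Longrightarrow> y \<in> N \<Longrightarrow> x \<oplus>\<^bsub>R\<^esub> y \<in> N"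
    "\<And>a x. a \<in> A \<Longrightarrow> x \<in> N \<Longrightarrow> a \<otimes>\<^bsub>R\<^esub> x \<in> N" "\<And>x. x \<in> N \<Longrightarrow> x \<in> carrier R"
  using assms by (auto simp: submod_def)

lemma (in ring) submod_neg:
  assumes "submod R A N" "subring A R" "x \<in> N"
  shows "\<ominus> x \<in> N"
proof -
  have "\<ominus> \<one> \<in> A" using subringE(3,5)[OF assms(2)] by blast
  then have "(\<ominus> \<one>) \<otimes> x \<in> N" using submodD(4)[OF assms(1)] assms(3) by blast
  then show ?thesis using submodD(5)[OF assms(1,3)] by (simp add: l_minus)
qed

lemma (in ring) submod_self: "subring A R \<Longrightarrow> submod R A A"
  using subringE[of A R] by (simp add: submod_def)

lemma (in ring) ideal_prod_closed:
  assumes "N \<subseteq> carrier R" "E \<subseteq> carrier R" "x \<in> ideal_prod R N E"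
  shows "x \<in> carrier R"
  using assms(3) assms(1,2) by induct auto

lemma ideal_prod_mono:
  assumes "N \<subseteq> N'" "E \<subseteq> E'"
  shows "ideal_prod R N E \<subseteq> ideal_prod R N' E'"
proof
  fix x assume "x \<in> ideal_prod R N E"
  then show "x \<in> ideal_prod R N' E'"
  proof induct
    case (prod i j)
    then show ?case using assms by (blast intro: ideal_prod.prod)
  next
    case (sum s t)
    then show ?case by (simp add: ideal_prod.sum)
  qed
qed

lemma (in ring) submod_ideal_prod:
  assumes "submod R A N" "E \<subseteq> carrier R" "E \<noteq> {}" "A \<subseteq> carrier R"
  shows "submod R A (ideal_prod R N E)"
  unfolding submod_def
proof (intro conjI ballI subsetI)
  note N = submodD[OF assms(1)]
  show "x \<in> carrier R" if "x \<in> ideal_prod R N E" for x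
    using ideal_prod_closed[OF N(1) assms(2) that] .
  obtain e where "e \<in> E" using assms(3) by blast
  then have "\<zero> \<otimes> e \<in> ideal_prod R N E" using N(2) by (blast intro: ideal_prod.prod)
  then show "\<zero> \<in> ideal_prod R N E" using \<open>e \<in> E\<close> assms(2) by auto
  fix a x assume a: "a \<in> A" and x: "x \<in> ideal_prod R N E"
  show "a \<otimes> x \<in> ideal_prod R N E"
    using x
  proof induct
    case (prod n e)
    then have "a \<otimes> n \<otimes> e \<in> ideal_prod R N E" using N(4) a by (blast intro: ideal_prod.prod)
    then show ?case using prod a assms N(5) by (simp add: m_assoc subsetD)
  next
    case (sum x y)
    then have "a \<otimes> x \<oplus> a \<otimes> y \<in> ideal_prod R N E" by (blast intro: ideal_prod.sum)
    then show ?case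
      using sum ideal_prod_closed[OF N(1) assms(2)] a assms(4) by (simp add: r_distr subsetD)
  qed
qed (simp add: ideal_prod.sum)

text \<open>A sum of products may repeat a generator. As \<open>N\<close> is closed under addition,
  the coefficients of equal generators can be collected; this gives the rows of a matrix with
  entries in \<open>N\<close>.\<close>

lemma (in cring) ideal_prod_finsum:
  assumes N: "submod R A N" and E: "finite E" "E \<subseteq> carrier R" and x: "x \<in> ideal_prod R N E"
  shows "\<exists>c\<in>E \<rightarrow> N. x = (\<Oplus>e\<in>E. c e \<otimes> e)"
  using x
proof induct
  case (prod n f)
  note N' = submodD[OF N]
  let ?c = "\<lambda>e. if e = f then n else \<zero>"
  have "(\<Oplus>e\<in>E. ?c e \<otimes> e) = (\<Oplus>e\<in>E. if f = e then n \<otimes> e else \<zero>)"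
    using prod E N'(5) by (intro finsum_cong') auto
  also have "\<dots> = n \<otimes> f"
    using prod E N'(5) by (intro add.finprod_singleton) auto
  finally show ?case using prod N'(2) by (intro bexI[of _ ?c]) auto
next
  case (sum x y)
  note N' = submodD[OF N]
  obtain c d where c: "c \<in> E \<rightarrow> N" "x = (\<Oplus>e\<in>E. c e \<otimes> e)" and d: "d \<in> E \<rightarrow> N" "y = (\<Oplus>e\<in>E. d e \<otimes> e)"
    using sum by blast
  have cl: "c e \<in> carrier R" "d e \<in> carrier R" "e \<in> carrier R" if "e \<in> E" for e
    using that c d E N'(5) by blast+
  have "(\<Oplus>e\<in>E. (c e \<oplus> d e) \<otimes> e) = (\<Oplus>e\<in>E. c e \<otimes> e \<oplus> d e \<otimes> e)"
    using cl by (intro finsum_cong') (auto simp: l_distr)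
  also have "\<dots> = x \<oplus> y"
    unfolding c d using cl by (intro finsum_addf) auto
  finally show ?case using c d N'(3) by (intro bexI[of _ "\<lambda>e. c e \<oplus> d e"]) auto
qed

text \<open>The choice \<open>N = A\<close> gives integrality over the ring \<open>A\<close>. A
  proper ideal \<open>N\<close> serves for integrality over \<open>Q[t]\<close>, where
  \<open>Q\<close> is a prime ideal of the subring.\<close>

locale coefficient_ideal = domain R for R (structure) + fixes A N
  assumes subring_A: "subring A R" and submod_N: "submod R A N" and N_sub_A: "N \<subseteq> A"
begin

lemmas A_sub = subringE[OF subring_A] and N_sub = submodD[OF submod_N]

lemma A_carr [simp]: "a \<in> A \<Longrightarrow> a \<in> carrier R" using A_sub(1) by blast
lemma N_carr [simp]: "a \<in> N \<Longrightarrow> a \<in> carrier R" using N_sub(1) by blast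

lemma N_mult: "c \<in> N \<Longrightarrow> c' \<in> N \<Longrightarrow> c \<otimes> c' \<in> N"
  using N_sub(4) N_sub_A by blast

section \<open>Arithmetic of polynomial values in Horner form\<close>

lemma low_monic_closed:
  assumes "u \<in> carrier R"
  shows "low_values R N u d \<subseteq> carrier R" "monic_values R N u d \<subseteq> carrier R"
  by (induct d) (use assms in \<open>auto simp: subset_iff\<close>)

lemmas low_closed = subsetD[OF low_monic_closed(1)]
lemmas monic_closed = subsetD[OF low_monic_closed(2)]

lemma low_SucI: "c \<in> N \<Longrightarrow> t \<in> low_values R N u d \<Longrightarrow> c \<oplus> u \<otimes> t \<in> low_values R N u (Suc d)"
  unfolding low_values.simps by blast

lemma monic_SucI: "c \<in> N \<Longrightarrow> t \<in> monic_values R N u d \<Longrightarrow> c \<oplus> u \<otimes> t \<in> monic_values R N u (Suc d)"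
  unfolding monic_values.simps by blast

lemma low_zero: "u \<in> carrier R \<Longrightarrow> \<zero> \<in> low_values R N u d"
proof (induct d)
  case (Suc d)
  then have "\<zero> \<oplus> u \<otimes> \<zero> \<in> low_values R N u (Suc d)" using N_sub(2) by (blast intro: low_SucI)
  then show ?case using Suc by (simp del: low_values.simps)
qed simp

lemma low_shift: "u \<in> carrier R \<Longrightarrow> x \<in> low_values R N u d \<Longrightarrow> u \<otimes> x \<in> low_values R N u (Suc d)"
  using low_SucI[OF N_sub(2), of x u d] low_closed[of u x d] by (simp del: low_values.simps)

lemma monic_shift: "u \<in> carrier R \<Longrightarrow> x \<in> monic_values R N u d \<Longrightarrow> u \<otimes> x \<in> monic_values R N u (Suc d)"
  using monic_SucI[OF N_sub(2), of x u d] monic_closed[of u x d] by (simp del: monic_values.simps)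

lemma low_Suc: "u \<in> carrier R \<Longrightarrow> x \<in> low_values R N u d \<Longrightarrow> x \<in> low_values R N u (Suc d)"
proof (induct d arbitrary: x)
  case 0 then show ?case using low_zero[of u "Suc 0"] by simp
next
  case (Suc d)
  then obtain c t where "c \<in> N" "t \<in> low_values R N u d" "x = c \<oplus> u \<otimes> t" by auto
  with Suc(1)[OF Suc(2), of t] show ?case
    by (subst low_values.simps(2)) blast
qed

lemma low_mono: "u \<in> carrier R \<Longrightarrow> x \<in> low_values R N u d \<Longrightarrow> d \<le> e \<Longrightarrow> x \<in> low_values R N u e"
  by (rule dec_induct[of d e "\<lambda>e. x \<in> low_values R N u e"]) (auto simp: low_Suc simp del: low_values.simps)

lemma add_shuffle:
  assumes "u \<in> carrier R" "c \<in> carrier R" "t \<in> carrier R" "c' \<in> carrier R" "t' \<in> carrier R"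
  shows "(c \<oplus> u \<otimes> t) \<oplus> (c' \<oplus> u \<otimes> t') = (c \<oplus> c') \<oplus> u \<otimes> (t \<oplus> t')"
  using assms by (simp add: r_distr a_ac)

lemma low_add: "u \<in> carrier R \<Longrightarrow> x \<in> low_values R N u d \<Longrightarrow> y \<in> low_values R N u d \<Longrightarrow>
    x \<oplus> y \<in> low_values R N u d"
proof (induct d arbitrary: x y)
  case (Suc d)
  note [simp] = low_closed[OF Suc(2)] monic_closed[OF Suc(2)]
  from Suc obtain c t c' t' where *: "c \<in> N" "t \<in> low_values R N u d" "x = c \<oplus> u \<otimes> t"
    "c' \<in> N" "t' \<in> low_values R N u d" "y = c' \<oplus> u \<otimes> t'" by auto
  then have "x \<oplus> y = (c \<oplus> c') \<oplus> u \<otimes> (t \<oplus> t')" using Suc(2) by (simp add: add_shuffle)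
  then show ?case using * Suc(1)[of t t'] Suc(2) N_sub(3) by (simp del: low_values.simps add: low_SucI)
qed simp

lemma monic_add_low: "u \<in> carrier R \<Longrightarrow> x \<in> monic_values R N u d \<Longrightarrow> y \<in> low_values R N u d \<Longrightarrow>
    x \<oplus> y \<in> monic_values R N u d"
proof (induct d arbitrary: x y)
  case (Suc d)
  note [simp] = low_closed[OF Suc(2)] monic_closed[OF Suc(2)]
  from Suc obtain c t c' t' where *: "c \<in> N" "t \<in> monic_values R N u d" "x = c \<oplus> u \<otimes> t"
    "c' \<in> N" "t' \<in> low_values R N u d" "y = c' \<oplus> u \<otimes> t'" by auto
  then have "x \<oplus> y = (c \<oplus> c') \<oplus> u \<otimes> (t \<oplus> t')" using Suc(2) by (simp add: add_shuffle)
  then show ?case using * Suc(1)[of t t'] Suc(2) N_sub(3) by (simp del: monic_values.simps add: monic_SucI)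
qed simp

lemma low_smult: "u \<in> carrier R \<Longrightarrow> a \<in> A \<Longrightarrow> x \<in> low_values R N u d \<Longrightarrow> a \<otimes> x \<in> low_values R N u d"
proof (induct d arbitrary: x)
  case (Suc d)
  note [simp] = low_closed[OF Suc(2)] monic_closed[OF Suc(2)]
  from Suc obtain c t where *: "c \<in> N" "t \<in> low_values R N u d" "x = c \<oplus> u \<otimes> t" by auto
  then have "a \<otimes> x = a \<otimes> c \<oplus> u \<otimes> (a \<otimes> t)" using Suc(2,3) by (simp add: r_distr m_ac)
  then show ?case using * Suc(1)[of t] Suc(2,3) N_sub(4) by (simp del: low_values.simps add: low_SucI)
qed simp

lemma low_neg: "u \<in> carrier R \<Longrightarrow> x \<in> low_values R N u d \<Longrightarrow> \<ominus> x \<in> low_values R N u d"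
  using low_smult[of u "\<ominus> \<one>" x d] A_sub(3,5) low_closed[of u x d] by (simp add: l_minus)

lemma monic_mult_low: "u \<in> carrier R \<Longrightarrow> x \<in> monic_values R N u d \<Longrightarrow> y \<in> low_values R N u e \<Longrightarrow>
    x \<otimes> y \<in> low_values R N u (d + e)"
proof (induct d arbitrary: x)
  case (Suc d)
  note [simp] = low_closed[OF Suc(2)] monic_closed[OF Suc(2)]
  from Suc obtain c t where *: "c \<in> N" "t \<in> monic_values R N u d" "x = c \<oplus> u \<otimes> t" by auto
  then have eq: "x \<otimes> y = c \<otimes> y \<oplus> u \<otimes> (t \<otimes> y)" using Suc(2,4) by (simp add: l_distr r_distr m_ac)
  have "c \<otimes> y \<in> low_values R N u (Suc (d + e))"
    by (rule low_mono[of u _ e]) (use * Suc low_smult[of u c y] N_sub_A in auto)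
  moreover have "u \<otimes> (t \<otimes> y) \<in> low_values R N u (Suc (d + e))"
    using Suc * low_shift by blast
  ultimately show ?case unfolding eq add_Suc using low_add Suc(2) by blast
qed (simp add: low_closed[of u y e])

lemma low_mult_low: "u \<in> carrier R \<Longrightarrow> x \<in> low_values R N u d \<Longrightarrow> y \<in> low_values R N u e \<Longrightarrow>
    x \<otimes> y \<in> low_values R N u (d + e)"
proof (induct d arbitrary: x)
  case 0 then show ?case using low_zero[of u e] low_closed[of u y e] by simp
next
  case (Suc d)
  note [simp] = low_closed[OF Suc(2)] monic_closed[OF Suc(2)]
  from Suc obtain c t where *: "c \<in> N" "t \<in> low_values R N u d" "x = c \<oplus> u \<otimes> t" by auto
  then have eq: "x \<otimes> y = c \<otimes> y \<oplus> u \<otimes> (t \<otimes> y)" using Suc(2,4) by (simp add: l_distr r_distr m_ac)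
  have "c \<otimes> y \<in> low_values R N u (Suc (d + e))"
    by (rule low_mono[of u _ e]) (use * Suc low_smult[of u c y] N_sub_A in auto)
  moreover have "u \<otimes> (t \<otimes> y) \<in> low_values R N u (Suc (d + e))"
    using Suc * low_shift by blast
  ultimately show ?case unfolding eq add_Suc using low_add Suc(2) by blast
qed

text \<open>The leading coefficient \<open>1\<close> of a monic value, which need not lie in
  \<open>N\<close>, becomes \<open>c\<close>, which does. So the product is a low value, but of
  length \<open>Suc d\<close>.\<close>

lemma coeff_mult_monic: "u \<in> carrier R \<Longrightarrow> c \<in> N \<Longrightarrow> x \<in> monic_values R N u d \<Longrightarrow>
    c \<otimes> x \<in> low_values R N u (Suc d)"
proof (induct d arbitrary: x)
  case 0
  then show ?case using low_SucI[of c \<zero> u 0] by (simp del: low_values.simps(2))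
next
  case (Suc d)
  note [simp] = low_closed[OF Suc(2)] monic_closed[OF Suc(2)]
  from Suc obtain c' t where *: "c' \<in> N" "t \<in> monic_values R N u d" "x = c' \<oplus> u \<otimes> t" by auto
  then have "c \<otimes> x = c \<otimes> c' \<oplus> u \<otimes> (c \<otimes> t)" using Suc(2,3) by (simp add: r_distr m_ac)
  then show ?case using Suc(1)[of t] * Suc(2,3) N_mult by (subst low_values.simps(2)) blast
qed

lemma monic_mult_monic: "u \<in> carrier R \<Longrightarrow> x \<in> monic_values R N u d \<Longrightarrow> y \<in> monic_values R N u e \<Longrightarrow>
    x \<otimes> y \<in> monic_values R N u (d + e)"
proof (induct d arbitrary: x)
  case (Suc d)
  note [simp] = low_closed[OF Suc(2)] monic_closed[OF Suc(2)]
  from Suc obtain c t where *: "c \<in> N" "t \<in> monic_values R N u d" "x = c \<oplus> u \<otimes> t" by auto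
  then have eq: "x \<otimes> y = u \<otimes> (t \<otimes> y) \<oplus> c \<otimes> y" using Suc(2,4) by (simp add: l_distr r_distr m_ac a_ac)
  have "c \<otimes> y \<in> low_values R N u (Suc (d + e))"
    by (rule low_mono[of u _ "Suc e"]) (use * Suc coeff_mult_monic[of u c y] in auto)
  moreover have "u \<otimes> (t \<otimes> y) \<in> monic_values R N u (Suc (d + e))"
    using Suc * monic_shift by blast
  ultimately show ?case unfolding eq add_Suc using monic_add_low Suc(2) by blast
qed (simp add: monic_closed[of u y e])

text \<open>Gaussian elimination, which replaces the determinant of the usual argument.\<close>

lemma elimination:
  assumes u: "u \<in> carrier R" and "finite E" "E \<noteq> {}" "E \<subseteq> carrier R - {\<zero>}"
    and "\<And>e. e \<in> E \<Longrightarrow> p e e \<in> monic_values R N u d"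
    and "\<And>e f. e \<in> E \<Longrightarrow> f \<in> E \<Longrightarrow> e \<noteq> f \<Longrightarrow> p e f \<in> low_values R N u d"
    and "\<And>e. e \<in> E \<Longrightarrow> (\<Oplus>f\<in>E. p e f \<otimes> f) = \<zero>"
  shows "\<exists>k. \<zero> \<in> monic_values R N u k"
  using assms(2-)
proof (induct E arbitrary: p d rule: finite_ne_induct)
  case (singleton x)
  note [simp] = low_closed[OF u] monic_closed[OF u]
  have "p x x \<in> carrier R" using singleton(2)[of x] u by simp
  then have "p x x \<otimes> x = \<zero>" using singleton(1) singleton(4)[of x] by simp
  then have "p x x = \<zero>" using singleton(1) \<open>p x x \<in> carrier R\<close> integral by auto
  then show ?case using singleton(2)[of x] by auto
next
  case (insert x F)
  note [simp] = low_closed[OF u] monic_closed[OF u]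
  have pc: "p e f \<in> carrier R" if "e \<in> insert x F" "f \<in> insert x F" for e f
    using insert(6)[of e] insert(7)[of e f] that u by (cases "e = f") auto
  have xc: "x \<in> carrier R" and Fc: "\<And>f. f \<in> F \<Longrightarrow> f \<in> carrier R" using insert(5) by auto
  \<comment> \<open>The pivot \<open>p x x\<close> times row \<open>e\<close> minus
    \<open>p e x\<close> times row \<open>x\<close>: column \<open>x\<close> cancels without a
    division. The product of two monic entries keeps the diagonal monic, of degree
    \<open>d + d\<close>; all other products are low.\<close>
  let ?q = "\<lambda>e f. p x x \<otimes> p e f \<oplus> \<ominus> (p e x \<otimes> p x f)"
  have row: "(\<Oplus>f\<in>F. p e f \<otimes> f) = \<ominus> (p e x \<otimes> x)" if "e \<in> insert x F" for e
  proof -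
    have "p e x \<otimes> x \<oplus> (\<Oplus>f\<in>F. p e f \<otimes> f) = \<zero>"
      using insert(8)[OF that] insert(1,3) that pc xc Fc by (simp add: finsum_insert)
    moreover have "(\<Oplus>f\<in>F. p e f \<otimes> f) \<in> carrier R" using pc Fc that by (intro finsum_closed) auto
    ultimately show ?thesis using pc[OF that, of x] xc by (metis a_comm insertI1 m_closed minus_equality)
  qed
  show ?case
  proof (rule insert(4)[of ?q "d + d"])
    show "F \<subseteq> carrier R - {\<zero>}" using insert(5) by blast
    fix e assume e: "e \<in> F"
    have neg: "\<ominus> (p e x \<otimes> p x f) \<in> low_values R N u (d + d)" if "f \<in> F" for f
      using e that insert(3) insert(7)[of e x] insert(7)[of x f] low_mult_low[OF u, of "p e x" d "p x f" d]
        low_neg[OF u, of "p e x \<otimes> p x f" "d + d"] by auto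
    show "?q e e \<in> monic_values R N u (d + d)"
      using monic_add_low[OF u _ neg[OF e]] monic_mult_monic[OF u] insert(6) e by blast
    show "?q e f \<in> low_values R N u (d + d)" if "f \<in> F" "e \<noteq> f" for f
      using low_add[OF u _ neg[OF that(1)]] monic_mult_low[OF u] insert(6,7) e that by blast
    have "(\<Oplus>f\<in>F. ?q e f \<otimes> f) = (\<Oplus>f\<in>F. p x x \<otimes> (p e f \<otimes> f) \<oplus> \<ominus> (p e x) \<otimes> (p x f \<otimes> f))"
      using pc Fc e by (intro finsum_cong') (auto simp: l_distr r_distr l_minus r_minus m_ac)
    also have "\<dots> = (\<Oplus>f\<in>F. p x x \<otimes> (p e f \<otimes> f)) \<oplus> (\<Oplus>f\<in>F. \<ominus> (p e x) \<otimes> (p x f \<otimes> f))"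
      using pc Fc e by (intro finsum_addf) auto
    also have "\<dots> = p x x \<otimes> (\<Oplus>f\<in>F. p e f \<otimes> f) \<oplus> \<ominus> (p e x) \<otimes> (\<Oplus>f\<in>F. p x f \<otimes> f)"
      using pc Fc e insert(1) by (subst (1 2) finsum_rdistr) auto
    also have "\<dots> = p x x \<otimes> (\<ominus> (p e x \<otimes> x)) \<oplus> \<ominus> (p e x) \<otimes> (\<ominus> (p x x \<otimes> x))"
      using row e by simp
    also have "\<dots> = \<zero>"
      using pc xc e by (simp add: l_minus r_minus m_ac r_neg l_neg)
    finally show "(\<Oplus>f\<in>F. ?q e f \<otimes> f) = \<zero>" .
  qed
qed

text \<open>The argument of Cayley and Hamilton: \<open>u\<close> minus the matrix of its action
  annihilates the nonzero generators, and elimination reduces this matrix to one monic value of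
  \<open>u\<close> that annihilates a nonzero element.\<close>

lemma module_stable_imp_integral:
  assumes "module_stable R N u"
  shows "integral_over R N u"
proof -
  have u: "u \<in> carrier R" using assms by (simp add: module_stable_def)
  obtain E where E: "finite E" "E \<noteq> {}" "E \<subseteq> carrier R - {\<zero>}"
    and st: "\<And>e. e \<in> E \<Longrightarrow> u \<otimes> e \<in> ideal_prod R N E"
    using assms by (auto simp: module_stable_def)
  have "\<forall>e\<in>E. \<exists>c. c \<in> E \<rightarrow> N \<and> u \<otimes> e = (\<Oplus>f\<in>E. c f \<otimes> f)"
    using ideal_prod_finsum[OF submod_N E(1) _ st] E(3) by blast
  then obtain c where c: "\<And>e. e \<in> E \<Longrightarrow> c e \<in> E \<rightarrow> N" "\<And>e. e \<in> E \<Longrightarrow> u \<otimes> e = (\<Oplus>f\<in>E. c e f \<otimes> f)"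
    by metis
  have cc: "c e f \<in> carrier R" "c e f \<in> N" if "e \<in> E" "f \<in> E" for e f
    using c(1)[OF that(1)] that(2) N_carr by (auto simp: Pi_def)
  have Ec: "e \<in> carrier R" if "e \<in> E" for e using E(3) that by blast
  have nN: "\<ominus> c e f \<in> N" if "e \<in> E" "f \<in> E" for e f
    using submod_neg[OF submod_N subring_A] cc that by blast
  \<comment> \<open>The entries are written in Horner form: \<open>u\<close> times \<open>1\<close>
    is monic of degree one on the diagonal, and \<open>u\<close> times \<open>0\<close> is low of
    length one elsewhere.\<close>
  let ?p = "\<lambda>e f. \<ominus> c e f \<oplus> u \<otimes> (if e = f then \<one> else \<zero>)"
  have "\<exists>k. \<zero> \<in> monic_values R N u k"
  proof (rule elimination[OF u E, where d = "Suc 0" and p = ?p])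
    show "?p e e \<in> monic_values R N u (Suc 0)" if "e \<in> E" for e
      using nN[OF that that] by auto
    show "?p e f \<in> low_values R N u (Suc 0)" if "e \<in> E" "f \<in> E" "e \<noteq> f" for e f
      using nN[OF that(1,2)] that(3) by auto
    fix e assume e: "e \<in> E"
    have "(\<Oplus>f\<in>E. ?p e f \<otimes> f) = (\<Oplus>f\<in>E. \<ominus> \<one> \<otimes> (c e f \<otimes> f) \<oplus> (if e = f then u \<otimes> f else \<zero>))"
      using cc Ec e u by (intro finsum_cong') (auto simp: l_distr l_minus)
    also have "\<dots> = (\<Oplus>f\<in>E. \<ominus> \<one> \<otimes> (c e f \<otimes> f)) \<oplus> (\<Oplus>f\<in>E. if e = f then u \<otimes> f else \<zero>)"
      using cc Ec e u by (intro finsum_addf) auto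
    also have "(\<Oplus>f\<in>E. if e = f then u \<otimes> f else \<zero>) = u \<otimes> e"
      using Ec e u E(1) by (intro add.finprod_singleton) auto
    also have "(\<Oplus>f\<in>E. \<ominus> \<one> \<otimes> (c e f \<otimes> f)) = \<ominus> \<one> \<otimes> (u \<otimes> e)"
      using cc Ec e E(1) c(2)[OF e] by (subst finsum_rdistr[symmetric]) auto
    finally show "(\<Oplus>f\<in>E. ?p e f \<otimes> f) = \<zero>" using e Ec u by (simp add: l_minus l_neg)
  qed
  then show ?thesis using u by (simp add: integral_over_def)
qed

section \<open>Products and sums of elements that have a stable module\<close>

lemma ideal_prod_mult:
  assumes y: "y \<in> ideal_prod R A E" and E: "E \<subseteq> carrier R" and u: "u \<in> carrier R"
    and st: "\<And>e. e \<in> E \<Longrightarrow> u \<otimes> e \<in> ideal_prod R N E"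
  shows "u \<otimes> y \<in> ideal_prod R N E"
proof -
  have "E \<noteq> {}" using y by induct auto
  note M = submodD[OF submod_ideal_prod[OF submod_N E \<open>E \<noteq> {}\<close> A_sub(1)]]
  show ?thesis
    using y
  proof induct
    case (prod a e)
    then have "u \<otimes> (a \<otimes> e) = a \<otimes> (u \<otimes> e)" using u E by (simp add: m_ac subsetD)
    then show ?case using prod M(4) st by simp
  next
    case (sum x y)
    then show ?case using M(3) ideal_prod_closed[OF A_sub(1) E] u by (simp add: r_distr)
  qed
qed

lemma ideal_prod_times:
  assumes E: "E \<subseteq> carrier R" "F \<subseteq> carrier R" and x: "x \<in> ideal_prod R N E" and f: "f \<in> F"
  shows "x \<otimes> f \<in> ideal_prod R N {e \<otimes> f |e f. e \<in> E \<and> f \<in> F}"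
  using x
proof induct
  case (prod n e)
  then have "n \<otimes> (e \<otimes> f) \<in> ideal_prod R N {e \<otimes> f |e f. e \<in> E \<and> f \<in> F}"
    using f by (auto intro!: ideal_prod.prod)
  then show ?case using prod f E by (simp add: m_ac subsetD)
next
  case (sum x y)
  then show ?case using ideal_prod_closed[OF N_sub(1) E(1)] f E(2) by (simp add: l_distr ideal_prod.sum subsetD)
qed

lemma coefficient_ideal_A: "coefficient_ideal R A A"
  using subring_A submod_self by (intro coefficient_ideal.intro coefficient_ideal_axioms.intro domain_axioms) auto

lemma product_basis:
  assumes E: "finite E" "E \<noteq> {}" "E \<subseteq> carrier R - {\<zero>}" and F: "finite F" "F \<noteq> {}" "F \<subseteq> carrier R - {\<zero>}"
  shows "finite {e \<otimes> f |e f. e \<in> E \<and> f \<in> F}" "{e \<otimes> f |e f. e \<in> E \<and> f \<in> F} \<noteq> {}"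
    "{e \<otimes> f |e f. e \<in> E \<and> f \<in> F} \<subseteq> carrier R - {\<zero>}"
proof -
  have "{e \<otimes> f |e f. e \<in> E \<and> f \<in> F} = (\<lambda>(e, f). e \<otimes> f) ` (E \<times> F)" by auto
  then show "finite {e \<otimes> f |e f. e \<in> E \<and> f \<in> F}" using E F by simp
  show "{e \<otimes> f |e f. e \<in> E \<and> f \<in> F} \<noteq> {}" using E F by blast
  show "{e \<otimes> f |e f. e \<in> E \<and> f \<in> F} \<subseteq> carrier R - {\<zero>}"
  proof
    fix g assume "g \<in> {e \<otimes> f |e f. e \<in> E \<and> f \<in> F}"
    then obtain e f where "e \<in> E" "f \<in> F" "g = e \<otimes> f" by blast
    then show "g \<in> carrier R - {\<zero>}" using E(3) F(3) integral[of e f] by auto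
  qed
qed

text \<open>The products of the generators of both modules span a module stable under both factors:
  \<open>v\<close> acts with coefficients in \<open>A\<close>, and then \<open>u\<close> brings all
  coefficients into \<open>N\<close>.\<close>

lemma module_stable_mult:
  assumes "module_stable R N u" "module_stable R A v"
  shows "module_stable R N (u \<otimes> v)"
proof -
  obtain E where E: "finite E" "E \<noteq> {}" "E \<subseteq> carrier R - {\<zero>}" "\<And>e. e \<in> E \<Longrightarrow> u \<otimes> e \<in> ideal_prod R N E"
    and u: "u \<in> carrier R" using assms(1) by (auto simp: module_stable_def)
  obtain F where F: "finite F" "F \<noteq> {}" "F \<subseteq> carrier R - {\<zero>}" "\<And>e. e \<in> F \<Longrightarrow> v \<otimes> e \<in> ideal_prod R A F"
    and v: "v \<in> carrier R" using assms(2) by (auto simp: module_stable_def)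
  let ?G = "{e \<otimes> f |e f. e \<in> E \<and> f \<in> F}"
  have Gc: "?G \<subseteq> carrier R" and Ec: "E \<subseteq> carrier R" and Fc: "F \<subseteq> carrier R" using E F by auto
  interpret AA: coefficient_ideal R A A by (rule coefficient_ideal_A)
  have st: "u \<otimes> g \<in> ideal_prod R N ?G" if g: "g \<in> ?G" for g
  proof -
    obtain e f where ef: "e \<in> E" "f \<in> F" "g = e \<otimes> f" using g by blast
    have "(u \<otimes> e) \<otimes> f \<in> ideal_prod R N ?G"
      by (rule ideal_prod_times[OF Ec Fc E(4)[OF ef(1)] ef(2)])
    then show ?thesis using ef u Ec Fc by (simp add: m_ac subsetD)
  qed
  have "(u \<otimes> v) \<otimes> g \<in> ideal_prod R N ?G" if g: "g \<in> ?G" for g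
  proof -
    obtain e f where ef: "e \<in> E" "f \<in> F" "g = e \<otimes> f" using g by blast
    have "(v \<otimes> f) \<otimes> e \<in> ideal_prod R A {f \<otimes> e |f e. f \<in> F \<and> e \<in> E}"
      by (rule AA.ideal_prod_times[OF Fc Ec F(4)[OF ef(2)] ef(1)])
    moreover have "{f \<otimes> e |f e. f \<in> F \<and> e \<in> E} = ?G"
      using Ec Fc m_comm by (auto simp: subset_iff) metis+
    ultimately have "v \<otimes> g \<in> ideal_prod R A ?G" using ef v Ec Fc by (simp add: m_ac subsetD)
    then have "u \<otimes> (v \<otimes> g) \<in> ideal_prod R N ?G" by (rule ideal_prod_mult[OF _ Gc u st])
    then show ?thesis using u v g Gc by (simp add: m_assoc subsetD)
  qed
  then show ?thesis using product_basis[OF E(1-3) F(1-3)] u v unfolding module_stable_def by blast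
qed

lemma module_stable_add:
  assumes "module_stable R N u" "module_stable R N v"
  shows "module_stable R N (u \<oplus> v)"
proof -
  obtain E where E: "finite E" "E \<noteq> {}" "E \<subseteq> carrier R - {\<zero>}" "\<And>e. e \<in> E \<Longrightarrow> u \<otimes> e \<in> ideal_prod R N E"
    and u: "u \<in> carrier R" using assms(1) by (auto simp: module_stable_def)
  obtain F where F: "finite F" "F \<noteq> {}" "F \<subseteq> carrier R - {\<zero>}" "\<And>e. e \<in> F \<Longrightarrow> v \<otimes> e \<in> ideal_prod R N F"
    and v: "v \<in> carrier R" using assms(2) by (auto simp: module_stable_def)
  let ?G = "{e \<otimes> f |e f. e \<in> E \<and> f \<in> F}"
  have Gc: "?G \<subseteq> carrier R" and Ec: "E \<subseteq> carrier R" and Fc: "F \<subseteq> carrier R" using E F by auto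
  have "(u \<oplus> v) \<otimes> g \<in> ideal_prod R N ?G" if g: "g \<in> ?G" for g
  proof -
    obtain e f where ef: "e \<in> E" "f \<in> F" "g = e \<otimes> f" using g by blast
    have "(v \<otimes> f) \<otimes> e \<in> ideal_prod R N {f \<otimes> e |f e. f \<in> F \<and> e \<in> E}"
      by (rule ideal_prod_times[OF Fc Ec F(4)[OF ef(2)] ef(1)])
    moreover have "{f \<otimes> e |f e. f \<in> F \<and> e \<in> E} = ?G"
      using Ec Fc m_comm by (auto simp: subset_iff) metis+
    ultimately have "v \<otimes> g \<in> ideal_prod R N ?G" using ef v Ec Fc by (simp add: m_ac subsetD)
    moreover have "(u \<otimes> e) \<otimes> f \<in> ideal_prod R N ?G"
      by (rule ideal_prod_times[OF Ec Fc E(4)[OF ef(1)] ef(2)])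
    then have "u \<otimes> g \<in> ideal_prod R N ?G" using ef u Ec Fc by (simp add: m_ac subsetD)
    ultimately have "u \<otimes> g \<oplus> v \<otimes> g \<in> ideal_prod R N ?G" by (simp add: ideal_prod.sum)
    then show ?thesis using u v g Gc by (simp add: l_distr subsetD)
  qed
  then show ?thesis using product_basis[OF E(1-3) F(1-3)] u v unfolding module_stable_def by blast
qed

text \<open>This is how an ideal of coefficients enters: the module that is stable under
  \<open>v\<close> over \<open>A\<close> serves unchanged, and the factor \<open>n\<close> moves the
  coefficients into \<open>N\<close>.\<close>

lemma module_stable_smult:
  assumes "n \<in> N" "module_stable R A v"
  shows "module_stable R N (n \<otimes> v)"
proof -
  obtain F where F: "finite F" "F \<noteq> {}" "F \<subseteq> carrier R - {\<zero>}" "\<And>e. e \<in> F \<Longrightarrow> v \<otimes> e \<in> ideal_prod R A F"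
    and v: "v \<in> carrier R" using assms(2) by (auto simp: module_stable_def)
  have Fc: "F \<subseteq> carrier R" using F by auto
  have "(n \<otimes> v) \<otimes> e \<in> ideal_prod R N F" if "e \<in> F" for e
  proof -
    have "n \<otimes> (v \<otimes> e) \<in> ideal_prod R N F"
    proof (rule ideal_prod_mult[OF F(4)[OF that] Fc])
      show "n \<in> carrier R" using assms(1) by simp
      show "n \<otimes> f \<in> ideal_prod R N F" if "f \<in> F" for f
        using that assms(1) by (rule ideal_prod.prod[rotated])
    qed
    then show ?thesis using that Fc v assms(1) by (simp add: m_assoc subsetD)
  qed
  then show ?thesis using F v assms(1) unfolding module_stable_def by auto
qed

end


lemma (in ring) submod_finsum:
  assumes M: "submod R A M" and f: "\<And>e. e \<in> E \<Longrightarrow> f e \<in> M"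
  shows "finsum R f E \<in> M"
  using f
proof (induct E rule: infinite_finite_induct)
  case (insert x F)
  then have "f \<in> F \<rightarrow> carrier R" "f x \<in> carrier R" using submodD(5)[OF M] by auto
  then show ?case using insert submodD(3)[OF M] by (simp add: finsum_insert)
qed (use submodD(2)[OF M] in auto)

context domain
begin

text \<open>The powers of \<open>u\<close> below the degree of a monic equation span a stable
  module. The case \<open>u = 0\<close> is treated apart, with the generator \<open>1\<close>,
  because a stable module is required to have nonzero generators.\<close>

lemma integral_imp_module_stable:
  assumes A: "subring A R" and "integral_over R A u"
  shows "module_stable R A u"
proof -
  interpret coefficient_ideal R A A
    using A submod_self by (intro coefficient_ideal.intro coefficient_ideal_axioms.intro domain_axioms) auto
  obtain k where u: "u \<in> carrier R" and k: "\<zero> \<in> monic_values R A u k"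
    using assms(2) by (auto simp: integral_over_def)
  have lead: "\<exists>l\<in>low_values R A u k. t = u [^] k \<oplus> l" if "t \<in> monic_values R A u k" for t k
    using that
  proof (induct k arbitrary: t)
    case (Suc k)
    then obtain c s where c: "c \<in> A" "s \<in> monic_values R A u k" "t = c \<oplus> u \<otimes> s" by auto
    then obtain l where l: "l \<in> low_values R A u k" "s = u [^] k \<oplus> l" using Suc(1) by blast
    have "t = u [^] Suc k \<oplus> (c \<oplus> u \<otimes> l)"
      using c l u low_closed[OF u l(1)] by (simp add: r_distr a_ac m_comm)
    then show ?case using low_SucI[OF c(1) l(1)] by blast
  qed simp
  \<comment> \<open>The power \<open>u [^] j\<close> in front is there for the induction: peeling
    off the constant coefficient raises \<open>j\<close> and lowers \<open>d\<close>, while their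
    sum stays fixed.\<close>
  have span: "u [^] j \<otimes> l \<in> ideal_prod R A {u [^] i |i. i < Suc (j + d)}" if "l \<in> low_values R A u (Suc d)" for j d l
    using that
  proof (induct d arbitrary: j l)
    case 0
    then obtain c where c: "c \<in> A" "l = c" using u by auto
    then have "c \<otimes> u [^] j \<in> ideal_prod R A {u [^] i |i. i < Suc (j + 0)}"
      by (intro ideal_prod.prod) auto
    then show ?case using c u by (simp add: m_comm)
  next
    case (Suc d)
    then obtain c s where c: "c \<in> A" "s \<in> low_values R A u (Suc d)" "l = c \<oplus> u \<otimes> s"
      unfolding low_values.simps(2)[of R A u "Suc d"] by blast
    have "c \<otimes> u [^] j \<in> ideal_prod R A {u [^] i |i. i < Suc (j + Suc d)}"
      using c(1) by (intro ideal_prod.prod) auto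
    moreover have "u [^] Suc j \<otimes> s \<in> ideal_prod R A {u [^] i |i. i < Suc (j + Suc d)}"
      using Suc(1)[OF c(2), of "Suc j"] by simp
    ultimately have "c \<otimes> u [^] j \<oplus> u [^] Suc j \<otimes> s \<in> ideal_prod R A {u [^] i |i. i < Suc (j + Suc d)}"
      by (rule ideal_prod.sum)
    moreover have "c \<otimes> u [^] j \<oplus> u [^] Suc j \<otimes> s = u [^] j \<otimes> l"
      using c u low_closed[OF u c(2)] by (simp add: r_distr m_ac)
    ultimately show ?case by simp
  qed
  show ?thesis
  proof (cases "u = \<zero>")
    case True
    have "\<zero> \<otimes> \<one> \<in> ideal_prod R A {\<one>}" using A_sub(2) by (blast intro: ideal_prod.prod)
    then show ?thesis unfolding module_stable_def using True by (auto intro!: exI[of _ "{\<one>}"])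
  next
    case False
    have pow: "u [^] i \<noteq> \<zero>" for i :: nat
      by (induct i) (use False u integral in auto)
    \<comment> \<open>In degree zero the only monic value is \<open>1\<close>, which is not zero in
      a domain.\<close>
    have "k \<noteq> 0" using k by (intro notI) simp
    then obtain d where d: "k = Suc d" using not0_implies_Suc by blast
    let ?E = "{u [^] i |i. i < Suc d}"
    have "u \<otimes> e \<in> ideal_prod R A ?E" if e: "e \<in> ?E" for e
    proof -
      obtain i where i: "i < Suc d" "e = u [^] i" using e by blast
      have ue: "u \<otimes> e = u [^] Suc i" using i u by (simp add: m_comm)
      show ?thesis
      proof (cases "Suc i < Suc d")
        case True
        then have "\<one> \<otimes> u [^] Suc i \<in> ideal_prod R A ?E"
          using A_sub(3) by (intro ideal_prod.prod) blast+
        then show ?thesis using ue u by simp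
      next
        case False
        then have "u \<otimes> e = u [^] k" using ue i d by (simp add: not_less_less_Suc_eq)
        moreover obtain l where l: "l \<in> low_values R A u k" "\<zero> = u [^] k \<oplus> l"
          using lead[OF k] by blast
        ultimately have ul: "u \<otimes> e = \<ominus> l"
          using u low_closed[OF u l(1)] by (metis minus_equality nat_pow_closed)
        have "\<ominus> l \<in> low_values R A u (Suc d)"
          using low_neg[OF u l(1)] d by (simp del: low_values.simps)
        then have "u [^] (0::nat) \<otimes> (\<ominus> l) \<in> ideal_prod R A ?E" using span[of "\<ominus> l" d 0] by simp
        then show ?thesis unfolding ul using low_closed[OF u l(1)] by simp
      qed
    qed
    moreover have "?E = (\<lambda>i. u [^] i) ` {..<Suc d}" by auto
    then have "finite ?E" "?E \<noteq> {}" by auto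
    moreover have "?E \<subseteq> carrier R - {\<zero>}" using u pow by auto
    ultimately show ?thesis unfolding module_stable_def using u by blast
  qed
qed

lemma integral_iff_module_stable:
  assumes "subring A R"
  shows "integral_over R A u \<longleftrightarrow> module_stable R A u"
proof -
  interpret coefficient_ideal R A A
    using assms submod_self by (intro coefficient_ideal.intro coefficient_ideal_axioms.intro domain_axioms) auto
  show ?thesis using module_stable_imp_integral integral_imp_module_stable[OF assms] by blast
qed

lemma integral_over_self:
  assumes "subring A R" "a \<in> A"
  shows "integral_over R A a"
proof -
  have a: "a \<in> carrier R" using subringE(1)[OF assms(1)] assms(2) by blast
  have "\<ominus> a \<oplus> a \<otimes> \<one> \<in> monic_values R A a (Suc 0)"
    using subringE(5)[OF assms] by auto
  then have "\<zero> \<in> monic_values R A a (Suc 0)" using a by (simp only: r_one l_neg)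
  then show ?thesis using a unfolding integral_over_def by blast
qed

lemma subring_integral_closure:
  assumes A: "subring A R"
  shows "subring {u. integral_over R A u} R"
proof -
  interpret coefficient_ideal R A A
    using assms submod_self by (intro coefficient_ideal.intro coefficient_ideal_axioms.intro domain_axioms) auto
  note iff = integral_iff_module_stable[OF A]
  show ?thesis
  proof (rule subringI)
    show "{u. integral_over R A u} \<subseteq> carrier R" by (auto simp: integral_over_def)
    show "\<one> \<in> {u. integral_over R A u}" using integral_over_self[OF A A_sub(3)] by simp
  next
    fix u assume "u \<in> {u. integral_over R A u}"
    then have u: "integral_over R A u" "u \<in> carrier R" by (auto simp: integral_over_def)
    have "integral_over R A ((\<ominus> \<one>) \<otimes> u)"
      using module_stable_mult[of "\<ominus> \<one>" u] integral_over_self[OF A A_sub(5)[OF A_sub(3)]] u iff by simp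
    then show "\<ominus> u \<in> {u. integral_over R A u}" using u by (simp add: l_minus)
  next
    fix u v assume "u \<in> {u. integral_over R A u}" "v \<in> {u. integral_over R A u}"
    then show "u \<otimes> v \<in> {u. integral_over R A u}" "u \<oplus> v \<in> {u. integral_over R A u}"
      using module_stable_mult[of u v] module_stable_add[of u v] iff by auto
  qed
qed

end

lemma (in abelian_monoid) finsum_lessThan_Suc_shift:
  assumes "f \<in> {..<Suc n} \<rightarrow> carrier G"
  shows "finsum G f {..<Suc n} = f 0 \<oplus> finsum G (\<lambda>i. f (Suc i)) {..<n}"
proof -
  have "finsum G f {..<Suc n} = finsum G f (insert 0 (Suc ` {..<n}))"
    by (simp add: lessThan_Suc_eq_insert_0)
  also have "\<dots> = f 0 \<oplus> finsum G f (Suc ` {..<n})"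
    using assms by (intro finsum_insert) auto
  also have "finsum G f (Suc ` {..<n}) = finsum G (\<lambda>i. f (Suc i)) {..<n}"
    using assms by (intro finsum_reindex) auto
  finally show ?thesis .
qed

text \<open>Connects the Horner form with the sum in \<open>integral_element\<close>. The
  coefficient of index \<open>0\<close> in the sum is the outermost one in Horner form, hence the
  shift of the index in the induction.\<close>

lemma (in cring) monic_values_iff:
  assumes b: "b \<in> carrier R" and \<phi>: "\<phi> \<in> carrier A \<rightarrow> carrier R"
  shows "t \<in> monic_values R (\<phi> ` carrier A) b n \<longleftrightarrow>
    (\<exists>c\<in>{..<n} \<rightarrow> carrier A. t = b [^] n \<oplus> (\<Oplus>i\<in>{..<n}. \<phi> (c i) \<otimes> b [^] i))"
proof (induct n arbitrary: t)
  case 0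
  show ?case by auto
next
  case (Suc n)
  have step: "b [^] Suc n \<oplus> (\<Oplus>i\<in>{..<Suc n}. \<phi> (c i) \<otimes> b [^] i) =
      \<phi> (c 0) \<oplus> b \<otimes> (b [^] n \<oplus> (\<Oplus>i\<in>{..<n}. \<phi> (c (Suc i)) \<otimes> b [^] i))"
    if c: "c \<in> {..<Suc n} \<rightarrow> carrier A" for c
  proof -
    have cc: "\<phi> (c i) \<in> carrier R" if "i < Suc n" for i using c \<phi> that by auto
    have "(\<Oplus>i\<in>{..<Suc n}. \<phi> (c i) \<otimes> b [^] i) = \<phi> (c 0) \<oplus> (\<Oplus>i\<in>{..<n}. \<phi> (c (Suc i)) \<otimes> b [^] Suc i)"
      using b cc by (subst finsum_lessThan_Suc_shift) auto
    also have "(\<Oplus>i\<in>{..<n}. \<phi> (c (Suc i)) \<otimes> b [^] Suc i) = (\<Oplus>i\<in>{..<n}. b \<otimes> (\<phi> (c (Suc i)) \<otimes> b [^] i))"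
      using b cc by (intro finsum_cong') (auto simp: m_ac)
    also have "\<dots> = b \<otimes> (\<Oplus>i\<in>{..<n}. \<phi> (c (Suc i)) \<otimes> b [^] i)"
      using b cc by (subst finsum_rdistr) auto
    finally have eq: "(\<Oplus>i\<in>{..<Suc n}. \<phi> (c i) \<otimes> b [^] i) =
        \<phi> (c 0) \<oplus> b \<otimes> (\<Oplus>i\<in>{..<n}. \<phi> (c (Suc i)) \<otimes> b [^] i)" .
    have "(\<Oplus>i\<in>{..<n}. \<phi> (c (Suc i)) \<otimes> b [^] i) \<in> carrier R"
      using b cc by (intro finsum_closed) auto
    then show ?thesis unfolding eq using b cc by (simp add: r_distr a_ac m_comm)
  qed
  show ?case
  proof
    assume "t \<in> monic_values R (\<phi> ` carrier A) b (Suc n)"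
    then obtain a s where a: "a \<in> carrier A" "t = \<phi> a \<oplus> b \<otimes> s" and s: "s \<in> monic_values R (\<phi> ` carrier A) b n"
      by auto
    then obtain c where c: "c \<in> {..<n} \<rightarrow> carrier A" "s = b [^] n \<oplus> (\<Oplus>i\<in>{..<n}. \<phi> (c i) \<otimes> b [^] i)"
      using Suc by blast
    let ?d = "case_nat a c"
    have d: "?d \<in> {..<Suc n} \<rightarrow> carrier A" using a c by (auto split: nat.splits)
    show "\<exists>c\<in>{..<Suc n} \<rightarrow> carrier A. t = b [^] Suc n \<oplus> (\<Oplus>i\<in>{..<Suc n}. \<phi> (c i) \<otimes> b [^] i)"
      using step[OF d] d a c by (intro bexI[of _ ?d]) auto
  next
    assume "\<exists>c\<in>{..<Suc n} \<rightarrow> carrier A. t = b [^] Suc n \<oplus> (\<Oplus>i\<in>{..<Suc n}. \<phi> (c i) \<otimes> b [^] i)"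
    then obtain c where c: "c \<in> {..<Suc n} \<rightarrow> carrier A"
      and t: "t = b [^] Suc n \<oplus> (\<Oplus>i\<in>{..<Suc n}. \<phi> (c i) \<otimes> b [^] i)" by blast
    have "b [^] n \<oplus> (\<Oplus>i\<in>{..<n}. \<phi> (c (Suc i)) \<otimes> b [^] i) \<in> monic_values R (\<phi> ` carrier A) b n"
      using c unfolding Suc by (intro bexI[of _ "\<lambda>i. c (Suc i)"]) auto
    then show "t \<in> monic_values R (\<phi> ` carrier A) b (Suc n)"
      unfolding t step[OF c] monic_values.simps(2) using c by blast
  qed
qed

lemma (in cring) integral_element_iff:
  assumes "b \<in> carrier R" "\<phi> \<in> carrier A \<rightarrow> carrier R"
  shows "integral_element A R \<phi> b \<longleftrightarrow> integral_over R (\<phi> ` carrier A) b"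
  unfolding integral_element_def integral_over_def monic_values_iff[OF assms]
  using assms(1) by (simp add: eq_commute[of "\<zero>"])

text \<open>Every element of \<open>B\<close> stabilizes the finite module \<open>B\<close> itself,
  once zero has been removed from the generators.\<close>

lemma finite_extension_integral:
  assumes B: "domain B" and fin: "finite_extension A B \<phi>"
  shows "integral_extension A B \<phi>"
proof -
  interpret domain B by fact
  obtain E where E: "E \<subseteq> carrier B" "finite E"
      "\<And>b. b \<in> carrier B \<Longrightarrow> \<exists>c \<in> E \<rightarrow> carrier A. b = (\<Oplus>\<^bsub>B\<^esub>e\<in>E. \<phi> (c e) \<otimes>\<^bsub>B\<^esub> e)"
    and ext: "ring_extension A B \<phi>"
    using fin unfolding finite_extension_def by blast
  interpret \<phi>: ring_hom_ring A B \<phi> using ext by (simp add: ring_extension_def)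
  have A0: "subring (\<phi> ` carrier A) B" using \<phi>.img_is_subring[OF \<phi>.R.carrier_is_subring] .
  interpret coefficient_ideal B "\<phi> ` carrier A" "\<phi> ` carrier A"
    using A0 submod_self by (intro coefficient_ideal.intro coefficient_ideal_axioms.intro domain_axioms) auto
  let ?F = "E - {\<zero>\<^bsub>B\<^esub>}"
  \<comment> \<open>If all generators were zero, then \<open>1\<close>, a combination of them, would
    be zero.\<close>
  have ne: "?F \<noteq> {}"
  proof
    assume "?F = {}"
    then have E0: "e = \<zero>\<^bsub>B\<^esub>" if "e \<in> E" for e using that by blast
    obtain c where c: "c \<in> E \<rightarrow> carrier A" "\<one>\<^bsub>B\<^esub> = (\<Oplus>\<^bsub>B\<^esub>e\<in>E. \<phi> (c e) \<otimes>\<^bsub>B\<^esub> e)" using E(3)[of "\<one>\<^bsub>B\<^esub>"] by auto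
    have "(\<Oplus>\<^bsub>B\<^esub>e\<in>E. \<phi> (c e) \<otimes>\<^bsub>B\<^esub> e) = (\<Oplus>\<^bsub>B\<^esub>e\<in>E. \<zero>\<^bsub>B\<^esub>)"
    proof (intro finsum_cong' refl)
      fix e assume e: "e \<in> E"
      then have "\<phi> (c e) \<in> carrier B" using c(1) by (auto intro: \<phi>.hom_closed)
      then show "\<phi> (c e) \<otimes>\<^bsub>B\<^esub> e = \<zero>\<^bsub>B\<^esub>" using E0[OF e] by simp
    qed simp
    then show False using c by simp
  qed
  have Fc: "?F \<subseteq> carrier B" using E by blast
  note M = submod_ideal_prod[OF submod_N Fc ne A_sub(1)]
  have span: "b \<in> ideal_prod B (\<phi> ` carrier A) ?F" if b: "b \<in> carrier B" for b
  proof -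
    obtain c where c: "c \<in> E \<rightarrow> carrier A" "b = (\<Oplus>\<^bsub>B\<^esub>e\<in>E. \<phi> (c e) \<otimes>\<^bsub>B\<^esub> e)" using E(3)[OF b] by blast
    have "\<phi> (c e) \<otimes>\<^bsub>B\<^esub> e \<in> ideal_prod B (\<phi> ` carrier A) ?F" if "e \<in> E" for e
    proof (cases "e = \<zero>\<^bsub>B\<^esub>")
      case True
      have "\<phi> (c e) \<in> carrier B" using c that by (auto intro: \<phi>.hom_closed)
      then show ?thesis using submodD(2)[OF M] True by simp
    next
      case False
      then show ?thesis using c that by (intro ideal_prod.prod) auto
    qed
    then show ?thesis unfolding c(2) by (rule submod_finsum[OF M])
  qed
  have "integral_element A B \<phi> b" if b: "b \<in> carrier B" for b
  proof -
    have "module_stable B (\<phi> ` carrier A) b"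
      unfolding module_stable_def using E(1,2) ne b span by (intro conjI exI[of _ ?F]) auto
    then have "integral_over B (\<phi> ` carrier A) b" by (rule module_stable_imp_integral)
    then show ?thesis using integral_element_iff[OF b, of \<phi> A] by auto
  qed
  then show ?thesis using ext by (simp add: integral_extension_def)
qed


section \<open>Polynomials with restricted coefficients\<close>

text \<open>Isolates one term in a coefficient of a product when all other terms are known to lie in
  \<open>M\<close>; both Gauss's lemma and McCoy's theorem below rest on this.\<close>

lemma (in cring) submod_finsum_remove:
  assumes A: "subring A R" and M: "submod R A M" and S: "finite S" "a \<in> S" "f \<in> S \<rightarrow> carrier R"
    and "finsum R f S \<in> M" and "\<And>x. x \<in> S \<Longrightarrow> x \<noteq> a \<Longrightarrow> f x \<in> M"
  shows "f a \<in> M"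
proof -
  have "finsum R f (insert a (S - {a})) = f a \<oplus> finsum R f (S - {a})"
    using S by (intro finsum_insert) auto
  then have "finsum R f S = f a \<oplus> finsum R f (S - {a})" using S(2) by (simp add: insert_absorb)
  moreover have r: "finsum R f (S - {a}) \<in> M" by (rule submod_finsum[OF M]) (use assms(7) in auto)
  moreover have "f a \<in> carrier R" using S by auto
  ultimately have "f a = finsum R f S \<oplus> \<ominus> finsum R f (S - {a})"
    using submodD(5)[OF M] by (simp add: a_assoc r_neg)
  then show ?thesis using submodD(3)[OF M assms(6) submod_neg[OF M A r]] by simp
qed

lemma (in cring) submod_subring_ideal:
  assumes A: "subring A R" and I: "ideal I (R\<lparr>carrier := A\<rparr>)"
  shows "submod R A I" "I \<subseteq> A"
proof -
  note add = ideal.axioms(1)[OF I]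
  show "I \<subseteq> A" using additive_subgroup.a_subset[OF add] by simp
  then show "submod R A I"
    unfolding submod_def
    using subringE(1)[OF A] additive_subgroup.zero_closed[OF add] additive_subgroup.a_closed[OF add]
      ideal.I_l_closed[OF I] by auto
qed

lemma (in cring) ideal_subringI:
  assumes A: "subring A R" and I: "submod R A I" "I \<subseteq> A"
  shows "ideal I (R\<lparr>carrier := A\<rparr>)"
proof -
  have "cring (R\<lparr>carrier := A\<rparr>)"
    using subring_is_ring[OF A] subringE(1)[OF A] by (intro cring.intro comm_monoid.intro comm_monoid_axioms.intro)
      (auto simp: ring_def m_comm subset_iff)
  from cring.idealI_cring[OF this, of I] show ?thesis using submodD[OF I(1)] I(2) by auto
qed

text \<open>Gauss's lemma for a prime ideal: for the least \<open>i\<close> and \<open>j\<close>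
  with \<open>u i\<close> and \<open>v j\<close> outside \<open>P\<close>, all other terms in degree
  \<open>i + j\<close> lie in \<open>P\<close>. It is stated for sequences because it serves
  polynomials as well as the sequences p_i y^i that define points of the blow-up.\<close>

lemma (in cring) convolution_prime:
  assumes A: "subring A R" and P: "primeideal P (R\<lparr>carrier := A\<rparr>)"
    and u: "\<And>i::nat. u i \<in> A" and v: "\<And>i::nat. v i \<in> A"
    and conv: "\<And>n. (\<Oplus>i\<in>{..n}. u i \<otimes> v (n - i)) \<in> P"
  shows "(\<forall>i. u i \<in> P) \<or> (\<forall>i. v i \<in> P)"
proof (rule ccontr)
  assume "\<not> ?thesis"
  then obtain i0 j0 where "u i0 \<notin> P" "v j0 \<notin> P" by blast
  then obtain i j where i: "u i \<notin> P" "\<And>k. k < i \<Longrightarrow> u k \<in> P" and j: "v j \<notin> P" "\<And>k. k < j \<Longrightarrow> v k \<in> P"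
    using exists_least_iff[of "\<lambda>i. u i \<notin> P"] exists_least_iff[of "\<lambda>i. v i \<notin> P"] by blast
  interpret P: primeideal P "R\<lparr>carrier := A\<rparr>" by (rule P)
  have Ac: "a \<in> carrier R" if "a \<in> A" for a using subringE(1)[OF A] that by blast
  have M: "submod R A P" by (rule submod_subring_ideal[OF A P.is_ideal])
  have "u i \<otimes> v (i + j - i) \<in> P"
  proof (rule submod_finsum_remove[OF A M, of "{..i + j}" i "\<lambda>k. u k \<otimes> v (i + j - k)"])
    fix k assume "k \<in> {..i + j}" "k \<noteq> i"
    then consider "k < i" | "i + j - k < j" by fastforce
    then show "u k \<otimes> v (i + j - k) \<in> P"
    proof cases
      case 1 then show ?thesis using i v P.I_r_closed by simp
    next
      case 2 then show ?thesis using j u P.I_l_closed by simp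
    qed
  qed (use u v Ac conv in auto)
  then show False using P.I_prime[of "u i" "v j"] u v i j by simp
qed

lemma (in abelian_monoid) finsum_atMost_split:
  assumes "f \<in> UNIV \<rightarrow> carrier G"
  shows "finsum G f {..n + Suc m} = finsum G f {..n} \<oplus> finsum G (\<lambda>i. f (n + Suc i)) {..m}"
proof (induct m)
  case 0
  have "f (Suc n) \<in> carrier G" "finsum G f {..n} \<in> carrier G"
    using assms by (auto intro!: finsum_closed)
  then show ?case using assms by (simp add: a_comm Pi_def)
next
  case (Suc m)
  have "finsum G f {..n + Suc (Suc m)} = f (n + Suc (Suc m)) \<oplus> finsum G f {..n + Suc m}"
    using finsum_Suc[of f "n + Suc m"] assms by (simp add: Pi_def)
  also have "\<dots> = finsum G f {..n} \<oplus> (f (n + Suc (Suc m)) \<oplus> finsum G (\<lambda>i. f (n + Suc i)) {..m})"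
    unfolding Suc using assms by (intro a_lcomm) (auto intro!: finsum_closed)
  also have "f (n + Suc (Suc m)) \<oplus> finsum G (\<lambda>i. f (n + Suc i)) {..m} = finsum G (\<lambda>i. f (n + Suc i)) {..Suc m}"
    using assms by (subst finsum_Suc) auto
  finally show ?case .
qed

text \<open>The terms are numbered so that they can become the coefficients of two polynomials whose
  product has the sum as one of its coefficients.\<close>

lemma (in ring) ideal_prod_sequence:
  assumes I: "I \<subseteq> carrier R" and Y: "Y \<subseteq> carrier R" and w: "w \<in> ideal_prod R I Y"
  shows "\<exists>n a y. (\<forall>i. a i \<in> I) \<and> (\<forall>i. y i \<in> Y) \<and> w = (\<Oplus>i\<in>{..n::nat}. a i \<otimes> y i)"
  using w
proof induct
  case (prod i j)
  then show ?case using I Y by (intro exI[of _ 0] exI[of _ "\<lambda>_. i"] exI[of _ "\<lambda>_. j"]) (auto simp: subset_iff)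
next
  case (sum s t)
  then obtain n a y m b z where 1: "\<And>i. a i \<in> I" "\<And>i. y i \<in> Y" "s = (\<Oplus>i\<in>{..n::nat}. a i \<otimes> y i)"
    "\<And>i. b i \<in> I" "\<And>i. z i \<in> Y" "t = (\<Oplus>i\<in>{..m::nat}. b i \<otimes> z i)" by metis
  let ?a = "\<lambda>i. if i \<le> n then a i else b (i - Suc n)"
  let ?y = "\<lambda>i. if i \<le> n then y i else z (i - Suc n)"
  have c: "a i \<in> carrier R" "y i \<in> carrier R" "b i \<in> carrier R" "z i \<in> carrier R" for i
    using 1 I Y by (auto simp: subset_iff)
  have "(\<Oplus>i\<in>{..n + Suc m}. ?a i \<otimes> ?y i) = (\<Oplus>i\<in>{..n}. ?a i \<otimes> ?y i) \<oplus> (\<Oplus>i\<in>{..m}. ?a (n + Suc i) \<otimes> ?y (n + Suc i))"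
    using c by (intro finsum_atMost_split) auto
  also have "(\<Oplus>i\<in>{..n}. ?a i \<otimes> ?y i) = s" unfolding 1 using c by (intro finsum_cong') auto
  also have "(\<Oplus>i\<in>{..m}. ?a (n + Suc i) \<otimes> ?y (n + Suc i)) = t" unfolding 1 using c by (intro finsum_cong') auto
  finally show ?case using 1 by (intro exI[of _ "n + Suc m"] exI[of _ ?a] exI[of _ ?y]) auto
qed

text \<open>The set \<open>M[t]\<close> inside \<open>R[t]\<close>. For a subring, an ideal of it,
  its integral closure and a fractional ideal, all these sets lie in one polynomial ring over the
  large ring \<open>R\<close>.\<close>

definition polys :: "('a, 'm) ring_scheme \<Rightarrow> 'a set \<Rightarrow> (nat \<Rightarrow> 'a) set" where
  "polys R M = {p \<in> carrier (UP R). \<forall>n. up_ring.coeff (UP R) p n \<in> M}"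

text \<open>The names \<open>coeff\<close> and \<open>monom\<close> of \<open>UnivPoly\<close> are hidden by those for polynomials as lists.\<close>

abbreviation (in UP) "pcoeff \<equiv> up_ring.coeff P"
abbreviation (in UP) "pmonom \<equiv> up_ring.monom P"

context UP_domain
begin

lemma polysI: "p \<in> carrier P \<Longrightarrow> (\<And>n. pcoeff p n \<in> M) \<Longrightarrow> p \<in> polys R M"
  by (simp add: polys_def P_def)

lemma polysD:
  assumes "p \<in> polys R M"
  shows "p \<in> carrier P" "pcoeff p n \<in> M"
  using assms by (auto simp: polys_def P_def)

lemma polys_mono: "M \<subseteq> M' \<Longrightarrow> polys R M \<subseteq> polys R M'"
  by (auto simp: polys_def)

lemma polys_mult:
  assumes M: "submod R A M" and p: "p \<in> polys R X1" and q: "q \<in> polys R X2"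
    and "\<And>x y. x \<in> X1 \<Longrightarrow> y \<in> X2 \<Longrightarrow> x \<otimes> y \<in> M"
  shows "p \<otimes>\<^bsub>P\<^esub> q \<in> polys R M"
proof (rule polysI)
  fix n
  show "pcoeff (p \<otimes>\<^bsub>P\<^esub> q) n \<in> M"
    using polysD[OF p] polysD[OF q] assms(4) by (auto intro!: R.submod_finsum[OF M])
qed (use polysD[OF p] polysD[OF q] in simp)

lemma monom_polys: "submod R A M \<Longrightarrow> a \<in> M \<Longrightarrow> pmonom a n \<in> polys R M"
  using submodD[of R A M] by (intro polysI) auto

lemma subring_polys:
  assumes A: "subring A R"
  shows "subring (polys R A) P"
proof (rule P.subringI)
  note A' = subringE[OF A]
  have M: "submod R A A" by (rule R.submod_self[OF A])
  show "polys R A \<subseteq> carrier P" using polysD by blast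
  show "\<one>\<^bsub>P\<^esub> \<in> polys R A" using A' by (intro polysI) auto
  show "\<ominus>\<^bsub>P\<^esub> p \<in> polys R A" if "p \<in> polys R A" for p
    using A' polysD[OF that] by (intro polysI) auto
  show "p \<oplus>\<^bsub>P\<^esub> q \<in> polys R A" if "p \<in> polys R A" "q \<in> polys R A" for p q
    using A' polysD[OF that(1)] polysD[OF that(2)] by (intro polysI) auto
  show "p \<otimes>\<^bsub>P\<^esub> q \<in> polys R A" if "p \<in> polys R A" "q \<in> polys R A" for p q
    by (rule polys_mult[OF M that]) (use A' in auto)
qed

lemma submod_polys:
  assumes "submod R A M"
  shows "submod P (polys R A) (polys R M)"
  unfolding submod_def
proof (intro conjI ballI)
  note M = submodD[OF assms]
  show "polys R M \<subseteq> carrier P" using polysD by blast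
  show "\<zero>\<^bsub>P\<^esub> \<in> polys R M" using M by (intro polysI) auto
  show "p \<oplus>\<^bsub>P\<^esub> q \<in> polys R M" if "p \<in> polys R M" "q \<in> polys R M" for p q
    using M polysD[OF that(1)] polysD[OF that(2)] by (intro polysI) auto
  show "p \<otimes>\<^bsub>P\<^esub> q \<in> polys R M" if "p \<in> polys R A" "q \<in> polys R M" for p q
    by (rule polys_mult[OF assms that]) (use M in auto)
qed

lemma polys_prime:
  assumes A: "subring A R" and Q: "primeideal Q (R\<lparr>carrier := A\<rparr>)"
    and p: "p \<in> polys R A" and q: "q \<in> polys R A" and pq: "p \<otimes>\<^bsub>P\<^esub> q \<in> polys R Q"
  shows "p \<in> polys R Q \<or> q \<in> polys R Q"
proof -
  have "(\<forall>i. pcoeff p i \<in> Q) \<or> (\<forall>i. pcoeff q i \<in> Q)"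
  proof (rule R.convolution_prime[OF A Q])
    show "(\<Oplus>i\<in>{..n}. pcoeff p i \<otimes> pcoeff q (n - i)) \<in> Q" for n
      using polysD(2)[OF pq, of n] polysD(1)[OF p] polysD(1)[OF q] by simp
  qed (use polysD p q in auto)
  then show ?thesis using polysD(1)[OF p] polysD(1)[OF q] polysI by blast
qed

lemma coeff_const_mult:
  assumes "c \<in> carrier R" "p \<in> carrier P"
  shows "pcoeff (pmonom c 0 \<otimes>\<^bsub>P\<^esub> p) n = c \<otimes> pcoeff p n"
  using assms monom_mult_is_smult coeff_smult by simp

text \<open>McCoy's theorem, for the ring \<open>B/J\<close> and a polynomial with a coefficient \<open>1\<close>.\<close>

lemma mccoy:
  assumes B: "subring B R" and J: "submod R B J" and h: "h \<in> polys R B" and hr: "pcoeff h r = \<one>"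
    and k: "k \<in> polys R B" and hk: "h \<otimes>\<^bsub>P\<^esub> k \<in> polys R J"
  shows "k \<in> polys R J"
proof -
  have main: "k \<in> polys R J"
    if "k \<in> polys R B" "h \<otimes>\<^bsub>P\<^esub> k \<in> polys R J" "\<And>i. n \<le> i \<Longrightarrow> pcoeff k i \<in> J" for n k
    using that
  proof (induct n arbitrary: k)
    case 0
    then show ?case using polysD by (intro polysI) auto
  next
    case (Suc n)
    note hc = polysD[OF h] and kc = polysD[OF Suc(2)]
    have Bc: "b \<in> carrier R" if "b \<in> B" for b using subringE(1)[OF B] that by blast
    \<comment> \<open>Each coefficient of \<open>h\<close> carries \<open>k\<close> into
      \<open>J[t]\<close>. The induction descends from indices above the degree of \<open>h\<close>,
      where the coefficients vanish; \<open>m\<close> bounds the distance to that range.\<close>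
    have all: "pmonom (pcoeff h i) 0 \<otimes>\<^bsub>P\<^esub> k \<in> polys R J" if "deg R h < i + m" for i m
      using that
    proof (induct m arbitrary: i)
      case 0
      then have "pcoeff h i = \<zero>" using hc by (intro deg_aboveD) auto
      then have "pmonom (pcoeff h i) 0 \<otimes>\<^bsub>P\<^esub> k = \<zero>\<^bsub>P\<^esub>" using kc by simp
      then show ?case using submodD(2)[OF submod_polys[OF J]] by simp
    next
      case (Suc m)
      let ?c = "pcoeff h i"
      have cB: "?c \<in> B" using hc by blast
      have later: "pcoeff h j \<otimes> pcoeff k l \<in> J" if "i < j" for j l
      proof -
        have "pmonom (pcoeff h j) 0 \<otimes>\<^bsub>P\<^esub> k \<in> polys R J"
        proof (cases "deg R h < j")
          case True
          then have "pcoeff h j = \<zero>" using hc by (intro deg_aboveD) auto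
          then have "pmonom (pcoeff h j) 0 \<otimes>\<^bsub>P\<^esub> k = \<zero>\<^bsub>P\<^esub>" using kc by simp
          then show ?thesis using submodD(2)[OF submod_polys[OF J]] by simp
        next
          case False
          then show ?thesis using Suc that by simp
        qed
        from polysD(2)[OF this, of l] show ?thesis using coeff_const_mult hc kc Bc by simp
      qed
      \<comment> \<open>In degree \<open>i + n\<close> of \<open>h k\<close>, the terms with a
        larger index in \<open>h\<close> are in \<open>J\<close> by \<open>later\<close>, and those
        with a smaller one involve coefficients of \<open>k\<close> above \<open>n\<close>, which
        lie in \<open>J\<close> by assumption.\<close>
      have top: "?c \<otimes> pcoeff k (i + n - i) \<in> J"
      proof (rule R.submod_finsum_remove[OF B J, of "{..i + n}" i "\<lambda>a. pcoeff h a \<otimes> pcoeff k (i + n - a)"])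
        show "(\<Oplus>a\<in>{..i + n}. pcoeff h a \<otimes> pcoeff k (i + n - a)) \<in> J"
          using polysD(2)[OF \<open>h \<otimes>\<^bsub>P\<^esub> k \<in> polys R J\<close>, of "i + n"] hc kc by simp
        fix a assume "a \<in> {..i + n}" "a \<noteq> i"
        then consider "i < a" | "Suc n \<le> i + n - a" by fastforce
        then show "pcoeff h a \<otimes> pcoeff k (i + n - a) \<in> J"
        proof cases
          case 1 then show ?thesis by (rule later)
        next
          case 2 then show ?thesis
            using submodD(4)[OF J polysD(2)[OF h]] \<open>\<And>i. Suc n \<le> i \<Longrightarrow> pcoeff k i \<in> J\<close> by blast
        qed
      qed (use hc kc in auto)
      \<comment> \<open>By \<open>top\<close> and the assumption on \<open>k\<close>, the
        coefficients of this polynomial lie in \<open>J\<close> from \<open>n\<close> on, one index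
        earlier than those of \<open>k\<close>. So the outer induction hypothesis applies to
        it.\<close>
      let ?k = "pmonom ?c 0 \<otimes>\<^bsub>P\<^esub> k"
      have kk: "pcoeff ?k l = ?c \<otimes> pcoeff k l" for l using coeff_const_mult hc kc Bc by simp
      have c: "?c \<in> carrier R" using cB Bc by blast
      show ?case
      proof (rule \<open>\<And>k. k \<in> polys R B \<Longrightarrow> h \<otimes>\<^bsub>P\<^esub> k \<in> polys R J \<Longrightarrow> (\<And>i. n \<le> i \<Longrightarrow> pcoeff k i \<in> J) \<Longrightarrow> k \<in> polys R J\<close>)
        show "?k \<in> polys R B"
          using kk kc c cB subringE(6)[OF B] by (intro polysI) (auto simp del: coeff_mult)
        have "h \<otimes>\<^bsub>P\<^esub> ?k = pmonom ?c 0 \<otimes>\<^bsub>P\<^esub> (h \<otimes>\<^bsub>P\<^esub> k)"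
          using hc kc c by (simp add: P.m_lcomm)
        then show "h \<otimes>\<^bsub>P\<^esub> ?k \<in> polys R J"
          using submodD(4)[OF submod_polys[OF J] monom_polys[OF R.submod_self[OF B] cB] \<open>h \<otimes>\<^bsub>P\<^esub> k \<in> polys R J\<close>]
          by simp
        fix l assume "n \<le> l"
        then consider "l = n" | "Suc n \<le> l" by fastforce
        then show "pcoeff ?k l \<in> J"
        proof cases
          case 1 then show ?thesis unfolding kk using top by simp
        next
          case 2 then show ?thesis unfolding kk
            using submodD(4)[OF J cB] \<open>\<And>i. Suc n \<le> i \<Longrightarrow> pcoeff k i \<in> J\<close> by blast
        qed
      qed
    qed
    \<comment> \<open>For the coefficient \<open>1\<close> of \<open>h\<close> the product is
      \<open>k\<close> itself.\<close>
    have "pmonom (pcoeff h r) 0 \<otimes>\<^bsub>P\<^esub> k \<in> polys R J" by (rule all[of r "Suc (deg R h)"]) simp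
    then show ?case using hr kc by simp
  qed
  show ?thesis
  proof (rule main[OF k hk])
    show "pcoeff k i \<in> J" if "Suc (deg R k) \<le> i" for i
    proof -
      have "pcoeff k i = \<zero>" using that polysD(1)[OF k] by (intro deg_aboveD) auto
      then show ?thesis using submodD(2)[OF J] by simp
    qed
  qed
qed

lemma submod_integral_polys:
  assumes A: "subring A R" and N: "submod R A N" "N \<subseteq> A"
  shows "coefficient_ideal P (polys R A) (polys R N)"
  using subring_polys[OF A] submod_polys[OF N(1)] polys_mono[OF N(2)]
  by (intro coefficient_ideal.intro coefficient_ideal_axioms.intro UP_domain)

lemma integral_monom:
  assumes A: "subring A R" and b: "integral_over R A b"
  shows "integral_over P (polys R A) (pmonom b 0)"
proof -
  have bc: "b \<in> carrier R" using b by (simp add: integral_over_def)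
  have "pmonom t 0 \<in> monic_values P (polys R A) (pmonom b 0) d \<and> t \<in> carrier R" if "t \<in> monic_values R A b d" for t d
    using that
  proof (induct d arbitrary: t)
    case 0
    then show ?case by simp
  next
    case (Suc d)
    then obtain c s where c: "c \<in> A" "s \<in> monic_values R A b d" "t = c \<oplus> b \<otimes> s" by auto
    have s: "pmonom s 0 \<in> monic_values P (polys R A) (pmonom b 0) d" "s \<in> carrier R"
      using Suc(1)[OF c(2)] by auto
    have cc: "c \<in> carrier R" using c(1) subringE(1)[OF A] by blast
    have "pmonom t 0 = pmonom c 0 \<oplus>\<^bsub>P\<^esub> pmonom b 0 \<otimes>\<^bsub>P\<^esub> pmonom s 0"
      unfolding c using cc s bc monom_mult[of b s 0 0] by simp
    then show ?case using s monom_polys[OF R.submod_self[OF A] c(1)] c cc bc by auto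
  qed
  moreover obtain d where "\<zero> \<in> monic_values R A b d" using b unfolding integral_over_def by blast
  ultimately have "pmonom \<zero> 0 \<in> monic_values P (polys R A) (pmonom b 0) d" by blast
  then show ?thesis using bc unfolding integral_over_def by auto
qed

text \<open>The constants of the integral closure and the powers of \<open>t\<close> are integral
  over \<open>A[t]\<close>, and integral elements form a ring.\<close>

lemma polys_integral:
  assumes A: "subring A R" and p: "p \<in> polys R {b. integral_over R A b}"
  shows "integral_over P (polys R A) p"
proof -
  interpret PD: "domain" P by (rule UP_domain)
  let ?C = "{u. integral_over P (polys R A) u}"
  have C: "subring ?C P" by (rule domain.subring_integral_closure[OF UP_domain subring_polys[OF A]])
  have one: "\<one> \<in> A" using subringE(3)[OF A] .
  note pc = polysD[OF p]
  have "pmonom (pcoeff p i) i \<in> ?C" for i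
  proof -
    have "pmonom (pcoeff p i) 0 \<in> ?C" using integral_monom[OF A] pc by simp
    moreover have "pmonom \<one> i \<in> ?C"
      using domain.integral_over_self[OF UP_domain subring_polys[OF A] monom_polys[OF R.submod_self[OF A] one]] by simp
    ultimately have "pmonom (pcoeff p i) 0 \<otimes>\<^bsub>P\<^esub> pmonom \<one> i \<in> ?C" using subringE(6)[OF C] by blast
    then show ?thesis using monom_mult[of "pcoeff p i" \<one> 0 i] pc by simp
  qed
  then have "(\<Oplus>\<^bsub>P\<^esub> i \<in> {..deg R p}. pmonom (pcoeff p i) i) \<in> ?C"
    by (rule P.submod_finsum[OF P.submod_self[OF C]])
  then show ?thesis using up_repr[OF pc(1)] by simp
qed

text \<open>For a monomial n b t^i with \<open>n\<close> in \<open>N\<close> and \<open>b\<close>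
  integral, a finite module stable under \<open>b\<close> over \<open>A[t]\<close> is carried by n
  t^i into \<open>N[t]\<close> times itself. Stable modules for the monomials combine to one for
  their sum.\<close>

lemma polys_extended_ideal_integral:
  assumes A: "subring A R" and N: "submod R A N" "N \<subseteq> A"
    and p: "p \<in> polys R (ideal_prod R N {b. integral_over R A b})"
  shows "integral_over P (polys R N) p"
proof -
  interpret PD: coefficient_ideal P "polys R A" "polys R N" by (rule submod_integral_polys[OF A N])
  let ?st = "module_stable P (polys R N)"
  note pc = polysD[OF p]
  have bc: "{b. integral_over R A b} \<subseteq> carrier R" by (auto simp: integral_over_def)
  note Nc = submodD[OF N(1)]
  have st: "?st (pmonom x i)" if "x \<in> ideal_prod R N {b. integral_over R A b}" for x i
    using that
  proof induct
    case (prod n b)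
    have "module_stable P (polys R A) (pmonom b 0)"
      using domain.integral_imp_module_stable[OF UP_domain subring_polys[OF A] integral_monom[OF A]] prod by simp
    then have "?st (pmonom n i \<otimes>\<^bsub>P\<^esub> pmonom b 0)"
      using PD.module_stable_smult[OF monom_polys[OF N(1)]] prod by blast
    then show ?case using monom_mult[of n b i 0] prod Nc bc by auto
  next
    case (sum x y)
    then show ?case using PD.module_stable_add R.ideal_prod_closed[OF Nc(1) bc] by simp
  qed
  have "\<zero> \<otimes> \<one> \<in> ideal_prod R N {b. integral_over R A b}"
    using Nc(2) R.integral_over_self[OF A subringE(3)[OF A]] by (intro ideal_prod.prod) auto
  then have z: "?st \<zero>\<^bsub>P\<^esub>" using st[of \<zero> 0] by simp
  have fs: "?st (finsum P (\<lambda>i. pmonom (pcoeff p i) i) S)" if "finite S" for S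
    using that
  proof induct
    case (insert x F)
    then show ?case using PD.module_stable_add[OF st[OF pc(2)] insert(3), of x] pc(1)
      by (simp add: P.finsum_insert)
  qed (use z in simp)
  have "?st p" using fs[of "{..deg R p}"] up_repr[OF pc(1)] by simp
  then show ?thesis by (rule PD.module_stable_imp_integral)
qed

end


section \<open>Powers of an ideal of a subring\<close>

text \<open>\<open>I\<close> is an ideal of the subring \<open>A\<close> of \<open>R\<close>, not of
  \<open>R\<close>. So its powers and the conductors between them are all subsets of
  \<open>R\<close>, which is a field in the applications.\<close>

primrec ideal_pow :: "('a, 'm) ring_scheme \<Rightarrow> 'a set \<Rightarrow> 'a set \<Rightarrow> nat \<Rightarrow> 'a set" where
  "ideal_pow R A I 0 = A"
| "ideal_pow R A I (Suc n) = ideal_prod R (ideal_pow R A I n) I"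

lemmas ideal_pow_Suc = ideal_pow.simps(2)
declare ideal_pow.simps(2) [simp del]

definition colon :: "('a, 'm) ring_scheme \<Rightarrow> 'a set \<Rightarrow> 'a set \<Rightarrow> 'a set" where
  "colon R M N = {y \<in> carrier R. \<forall>x\<in>N. y \<otimes>\<^bsub>R\<^esub> x \<in> M}"

locale subring_ideal = domain R for R (structure) + fixes A I
  assumes subring_A: "subring A R" and submod_I: "submod R A I" and I_sub_A: "I \<subseteq> A"
begin

lemmas A_sub = subringE[OF subring_A] and I_sub = submodD[OF submod_I]

lemma A_carr [simp]: "a \<in> A \<Longrightarrow> a \<in> carrier R" using A_sub(1) by blast
lemma I_carr [simp]: "a \<in> I \<Longrightarrow> a \<in> carrier R" using I_sub(1) by blast

abbreviation "J \<equiv> ideal_pow R A I"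

lemma J_submod: "submod R A (J n)"
proof (induct n)
  case 0 then show ?case using submod_self[OF subring_A] by simp
next
  case (Suc n)
  then show ?case using submod_ideal_prod[OF Suc I_sub(1) _ A_sub(1)] I_sub(2) by (auto simp: ideal_pow_Suc)
qed

lemmas J_sub = submodD[OF J_submod]

lemma J_carr: "x \<in> J n \<Longrightarrow> x \<in> carrier R"
  using J_sub(1) by blast

lemma J_prodI: "x \<in> J n \<Longrightarrow> a \<in> I \<Longrightarrow> x \<otimes> a \<in> J (Suc n)"
  by (simp add: ideal_prod.prod ideal_pow_Suc)

lemma J_1: "J (Suc 0) = I"
proof
  show "J (Suc 0) \<subseteq> I"
  proof
    fix x assume "x \<in> J (Suc 0)"
    then have "x \<in> ideal_prod R A I" by (simp add: ideal_pow_Suc)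
    then show "x \<in> I" by induct (use I_sub in auto)
  qed
  show "I \<subseteq> J (Suc 0)"
  proof
    fix x assume "x \<in> I"
    then have "\<one> \<otimes> x \<in> J (Suc 0)" using A_sub(3) unfolding ideal_pow_Suc ideal_pow.simps(1) by (blast intro: ideal_prod.prod)
    then show "x \<in> J (Suc 0)" using \<open>x \<in> I\<close> by simp
  qed
qed

lemma J_mult: "x \<in> J m \<Longrightarrow> y \<in> J n \<Longrightarrow> x \<otimes> y \<in> J (m + n)"
proof (induct n arbitrary: y)
  case 0
  then have "y \<otimes> x \<in> J m" using J_sub(4) by simp
  then show ?case using 0 J_carr by (simp add: m_comm)
next
  case (Suc n)
  from Suc(3) have "y \<in> ideal_prod R (J n) I" by (simp add: ideal_pow_Suc)
  then show ?case
  proof induct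
    case (prod i j)
    then have "(x \<otimes> i) \<otimes> j \<in> J (Suc (m + n))" using Suc(1)[OF Suc(2)] J_prodI by blast
    then show ?case using prod Suc(2) J_carr by (simp add: m_assoc)
  next
    case (sum s t)
    have "s \<in> carrier R" "t \<in> carrier R"
      using sum(1,3) J_carr[of _ "Suc n"] by (auto simp: ideal_pow_Suc)
    then show ?case using sum(2,4) J_sub(3) J_carr[OF Suc(2)] by (simp add: r_distr)
  qed
qed

lemma J_pow: "a \<in> I \<Longrightarrow> a [^] (n::nat) \<in> J n"
  by (induct n) (use A_sub(3) J_prodI in auto)

text \<open>For \<open>n = 0\<close> this is the inverse fractional ideal (A : I). In general its
  product with \<open>I\<close> consists of multipliers of I^n; it measures how far \<open>I\<close>
  is from being invertible over the multiplier ring of I^n.\<close>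

definition "T n = colon R (J n) (J (Suc n))"

lemma T_iff: "y \<in> T n \<longleftrightarrow> y \<in> carrier R \<and> (\<forall>x\<in>J (Suc n). y \<otimes> x \<in> J n)"
  by (simp add: T_def colon_def)

lemma T_carr: "y \<in> T n \<Longrightarrow> y \<in> carrier R" by (simp add: T_iff)

lemma T_submod: "submod R A (T n)"
  unfolding submod_def
proof (intro conjI ballI subsetI)
  fix y z assume yz: "y \<in> T n" "z \<in> T n"
  have "(y \<oplus> z) \<otimes> x \<in> J n" if x: "x \<in> J (Suc n)" for x
  proof -
    have "y \<otimes> x \<oplus> z \<otimes> x \<in> J n" using yz x by (intro J_sub(3)) (auto simp: T_iff)
    then show ?thesis using yz x J_carr[OF x] by (simp add: T_iff l_distr)
  qed
  then show "y \<oplus> z \<in> T n" using yz by (simp add: T_iff)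
next
  fix a y assume a: "a \<in> A" and y: "y \<in> T n"
  have "(a \<otimes> y) \<otimes> x \<in> J n" if x: "x \<in> J (Suc n)" for x
  proof -
    have "a \<otimes> (y \<otimes> x) \<in> J n" using y x by (intro J_sub(4)[OF a]) (auto simp: T_iff)
    then show ?thesis using y a J_carr[OF x] by (simp add: T_iff m_assoc)
  qed
  then show "a \<otimes> y \<in> T n" using a y by (simp add: T_iff)
next
  show "\<zero> \<in> T n" using J_sub(2) J_carr[of _ "Suc n"] by (simp add: T_iff)
qed (rule T_carr)

text \<open>A generator of I^(n+2) is an element of I^(n+1) times one of \<open>I\<close>, and
  \<open>y\<close> acts on the first factor alone. Monotonicity later makes the union of the
  products \<open>I\<close> times \<open>T n\<close> closed under addition.\<close>

lemma T_Suc: "T n \<subseteq> T (Suc n)"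
proof
  fix y assume y: "y \<in> T n"
  have "y \<otimes> x \<in> J (Suc n)" if "x \<in> ideal_prod R (J (Suc n)) I" for x
    using that
  proof induct
    case (prod i j)
    then have "(y \<otimes> i) \<otimes> j \<in> J (Suc n)" using y J_prodI by (auto simp: T_iff)
    then show ?case using prod y J_carr T_carr by (simp add: m_assoc)
  next
    case (sum s t)
    have "s \<in> carrier R" "t \<in> carrier R"
      using sum(1,3) J_carr[of _ "Suc (Suc n)"] by (auto simp: ideal_pow_Suc)
    then show ?case using sum(2,4) J_sub(3)[of _ "Suc n"] T_carr[OF y] by (simp add: r_distr)
  qed
  then show "y \<in> T (Suc n)" using T_carr[OF y] unfolding T_iff ideal_pow_Suc[of R A I "Suc n"] by blast
qed

lemma T_mono: "m \<le> n \<Longrightarrow> T m \<subseteq> T n"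
  by (rule lift_Suc_mono_le[of T]) (rule T_Suc)

end

locale subring_ideal_poly = UP_domain R P + subring_ideal R A I
  for R (structure) and P (structure) and A I
begin

abbreviation "const c \<equiv> pmonom c 0"

lemma polys_A: "subring (polys R A) P" by (rule subring_polys[OF subring_A])

lemma J_polys_submod: "submod P (polys R A) (polys R (J n))"
  by (rule submod_polys[OF J_submod])

lemma polys_J_mult: "p \<in> polys R (J m) \<Longrightarrow> q \<in> polys R (J n) \<Longrightarrow> p \<otimes>\<^bsub>P\<^esub> q \<in> polys R (J (m + n))"
  using polys_mult[OF J_submod] J_mult by blast

text \<open>The fractions \<open>c = p / f\<^sup>n\<close> with \<open>p \<in> I\<^sup>n[t]\<close>.\<close>

definition "C f n = {c \<in> carrier P. f [^]\<^bsub>P\<^esub> n \<otimes>\<^bsub>P\<^esub> c \<in> polys R (J n)}"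

context
  fixes f assumes f: "f \<in> polys R I"
begin

lemma f_closed [simp]: "f \<in> carrier P" using polysD(1)[OF f] .

lemma f_pow: "f [^]\<^bsub>P\<^esub> (n::nat) \<in> polys R (J n)"
proof (induct n)
  case 0
  then show ?case using subringE(3)[OF polys_A] by simp
next
  case (Suc n)
  then show ?case using polys_J_mult[of _ n f "Suc 0"] f J_1 by simp
qed

lemma C_carr: "c \<in> C f n \<Longrightarrow> c \<in> carrier P" by (simp add: C_def)

lemma C_mult:
  assumes "c \<in> C f m" "d \<in> C f n"
  shows "c \<otimes>\<^bsub>P\<^esub> d \<in> C f (m + n)"
proof -
  have "f [^]\<^bsub>P\<^esub> (m + n) \<otimes>\<^bsub>P\<^esub> (c \<otimes>\<^bsub>P\<^esub> d) = (f [^]\<^bsub>P\<^esub> m \<otimes>\<^bsub>P\<^esub> c) \<otimes>\<^bsub>P\<^esub> (f [^]\<^bsub>P\<^esub> n \<otimes>\<^bsub>P\<^esub> d)"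
    using assms by (simp add: C_def P.nat_pow_mult[symmetric] P.m_ac)
  then show ?thesis using assms polys_J_mult by (simp add: C_def)
qed

lemma C_submod: "submod P (polys R A) (C f n)"
  unfolding submod_def
proof (intro conjI ballI subsetI)
  note JP = submodD[OF J_polys_submod]
  fix c d assume c: "c \<in> C f n" and d: "d \<in> C f n"
  show "c \<oplus>\<^bsub>P\<^esub> d \<in> C f n" using c d JP(3) by (simp add: C_def P.r_distr)
next
  note JP = submodD[OF J_polys_submod]
  fix a c assume a: "a \<in> polys R A" and c: "c \<in> C f n"
  have "f [^]\<^bsub>P\<^esub> n \<otimes>\<^bsub>P\<^esub> (a \<otimes>\<^bsub>P\<^esub> c) = a \<otimes>\<^bsub>P\<^esub> (f [^]\<^bsub>P\<^esub> n \<otimes>\<^bsub>P\<^esub> c)"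
    using c polysD(1)[OF a] by (simp add: C_def P.m_ac)
  then show "a \<otimes>\<^bsub>P\<^esub> c \<in> C f n" using c a polysD(1)[OF a] JP(4) by (simp add: C_def)
next
  show "\<zero>\<^bsub>P\<^esub> \<in> C f n" using submodD(2)[OF J_polys_submod] by (simp add: C_def)
qed (simp add: C_def)

lemma one_C: "\<one>\<^bsub>P\<^esub> \<in> C f n"
  using f_pow by (simp add: C_def)

lemma low_values_C:
  assumes u: "u \<in> C f (Suc 0)" and x: "x \<in> low_values P (polys R A) u d"
  shows "x \<in> C f d"
  using x
proof (induct d arbitrary: x)
  case 0 then show ?case using submodD(2)[OF C_submod] by simp
next
  case (Suc d)
  then obtain c t where c: "c \<in> polys R A" "t \<in> low_values P (polys R A) u d" "x = c \<oplus>\<^bsub>P\<^esub> u \<otimes>\<^bsub>P\<^esub> t" by auto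
  have "c \<otimes>\<^bsub>P\<^esub> \<one>\<^bsub>P\<^esub> \<in> C f (Suc d)" using submodD(4)[OF C_submod c(1) one_C] .
  then have "c \<in> C f (Suc d)" using polysD(1)[OF c(1)] by simp
  moreover have "u \<otimes>\<^bsub>P\<^esub> t \<in> C f (Suc d)" using C_mult[OF u Suc(1)[OF c(2)]] by simp
  ultimately show ?case unfolding c(3) by (rule submodD(3)[OF C_submod])
qed

text \<open>By the monic equation all powers of \<open>u\<close> are values of polynomials of degree
  less than \<open>d\<close> over \<open>A[t]\<close>, and these have the common denominator
  \<open>f\<close> to the power \<open>d\<close>.\<close>

lemma integral_pow_C:
  assumes u: "u \<in> C f (Suc 0)" and int: "integral_over P (polys R A) u"
  shows "\<exists>d. \<forall>k::nat. u [^]\<^bsub>P\<^esub> k \<in> C f d"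
proof -
  interpret PA: coefficient_ideal P "polys R A" "polys R A"
    by (rule submod_integral_polys[OF subring_A R.submod_self[OF subring_A] order_refl])
  have uc: "u \<in> carrier P" using u by (simp add: C_def)
  obtain d where d: "\<zero>\<^bsub>P\<^esub> \<in> monic_values P (polys R A) u d" using int by (auto simp: integral_over_def)
  \<comment> \<open>Division with remainder by a monic value \<open>m\<close>, written in Horner
    form: a multiple of \<open>m\<close> is subtracted to remove the leading term.\<close>
  have red: "\<exists>a\<in>polys R A. x \<oplus>\<^bsub>P\<^esub> \<ominus>\<^bsub>P\<^esub> (a \<otimes>\<^bsub>P\<^esub> m) \<in> low_values P (polys R A) u d"
    if "x \<in> low_values P (polys R A) u (Suc d)" "m \<in> monic_values P (polys R A) u d" for x m d
    using that
  proof (induct d arbitrary: x m)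
    case 0
    then have "x \<in> polys R A" "x \<in> carrier P" "m = \<one>\<^bsub>P\<^esub>" using uc polysD(1) by auto
    then show ?case by (intro bexI[of _ x]) (auto simp: P.r_neg)
  next
    case (Suc d)
    from Suc(2) obtain c t where c: "c \<in> polys R A" "t \<in> low_values P (polys R A) u (Suc d)" "x = c \<oplus>\<^bsub>P\<^esub> u \<otimes>\<^bsub>P\<^esub> t"
      unfolding low_values.simps(2)[of P _ u "Suc d"] by blast
    from Suc(3) obtain c' m' where c': "c' \<in> polys R A" "m' \<in> monic_values P (polys R A) u d" "m = c' \<oplus>\<^bsub>P\<^esub> u \<otimes>\<^bsub>P\<^esub> m'" by auto
    obtain a where a: "a \<in> polys R A" "t \<oplus>\<^bsub>P\<^esub> \<ominus>\<^bsub>P\<^esub> (a \<otimes>\<^bsub>P\<^esub> m') \<in> low_values P (polys R A) u d"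
      using Suc(1)[OF c(2) c'(2)] by blast
    have cc: "c \<in> carrier P" "c' \<in> carrier P" "a \<in> carrier P" "t \<in> carrier P" "m' \<in> carrier P"
      using c c' a polysD(1) PA.low_closed[OF uc c(2)] PA.monic_closed[OF uc c'(2)] by auto
    have "x \<oplus>\<^bsub>P\<^esub> \<ominus>\<^bsub>P\<^esub> (a \<otimes>\<^bsub>P\<^esub> m) = (c \<oplus>\<^bsub>P\<^esub> \<ominus>\<^bsub>P\<^esub> (a \<otimes>\<^bsub>P\<^esub> c')) \<oplus>\<^bsub>P\<^esub> u \<otimes>\<^bsub>P\<^esub> (t \<oplus>\<^bsub>P\<^esub> \<ominus>\<^bsub>P\<^esub> (a \<otimes>\<^bsub>P\<^esub> m'))"
      unfolding c c' using cc uc by (simp add: P.r_distr P.l_distr P.minus_add P.r_minus P.m_ac P.a_ac)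
    moreover have "c \<oplus>\<^bsub>P\<^esub> \<ominus>\<^bsub>P\<^esub> (a \<otimes>\<^bsub>P\<^esub> c') \<in> polys R A"
      using subringE(5-7)[OF polys_A] c(1) c'(1) a(1) by blast
    ultimately have "x \<oplus>\<^bsub>P\<^esub> \<ominus>\<^bsub>P\<^esub> (a \<otimes>\<^bsub>P\<^esub> m) \<in> low_values P (polys R A) u (Suc d)"
      using PA.low_SucI[OF _ a(2)] by (simp del: low_values.simps)
    then show ?case using a(1) by blast
  qed
  \<comment> \<open>The monic value given by the integral equation is zero. So the multiple that is
    subtracted in the division vanishes, and \<open>u x\<close> itself has a lower form.\<close>
  have shift: "u \<otimes>\<^bsub>P\<^esub> x \<in> low_values P (polys R A) u d" if x: "x \<in> low_values P (polys R A) u d" for x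
  proof -
    obtain a where a: "a \<in> polys R A" "(u \<otimes>\<^bsub>P\<^esub> x) \<oplus>\<^bsub>P\<^esub> \<ominus>\<^bsub>P\<^esub> (a \<otimes>\<^bsub>P\<^esub> \<zero>\<^bsub>P\<^esub>) \<in> low_values P (polys R A) u d"
      using red[OF PA.low_shift[OF uc x] d] by blast
    then show ?thesis using uc PA.low_closed[OF uc x] polysD(1)[OF a(1)] by simp
  qed
  have "d \<noteq> 0" using d by (intro notI) simp
  then obtain e where e: "d = Suc e" using not0_implies_Suc by blast
  have "\<one>\<^bsub>P\<^esub> \<oplus>\<^bsub>P\<^esub> u \<otimes>\<^bsub>P\<^esub> \<zero>\<^bsub>P\<^esub> \<in> low_values P (polys R A) u (Suc e)"
    by (rule PA.low_SucI) (use subringE(3)[OF polys_A] PA.low_zero[OF uc] in auto)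
  then have one: "\<one>\<^bsub>P\<^esub> \<in> low_values P (polys R A) u d" using uc e by (simp del: low_values.simps)
  have "u [^]\<^bsub>P\<^esub> k \<in> low_values P (polys R A) u d" for k :: nat
  proof (induct k)
    case (Suc k)
    then show ?case using shift[of "u [^]\<^bsub>P\<^esub> k"] uc by (simp add: P.m_comm)
  qed (use one in simp)
  then show ?thesis using low_values_C[OF u] by blast
qed

text \<open>\<open>D\<close> may be thought of as the set of all products of powers of elements of
  \<open>U\<close>. The elements are added one at a time, and each raises the common denominator by
  the exponent that bounds its own powers.\<close>

lemma stable_set:
  assumes "finite U" and "\<And>u. u \<in> U \<Longrightarrow> u \<in> C f (Suc 0) \<and> integral_over P (polys R A) u"
  shows "\<exists>N D. D \<subseteq> C f N \<and> \<one>\<^bsub>P\<^esub> \<in> D \<and> (\<forall>u\<in>U. \<forall>x\<in>D. u \<otimes>\<^bsub>P\<^esub> x \<in> D)"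
  using assms
proof (induct U)
  case empty
  show ?case using one_C by (intro exI[of _ 0] exI[of _ "{\<one>\<^bsub>P\<^esub>}"]) auto
next
  case (insert v U)
  then obtain N D where D: "D \<subseteq> C f N" "\<one>\<^bsub>P\<^esub> \<in> D" "\<And>u x. u \<in> U \<Longrightarrow> x \<in> D \<Longrightarrow> u \<otimes>\<^bsub>P\<^esub> x \<in> D"
    by (metis insertCI)
  obtain d where d: "\<And>k::nat. v [^]\<^bsub>P\<^esub> k \<in> C f d"
    using integral_pow_C[of v] insert(4)[of v] by blast
  have vc: "v \<in> carrier P" using insert(4)[of v] C_carr by blast
  have Uc: "u \<in> carrier P" if "u \<in> U" for u using insert(4)[of u] that C_carr by blast
  have Dc: "x \<in> carrier P" if "x \<in> D" for x using D(1) that C_carr by blast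
  define D' where "D' = {v [^]\<^bsub>P\<^esub> k \<otimes>\<^bsub>P\<^esub> x |(k::nat) x. x \<in> D}"
  have "D' \<subseteq> C f (d + N)" using C_mult[OF d] D(1) by (auto simp: D'_def)
  moreover have "v [^]\<^bsub>P\<^esub> (0::nat) \<otimes>\<^bsub>P\<^esub> \<one>\<^bsub>P\<^esub> \<in> D'" using D(2) unfolding D'_def by blast
  then have "\<one>\<^bsub>P\<^esub> \<in> D'" by simp
  moreover have "u \<otimes>\<^bsub>P\<^esub> y \<in> D'" if u: "u \<in> insert v U" and y: "y \<in> D'" for u y
  proof -
    obtain k :: nat and x where x: "x \<in> D" "y = v [^]\<^bsub>P\<^esub> k \<otimes>\<^bsub>P\<^esub> x" using y by (auto simp: D'_def)
    show ?thesis
    proof (cases "u = v")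
      case True
      then have "u \<otimes>\<^bsub>P\<^esub> y = v [^]\<^bsub>P\<^esub> Suc k \<otimes>\<^bsub>P\<^esub> x" using x vc Dc by (simp add: P.m_ac)
      then show ?thesis using x(1) unfolding D'_def by blast
    next
      case False
      then have "u \<in> U" using u by simp
      then have "u \<otimes>\<^bsub>P\<^esub> y = v [^]\<^bsub>P\<^esub> k \<otimes>\<^bsub>P\<^esub> (u \<otimes>\<^bsub>P\<^esub> x)" using x vc Uc Dc by (simp add: P.m_ac)
      then show ?thesis using D(3)[OF \<open>u \<in> U\<close> x(1)] unfolding D'_def by blast
    qed
  qed
  ultimately show ?case by blast
qed

text \<open>For z in \<open>I\<close> the element z v is a fraction with denominator
  \<open>f\<close>, as f z v = z s lies in \<open>I[t]\<close>; it is also integral, so products of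
  any number of such elements have a common denominator f^N. Thus I^(N+1) v^(N+1) lies in C f N, and
  clearing the denominator turns N of the factors \<open>v\<close> into \<open>s\<close>.\<close>

lemma conductor_power:
  assumes Z: "finite Z" "Z \<subseteq> I" "I \<subseteq> ideal_prod R A Z" and v: "v \<in> carrier P"
    and s: "f \<otimes>\<^bsub>P\<^esub> v \<in> polys R A"
    and int: "\<And>z. z \<in> I \<Longrightarrow> integral_over P (polys R A) (const z \<otimes>\<^bsub>P\<^esub> v)"
  shows "\<exists>N. \<forall>w\<in>J (Suc N). (v \<otimes>\<^bsub>P\<^esub> (f \<otimes>\<^bsub>P\<^esub> v) [^]\<^bsub>P\<^esub> N) \<otimes>\<^bsub>P\<^esub> const w \<in> polys R (J N)"
proof -
  have u: "const z \<otimes>\<^bsub>P\<^esub> v \<in> C f (Suc 0)" if z: "z \<in> I" for z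
  proof -
    have "f [^]\<^bsub>P\<^esub> Suc 0 \<otimes>\<^bsub>P\<^esub> (const z \<otimes>\<^bsub>P\<^esub> v) = const z \<otimes>\<^bsub>P\<^esub> (f \<otimes>\<^bsub>P\<^esub> v)"
      using z v by (simp add: P.m_ac)
    moreover have "const z \<otimes>\<^bsub>P\<^esub> (f \<otimes>\<^bsub>P\<^esub> v) \<in> polys R (J (Suc 0 + 0))"
      using polys_J_mult[of "const z" "Suc 0" "f \<otimes>\<^bsub>P\<^esub> v" 0] monom_polys[OF J_submod, of z "Suc 0" 0] s z J_1
      by simp
    ultimately show ?thesis using z v by (simp add: C_def)
  qed
  have "w \<in> C f (Suc 0) \<and> integral_over P (polys R A) w" if "w \<in> (\<lambda>z. const z \<otimes>\<^bsub>P\<^esub> v) ` Z" for w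
    using that u int Z(2) by blast
  from stable_set[OF finite_imageI[OF Z(1)] this]
  have "\<exists>N D. D \<subseteq> C f N \<and> \<one>\<^bsub>P\<^esub> \<in> D \<and>
    (\<forall>w\<in>(\<lambda>z. const z \<otimes>\<^bsub>P\<^esub> v) ` Z. \<forall>x\<in>D. w \<otimes>\<^bsub>P\<^esub> x \<in> D)" .
  then obtain N D where "D \<subseteq> C f N \<and> \<one>\<^bsub>P\<^esub> \<in> D \<and>
    (\<forall>w\<in>(\<lambda>z. const z \<otimes>\<^bsub>P\<^esub> v) ` Z. \<forall>x\<in>D. w \<otimes>\<^bsub>P\<^esub> x \<in> D)"
    by (elim exE) (rule that)
  then have D: "D \<subseteq> C f N" "\<one>\<^bsub>P\<^esub> \<in> D"
    "\<And>z x. z \<in> Z \<Longrightarrow> x \<in> D \<Longrightarrow> (const z \<otimes>\<^bsub>P\<^esub> v) \<otimes>\<^bsub>P\<^esub> x \<in> D" by blast+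
  have Dc: "x \<in> carrier P" if "x \<in> D" for x using D(1) that C_carr by blast
  \<comment> \<open>The multipliers of \<open>D\<close> into C f N. Unlike \<open>D\<close>, this
    set is closed under addition and under \<open>A[t]\<close>, so a statement about the generators
    in \<open>Z\<close> extends to all of \<open>I\<close> and its powers.\<close>
  define G where "G = {c \<in> carrier P. \<forall>x\<in>D. c \<otimes>\<^bsub>P\<^esub> x \<in> C f N}"
  note CS = submodD[OF C_submod]
  have G_add: "c \<oplus>\<^bsub>P\<^esub> d \<in> G" if "c \<in> G" "d \<in> G" for c d
    using that CS(3) Dc by (auto simp: G_def P.l_distr)
  have G_smult: "a \<otimes>\<^bsub>P\<^esub> c \<in> G" if "a \<in> polys R A" "c \<in> G" for a c
    using that CS(4)[OF that(1)] Dc polysD(1)[OF that(1)] by (auto simp: G_def P.m_assoc)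
  have G_Z: "c \<otimes>\<^bsub>P\<^esub> (const z \<otimes>\<^bsub>P\<^esub> v) \<in> G" if "c \<in> G" "z \<in> Z" for c z
  proof -
    have zc: "z \<in> carrier R" using that Z(2) by auto
    have "c \<otimes>\<^bsub>P\<^esub> (const z \<otimes>\<^bsub>P\<^esub> v) \<otimes>\<^bsub>P\<^esub> x = c \<otimes>\<^bsub>P\<^esub> ((const z \<otimes>\<^bsub>P\<^esub> v) \<otimes>\<^bsub>P\<^esub> x)" if "x \<in> D" for x
      using that \<open>c \<in> G\<close> zc v Dc by (simp add: G_def P.m_assoc)
    then show ?thesis using that D(3) zc v by (simp add: G_def)
  qed
  have G_I: "c \<otimes>\<^bsub>P\<^esub> (const z \<otimes>\<^bsub>P\<^esub> v) \<in> G" if "c \<in> G" "z \<in> ideal_prod R A Z" for c z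
    using that(2)
  proof induct
    case (prod a z)
    have zc: "z \<in> carrier R" "a \<in> carrier R" using prod Z(2) by auto
    have "const (a \<otimes> z) = const a \<otimes>\<^bsub>P\<^esub> const z" using zc monom_mult[of a z 0 0] by simp
    then have "c \<otimes>\<^bsub>P\<^esub> (const (a \<otimes> z) \<otimes>\<^bsub>P\<^esub> v) = const a \<otimes>\<^bsub>P\<^esub> (c \<otimes>\<^bsub>P\<^esub> (const z \<otimes>\<^bsub>P\<^esub> v))"
      using zc v \<open>c \<in> G\<close> by (simp add: G_def P.m_ac)
    then show ?case
      using G_smult[OF monom_polys[OF R.submod_self[OF subring_A] prod(1)] G_Z[OF \<open>c \<in> G\<close> prod(2)]] by simp
  next
    case (sum x y)
    have Zc: "Z \<subseteq> carrier R" using Z(2) I_sub(1) by blast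
    have "x \<in> carrier R" "y \<in> carrier R" using sum R.ideal_prod_closed[OF A_sub(1) Zc] by auto
    then have "c \<otimes>\<^bsub>P\<^esub> (const (x \<oplus> y) \<otimes>\<^bsub>P\<^esub> v) = c \<otimes>\<^bsub>P\<^esub> (const x \<otimes>\<^bsub>P\<^esub> v) \<oplus>\<^bsub>P\<^esub> c \<otimes>\<^bsub>P\<^esub> (const y \<otimes>\<^bsub>P\<^esub> v)"
      using v \<open>c \<in> G\<close> by (simp add: G_def P.l_distr P.r_distr)
    then show ?case using G_add sum by simp
  qed
  have pow: "v [^]\<^bsub>P\<^esub> n \<otimes>\<^bsub>P\<^esub> const w \<in> G" if "w \<in> J n" for n w
    using that
  proof (induct n arbitrary: w)
    case 0
    then have "const w \<otimes>\<^bsub>P\<^esub> \<one>\<^bsub>P\<^esub> \<in> G" 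
      using D(1) Dc by (intro G_smult monom_polys[OF R.submod_self[OF subring_A]]) (auto simp: G_def)
    then show ?case using 0 by simp
  next
    case (Suc n)
    then have "w \<in> ideal_prod R (J n) I" by (simp add: ideal_pow_Suc)
    then show ?case
    proof induct
      case (prod x z)
      have c: "x \<in> carrier R" "z \<in> carrier R" using prod J_carr by auto
      then have "const (x \<otimes> z) = const x \<otimes>\<^bsub>P\<^esub> const z" using monom_mult[of x z 0 0] by simp
      then have "v [^]\<^bsub>P\<^esub> Suc n \<otimes>\<^bsub>P\<^esub> const (x \<otimes> z) = (v [^]\<^bsub>P\<^esub> n \<otimes>\<^bsub>P\<^esub> const x) \<otimes>\<^bsub>P\<^esub> (const z \<otimes>\<^bsub>P\<^esub> v)"
        using c v by (simp add: P.m_ac)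
      then show ?case using G_I[OF Suc(1)[OF prod(1)]] prod(2) Z(3) by auto
    next
      case (sum x y)
      have "x \<in> carrier R" "y \<in> carrier R" using sum J_carr[of _ "Suc n"] by (auto simp: ideal_pow_Suc)
      then have "v [^]\<^bsub>P\<^esub> Suc n \<otimes>\<^bsub>P\<^esub> const (x \<oplus> y) =
          v [^]\<^bsub>P\<^esub> Suc n \<otimes>\<^bsub>P\<^esub> const x \<oplus>\<^bsub>P\<^esub> v [^]\<^bsub>P\<^esub> Suc n \<otimes>\<^bsub>P\<^esub> const y"
        using v by (simp add: P.r_distr)
      then show ?case using G_add sum by simp
    qed
  qed
  \<comment> \<open>The power N+1 of \<open>v\<close> against the denominator f^N: all but one of
    the factors \<open>v\<close> are absorbed into s^N, and the remaining one is the fraction whose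
    coefficients are sought.\<close>
  have "(v \<otimes>\<^bsub>P\<^esub> (f \<otimes>\<^bsub>P\<^esub> v) [^]\<^bsub>P\<^esub> N) \<otimes>\<^bsub>P\<^esub> const w \<in> polys R (J N)" if w: "w \<in> J (Suc N)" for w
  proof -
    have wc: "w \<in> carrier R" using w J_carr by blast
    have "(v [^]\<^bsub>P\<^esub> Suc N \<otimes>\<^bsub>P\<^esub> const w) \<otimes>\<^bsub>P\<^esub> \<one>\<^bsub>P\<^esub> \<in> C f N"
      using pow[OF w] D(2) unfolding G_def by blast
    then have "f [^]\<^bsub>P\<^esub> N \<otimes>\<^bsub>P\<^esub> (v [^]\<^bsub>P\<^esub> Suc N \<otimes>\<^bsub>P\<^esub> const w) \<in> polys R (J N)"
      using v wc by (simp add: C_def)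
    moreover have "f [^]\<^bsub>P\<^esub> N \<otimes>\<^bsub>P\<^esub> (v [^]\<^bsub>P\<^esub> Suc N \<otimes>\<^bsub>P\<^esub> const w) = (v \<otimes>\<^bsub>P\<^esub> (f \<otimes>\<^bsub>P\<^esub> v) [^]\<^bsub>P\<^esub> N) \<otimes>\<^bsub>P\<^esub> const w"
      using v wc by (simp add: P.nat_pow_distrib P.m_ac)
    ultimately show ?thesis by simp
  qed
  then show ?thesis by blast
qed

end

end


section \<open>Multiples of a polynomial that lie in \<open>A[t]\<close> but outside a prime\<close>

lemma coeff_UP: "p \<in> carrier (UP R) \<Longrightarrow> up_ring.coeff (UP R) p i = p i"
  by (simp add: UP_def)

text \<open>A constant term outside \<open>Q[t]\<close> in a monic equation of \<open>h\<close> over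
  \<open>A[t]\<close> would be, up to sign, the multiple sought. Such a term is first found modulo
  \<open>QB[t]\<close>, where \<open>h\<close> can be cancelled by McCoy's theorem; the error in
  \<open>QB[t]\<close> is then removed because it is integral over \<open>Q[t]\<close>.\<close>

lemma (in UP_domain) separating_multiple:
  assumes A: "subring A R" and Q: "primeideal Q (R\<lparr>carrier := A\<rparr>)"
    and h: "h \<in> polys R {b. integral_over R A b}" and hr: "pcoeff h r = \<one>"
  shows "\<exists>w\<in>polys R {b. integral_over R A b}. h \<otimes>\<^bsub>P\<^esub> w \<in> polys R A - polys R Q"
proof -
  let ?B = "{b. integral_over R A b}" and ?QB = "ideal_prod R Q {b. integral_over R A b}"
  have B: "subring ?B R" by (rule R.subring_integral_closure[OF A])
  note Qm = R.submod_subring_ideal[OF A primeideal.axioms(1)[OF Q]]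
  have AB: "A \<subseteq> ?B" using R.integral_over_self[OF A] by blast
  have one_Q: "\<one> \<notin> Q" using primeideal_one_notin[OF Q] by simp
  have Bc: "?B \<subseteq> carrier R" and Bne: "?B \<noteq> {}" using subringE(1,4)[OF B] by auto
  have QB: "submod R ?B ?QB"
  proof -
    have "b \<otimes> x \<in> ?QB" if "b \<in> ?B" "x \<in> ?QB" for b x
      using that(2)
    proof induct
      case (prod q c)
      have "q \<otimes> (b \<otimes> c) \<in> ?QB" using prod that(1) subringE(6)[OF B] by (blast intro: ideal_prod.prod)
      moreover have "b \<in> carrier R" "c \<in> carrier R" using prod that(1) Bc by blast+
      ultimately show ?case using submodD(5)[OF Qm(1) prod(1)] by (simp add: R.m_lcomm)
    next
      case (sum x y)
      have "x \<in> carrier R" "y \<in> carrier R" using sum R.ideal_prod_closed[OF submodD(1)[OF Qm(1)] Bc] by auto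
      then show ?case using sum that(1) Bc by (auto simp: R.r_distr ideal_prod.sum)
    qed
    then show ?thesis using R.submod_ideal_prod[OF Qm(1) Bc Bne subringE(1)[OF A]] by (auto simp: submod_def)
  qed
  note PA = submodD[OF submod_polys[OF R.submod_self[OF A]]]
  note PQB = submodD[OF submod_polys[OF QB]]
  note PB = subringE[OF subring_polys[OF B]]
  note PAr = subringE[OF subring_polys[OF A]]
  have hint: "integral_over P (polys R A) h" by (rule polys_integral[OF A h])
  then obtain d where d: "\<zero>\<^bsub>P\<^esub> \<in> monic_values P (polys R A) h d" by (auto simp: integral_over_def)
  have PAB: "polys R A \<subseteq> polys R ?B" by (rule polys_mono[OF AB])
  have mB: "t \<in> polys R ?B" if "t \<in> monic_values P (polys R A) h d" for t d
    using that
  proof (induct d arbitrary: t)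
    case 0 then show ?case using PB(3) by simp
  next
    case (Suc d)
    then show ?case using PB(6,7) h PAB by (auto simp del: UP_mult_closed UP_a_closed)
  qed
  have Qsub: "polys R Q \<subseteq> polys R ?QB"
  proof (rule polys_mono)
    show "Q \<subseteq> ?QB"
    proof
      fix q assume "q \<in> Q"
      then have "q \<otimes> \<one> \<in> ?QB" using subringE(3)[OF B] by (intro ideal_prod.prod) auto
      then show "q \<in> ?QB" using \<open>q \<in> Q\<close> submodD(5)[OF Qm(1)] by simp
    qed
  qed
  have one_notin: "\<one>\<^bsub>P\<^esub> \<notin> polys R Q"
    using one_Q polysD(2)[of "\<one>\<^bsub>P\<^esub>" Q 0] by auto
  \<comment> \<open>Peels off constant coefficients: if one lies in \<open>Q[t]\<close>, the rest
    \<open>h s\<close> is in \<open>QB[t]\<close>, and McCoy's theorem gives the same for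
    \<open>s\<close>, a monic value of lower degree. At the latest the value \<open>1\<close> in
    degree zero is outside \<open>Q[t]\<close>.\<close>
  have step: "\<exists>c\<in>polys R A - polys R Q. \<exists>w\<in>polys R ?B. c \<oplus>\<^bsub>P\<^esub> h \<otimes>\<^bsub>P\<^esub> w \<in> polys R ?QB"
    if "t \<in> monic_values P (polys R A) h d" "t \<in> polys R ?QB" for t d
    using that
  proof (induct d arbitrary: t)
    case 0
    then show ?case using one_notin PAr(3) PB(2) polysD(1)[OF h]
      by (intro bexI[of _ "\<one>\<^bsub>P\<^esub>"] bexI[of _ "\<zero>\<^bsub>P\<^esub>"]) auto
  next
    case (Suc d)
    then obtain c s where c: "c \<in> polys R A" "s \<in> monic_values P (polys R A) h d" "t = c \<oplus>\<^bsub>P\<^esub> h \<otimes>\<^bsub>P\<^esub> s" by auto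
    show ?case
    proof (cases "c \<in> polys R Q")
      case False
      then show ?thesis using c mB Suc(3) by blast
    next
      case True
      have cs: "c \<in> carrier P" "h \<otimes>\<^bsub>P\<^esub> s \<in> carrier P" using c mB[OF c(2)] polysD(1) h by auto
      have "\<ominus>\<^bsub>P\<^esub> c \<oplus>\<^bsub>P\<^esub> t \<in> polys R ?QB"
        using PQB(3) Suc(3) True Qsub P.submod_neg[OF submod_polys[OF QB] subring_polys[OF B]] by blast
      then have "h \<otimes>\<^bsub>P\<^esub> s \<in> polys R ?QB" using c(3) cs by (simp add: P.a_assoc[symmetric] P.l_neg)
      then have "s \<in> polys R ?QB" by (rule mccoy[OF B QB h hr mB[OF c(2)]])
      then show ?thesis using Suc(1)[OF c(2)] by blast
    qed
  qed
  have "\<zero>\<^bsub>P\<^esub> \<in> polys R ?QB" using PQB(2) .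
  from step[OF d this] obtain c w where c: "c \<in> polys R A" "c \<notin> polys R Q" and w: "w \<in> polys R ?B"
    and \<mu>: "c \<oplus>\<^bsub>P\<^esub> h \<otimes>\<^bsub>P\<^esub> w \<in> polys R ?QB" by blast
  define \<mu> where "\<mu> = c \<oplus>\<^bsub>P\<^esub> h \<otimes>\<^bsub>P\<^esub> w"
  have "integral_over P (polys R Q) \<mu>"
    using polys_extended_ideal_integral[OF A Qm] \<mu> by (simp add: \<mu>_def)
  then obtain k where k: "\<zero>\<^bsub>P\<^esub> \<in> monic_values P (polys R Q) \<mu> k" by (auto simp: integral_over_def)
  have \<mu>B: "\<mu> \<in> polys R ?B" unfolding \<mu>_def using c w h PAB PB(6,7) by blast
  note cc = polysD(1)[OF c(1)] polysD(1)[OF w] polysD(1)[OF h]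
  \<comment> \<open>Modulo \<open>h\<close> the element \<mu> is \<open>c\<close>. So a monic value
    of degree k at \<mu> with lower coefficients in \<open>Q[t]\<close> is congruent to c^k plus an
    element of \<open>Q[t]\<close>, and this stays outside \<open>Q[t]\<close> by Gauss's
    lemma.\<close>
  have "\<exists>s\<in>polys R A - polys R Q. \<exists>v\<in>polys R ?B. t = s \<oplus>\<^bsub>P\<^esub> h \<otimes>\<^bsub>P\<^esub> v \<and> t \<in> polys R ?B"
    if "t \<in> monic_values P (polys R Q) \<mu> k" for t k
    using that
  proof (induct k arbitrary: t)
    case 0
    then show ?case using one_notin PAr(3) PB(2,3) cc
      by (intro bexI[of _ "\<one>\<^bsub>P\<^esub>"] bexI[of _ "\<zero>\<^bsub>P\<^esub>"]) auto
  next
    case (Suc k)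
    then obtain m t' where m: "m \<in> polys R Q" "t' \<in> monic_values P (polys R Q) \<mu> k" "t = m \<oplus>\<^bsub>P\<^esub> \<mu> \<otimes>\<^bsub>P\<^esub> t'" by auto
    obtain s v where s: "s \<in> polys R A" "s \<notin> polys R Q" and v: "v \<in> polys R ?B" and t': "t' = s \<oplus>\<^bsub>P\<^esub> h \<otimes>\<^bsub>P\<^esub> v" "t' \<in> polys R ?B"
      using Suc(1)[OF m(2)] by blast
    have QA: "polys R Q \<subseteq> polys R A" by (rule polys_mono[OF Qm(2)])
    note car = cc polysD(1)[OF m(1)] polysD(1)[OF s(1)] polysD(1)[OF v] polysD(1)[OF t'(2)]
    let ?s = "m \<oplus>\<^bsub>P\<^esub> c \<otimes>\<^bsub>P\<^esub> s" and ?v = "c \<otimes>\<^bsub>P\<^esub> v \<oplus>\<^bsub>P\<^esub> w \<otimes>\<^bsub>P\<^esub> t'"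
    have "?s \<in> polys R A" using m(1) QA c(1) s(1) PAr(6,7) by blast
    moreover have "?s \<notin> polys R Q"
    proof
      assume "?s \<in> polys R Q"
      then have "\<ominus>\<^bsub>P\<^esub> m \<oplus>\<^bsub>P\<^esub> ?s \<in> polys R Q"
        using submodD(3)[OF submod_polys[OF Qm(1)]] P.submod_neg[OF submod_polys[OF Qm(1)] subring_polys[OF A] m(1)] by blast
      then have "c \<otimes>\<^bsub>P\<^esub> s \<in> polys R Q" using car by (simp add: P.a_assoc[symmetric] P.l_neg)
      then show False using polys_prime[OF A Q c(1) s(1)] c(2) s(2) by blast
    qed
    moreover have "?v \<in> polys R ?B" using c(1) v w t'(2) PAB PB(6,7) by blast
    moreover have "t = ?s \<oplus>\<^bsub>P\<^esub> h \<otimes>\<^bsub>P\<^esub> ?v"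
    proof -
      have "t = m \<oplus>\<^bsub>P\<^esub> (c \<otimes>\<^bsub>P\<^esub> t' \<oplus>\<^bsub>P\<^esub> (h \<otimes>\<^bsub>P\<^esub> w) \<otimes>\<^bsub>P\<^esub> t')"
        unfolding m(3) \<mu>_def using car by (simp add: P.l_distr)
      also have "c \<otimes>\<^bsub>P\<^esub> t' = c \<otimes>\<^bsub>P\<^esub> s \<oplus>\<^bsub>P\<^esub> h \<otimes>\<^bsub>P\<^esub> (c \<otimes>\<^bsub>P\<^esub> v)"
        unfolding t'(1) using car by (simp add: P.r_distr P.m_ac)
      finally show ?thesis using car by (simp add: P.r_distr P.m_ac P.a_ac)
    qed
    moreover have "t \<in> polys R ?B" unfolding m(3) using m(1) QA PAB \<mu>B t'(2) PB(6,7) by blast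
    ultimately show ?case by blast
  qed
  from this[OF k] obtain s v where s: "s \<in> polys R A" "s \<notin> polys R Q" and v: "v \<in> polys R ?B"
    and eq: "\<zero>\<^bsub>P\<^esub> = s \<oplus>\<^bsub>P\<^esub> h \<otimes>\<^bsub>P\<^esub> v" by blast
  have vc: "v \<in> carrier P" "s \<in> carrier P" using v s polysD(1) by auto
  have "h \<otimes>\<^bsub>P\<^esub> (\<ominus>\<^bsub>P\<^esub> v) = s"
  proof -
    have "s = \<ominus>\<^bsub>P\<^esub> (h \<otimes>\<^bsub>P\<^esub> v)" using eq vc cc by (metis P.m_closed P.minus_equality)
    then show ?thesis using vc cc by (simp add: P.r_minus)
  qed
  then show ?thesis using s PB(5)[OF v] by (intro bexI[of _ "\<ominus>\<^bsub>P\<^esub> v"]) auto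
qed

context subring_ideal
begin

text \<open>If \<open>1\<close> is in none of the products \<open>I\<close> times
  \<open>T N\<close>, their intersections with \<open>A\<close> unite to a proper ideal; a prime
  \<open>Q\<close> above it is the one for which \<open>separating_multiple\<close> is invoked. Then
  a power of \<open>s\<close> has all coefficients in \<open>Q\<close>, although \<open>s\<close> is
  outside the prime ideal \<open>Q[t]\<close>.\<close>

lemma one_in_prod_T_of_integral:
  assumes Z: "finite Z" "Z \<subseteq> I" "I \<subseteq> ideal_prod R A Z"
    and inv: "\<one> \<in> ideal_prod R I (colon R {b. integral_over R A b} I)"
  shows "\<exists>N. \<one> \<in> ideal_prod R I (T N)"
proof (rule ccontr)
  assume not: "\<not> ?thesis"
  let ?B = "{b. integral_over R A b}"
  interpret SP: subring_ideal_poly R "UP R" A I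
    by intro_locales
  let ?P = "UP R"
  have B: "subring ?B R" by (rule subring_integral_closure[OF subring_A])
  \<comment> \<open>A directed union, as \<open>T\<close> grows with its index; that is why it is
    closed under addition.\<close>
  define \<aa> where "\<aa> = {a \<in> A. \<exists>N. a \<in> ideal_prod R I (T N)}"
  have prod_submod: "submod R A (ideal_prod R I (T N))" for N
    using submodD(2)[OF T_submod] by (intro submod_ideal_prod[OF submod_I]) (auto simp: T_carr A_sub(1))
  have "submod R A \<aa>"
    unfolding submod_def
  proof (intro conjI ballI)
    show "\<aa> \<subseteq> carrier R" by (auto simp: \<aa>_def)
    show "\<zero> \<in> \<aa>" using submodD(2)[OF prod_submod] A_sub(2) by (auto simp: \<aa>_def)
    show "a \<otimes> x \<in> \<aa>" if "a \<in> A" "x \<in> \<aa>" for a x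
      using that submodD(4)[OF prod_submod] A_sub(6) by (auto simp: \<aa>_def)
    show "x \<oplus> y \<in> \<aa>" if xy: "x \<in> \<aa>" "y \<in> \<aa>" for x y
    proof -
      obtain M N where "x \<in> ideal_prod R I (T M)" "y \<in> ideal_prod R I (T N)" using xy by (auto simp: \<aa>_def)
      then have "x \<in> ideal_prod R I (T (max M N))" "y \<in> ideal_prod R I (T (max M N))"
        using ideal_prod_mono[OF order_refl T_mono] by (meson max.cobounded1 max.cobounded2 subsetD)+
      then have "x \<oplus> y \<in> ideal_prod R I (T (max M N))" by (rule ideal_prod.sum)
      then show ?thesis using xy A_sub(7) by (auto simp: \<aa>_def)
    qed
  qed
  then have id: "ideal \<aa> (R\<lparr>carrier := A\<rparr>)" by (rule ideal_subringI[OF subring_A]) (auto simp: \<aa>_def)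
  have cr: "cring (R\<lparr>carrier := A\<rparr>)"
    using domain.axioms(1)[OF subring_is_domain[OF subring_A]] .
  have "\<one>\<^bsub>R\<lparr>carrier := A\<rparr>\<^esub> \<notin> \<aa>" using not by (auto simp: \<aa>_def)
  then obtain Q where Q: "primeideal Q (R\<lparr>carrier := A\<rparr>)" "\<aa> \<subseteq> Q"
    using cring.exists_prime_ideal[OF cr id] by blast
  have Yc: "colon R ?B I \<subseteq> carrier R" by (auto simp: colon_def)
  obtain n a y where ay: "\<And>i. a i \<in> I" "\<And>i. y i \<in> colon R ?B I" "\<one> = (\<Oplus>i\<in>{..n::nat}. a i \<otimes> y i)"
    using ideal_prod_sequence[OF I_sub(1) Yc inv] by metis
  have ac: "a i \<in> carrier R" "y i \<in> carrier R" for i using ay I_carr Yc by auto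
  define f where "f = (\<lambda>i. if i \<le> n then a i else \<zero>)"
  \<comment> \<open>The order is reversed so that the coefficient of degree \<open>n\<close> of
    \<open>f g\<close> is the sum of all \<open>a i\<close> times \<open>y i\<close>, which is
    \<open>1\<close>.\<close>
  define g where "g = (\<lambda>i. if i \<le> n then y (n - i) else \<zero>)"
  have up: "f \<in> carrier ?P" "g \<in> carrier ?P"
    using ac by (auto simp: UP_def f_def g_def intro!: mem_upI exI[of _ n] bound.intro)
  have cf: "up_ring.coeff ?P f i = (if i \<le> n then a i else \<zero>)" for i
    unfolding coeff_UP[OF up(1)] by (simp add: f_def)
  have cg: "up_ring.coeff ?P g i = (if i \<le> n then y (n - i) else \<zero>)" for i
    unfolding coeff_UP[OF up(2)] by (simp add: g_def)
  have fI: "f \<in> polys R I" by (rule SP.polysI[OF up(1)]) (simp add: cf ay I_sub(2))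
  define h where "h = f \<otimes>\<^bsub>?P\<^esub> g"
  have zg: "up_ring.monom ?P z 0 \<otimes>\<^bsub>?P\<^esub> g \<in> polys R ?B" if z: "z \<in> I" for z
  proof (rule SP.polysI)
    show "up_ring.coeff ?P (up_ring.monom ?P z 0 \<otimes>\<^bsub>?P\<^esub> g) i \<in> ?B" for i
    proof -
      have "z \<otimes> y k \<in> ?B" for k using ay(2)[of k] z ac by (simp add: colon_def m_comm)
      then show ?thesis
        unfolding SP.coeff_const_mult[OF I_carr[OF z] up(2)] cg using subringE(2)[OF B] z by simp
    qed
  qed (use up z in simp)
  have hB: "h \<in> polys R ?B"
    unfolding h_def
  proof (rule SP.polys_mult[OF submod_self[OF B], where ?X1.0 = I and ?X2.0 = "colon R ?B I"])
    show "g \<in> polys R (colon R ?B I)"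
    proof (rule SP.polysI[OF up(2)])
      have "\<zero> \<in> colon R ?B I" using subringE(2)[OF B] by (simp add: colon_def)
      then show "up_ring.coeff ?P g i \<in> colon R ?B I" for i using ay(2) by (simp add: cg)
    qed
    show "x \<otimes> z \<in> ?B" if "x \<in> I" "z \<in> colon R ?B I" for x z
      using that I_carr by (auto simp: colon_def m_comm)
  qed (rule fI)
  have h1: "up_ring.coeff ?P h n = \<one>"
  proof -
    have "up_ring.coeff ?P h n = (\<Oplus>i\<in>{..n}. (if i \<le> n then a i else \<zero>) \<otimes>
        (if n - i \<le> n then y (n - (n - i)) else \<zero>))"
      unfolding h_def SP.coeff_mult[OF up] cf cg ..
    also have "\<dots> = (\<Oplus>i\<in>{..n}. a i \<otimes> y i)"
      using ac by (intro finsum_cong') auto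
    finally show ?thesis using ay(3) by simp
  qed
  obtain w where w: "w \<in> polys R ?B" "h \<otimes>\<^bsub>?P\<^esub> w \<in> polys R A" "h \<otimes>\<^bsub>?P\<^esub> w \<notin> polys R Q"
    using SP.separating_multiple[OF subring_A Q(1) hB h1] by blast
  have wc: "w \<in> carrier ?P" using SP.polysD(1)[OF w(1)] .
  define v where "v = g \<otimes>\<^bsub>?P\<^esub> w"
  have vc: "v \<in> carrier ?P" using up wc by (simp add: v_def)
  define s where "s = h \<otimes>\<^bsub>?P\<^esub> w"
  have fv: "f \<otimes>\<^bsub>?P\<^esub> v = s" using up wc by (simp add: s_def v_def h_def SP.P.m_assoc)
  have sc: "s \<in> carrier ?P" using fv up vc by auto
  have int: "integral_over ?P (polys R A) (up_ring.monom ?P z 0 \<otimes>\<^bsub>?P\<^esub> v)" if "z \<in> I" for z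
  proof -
    have "(up_ring.monom ?P z 0 \<otimes>\<^bsub>?P\<^esub> g) \<otimes>\<^bsub>?P\<^esub> w \<in> polys R ?B"
      using subringE(6)[OF SP.subring_polys[OF B] zg[OF that] w(1)] .
    then show ?thesis
      using SP.polys_integral[OF subring_A] that up wc by (simp add: v_def SP.P.m_assoc)
  qed
  obtain N where N: "\<And>x. x \<in> J (Suc N) \<Longrightarrow> (v \<otimes>\<^bsub>?P\<^esub> s [^]\<^bsub>?P\<^esub> N) \<otimes>\<^bsub>?P\<^esub> up_ring.monom ?P x 0 \<in> polys R (J N)"
    using SP.conductor_power[OF fI Z vc _ int] fv w(2) by (auto simp: s_def)
  define \<gamma> where "\<gamma> = v \<otimes>\<^bsub>?P\<^esub> s [^]\<^bsub>?P\<^esub> N"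
  have \<gamma>c: "\<gamma> \<in> carrier ?P" using vc sc by (simp add: \<gamma>_def)
  have \<gamma>T: "up_ring.coeff ?P \<gamma> i \<in> T N" for i
    unfolding T_iff
  proof (intro conjI ballI)
    fix x assume x: "x \<in> J (Suc N)"
    have "up_ring.coeff ?P (up_ring.monom ?P x 0 \<otimes>\<^bsub>?P\<^esub> \<gamma>) i \<in> J N"
      using SP.polysD(2)[OF N[OF x], of i] \<gamma>c J_carr[OF x] by (simp add: \<gamma>_def[symmetric] SP.P.m_comm del: SP.coeff_mult)
    then show "up_ring.coeff ?P \<gamma> i \<otimes> x \<in> J N"
      using SP.coeff_const_mult[OF J_carr[OF x] \<gamma>c, of i] \<gamma>c J_carr[OF x] by (simp add: m_comm del: SP.coeff_mult)
  qed (use \<gamma>c in simp)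
  have sA: "s [^]\<^bsub>?P\<^esub> n \<in> polys R A" for n :: nat
    by (induct n) (use subringE(3,6)[OF SP.subring_polys[OF subring_A]] w(2) in \<open>auto simp: s_def simp del: SP.UP_mult_closed\<close>)
  have "f \<otimes>\<^bsub>?P\<^esub> \<gamma> = s [^]\<^bsub>?P\<^esub> Suc N"
    using fv up vc sc by (simp add: \<gamma>_def SP.P.m_assoc[symmetric] SP.P.m_comm)
  moreover have "f \<otimes>\<^bsub>?P\<^esub> \<gamma> \<in> polys R (ideal_prod R I (T N))"
    using SP.polysI[OF \<gamma>c \<gamma>T] by (intro SP.polys_mult[OF prod_submod fI]) (auto intro: ideal_prod.prod)
  ultimately have sT: "s [^]\<^bsub>?P\<^esub> Suc N \<in> polys R (ideal_prod R I (T N))" by (simp only:)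
  have "s [^]\<^bsub>?P\<^esub> Suc N \<in> polys R \<aa>"
  proof (rule SP.polysI[OF SP.polysD(1)[OF sT]])
    show "up_ring.coeff ?P (s [^]\<^bsub>?P\<^esub> Suc N) i \<in> \<aa>" for i
      using SP.polysD(2)[OF sT, of i] SP.polysD(2)[OF sA[of "Suc N"], of i] unfolding \<aa>_def by blast
  qed
  then have pQ: "s [^]\<^bsub>?P\<^esub> Suc N \<in> polys R Q" using SP.polys_mono[OF Q(2)] by blast
  have "s [^]\<^bsub>?P\<^esub> n \<notin> polys R Q" for n :: nat
  proof (induct n)
    case 0
    have "\<one> \<notin> Q" using primeideal_one_notin[OF Q(1)] by simp
    then show ?case using SP.polysD(2)[of "\<one>\<^bsub>?P\<^esub>" Q 0] by auto
  next
    case (Suc n)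
    then show ?case
      using SP.polys_prime[OF subring_A Q(1) sA[of n], of s] w(2,3) by (auto simp: s_def)
  qed
  then show False using pQ by blast
qed

end


section \<open>Embeddings into fields\<close>

lemma (in domain) mult_subset_nonzero: "mult_subset R (carrier R - {\<zero>})"
  by unfold_locales (use integral in auto)

lemma (in domain) field_fraction_field: "field (fraction_field R)"
proof -
  interpret M: mult_subset R "carrier R - {\<zero>}" by (rule mult_subset_nonzero)
  interpret F: cring "fraction_field R" unfolding fraction_field_def by (rule M.cring_localization)
  have zero_iff: "fraction R (carrier R - {\<zero>}) a s = \<zero>\<^bsub>fraction_field R\<^esub> \<longleftrightarrow> a = \<zero>"
    if "a \<in> carrier R" "s \<in> carrier R - {\<zero>}" for a s
  proof -
    have "fraction R (carrier R - {\<zero>}) a s = \<zero>\<^bsub>fraction_field R\<^esub> \<longleftrightarrow> (\<exists>u\<in>carrier R - {\<zero>}. u \<otimes> a = \<zero>)"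
      unfolding fraction_field_def M.zero_localization M.fraction_eq_iff[OF that(1) zero_closed that(2) M.one_in_S]
      using that by (intro bex_cong) simp_all
    also have "\<dots> \<longleftrightarrow> a = \<zero>"
    proof
      assume "\<exists>u\<in>carrier R - {\<zero>}. u \<otimes> a = \<zero>"
      then show "a = \<zero>" using integral that(1) by blast
    next
      assume "a = \<zero>"
      then show "\<exists>u\<in>carrier R - {\<zero>}. u \<otimes> a = \<zero>" by (intro bexI[of _ \<one>]) simp_all
    qed
    finally show ?thesis .
  qed
  show ?thesis
  proof (rule F.cring_fieldI2)
    show "\<zero>\<^bsub>fraction_field R\<^esub> \<noteq> \<one>\<^bsub>fraction_field R\<^esub>"
    proof
      assume "\<zero>\<^bsub>fraction_field R\<^esub> = \<one>\<^bsub>fraction_field R\<^esub>"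
      then have "fraction R (carrier R - {\<zero>}) \<one> \<one> = \<zero>\<^bsub>fraction_field R\<^esub>"
        by (simp add: fraction_field_def M.one_localization)
      then show False using zero_iff[of \<one> \<one>] by simp
    qed
    fix x assume x: "x \<in> carrier (fraction_field R)" "x \<noteq> \<zero>\<^bsub>fraction_field R\<^esub>"
    then obtain a s where a: "a \<in> carrier R" "s \<in> carrier R - {\<zero>}" "x = fraction R (carrier R - {\<zero>}) a s"
      unfolding fraction_field_def by (elim M.localization_cases)
    then have "a \<noteq> \<zero>" using x zero_iff by blast
    then have sa: "s \<in> carrier R" "s \<noteq> \<zero>" "a \<in> carrier R - {\<zero>}" using a by auto
    have "fraction R (carrier R - {\<zero>}) (a \<otimes> s) (s \<otimes> a) = fraction R (carrier R - {\<zero>}) \<one> \<one>"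
      using M.mult_in_S[OF a(2) sa(3)] sa a by (intro M.fraction_eqI) (simp_all add: m_comm)
    then have "x \<otimes>\<^bsub>fraction_field R\<^esub> fraction R (carrier R - {\<zero>}) s a = \<one>\<^bsub>fraction_field R\<^esub>"
      unfolding fraction_field_def a(3) M.one_localization
      by (simp only: M.mult_fraction[OF a(1) sa(1) a(2) sa(3)])
    then show "\<exists>b\<in>carrier (fraction_field R). x \<otimes>\<^bsub>fraction_field R\<^esub> b = \<one>\<^bsub>fraction_field R\<^esub>"
      using M.fraction_closed[OF sa(1,3)] unfolding fraction_field_def by blast
  qed
qed

lemma (in domain) to_fraction_field_hom: "to_fraction_field R \<in> ring_hom R (fraction_field R)"
proof -
  interpret M: mult_subset R "carrier R - {\<zero>}" by (rule mult_subset_nonzero)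
  show ?thesis using M.fraction_hom by (simp add: to_fraction_field_def[abs_def] fraction_field_def)
qed

lemma (in domain) to_fraction_field_inj: "inj_on (to_fraction_field R) (carrier R)"
proof (rule inj_onI)
  interpret M: mult_subset R "carrier R - {\<zero>}" by (rule mult_subset_nonzero)
  fix x y assume xy: "x \<in> carrier R" "y \<in> carrier R" "to_fraction_field R x = to_fraction_field R y"
  then obtain u where u: "u \<in> carrier R - {\<zero>}" "u \<otimes> (\<one> \<otimes> x) = u \<otimes> (\<one> \<otimes> y)"
    using M.fraction_eq_iff[of x y \<one> \<one>] unfolding to_fraction_field_def by (auto simp del: l_one)
  then show "x = y" using xy by (simp add: m_lcancel)
qed

text \<open>A constant for the powers of \<open>I\<close>, which the simplifier does not unfold.\<close>

definition ipow :: "('a, 'm) ring_scheme \<Rightarrow> 'a set \<Rightarrow> nat \<Rightarrow> 'a set" where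
  "ipow A I n = ideal_power A I n"

text \<open>For p in the inner set, p/q is an element of (I^m : I^(m+1)) with numerator in
  \<open>A\<close> and denominator \<open>q\<close>. The condition thus says that \<open>1\<close>
  lies in I (I^m : I^(m+1)), multiplied by a common denominator \<open>q\<close>.\<close>

definition conductor_condition :: "('a, 'm) ring_scheme \<Rightarrow> 'a set \<Rightarrow> bool" where
  "conductor_condition A I \<longleftrightarrow> (\<exists>m. \<exists>q\<in>carrier A - {\<zero>\<^bsub>A\<^esub>}.
     q \<in> ideal_prod A I {p \<in> carrier A. \<forall>x\<in>ipow A I (Suc m). \<exists>y\<in>ipow A I m.
       p \<otimes>\<^bsub>A\<^esub> x = q \<otimes>\<^bsub>A\<^esub> y})"

lemma ipow_0: "ipow A I 0 = carrier A"
  by (simp add: ipow_def ideals_set_def)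

lemma ipow_Suc: "ipow A I (Suc n) = ideal_prod A (ipow A I n) I"
  by (simp add: ipow_def ideals_set_def)

lemma (in ring) ipow_ideal: "ideal I R \<Longrightarrow> ideal (ipow R I n) R"
  by (induct n) (auto simp: ipow_0 ipow_Suc oneideal ideal_prod_is_ideal)

lemma (in ring) genideal_ideal_prod:
  assumes "cring R" "E \<subseteq> carrier R" "E \<noteq> {}"
  shows "Idl E \<subseteq> ideal_prod R (carrier R) E"
proof (rule genideal_minimal)
  interpret cring R by fact
  have "submod R (carrier R) (ideal_prod R (carrier R) E)"
    by (rule submod_ideal_prod[OF submod_self[OF carrier_is_subring]]) (use assms in auto)
  from submodD[OF this] show "ideal (ideal_prod R (carrier R) E) R" by (intro idealI_cring) auto
  show "E \<subseteq> ideal_prod R (carrier R) E"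
  proof
    fix e assume e: "e \<in> E"
    then have "\<one> \<otimes> e \<in> ideal_prod R (carrier R) E" by (intro ideal_prod.prod) auto
    then show "e \<in> ideal_prod R (carrier R) E" using e assms(2) by auto
  qed
qed

lemma ring_hom_ideal_prod:
  fixes R (structure)
  assumes h: "h \<in> ring_hom R S" and U: "U \<subseteq> carrier R" and Y: "Y \<subseteq> carrier R" and R: "ring R"
  shows "h ` ideal_prod R U Y = ideal_prod S (h ` U) (h ` Y)"
proof (intro equalityI subsetI)
  interpret ring R by fact
  fix z assume "z \<in> h ` ideal_prod R U Y"
  then obtain w where "w \<in> ideal_prod R U Y" "z = h w" by blast
  then show "z \<in> ideal_prod S (h ` U) (h ` Y)"
  proof (induct w arbitrary: z)
    case (prod i j)
    then have "z = h i \<otimes>\<^bsub>S\<^esub> h j" using U Y ring_hom_mult[OF h] by blast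
    then show ?case using prod by (blast intro: ideal_prod.prod)
  next
    case (sum s t)
    then have "z = h s \<oplus>\<^bsub>S\<^esub> h t" using ideal_prod_closed[OF U Y] ring_hom_add[OF h] by blast
    then show ?case using sum by (simp add: ideal_prod.sum)
  qed
next
  interpret ring R by fact
  fix z assume "z \<in> ideal_prod S (h ` U) (h ` Y)"
  then show "z \<in> h ` ideal_prod R U Y"
  proof induct
    case (prod i j)
    then obtain x y where "x \<in> U" "y \<in> Y" "i = h x" "j = h y" by blast
    then have "i \<otimes>\<^bsub>S\<^esub> j = h (x \<otimes> y)" "x \<otimes> y \<in> ideal_prod R U Y"
      using U Y ring_hom_mult[OF h, of x y] by (blast intro: ideal_prod.prod ring_hom_mult[OF h, symmetric])+
    then show ?case by blast
  next
    case (sum s t)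
    then obtain x y where "x \<in> ideal_prod R U Y" "y \<in> ideal_prod R U Y" "s = h x" "t = h y" by blast
    then have "s \<oplus>\<^bsub>S\<^esub> t = h (x \<oplus> y)" "x \<oplus> y \<in> ideal_prod R U Y"
      using ideal_prod_closed[OF U Y] ring_hom_add[OF h, of x y] by (auto intro: ideal_prod.sum)
    then show ?case by blast
  qed
qed

lemma ring_hom_monic_values:
  fixes R (structure)
  assumes h: "h \<in> ring_hom R S" and R: "ring R" and N: "N \<subseteq> carrier R" and u: "u \<in> carrier R"
  shows "t \<in> monic_values R N u d \<Longrightarrow> t \<in> carrier R \<and> h t \<in> monic_values S (h ` N) (h u) d"
proof (induct d arbitrary: t)
  case 0
  interpret ring R by fact
  show ?case using 0 ring_hom_one[OF h] by simp
next
  case (Suc d)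
  interpret ring R by fact
  obtain c s where c: "c \<in> N" "s \<in> monic_values R N u d" "t = c \<oplus> u \<otimes> s" using Suc(2) by auto
  have s: "s \<in> carrier R" "h s \<in> monic_values S (h ` N) (h u) d" using Suc(1)[OF c(2)] by auto
  have cc: "c \<in> carrier R" using c N by blast
  have "h t = h c \<oplus>\<^bsub>S\<^esub> h u \<otimes>\<^bsub>S\<^esub> h s"
    unfolding c(3) using cc u s by (simp add: ring_hom_add[OF h] ring_hom_mult[OF h])
  then show ?case using s c cc u by auto
qed

lemma ring_hom_integral_over:
  assumes h: "h \<in> ring_hom R S" and R: "ring R" and S: "ring S" and N: "N \<subseteq> carrier R"
    and u: "integral_over R N u"
  shows "integral_over S (h ` N) (h u)"
proof -
  interpret R: ring R by fact
  interpret S: ring S by fact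
  have "h \<zero>\<^bsub>R\<^esub> = \<zero>\<^bsub>S\<^esub>"
    using ring_hom_zero[OF h R S] .
  then show ?thesis
    using ring_hom_monic_values[OF h R N, of u "\<zero>\<^bsub>R\<^esub>"] u ring_hom_closed[OF h]
    unfolding integral_over_def by fastforce
qed

text \<open>The field is arbitrary: the locale is used with the fraction field of \<open>A\<close>,
  with that of an integral extension of \<open>A\<close>, and with a copy of the former on another
  type.\<close>

locale embedded_ideal = A: "domain" A + K: field K for A and K (structure) +
  fixes \<phi> I
  assumes hom: "\<phi> \<in> ring_hom A K" and inj: "inj_on \<phi> (carrier A)" and ideal_I: "ideal I A"
begin

abbreviation "Ipow n \<equiv> ipow A I n"

lemma Ipow_ideal: "ideal (Ipow n) A" by (rule A.ipow_ideal[OF ideal_I])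

lemma Ipow_carr: "x \<in> Ipow n \<Longrightarrow> x \<in> carrier A"
  using ideal.Icarr[OF Ipow_ideal] .

lemma I_carr_A: "x \<in> I \<Longrightarrow> x \<in> carrier A" using ideal.Icarr[OF ideal_I] .

lemma \<phi>_closed [simp]: "x \<in> carrier A \<Longrightarrow> \<phi> x \<in> carrier K" using ring_hom_closed[OF hom] .
lemma \<phi>_mult: "x \<in> carrier A \<Longrightarrow> y \<in> carrier A \<Longrightarrow> \<phi> (x \<otimes>\<^bsub>A\<^esub> y) = \<phi> x \<otimes> \<phi> y" using ring_hom_mult[OF hom] .
lemma \<phi>_add: "x \<in> carrier A \<Longrightarrow> y \<in> carrier A \<Longrightarrow> \<phi> (x \<oplus>\<^bsub>A\<^esub> y) = \<phi> x \<oplus> \<phi> y" using ring_hom_add[OF hom] .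
lemma \<phi>_one: "\<phi> \<one>\<^bsub>A\<^esub> = \<one>" using ring_hom_one[OF hom] .
lemma \<phi>_zero: "\<phi> \<zero>\<^bsub>A\<^esub> = \<zero>" using ring_hom_zero[OF hom A.ring_axioms K.ring_axioms] .
lemma \<phi>_eq: "x \<in> carrier A \<Longrightarrow> y \<in> carrier A \<Longrightarrow> \<phi> x = \<phi> y \<longleftrightarrow> x = y" using inj by (auto dest: inj_onD)
lemma \<phi>_eq_zero: "x \<in> carrier A \<Longrightarrow> \<phi> x = \<zero> \<longleftrightarrow> x = \<zero>\<^bsub>A\<^esub>" using \<phi>_eq[of x "\<zero>\<^bsub>A\<^esub>"] \<phi>_zero by simp

lemma ring_hom_ring_\<phi>: "ring_hom_ring A K \<phi>"
  by (intro ring_hom_ring.intro ring_hom_ring_axioms.intro A.ring_axioms K.ring_axioms hom)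

lemma subring_image: "subring (\<phi> ` carrier A) K"
  using ring_hom_ring.img_is_subring[OF ring_hom_ring_\<phi> A.carrier_is_subring] .

lemma submod_image: "ideal U A \<Longrightarrow> submod K (\<phi> ` carrier A) (\<phi> ` U)"
proof -
  assume U: "ideal U A"
  note Xc = ideal.Icarr[OF U]
  note add = ideal.axioms(1)[OF U]
  show ?thesis
    unfolding submod_def
  proof (intro conjI ballI)
    show "\<phi> ` U \<subseteq> carrier K" using Xc by auto
    have "\<phi> \<zero>\<^bsub>A\<^esub> \<in> \<phi> ` U" using additive_subgroup.zero_closed[OF add] by blast
    then show "\<zero> \<in> \<phi> ` U" by (simp add: \<phi>_zero)
    fix x y assume "x \<in> \<phi> ` U" "y \<in> \<phi> ` U"
    then obtain a b where "a \<in> U" "b \<in> U" "x = \<phi> a" "y = \<phi> b" by blast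
    then show "x \<oplus> y \<in> \<phi> ` U"
      using \<phi>_add[of a b] Xc additive_subgroup.a_closed[OF add, of a b] by (metis image_eqI)
  next
    fix a x assume "a \<in> \<phi> ` carrier A" "x \<in> \<phi> ` U"
    then obtain c b where "c \<in> carrier A" "b \<in> U" "x = \<phi> b" "a = \<phi> c" by blast
    then show "a \<otimes> x \<in> \<phi> ` U"
      using \<phi>_mult[of c b] Xc ideal.I_l_closed[OF U, of b c] by (metis image_eqI)
  qed
qed

sublocale subring_ideal K "\<phi> ` carrier A" "\<phi> ` I"
  by (intro subring_ideal.intro subring_ideal_axioms.intro subring_image submod_image ideal_I K.domain_axioms)
    (use I_carr_A in auto)

lemma J_image: "J n = \<phi> ` Ipow n"
proof (induct n)
  case 0
  then show ?case by (simp add: ipow_0)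
next
  case (Suc n)
  then show ?case
    unfolding ideal_pow_Suc ipow_Suc
    by (subst ring_hom_ideal_prod[OF hom]) (use Ipow_carr I_carr_A A.ring_axioms in auto)
qed

lemma conductor_condition_imp:
  assumes "conductor_condition A I"
  shows "\<exists>m. \<one> \<in> ideal_prod K (\<phi> ` I) (T m)"
proof -
  obtain m q where q: "q \<in> carrier A" "q \<noteq> \<zero>\<^bsub>A\<^esub>"
    and mem: "q \<in> ideal_prod A I {p \<in> carrier A. \<forall>x\<in>Ipow (Suc m). \<exists>y\<in>Ipow m. p \<otimes>\<^bsub>A\<^esub> x = q \<otimes>\<^bsub>A\<^esub> y}" (is "_ \<in> ideal_prod A I ?Y")
    using assms unfolding conductor_condition_def by blast
  have \<phi>q: "\<phi> q \<in> carrier K" "\<phi> q \<noteq> \<zero>" using q \<phi>_eq_zero by auto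
  note qi = K.nonzero_inv[OF \<phi>q]
  have "z \<in> carrier A \<and> \<phi> z \<otimes> inv (\<phi> q) \<in> ideal_prod K (\<phi> ` I) (T m)" if "z \<in> ideal_prod A I ?Y" for z
    using that
  proof induct
    case (prod i p)
    have c: "i \<in> carrier A" "p \<in> carrier A" using prod I_carr_A by auto
    have "\<phi> p \<otimes> inv (\<phi> q) \<in> T m"
      unfolding T_iff
    proof (intro conjI ballI)
      fix x assume "x \<in> J (Suc m)"
      then obtain x' where x': "x' \<in> Ipow (Suc m)" "x = \<phi> x'" by (auto simp only: J_image)
      then obtain y where y: "y \<in> Ipow m" "p \<otimes>\<^bsub>A\<^esub> x' = q \<otimes>\<^bsub>A\<^esub> y" using prod(2) by blast
      have cc: "x' \<in> carrier A" "y \<in> carrier A" using x' y Ipow_carr by blast+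
      have "(\<phi> p \<otimes> inv (\<phi> q)) \<otimes> x = inv (\<phi> q) \<otimes> \<phi> (p \<otimes>\<^bsub>A\<^esub> x')"
        using c cc qi x' by (simp add: \<phi>_mult K.m_ac)
      also have "\<dots> = \<phi> y" unfolding y(2) using q cc \<phi>q by (simp add: \<phi>_mult K.mult_inv_cancel)
      finally show "(\<phi> p \<otimes> inv (\<phi> q)) \<otimes> x \<in> J m" using y(1) by (simp add: J_image)
    qed (use c qi in simp)
    then have "\<phi> i \<otimes> (\<phi> p \<otimes> inv (\<phi> q)) \<in> ideal_prod K (\<phi> ` I) (T m)" using prod(1) by (blast intro: ideal_prod.prod)
    then show ?case using c qi by (simp add: \<phi>_mult K.m_assoc)
  next
    case (sum x y)
    then show ?case using qi by (auto simp: \<phi>_add K.l_distr ideal_prod.sum)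
  qed
  from this[OF mem] show ?thesis using qi by auto
qed

lemma conductor_conditionI:
  assumes one: "\<one> \<in> ideal_prod K (\<phi> ` I) (T m)" and "I \<noteq> {\<zero>\<^bsub>A\<^esub>}"
  shows "conductor_condition A I"
proof -
  have "\<zero>\<^bsub>A\<^esub> \<in> I" using additive_subgroup.zero_closed[OF ideal.axioms(1)[OF ideal_I]] .
  then obtain a where a: "a \<in> I" "a \<noteq> \<zero>\<^bsub>A\<^esub>" using assms(2) by blast
  have ac: "a \<in> carrier A" using a I_carr_A by blast
  \<comment> \<open>This element lies in I^(m+1). So multiplication by \<open>q\<close> carries
    every element of \<open>T m\<close> into I^m, in particular into \<open>A\<close>, and
    \<open>q\<close> is a common denominator.\<close>
  define q where "q = a [^]\<^bsub>A\<^esub> Suc m"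
  have "\<phi> (a [^]\<^bsub>A\<^esub> n) = \<phi> a [^] n" for n :: nat
    by (induct n) (use ac in \<open>auto simp: \<phi>_one \<phi>_mult\<close>)
  then have "\<phi> q = \<phi> a [^] Suc m" unfolding q_def by (simp only:)
  then have "\<phi> q \<in> J (Suc m)" using J_pow[of "\<phi> a" "Suc m"] a by (simp only: imageI)
  have qc: "q \<in> carrier A" using ac by (simp add: q_def)
  have q0: "q \<noteq> \<zero>\<^bsub>A\<^esub>"
  proof -
    have "a [^]\<^bsub>A\<^esub> n \<noteq> \<zero>\<^bsub>A\<^esub>" for n :: nat
      by (induct n) (use ac a A.integral in auto)
    then show ?thesis by (simp only: q_def) simp
  qed
  let ?Y = "{p \<in> carrier A. \<forall>x\<in>Ipow (Suc m). \<exists>y\<in>Ipow m. p \<otimes>\<^bsub>A\<^esub> x = q \<otimes>\<^bsub>A\<^esub> y}"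
  have "z \<in> carrier K \<and> (\<exists>z'\<in>ideal_prod A I ?Y. z' \<in> carrier A \<and> \<phi> z' = z \<otimes> \<phi> q)" if "z \<in> ideal_prod K (\<phi> ` I) (T m)" for z
    using that
  proof induct
    case (prod i y)
    obtain x where x: "x \<in> I" "i = \<phi> x" using prod by blast
    have y: "y \<in> carrier K" "\<And>w. w \<in> J (Suc m) \<Longrightarrow> y \<otimes> w \<in> J m" using prod(2) by (auto simp: T_iff)
    obtain p where p: "p \<in> Ipow m" "y \<otimes> \<phi> q = \<phi> p" using y(2)[OF \<open>\<phi> q \<in> J (Suc m)\<close>] by (auto simp only: J_image)
    have c: "x \<in> carrier A" "p \<in> carrier A" using x p I_carr_A Ipow_carr by auto
    have "p \<in> ?Y"
    proof (intro CollectI conjI ballI)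
      fix w assume w: "w \<in> Ipow (Suc m)"
      then have "y \<otimes> \<phi> w \<in> J m" by (intro y(2)) (simp add: J_image)
      then obtain v where v: "v \<in> Ipow m" "y \<otimes> \<phi> w = \<phi> v" by (auto simp only: J_image)
      have cc: "w \<in> carrier A" "v \<in> carrier A" using w v Ipow_carr by blast+
      have "\<phi> (p \<otimes>\<^bsub>A\<^esub> w) = (y \<otimes> \<phi> q) \<otimes> \<phi> w" using c cc p by (simp add: \<phi>_mult)
      also have "\<dots> = \<phi> q \<otimes> (y \<otimes> \<phi> w)" using y(1) qc cc by (simp add: K.m_ac)
      also have "\<dots> = \<phi> (q \<otimes>\<^bsub>A\<^esub> v)" using v qc cc by (simp add: \<phi>_mult)
      finally have "p \<otimes>\<^bsub>A\<^esub> w = q \<otimes>\<^bsub>A\<^esub> v" using \<phi>_eq c cc qc by simp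
      then show "\<exists>v\<in>Ipow m. p \<otimes>\<^bsub>A\<^esub> w = q \<otimes>\<^bsub>A\<^esub> v" using v(1) by blast
    qed (rule c)
    then have "x \<otimes>\<^bsub>A\<^esub> p \<in> ideal_prod A I ?Y" using x(1) by (blast intro: ideal_prod.prod)
    moreover have "\<phi> (x \<otimes>\<^bsub>A\<^esub> p) = (i \<otimes> y) \<otimes> \<phi> q" using c p x y qc by (simp add: \<phi>_mult K.m_assoc)
    ultimately show ?case using c x y by auto
  next
    case (sum s t)
    then obtain s' t' where st: "s' \<in> ideal_prod A I ?Y" "s' \<in> carrier A" "\<phi> s' = s \<otimes> \<phi> q"
      "t' \<in> ideal_prod A I ?Y" "t' \<in> carrier A" "\<phi> t' = t \<otimes> \<phi> q" by blast
    then have "s' \<oplus>\<^bsub>A\<^esub> t' \<in> ideal_prod A I ?Y" by (simp add: ideal_prod.sum)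
    moreover have "\<phi> (s' \<oplus>\<^bsub>A\<^esub> t') = (s \<oplus> t) \<otimes> \<phi> q" using st sum qc by (simp add: \<phi>_add K.l_distr)
    ultimately show ?case using st sum by auto
  qed
  from this[OF one] obtain z where z: "z \<in> ideal_prod A I ?Y" "z \<in> carrier A" "\<phi> z = \<phi> q" using qc by auto
  then have "z = q" using \<phi>_eq qc by blast
  then show ?thesis unfolding conductor_condition_def using z qc q0 by blast
qed

end


section \<open>Invertible ideals\<close>

lemma (in cring) mult_subset_prime: "primeideal p R \<Longrightarrow> mult_subset R (carrier R - p)"
proof
  assume p: "primeideal p R"
  show "\<one> \<in> carrier R - p" using primeideal_one_notin[OF p] by simp
  show "s \<otimes> t \<in> carrier R - p" if "s \<in> carrier R - p" "t \<in> carrier R - p" for s t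
    using that primeideal.I_prime[OF p, of s t] by auto
qed auto

lemma (in mult_subset) extended_ideal_subset:
  assumes J: "ideal J R"
  shows "extended_ideal L (\<lambda>a. fraction R S a \<one>) J \<subseteq> {fraction R S b s | b s. b \<in> J \<and> s \<in> S}"
  unfolding extended_ideal_def
proof (rule ring.genideal_minimal)
  note Jc = ideal.Icarr[OF J] and add = ideal.axioms(1)[OF J]
  interpret Lr: cring L by (rule cring_localization)
  show "ring L" by (rule Lr.ring_axioms)
  show "(\<lambda>a. fraction R S a \<one>) ` J \<subseteq> {fraction R S b s | b s. b \<in> J \<and> s \<in> S}"
    using one_in_S by blast
  show "ideal {fraction R S b s | b s. b \<in> J \<and> s \<in> S} L"
  proof (rule Lr.idealI_cring)
    show "{fraction R S b s | b s. b \<in> J \<and> s \<in> S} \<subseteq> carrier L" using Jc by auto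
    show "\<zero>\<^bsub>L\<^esub> \<in> {fraction R S b s | b s. b \<in> J \<and> s \<in> S}"
      using additive_subgroup.zero_closed[OF add] one_in_S unfolding zero_localization by blast
  next
    fix x y assume "x \<in> {fraction R S b s | b s. b \<in> J \<and> s \<in> S}" "y \<in> {fraction R S b s | b s. b \<in> J \<and> s \<in> S}"
    then obtain b s c t where *: "b \<in> J" "s \<in> S" "x = fraction R S b s" "c \<in> J" "t \<in> S" "y = fraction R S c t" by blast
    have "x \<oplus>\<^bsub>L\<^esub> y = fraction R S (t \<otimes> b \<oplus> s \<otimes> c) (s \<otimes> t)"
      using * Jc by (simp add: add_fraction)
    moreover have "t \<otimes> b \<oplus> s \<otimes> c \<in> J"
      using * ideal.I_l_closed[OF J] additive_subgroup.a_closed[OF add] by simp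
    ultimately show "x \<oplus>\<^bsub>L\<^esub> y \<in> {fraction R S b s | b s. b \<in> J \<and> s \<in> S}" using *(2,5) mult_in_S by blast
  next
    fix a x assume "a \<in> carrier L" "x \<in> {fraction R S b s | b s. b \<in> J \<and> s \<in> S}"
    then obtain b s c t where *: "b \<in> J" "s \<in> S" "x = fraction R S b s" "c \<in> carrier R" "t \<in> S" "a = fraction R S c t"
      by (elim localization_cases) blast
    have "a \<otimes>\<^bsub>L\<^esub> x = fraction R S (c \<otimes> b) (t \<otimes> s)" using * Jc by (simp add: mult_fraction)
    moreover have "c \<otimes> b \<in> J" using * ideal.I_l_closed[OF J] by simp
    ultimately show "a \<otimes>\<^bsub>L\<^esub> x \<in> {fraction R S b s | b s. b \<in> J \<and> s \<in> S}" using *(2,5) mult_in_S by blast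
  qed
qed

context embedded_ideal
begin

abbreviation "inverse_ideal \<equiv> colon K (\<phi> ` carrier A) (\<phi> ` I)"

lemma inverse_ideal_submod: "submod K (\<phi> ` carrier A) inverse_ideal"
  unfolding submod_def
proof (intro conjI ballI)
  show "inverse_ideal \<subseteq> carrier K" by (auto simp: colon_def)
  show "\<zero> \<in> inverse_ideal" using A_sub(2) by (auto simp: colon_def)
  show "x \<oplus> y \<in> inverse_ideal" if "x \<in> inverse_ideal" "y \<in> inverse_ideal" for x y
  proof -
    have "(x \<oplus> y) \<otimes> z \<in> \<phi> ` carrier A" if "z \<in> \<phi> ` I" for z
      using that \<open>x \<in> _\<close> \<open>y \<in> _\<close> A_sub(7)[of "x \<otimes> z" "y \<otimes> z"] I_carr by (auto simp: colon_def K.l_distr)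
    then show ?thesis using that by (simp add: colon_def)
  qed
  show "a \<otimes> y \<in> inverse_ideal" if "a \<in> \<phi> ` carrier A" "y \<in> inverse_ideal" for a y
  proof -
    have "(a \<otimes> y) \<otimes> z \<in> \<phi> ` carrier A" if "z \<in> \<phi> ` I" for z
      using that \<open>a \<in> _\<close> \<open>y \<in> _\<close> A_sub(6)[of a "y \<otimes> z"] I_carr A_carr by (auto simp: colon_def K.m_assoc)
    then show ?thesis using that A_carr by (simp add: colon_def)
  qed
qed

lemma prod_inverse_submod: "submod K (\<phi> ` carrier A) (ideal_prod K (\<phi> ` I) inverse_ideal)"
  using submodD(1,2)[OF inverse_ideal_submod] A_sub(1)
  by (intro K.submod_ideal_prod[OF submod_I]) auto

text \<open>Otherwise the elements of \<open>A\<close> in the product lie in a prime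
  \<open>Q\<close>. At \<open>Q\<close> the ideal is generated by some b/s, and finite generation
  yields one t outside \<open>Q\<close> such that t I is contained in b A. Then t/b is an inverse of
  \<open>I\<close>, and t = b (t/b) lies in \<open>Q\<close> after all.\<close>

lemma invertible_imp_one_in_prod:
  assumes inv: "invertible_ideal A I"
  shows "\<one> \<in> ideal_prod K (\<phi> ` I) inverse_ideal"
proof (rule ccontr)
  assume not: "\<one> \<notin> ideal_prod K (\<phi> ` I) inverse_ideal"
  define \<aa> where "\<aa> = {r \<in> carrier A. \<phi> r \<in> ideal_prod K (\<phi> ` I) inverse_ideal}"
  note PI = submodD[OF prod_inverse_submod]
  have "ideal \<aa> A"
  proof (rule A.idealI_cring)
    show "\<zero>\<^bsub>A\<^esub> \<in> \<aa>" using PI(2) by (simp add: \<aa>_def \<phi>_zero)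
    show "x \<oplus>\<^bsub>A\<^esub> y \<in> \<aa>" if "x \<in> \<aa>" "y \<in> \<aa>" for x y using that PI(3) by (simp add: \<aa>_def \<phi>_add)
    show "a \<otimes>\<^bsub>A\<^esub> x \<in> \<aa>" if "a \<in> carrier A" "x \<in> \<aa>" for a x using that PI(4) by (simp add: \<aa>_def \<phi>_mult)
  qed (auto simp: \<aa>_def)
  moreover have "\<one>\<^bsub>A\<^esub> \<notin> \<aa>" using not by (simp add: \<aa>_def \<phi>_one)
  ultimately obtain Q where Q: "primeideal Q A" "\<aa> \<subseteq> Q" using A.exists_prime_ideal by blast
  interpret M: mult_subset A "carrier A - Q" by (rule A.mult_subset_prime[OF Q(1)])
  note [simp del] = M.S_closed
  interpret Lr: cring M.L by (rule M.cring_localization)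
  let ?fr = "\<lambda>a. fraction A (carrier A - Q) a \<one>\<^bsub>A\<^esub>"
  obtain g where g: "nonzerodivisor M.L g" "extended_ideal M.L ?fr I = PIdl\<^bsub>M.L\<^esub> g"
    using inv Q(1) unfolding invertible_ideal_def Let_def by blast
  have "\<exists>E\<subseteq>carrier A. finite E \<and> I = Idl\<^bsub>A\<^esub> E"
    using inv unfolding invertible_ideal_def by (elim conjE)
  then obtain E where E: "E \<subseteq> carrier A" "finite E" "I = Idl\<^bsub>A\<^esub> E" by (elim exE conjE)
  have gc: "g \<in> carrier M.L" using g(1) by (simp add: nonzerodivisor_def)
  have "g \<in> extended_ideal M.L ?fr I" unfolding g(2) using Lr.cgenideal_self[OF gc] .
  then obtain b s where b: "b \<in> I" "s \<in> carrier A - Q" "g = fraction A (carrier A - Q) b s"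
    using M.extended_ideal_subset[OF ideal_I] by blast
  have bc: "b \<in> carrier A" using b I_carr_A by blast
  have one_S: "\<one>\<^bsub>A\<^esub> \<in> carrier A - Q" by (rule M.one_in_S)
  have dvd: "\<exists>t\<in>carrier A - Q. \<exists>c\<in>carrier A. t \<otimes>\<^bsub>A\<^esub> j = b \<otimes>\<^bsub>A\<^esub> c" if j: "j \<in> I" for j
  proof -
    have jc: "j \<in> carrier A" using j I_carr_A by blast
    have "?fr j \<in> extended_ideal M.L ?fr I"
      unfolding extended_ideal_def using j I_carr_A M.fraction_closed[OF _ one_S]
      by (intro subsetD[OF Lr.genideal_self]) auto
    then obtain x where x: "x \<in> carrier M.L" "?fr j = x \<otimes>\<^bsub>M.L\<^esub> g"
      unfolding g(2) by (auto simp: cgenideal_def)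
    then obtain c t where c: "c \<in> carrier A" "t \<in> carrier A - Q" "x = fraction A (carrier A - Q) c t"
      by (elim M.localization_cases)
    have ts: "t \<otimes>\<^bsub>A\<^esub> s \<in> carrier A - Q" using M.mult_in_S c(2) b(2) by blast
    have "?fr j = fraction A (carrier A - Q) (c \<otimes>\<^bsub>A\<^esub> b) (t \<otimes>\<^bsub>A\<^esub> s)"
      unfolding x(2) c(3) b(3) using c b bc by (simp only: M.mult_fraction)
    then obtain u where u: "u \<in> carrier A - Q" "u \<otimes>\<^bsub>A\<^esub> ((t \<otimes>\<^bsub>A\<^esub> s) \<otimes>\<^bsub>A\<^esub> j) = u \<otimes>\<^bsub>A\<^esub> (\<one>\<^bsub>A\<^esub> \<otimes>\<^bsub>A\<^esub> (c \<otimes>\<^bsub>A\<^esub> b))"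
      using M.fraction_eq_iff[OF jc A.m_closed[OF c(1) bc] one_S ts] by blast
    have "(u \<otimes>\<^bsub>A\<^esub> (t \<otimes>\<^bsub>A\<^esub> s)) \<otimes>\<^bsub>A\<^esub> j = b \<otimes>\<^bsub>A\<^esub> (u \<otimes>\<^bsub>A\<^esub> c)"
      using u c b bc jc ts by (simp add: A.m_ac)
    moreover have "u \<otimes>\<^bsub>A\<^esub> (t \<otimes>\<^bsub>A\<^esub> s) \<in> carrier A - Q" using M.mult_in_S u(1) ts by blast
    moreover have "u \<otimes>\<^bsub>A\<^esub> c \<in> carrier A" using u(1) c(1) by simp
    ultimately show ?thesis by blast
  qed
  \<comment> \<open>Multiplies the finitely many denominators; this is where the finite generation
    of \<open>I\<close> enters.\<close>
  have fin: "\<exists>t\<in>carrier A - Q. \<forall>j\<in>F. \<exists>c\<in>carrier A. t \<otimes>\<^bsub>A\<^esub> j = b \<otimes>\<^bsub>A\<^esub> c" if "finite F" "F \<subseteq> I" for F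
    using that
  proof induct
    case empty
    then show ?case using one_S by blast
  next
    case (insert j F)
    then obtain t where t: "t \<in> carrier A - Q" "\<And>j. j \<in> F \<Longrightarrow> \<exists>c\<in>carrier A. t \<otimes>\<^bsub>A\<^esub> j = b \<otimes>\<^bsub>A\<^esub> c" by blast
    obtain t' c' where t': "t' \<in> carrier A - Q" "c' \<in> carrier A" "t' \<otimes>\<^bsub>A\<^esub> j = b \<otimes>\<^bsub>A\<^esub> c'" using dvd[of j] insert(4) by blast
    have jc: "j \<in> carrier A" using insert(4) I_carr_A by blast
    have "\<exists>c\<in>carrier A. (t \<otimes>\<^bsub>A\<^esub> t') \<otimes>\<^bsub>A\<^esub> k = b \<otimes>\<^bsub>A\<^esub> c" if k: "k \<in> insert j F" for k
    proof (cases "k = j")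
      case True
      have "(t \<otimes>\<^bsub>A\<^esub> t') \<otimes>\<^bsub>A\<^esub> k = t \<otimes>\<^bsub>A\<^esub> (t' \<otimes>\<^bsub>A\<^esub> j)" using t t' jc True by (simp add: A.m_assoc)
      also have "\<dots> = b \<otimes>\<^bsub>A\<^esub> (t \<otimes>\<^bsub>A\<^esub> c')" unfolding t'(3) using t t' bc by (simp add: A.m_ac)
      finally show ?thesis using t t' by (intro bexI[of _ "t \<otimes>\<^bsub>A\<^esub> c'"]) auto
    next
      case False
      then have kF: "k \<in> F" using k by simp
      then obtain c where c: "c \<in> carrier A" "t \<otimes>\<^bsub>A\<^esub> k = b \<otimes>\<^bsub>A\<^esub> c" using t(2) by blast
      have kc: "k \<in> carrier A" using kF insert(4) I_carr_A by blast
      have "(t \<otimes>\<^bsub>A\<^esub> t') \<otimes>\<^bsub>A\<^esub> k = t' \<otimes>\<^bsub>A\<^esub> (t \<otimes>\<^bsub>A\<^esub> k)" using t t' kc by (simp add: A.m_ac)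
      also have "\<dots> = b \<otimes>\<^bsub>A\<^esub> (t' \<otimes>\<^bsub>A\<^esub> c)" unfolding c(2) using c t' bc by (simp add: A.m_ac)
      finally show ?thesis using c t' by (intro bexI[of _ "t' \<otimes>\<^bsub>A\<^esub> c"]) auto
    qed
    then show ?case using M.mult_in_S[OF t(1) t'(1)] by blast
  qed
  have EI: "E \<subseteq> I" using E(1,3) A.genideal_self by blast
  obtain t where t: "t \<in> carrier A - Q" "\<And>j. j \<in> E \<Longrightarrow> \<exists>c\<in>carrier A. t \<otimes>\<^bsub>A\<^esub> j = b \<otimes>\<^bsub>A\<^esub> c"
    using fin[OF E(2) EI] by blast
  have tc: "t \<in> carrier A" using t by blast
  let ?D = "{j \<in> carrier A. \<exists>c\<in>carrier A. t \<otimes>\<^bsub>A\<^esub> j = b \<otimes>\<^bsub>A\<^esub> c}"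
  have "ideal ?D A"
  proof (rule A.idealI_cring)
    show "\<zero>\<^bsub>A\<^esub> \<in> ?D" using tc bc by (auto intro!: bexI[of _ "\<zero>\<^bsub>A\<^esub>"])
    fix x y assume "x \<in> ?D" "y \<in> ?D"
    then obtain c d where cd: "x \<in> carrier A" "c \<in> carrier A" "t \<otimes>\<^bsub>A\<^esub> x = b \<otimes>\<^bsub>A\<^esub> c"
      "y \<in> carrier A" "d \<in> carrier A" "t \<otimes>\<^bsub>A\<^esub> y = b \<otimes>\<^bsub>A\<^esub> d" by blast
    have "t \<otimes>\<^bsub>A\<^esub> (x \<oplus>\<^bsub>A\<^esub> y) = b \<otimes>\<^bsub>A\<^esub> (c \<oplus>\<^bsub>A\<^esub> d)" using cd tc bc by (simp add: A.r_distr)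
    then show "x \<oplus>\<^bsub>A\<^esub> y \<in> ?D" using cd by blast
  next
    fix a x assume a: "a \<in> carrier A" and "x \<in> ?D"
    then obtain c where c: "x \<in> carrier A" "c \<in> carrier A" "t \<otimes>\<^bsub>A\<^esub> x = b \<otimes>\<^bsub>A\<^esub> c" by blast
    have "t \<otimes>\<^bsub>A\<^esub> (a \<otimes>\<^bsub>A\<^esub> x) = a \<otimes>\<^bsub>A\<^esub> (t \<otimes>\<^bsub>A\<^esub> x)" using a c tc by (simp add: A.m_ac)
    also have "\<dots> = b \<otimes>\<^bsub>A\<^esub> (a \<otimes>\<^bsub>A\<^esub> c)" unfolding c(3) using a c bc by (simp add: A.m_ac)
    finally show "a \<otimes>\<^bsub>A\<^esub> x \<in> ?D" using a c by blast
  qed blast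
  moreover have "E \<subseteq> ?D" using t(2) E(1) by blast
  ultimately have tI: "\<exists>c\<in>carrier A. t \<otimes>\<^bsub>A\<^esub> j = b \<otimes>\<^bsub>A\<^esub> c" if "j \<in> I" for j
    using A.genideal_minimal[of ?D E] E(3) that by blast
  \<comment> \<open>With \<open>b = 0\<close> the generator \<open>g\<close>, a non-zero-divisor,
    would be zero. That happens only in the zero ring, which is not the localization at a
    prime.\<close>
  have b0: "b \<noteq> \<zero>\<^bsub>A\<^esub>"
  proof
    assume "b = \<zero>\<^bsub>A\<^esub>"
    then have "g = \<zero>\<^bsub>M.L\<^esub>"
      using b(2) one_S unfolding b(3) M.zero_localization by (intro M.fraction_eqI) auto
    then have "\<one>\<^bsub>M.L\<^esub> = \<zero>\<^bsub>M.L\<^esub>" using g(1) unfolding nonzerodivisor_def by (metis Lr.l_null Lr.one_closed)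
    then obtain u where "u \<in> carrier A - Q" "u \<otimes>\<^bsub>A\<^esub> (\<one>\<^bsub>A\<^esub> \<otimes>\<^bsub>A\<^esub> \<one>\<^bsub>A\<^esub>) = u \<otimes>\<^bsub>A\<^esub> (\<one>\<^bsub>A\<^esub> \<otimes>\<^bsub>A\<^esub> \<zero>\<^bsub>A\<^esub>)"
      unfolding M.one_localization M.zero_localization
      using M.fraction_eq_iff[OF A.one_closed A.zero_closed one_S one_S] by blast
    then have "\<zero>\<^bsub>A\<^esub> \<in> carrier A - Q" by auto
    moreover have "\<zero>\<^bsub>A\<^esub> \<in> Q"
      using additive_subgroup.zero_closed[OF ideal.axioms(1)[OF primeideal.axioms(1)[OF Q(1)]]] .
    ultimately show False by blast
  qed
  have \<phi>b: "\<phi> b \<in> carrier K" "\<phi> b \<noteq> \<zero>" using bc b0 \<phi>_eq_zero by auto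
  let ?y = "\<phi> t \<otimes> inv \<phi> b"
  have "?y \<in> inverse_ideal"
    unfolding colon_def
  proof (intro CollectI conjI ballI)
    fix x assume "x \<in> \<phi> ` I"
    then obtain j where j: "j \<in> I" "x = \<phi> j" by blast
    obtain c where c: "c \<in> carrier A" "t \<otimes>\<^bsub>A\<^esub> j = b \<otimes>\<^bsub>A\<^esub> c" using tI[OF j(1)] by blast
    have jc: "j \<in> carrier A" using j I_carr_A by blast
    have "?y \<otimes> x = inv \<phi> b \<otimes> \<phi> (t \<otimes>\<^bsub>A\<^esub> j)" using K.nonzero_inv[OF \<phi>b] tc jc j by (simp add: \<phi>_mult K.m_ac)
    also have "\<dots> = \<phi> c" unfolding c(2) using K.mult_inv_cancel(4)[OF _ \<phi>b, of "\<phi> c"] bc c by (simp add: \<phi>_mult)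
    finally show "?y \<otimes> x \<in> \<phi> ` carrier A" using c by blast
  qed (use K.nonzero_inv[OF \<phi>b] tc in simp)
  then have "\<phi> b \<otimes> ?y \<in> ideal_prod K (\<phi> ` I) inverse_ideal" using b(1) by (blast intro: ideal_prod.prod)
  then have "\<phi> t \<in> ideal_prod K (\<phi> ` I) inverse_ideal" using K.mult_inv_cancel(1)[OF _ \<phi>b, of "\<phi> t"] tc by simp
  then show False using t Q(2) tc unfolding \<aa>_def by blast
qed

text \<open>As \<open>1\<close> is a sum of products c y, one of them lies outside \<open>Q\<close>.
  For j in \<open>I\<close> one has (c y) j = (j y) c with j y in \<open>A\<close>, and c y is a
  unit at \<open>Q\<close>; so c generates the extended ideal there.\<close>

lemma one_in_prod_imp_invertible:
  assumes one: "\<one> \<in> ideal_prod K (\<phi> ` I) inverse_ideal"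
    and fg: "E \<subseteq> carrier A" "finite E" "I = Idl\<^bsub>A\<^esub> E"
  shows "invertible_ideal A I"
  unfolding invertible_ideal_def Let_def
proof (intro conjI allI impI)
  fix Q assume Q: "primeideal Q A"
  interpret M: mult_subset A "carrier A - Q" by (rule A.mult_subset_prime[OF Q])
  note [simp del] = M.S_closed
  interpret Lr: cring M.L by (rule M.cring_localization)
  let ?fr = "\<lambda>a. fraction A (carrier A - Q) a \<one>\<^bsub>A\<^esub>"
  note Qi = primeideal.axioms(1)[OF Q]
  have "\<exists>c\<in>I. \<exists>y\<in>inverse_ideal. \<phi> c \<otimes> y \<notin> \<phi> ` Q"
  proof (rule ccontr)
    assume no: "\<not> ?thesis"
    have "z \<in> \<phi> ` Q" if "z \<in> ideal_prod K (\<phi> ` I) inverse_ideal" for z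
      using that
    proof induct
      case (sum x y)
      then show ?case using submodD(3)[OF submod_image[OF Qi]] by blast
    qed (use no in blast)
    from this[OF one] obtain q where "q \<in> Q" "\<phi> q = \<one>" by auto
    moreover have "q \<in> carrier A" using \<open>q \<in> Q\<close> ideal.Icarr[OF Qi] by blast
    ultimately have "q = \<one>\<^bsub>A\<^esub>" using \<phi>_eq[of q "\<one>\<^bsub>A\<^esub>"] by (simp add: \<phi>_one)
    then show False using \<open>q \<in> Q\<close> primeideal_one_notin[OF Q] by blast
  qed
  then obtain c y where c: "c \<in> I" and y: "y \<in> inverse_ideal" and cy: "\<phi> c \<otimes> y \<notin> \<phi> ` Q" by blast
  have cc: "c \<in> carrier A" and yc: "y \<in> carrier K" using c y I_carr_A by (auto simp: colon_def)
  have yI: "\<exists>r\<in>carrier A. \<phi> j \<otimes> y = \<phi> r" if "j \<in> I" for j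
  proof -
    have "y \<otimes> \<phi> j \<in> \<phi> ` carrier A" using y that by (auto simp: colon_def)
    then show ?thesis using yc I_carr_A[OF that] by (auto simp: K.m_comm)
  qed
  obtain p where p: "p \<in> carrier A" "\<phi> c \<otimes> y = \<phi> p" using yI[OF c] by blast
  have pS: "p \<in> carrier A - Q" using p cy by auto
  have one_S: "\<one>\<^bsub>A\<^esub> \<in> carrier A - Q" by (rule M.one_in_S)
  have frc: "?fr c \<in> carrier M.L" using M.fraction_closed[OF cc one_S] .
  have c0: "c \<noteq> \<zero>\<^bsub>A\<^esub>"
  proof
    assume "c = \<zero>\<^bsub>A\<^esub>"
    then have "\<phi> p = \<phi> \<zero>\<^bsub>A\<^esub>" using p yc by (simp add: \<phi>_zero)
    then have "p = \<zero>\<^bsub>A\<^esub>" using \<phi>_eq p by blast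
    then show False using pS additive_subgroup.zero_closed[OF ideal.axioms(1)[OF Qi]] by simp
  qed
  show "\<exists>g. nonzerodivisor M.L g \<and> extended_ideal M.L ?fr I = PIdl\<^bsub>M.L\<^esub> g"
  proof (intro exI conjI)
    show "nonzerodivisor M.L (?fr c)"
      unfolding nonzerodivisor_def
    proof (intro conjI ballI impI frc)
      fix x assume xL: "x \<in> carrier M.L" and x0: "?fr c \<otimes>\<^bsub>M.L\<^esub> x = \<zero>\<^bsub>M.L\<^esub>"
      obtain a s where a: "a \<in> carrier A" "s \<in> carrier A - Q" "x = fraction A (carrier A - Q) a s"
        using xL by (rule M.localization_cases)
      from x0 have "fraction A (carrier A - Q) (c \<otimes>\<^bsub>A\<^esub> a) (\<one>\<^bsub>A\<^esub> \<otimes>\<^bsub>A\<^esub> s) = fraction A (carrier A - Q) \<zero>\<^bsub>A\<^esub> \<one>\<^bsub>A\<^esub>"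
        unfolding a(3) M.mult_fraction[OF cc a(1) one_S a(2)] M.zero_localization .
      then obtain u where u: "u \<in> carrier A - Q" "u \<otimes>\<^bsub>A\<^esub> (\<one>\<^bsub>A\<^esub> \<otimes>\<^bsub>A\<^esub> (c \<otimes>\<^bsub>A\<^esub> a)) = u \<otimes>\<^bsub>A\<^esub> ((\<one>\<^bsub>A\<^esub> \<otimes>\<^bsub>A\<^esub> s) \<otimes>\<^bsub>A\<^esub> \<zero>\<^bsub>A\<^esub>)"
        using M.fraction_eq_iff[OF A.m_closed[OF cc a(1)] A.zero_closed M.mult_in_S[OF one_S a(2)] one_S] by blast
      have u0: "u \<noteq> \<zero>\<^bsub>A\<^esub>" using u(1) additive_subgroup.zero_closed[OF ideal.axioms(1)[OF Qi]] by blast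
      have "u \<otimes>\<^bsub>A\<^esub> (c \<otimes>\<^bsub>A\<^esub> a) = \<zero>\<^bsub>A\<^esub>" using u a cc by simp
      then have "a = \<zero>\<^bsub>A\<^esub>" using A.integral u u0 c0 cc a(1) by (metis A.m_closed DiffD1)
      then show "x = \<zero>\<^bsub>M.L\<^esub>"
        unfolding a(3) M.zero_localization using a one_S by (intro M.fraction_eqI) auto
    qed
    show "extended_ideal M.L ?fr I = PIdl\<^bsub>M.L\<^esub> (?fr c)"
    proof
      show "extended_ideal M.L ?fr I \<subseteq> PIdl\<^bsub>M.L\<^esub> (?fr c)"
        unfolding extended_ideal_def
      proof (rule Lr.genideal_minimal[OF Lr.cgenideal_ideal[OF frc]], rule image_subsetI)
        fix j assume j: "j \<in> I"
        obtain r where r: "r \<in> carrier A" "\<phi> j \<otimes> y = \<phi> r" using yI[OF j] by blast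
        have jc: "j \<in> carrier A" using j I_carr_A by blast
        have "\<phi> (p \<otimes>\<^bsub>A\<^esub> j) = \<phi> c \<otimes> (\<phi> j \<otimes> y)" using p jc cc yc by (simp add: \<phi>_mult p(2)[symmetric] K.m_ac)
        also have "\<dots> = \<phi> (r \<otimes>\<^bsub>A\<^esub> c)" unfolding r(2) using r cc by (simp add: \<phi>_mult K.m_comm)
        finally have eq: "p \<otimes>\<^bsub>A\<^esub> j = r \<otimes>\<^bsub>A\<^esub> c" using \<phi>_eq p jc r cc by simp
        have "?fr j = fraction A (carrier A - Q) r p \<otimes>\<^bsub>M.L\<^esub> ?fr c"
          unfolding M.mult_fraction[OF r(1) cc pS one_S]
          using jc r cc one_S M.mult_in_S[OF pS one_S] p eq by (intro M.fraction_eqI) auto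
        then show "?fr j \<in> PIdl\<^bsub>M.L\<^esub> (?fr c)"
          unfolding cgenideal_def using M.fraction_closed[OF r(1) pS] by blast
      qed
      show "PIdl\<^bsub>M.L\<^esub> (?fr c) \<subseteq> extended_ideal M.L ?fr I"
      proof (rule Lr.cgenideal_minimal)
        have sub: "?fr ` I \<subseteq> carrier M.L" using I_carr_A M.fraction_closed[OF _ one_S] by blast
        show "ideal (extended_ideal M.L ?fr I) M.L"
          unfolding extended_ideal_def by (rule Lr.genideal_ideal[OF sub])
        show "?fr c \<in> extended_ideal M.L ?fr I"
          unfolding extended_ideal_def using Lr.genideal_self[OF sub] c by blast
      qed
    qed
  qed
qed (use ideal_I fg in auto)

end


section \<open>The conductor condition and invertibility in integral extensions\<close>

lemma monic_values_update [simp]: "monic_values (R\<lparr>carrier := H\<rparr>) N u d = monic_values R N u d"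
  by (induct d) simp_all

lemma ideal_prod_update [simp]: "ideal_prod (R\<lparr>carrier := H\<rparr>) M N = ideal_prod R M N"
proof (intro equalityI subsetI)
  fix x assume "x \<in> ideal_prod (R\<lparr>carrier := H\<rparr>) M N"
  then show "x \<in> ideal_prod R M N"
    by induct (simp_all add: ideal_prod.intros)
next
  fix x assume "x \<in> ideal_prod R M N"
  then show "x \<in> ideal_prod (R\<lparr>carrier := H\<rparr>) M N"
  proof induct
    case (prod i j)
    then show ?case using ideal_prod.prod[of i M j N "R\<lparr>carrier := H\<rparr>"] by simp
  next
    case (sum s t)
    then show ?case using ideal_prod.sum[of s "R\<lparr>carrier := H\<rparr>" M N t] by simp
  qed
qed

lemma (in ring) finsum_update:
  assumes H: "subring H R" and f: "f \<in> E \<rightarrow> H"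
  shows "finsum (R\<lparr>carrier := H\<rparr>) f E = finsum R f E"
proof -
  interpret H: ring "R\<lparr>carrier := H\<rparr>" by (rule subring_is_ring[OF H])
  have Hc: "H \<subseteq> carrier R" by (rule subringE(1)[OF H])
  show ?thesis
    using f
  proof (induct E rule: infinite_finite_induct)
    case (insert x F)
    have "finsum (R\<lparr>carrier := H\<rparr>) f (insert x F) = f x \<oplus> finsum (R\<lparr>carrier := H\<rparr>) f F"
      using insert by (subst H.finsum_insert) auto
    also have "\<dots> = finsum R f (insert x F)"
      using insert Hc by (subst finsum_insert) (auto simp: Pi_def)
    finally show ?case .
  qed (use H.finsum_infinite in simp_all)
qed

lemma (in ring) ideal_prod_drop_zero:
  assumes N: "submod R A N" and A: "A \<subseteq> carrier R" and E: "E \<subseteq> carrier R" "E - {\<zero>} \<noteq> {}"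
  shows "ideal_prod R N E \<subseteq> ideal_prod R N (E - {\<zero>})"
proof
  fix x assume "x \<in> ideal_prod R N E"
  then show "x \<in> ideal_prod R N (E - {\<zero>})"
  proof induct
    case (prod n e)
    show ?case
    proof (cases "e = \<zero>")
      case True
      have "submod R A (ideal_prod R N (E - {\<zero>}))" using E by (intro submod_ideal_prod[OF N _ _ A]) auto
      then show ?thesis using True submodD(2,5) prod submodD(5)[OF N] by auto
    qed (use prod in \<open>auto intro: ideal_prod.prod\<close>)
  qed (rule ideal_prod.sum)
qed

lemma (in domain) subring_of_embedding:
  "subring H R \<Longrightarrow> cring (R\<lparr>carrier := H\<rparr>)"
  using subring_is_domain by (simp add: domain_def)

section \<open>Extensions of \<open>A\<close> inside \<open>K\<close> and the multiplier rings of
  the powers of \<open>I\<close>\<close>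

context embedded_ideal
begin

text \<open>Zero is joined to the generators because \<open>ideal_prod\<close> with an empty factor
  is empty instead of being the zero ideal.\<close>

lemma generators_image:
  assumes G: "finite G" "G \<subseteq> carrier A" "U = Idl\<^bsub>A\<^esub> G" 
  shows "\<phi> ` U \<subseteq> ideal_prod K (\<phi> ` carrier A) (\<phi> ` insert \<zero>\<^bsub>A\<^esub> G)"
proof -
  let ?G = "insert \<zero>\<^bsub>A\<^esub> G"
  have "Idl\<^bsub>A\<^esub> G \<subseteq> Idl\<^bsub>A\<^esub> ?G"
    using A.genideal_self[of ?G] G by (intro A.genideal_minimal A.genideal_ideal) auto
  also have "\<dots> \<subseteq> ideal_prod A (carrier A) ?G"
    using A.genideal_ideal_prod[OF A.is_cring, of ?G] G by auto
  finally have "\<phi> ` U \<subseteq> \<phi> ` ideal_prod A (carrier A) ?G" unfolding G(3) by blast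
  then show ?thesis using ring_hom_ideal_prod[OF hom order_refl _ A.ring_axioms, of ?G] G(2) by auto
qed

lemma ring_extension_update:
  assumes H: "subring H K" "\<phi> ` carrier A \<subseteq> H"
  shows "ring_extension A (K\<lparr>carrier := H\<rparr>) \<phi>"
proof -
  have "\<phi> \<in> ring_hom A (K\<lparr>carrier := H\<rparr>)"
    using H(2) by (intro ring_hom_memI) (auto simp: \<phi>_mult \<phi>_add \<phi>_one)
  then show ?thesis
    unfolding ring_extension_def
    by (intro conjI inj ring_hom_ring.intro ring_hom_ring_axioms.intro A.ring_axioms K.subring_is_ring[OF H(1)])
qed

lemma integral_extension_update:
  assumes H: "subring H K" "\<phi> ` carrier A \<subseteq> H" and int: "\<And>x. x \<in> H \<Longrightarrow> integral_over K (\<phi> ` carrier A) x"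
  shows "integral_extension A (K\<lparr>carrier := H\<rparr>) \<phi>"
proof -
  interpret H: cring "K\<lparr>carrier := H\<rparr>" by (rule K.subring_of_embedding[OF H(1)])
  have "integral_element A (K\<lparr>carrier := H\<rparr>) \<phi> x" if "x \<in> H" for x
    using H.integral_element_iff[of x \<phi> A] that H(2) int[OF that] by (auto simp: integral_over_def)
  then show ?thesis unfolding integral_extension_def using ring_extension_update[OF H] by simp
qed

text \<open>The elements of \<open>K\<close> that carry \<open>I\<close> into \<open>H\<close> also
  carry the ideal generated by \<open>I\<close> in \<open>H\<close> into \<open>H\<close>. So the
  criterion \<open>one_in_prod_imp_invertible\<close>, applied over \<open>H\<close>, follows from
  the hypothesis about \<open>I\<close>.\<close>

lemma invertible_in_subring:
  assumes H: "subring H K" "\<phi> ` carrier A \<subseteq> H"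
    and one: "\<one> \<in> ideal_prod K (\<phi> ` I) (colon K H (\<phi> ` I))"
    and fg: "finite E" "E \<subseteq> carrier A" "I = Idl\<^bsub>A\<^esub> E"
  shows "invertible_ideal (K\<lparr>carrier := H\<rparr>) (extended_ideal (K\<lparr>carrier := H\<rparr>) \<phi> I)"
proof -
  let ?B = "K\<lparr>carrier := H\<rparr>"
  have dB: "domain ?B" by (rule K.subring_is_domain[OF H(1)])
  interpret B: "domain" ?B by (rule dB)
  let ?IB = "extended_ideal ?B \<phi> I"
  have IH: "\<phi> ` I \<subseteq> H" using H(2) I_carr_A by blast
  have Hc: "H \<subseteq> carrier K" by (rule subringE(1)[OF H(1)])
  have ideal: "ideal ?IB ?B" unfolding extended_ideal_def using IH by (intro B.genideal_ideal) simp
  interpret eB: embedded_ideal ?B K id ?IB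
    using dB ideal Hc by (intro embedded_ideal.intro embedded_ideal_axioms.intro K.field_axioms)
      (auto intro!: ring_hom_memI)
  have I_IB: "\<phi> ` I \<subseteq> ?IB" unfolding extended_ideal_def using IH by (intro B.genideal_self) simp
  have IB_prod: "?IB \<subseteq> ideal_prod K H (\<phi> ` I)"
    unfolding extended_ideal_def using B.genideal_ideal_prod[OF B.is_cring, of "\<phi> ` I"] IH
      I_sub(2) by auto
  have colon: "colon K H (\<phi> ` I) \<subseteq> colon K H ?IB"
  proof
    fix y assume y: "y \<in> colon K H (\<phi> ` I)"
    have yc: "y \<in> carrier K" using y by (simp add: colon_def)
    have "z \<in> carrier K \<and> y \<otimes> z \<in> H" if "z \<in> ideal_prod K H (\<phi> ` I)" for z
      using that
    proof induct
      case (prod h i)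
      have c: "h \<in> carrier K" "i \<in> carrier K" using prod Hc IH by auto
      have "y \<otimes> i \<in> H" using y prod by (auto simp: colon_def)
      then have "h \<otimes> (y \<otimes> i) \<in> H" using subringE(6)[OF H(1)] prod by blast
      then show ?case using c yc by (simp add: K.m_ac)
    next
      case (sum s t)
      then show ?case using yc subringE(7)[OF H(1)] by (simp add: K.r_distr)
    qed
    then show "y \<in> colon K H ?IB" using IB_prod yc by (auto simp: colon_def)
  qed
  have "\<one> \<in> ideal_prod K (id ` ?IB) eB.inverse_ideal"
    using ideal_prod_mono[OF I_IB colon] one by auto
  moreover have "?IB = Idl\<^bsub>?B\<^esub> (\<phi> ` E)"
  proof
    have EH: "\<phi> ` E \<subseteq> carrier ?B" using fg(2) H(2) by auto
    have EI: "E \<subseteq> I" unfolding fg(3) by (rule A.genideal_self[OF fg(2)])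
    show "Idl\<^bsub>?B\<^esub> (\<phi> ` E) \<subseteq> ?IB"
      using I_IB EI by (intro B.genideal_minimal ideal) blast
    note D = ideal.axioms(1)[OF B.genideal_ideal[OF EH]]
    have ID: "ideal {a \<in> carrier A. \<phi> a \<in> Idl\<^bsub>?B\<^esub> (\<phi> ` E)} A"
    proof (rule A.idealI_cring)
      show "\<zero>\<^bsub>A\<^esub> \<in> {a \<in> carrier A. \<phi> a \<in> Idl\<^bsub>?B\<^esub> (\<phi> ` E)}"
        using additive_subgroup.zero_closed[OF D] by (simp add: \<phi>_zero)
      show "x \<oplus>\<^bsub>A\<^esub> y \<in> {a \<in> carrier A. \<phi> a \<in> Idl\<^bsub>?B\<^esub> (\<phi> ` E)}"
        if "x \<in> {a \<in> carrier A. \<phi> a \<in> Idl\<^bsub>?B\<^esub> (\<phi> ` E)}" "y \<in> {a \<in> carrier A. \<phi> a \<in> Idl\<^bsub>?B\<^esub> (\<phi> ` E)}" for x y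
        using that additive_subgroup.a_closed[OF D, of "\<phi> x" "\<phi> y"] by (simp add: \<phi>_add)
      show "a \<otimes>\<^bsub>A\<^esub> x \<in> {a \<in> carrier A. \<phi> a \<in> Idl\<^bsub>?B\<^esub> (\<phi> ` E)}"
        if "a \<in> carrier A" "x \<in> {a \<in> carrier A. \<phi> a \<in> Idl\<^bsub>?B\<^esub> (\<phi> ` E)}" for a x
        using that ideal.I_l_closed[OF B.genideal_ideal[OF EH], of "\<phi> x" "\<phi> a"] H(2) by (auto simp: \<phi>_mult)
    qed auto
    have "I \<subseteq> {a \<in> carrier A. \<phi> a \<in> Idl\<^bsub>?B\<^esub> (\<phi> ` E)}"
      unfolding fg(3) using B.genideal_self[OF EH] fg(2) by (intro A.genideal_minimal[OF ID]) blast
    then show "?IB \<subseteq> Idl\<^bsub>?B\<^esub> (\<phi> ` E)"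
      unfolding extended_ideal_def by (intro B.genideal_minimal B.genideal_ideal EH) blast
  qed
  ultimately show ?thesis
    using fg H(2) by (intro eB.one_in_prod_imp_invertible[of "\<phi> ` E"]) auto
qed

definition "Rm m = colon K (J m) (J m)"

lemma Rm_iff: "r \<in> Rm m \<longleftrightarrow> r \<in> carrier K \<and> (\<forall>w\<in>J m. r \<otimes> w \<in> J m)"
  by (simp add: Rm_def colon_def)

lemma Rm_subring: "subring (Rm m) K"
proof (rule K.subringI)
  show "Rm m \<subseteq> carrier K" by (auto simp: Rm_iff)
  show "\<one> \<in> Rm m" using J_carr by (simp add: Rm_iff)
  fix x y assume xy: "x \<in> Rm m" "y \<in> Rm m"
  show "x \<otimes> y \<in> Rm m" using xy J_carr by (simp add: Rm_iff K.m_assoc)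
  show "x \<oplus> y \<in> Rm m" using xy J_carr J_sub(3) by (simp add: Rm_iff K.l_distr)
next
  fix x assume x: "x \<in> Rm m"
  have "\<ominus> x \<otimes> w \<in> J m" if "w \<in> J m" for w
    using K.submod_neg[OF J_submod subring_A, of "x \<otimes> w" m] x that J_carr[OF that] by (simp add: Rm_iff K.l_minus)
  then show "\<ominus> x \<in> Rm m" using x by (simp add: Rm_iff)
qed

lemma A_sub_Rm: "\<phi> ` carrier A \<subseteq> Rm m"
  using J_sub(4) A_carr by (auto simp: Rm_iff)

text \<open>For x in \<open>I\<close> and w in I^m the product x w is in I^(m+1), which
  \<open>y\<close> carries back into I^m. So y x is a multiplier of I^m, and \<open>y\<close> is an
  inverse of \<open>I\<close> over the multiplier ring.\<close>

lemma T_sub_colon: "T m \<subseteq> colon K (Rm m) (\<phi> ` I)"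
proof
  fix y assume y: "y \<in> T m"
  have yc: "y \<in> carrier K" by (rule T_carr[OF y])
  have "y \<otimes> x \<in> Rm m" if x: "x \<in> \<phi> ` I" for x
    unfolding Rm_iff
  proof (intro conjI ballI)
    fix w assume w: "w \<in> J m"
    have "y \<otimes> (w \<otimes> x) \<in> J m" using y J_prodI[OF w x] by (simp add: T_iff)
    then show "(y \<otimes> x) \<otimes> w \<in> J m" using yc J_carr[OF w] I_carr[OF x] by (simp add: K.m_ac)
  qed (use yc I_carr[OF x] in simp)
  then show "y \<in> colon K (Rm m) (\<phi> ` I)" using yc by (simp add: colon_def)
qed

lemma J_nonzero:
  assumes "I \<noteq> {\<zero>\<^bsub>A\<^esub>}"
  shows "\<exists>w\<in>J m. w \<noteq> \<zero>"
proof -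
  have "\<zero>\<^bsub>A\<^esub> \<in> I" using additive_subgroup.zero_closed[OF ideal.axioms(1)[OF ideal_I]] .
  then obtain a where a: "a \<in> I" "a \<noteq> \<zero>\<^bsub>A\<^esub>" using assms by blast
  then have c: "\<phi> a \<in> carrier K" "\<phi> a \<noteq> \<zero>" using I_carr_A \<phi>_eq_zero by auto
  have "\<phi> a [^] n \<noteq> \<zero>" for n :: nat
    by (induct n) (use c K.integral in auto)
  then show ?thesis using J_pow[of "\<phi> a" m] a by blast
qed

text \<open>A multiplier of I^m stabilizes the finitely generated module I^m, and this module is
  nonzero because \<open>I\<close> is.\<close>

lemma Rm_integral:
  assumes noeth: "noetherian_ring A" and I0: "I \<noteq> {\<zero>\<^bsub>A\<^esub>}" and r: "r \<in> Rm m"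
  shows "integral_over K (\<phi> ` carrier A) r"
proof -
  interpret KA: coefficient_ideal K "\<phi> ` carrier A" "\<phi> ` carrier A"
    using subring_A K.submod_self by (intro coefficient_ideal.intro coefficient_ideal_axioms.intro K.domain_axioms) auto
  obtain G where G: "G \<subseteq> carrier A" "finite G" "Ipow m = Idl\<^bsub>A\<^esub> G"
    using noetherian_ring.finetely_gen[OF noeth Ipow_ideal[of m]] by blast
  let ?G = "\<phi> ` insert \<zero>\<^bsub>A\<^esub> G"
  have Gc: "?G \<subseteq> carrier K" using G by auto
  have GJ: "?G \<subseteq> J m"
    unfolding J_image using A.genideal_self[OF G(1)] G(3)
      additive_subgroup.zero_closed[OF ideal.axioms(1)[OF Ipow_ideal[of m]]] by blast
  have gen: "J m \<subseteq> ideal_prod K (\<phi> ` carrier A) ?G"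
    unfolding J_image by (rule generators_image) (use G in auto)
  obtain w where w: "w \<in> J m" "w \<noteq> \<zero>" using J_nonzero[OF I0] by blast
  have ne: "?G - {\<zero>} \<noteq> {}"
  proof
    assume "?G - {\<zero>} = {}"
    then have G0: "e = \<zero>" if "e \<in> ?G" for e using that by blast
    have "z = \<zero>" if "z \<in> ideal_prod K (\<phi> ` carrier A) ?G" for z
      using that
    proof induct
      case (prod a e)
      then show ?case using G0[OF prod(2)] A_carr[OF prod(1)] by simp
    qed simp
    then show False using gen w by blast
  qed
  have gen': "J m \<subseteq> ideal_prod K (\<phi> ` carrier A) (?G - {\<zero>})"
    using gen K.ideal_prod_drop_zero[OF KA.submod_N A_sub(1) Gc ne] by blast
  have "module_stable K (\<phi> ` carrier A) r"
    unfolding module_stable_def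
  proof (intro conjI exI[of _ "?G - {\<zero>}"] ballI)
    show "r \<in> carrier K" using r by (simp add: Rm_iff)
    show "r \<otimes> e \<in> ideal_prod K (\<phi> ` carrier A) (?G - {\<zero>})" if "e \<in> ?G - {\<zero>}" for e
    proof -
      have "e \<in> J m" using that GJ by blast
      then show ?thesis using r gen' by (auto simp: Rm_iff)
    qed
  qed (use ne G Gc in auto)
  then show ?thesis by (rule KA.module_stable_imp_integral)
qed

text \<open>Multiplication by a nonzero \<open>w\<close> in I^m maps \<open>Rm m\<close> injectively
  into \<open>A\<close>. The image is an ideal, hence finitely generated, and its generators divided
  by \<open>w\<close> generate \<open>Rm m\<close>.\<close>

lemma Rm_finite:
  assumes noeth: "noetherian_ring A" and I0: "I \<noteq> {\<zero>\<^bsub>A\<^esub>}"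
  shows "finite_extension A (K\<lparr>carrier := Rm m\<rparr>) \<phi>"
proof -
  obtain w where w: "w \<in> J m" "w \<noteq> \<zero>" using J_nonzero[OF I0] by blast
  have wc: "w \<in> carrier K" using w J_carr by blast
  note wi = K.nonzero_inv[OF wc w(2)]
  have Rc: "r \<in> carrier K" if "r \<in> Rm m" for r using that by (simp add: Rm_iff)
  note Rs = subringE[OF Rm_subring[of m]]
  define \<bb> where "\<bb> = {b \<in> carrier A. \<exists>r\<in>Rm m. \<phi> b = r \<otimes> w}"
  have "ideal \<bb> A"
  proof (rule A.idealI_cring)
    show "\<zero>\<^bsub>A\<^esub> \<in> \<bb>" using Rs(2) wc by (auto simp: \<bb>_def \<phi>_zero intro!: bexI[of _ \<zero>])
    fix x y assume "x \<in> \<bb>" "y \<in> \<bb>"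
    then obtain r s where rs: "x \<in> carrier A" "y \<in> carrier A" "r \<in> Rm m" "\<phi> x = r \<otimes> w" "s \<in> Rm m" "\<phi> y = s \<otimes> w"
      by (auto simp: \<bb>_def)
    have "\<phi> (x \<oplus>\<^bsub>A\<^esub> y) = (r \<oplus> s) \<otimes> w" using rs Rc wc by (simp add: \<phi>_add K.l_distr)
    then show "x \<oplus>\<^bsub>A\<^esub> y \<in> \<bb>" using rs Rs(7) unfolding \<bb>_def by blast
  next
    fix a x assume a: "a \<in> carrier A" and "x \<in> \<bb>"
    then obtain r where r: "x \<in> carrier A" "r \<in> Rm m" "\<phi> x = r \<otimes> w" by (auto simp: \<bb>_def)
    have "\<phi> (a \<otimes>\<^bsub>A\<^esub> x) = (\<phi> a \<otimes> r) \<otimes> w" using a r Rc wc by (simp add: \<phi>_mult K.m_assoc)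
    moreover have "\<phi> a \<otimes> r \<in> Rm m" using Rs(6) A_sub_Rm a r by blast
    ultimately show "a \<otimes>\<^bsub>A\<^esub> x \<in> \<bb>" using a r unfolding \<bb>_def by blast
  qed (auto simp: \<bb>_def)
  then obtain G where G: "G \<subseteq> carrier A" "finite G" "\<bb> = Idl\<^bsub>A\<^esub> G"
    using noetherian_ring.finetely_gen[OF noeth] by blast
  let ?G = "insert \<zero>\<^bsub>A\<^esub> G"
  let ?E = "(\<lambda>g. \<phi> g \<otimes> inv w) ` ?G"
  have G\<bb>: "?G \<subseteq> \<bb>" using A.genideal_self[OF G(1)] G(3) additive_subgroup.zero_closed[OF ideal.axioms(1)[OF \<open>ideal \<bb> A\<close>]] by blast
  have ER: "?E \<subseteq> Rm m"
  proof (rule image_subsetI)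
    fix g assume "g \<in> ?G"
    then obtain r where r: "r \<in> Rm m" "\<phi> g = r \<otimes> w" using G\<bb> by (auto simp: \<bb>_def)
    then show "\<phi> g \<otimes> inv w \<in> Rm m" using K.mult_inv_cancel(5)[OF Rc[OF r(1)] wc w(2)] by simp
  qed
  have Ec: "?E \<subseteq> carrier K" using ER Rc by blast
  have span: "r \<in> ideal_prod K (\<phi> ` carrier A) ?E" if r: "r \<in> Rm m" for r
  proof -
    have "r \<otimes> w \<in> J m" using r w by (simp add: Rm_iff)
    then obtain b where b: "b \<in> carrier A" "r \<otimes> w = \<phi> b" using J_image Ipow_carr by blast
    then have "b \<in> \<bb>" using r unfolding \<bb>_def by (metis (mono_tags, lifting) mem_Collect_eq)
    then have mem: "\<phi> b \<in> ideal_prod K (\<phi> ` carrier A) (\<phi> ` ?G)"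
      using generators_image[OF G(2,1) refl] G(3) by blast
    have "z \<in> carrier K \<and> z \<otimes> inv w \<in> ideal_prod K (\<phi> ` carrier A) ?E" if "z \<in> ideal_prod K (\<phi> ` carrier A) (\<phi> ` ?G)" for z
      using that
    proof induct
      case (prod a e)
      have c: "a \<in> carrier K" "e \<in> carrier K" using prod G(1) by auto
      have "a \<otimes> (e \<otimes> inv w) \<in> ideal_prod K (\<phi> ` carrier A) ?E" using prod by (intro ideal_prod.prod) auto
      then show ?case using c wi by (simp add: K.m_assoc)
    next
      case (sum s t)
      then show ?case using wi by (simp add: K.l_distr ideal_prod.sum)
    qed
    from this[OF mem] show ?thesis using b K.mult_inv_cancel(5)[OF Rc[OF r] wc w(2)] by simp
  qed
  have "\<exists>c\<in>?E \<rightarrow> carrier A. r = (\<Oplus>\<^bsub>K\<lparr>carrier := Rm m\<rparr>\<^esub>e\<in>?E. \<phi> (c e) \<otimes> e)" if r: "r \<in> Rm m" for r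
  proof -
    obtain c where c: "c \<in> ?E \<rightarrow> \<phi> ` carrier A" "r = (\<Oplus>e\<in>?E. c e \<otimes> e)"
      using K.ideal_prod_finsum[OF K.submod_self[OF subring_A] _ Ec span[OF r]] G(2) by blast
    define d where "d = (\<lambda>e. inv_into (carrier A) \<phi> (c e))"
    have d: "d e \<in> carrier A" "\<phi> (d e) = c e" if "e \<in> ?E" for e
    proof -
      have ce: "c e \<in> \<phi> ` carrier A" using c(1) that by blast
      show "d e \<in> carrier A" "\<phi> (d e) = c e" unfolding d_def using inv_into_into[OF ce] f_inv_into_f[OF ce] by auto
    qed
    have "(\<Oplus>\<^bsub>K\<lparr>carrier := Rm m\<rparr>\<^esub>e\<in>?E. \<phi> (d e) \<otimes> e) = (\<Oplus>e\<in>?E. \<phi> (d e) \<otimes> e)"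
    proof (rule K.finsum_update[OF Rm_subring])
      show "(\<lambda>e. \<phi> (d e) \<otimes> e) \<in> ?E \<rightarrow> Rm m"
        using d(1) ER A_sub_Rm Rs(6) by blast
    qed
    also have "\<dots> = (\<Oplus>e\<in>?E. c e \<otimes> e)"
    proof (rule K.finsum_cong')
      show "(\<lambda>e. c e \<otimes> e) \<in> ?E \<rightarrow> carrier K" using c(1) Ec A_carr by blast
    qed (use d(2) in auto)
    finally show ?thesis using c(2) d(1) by (intro bexI[of _ d]) auto
  qed
  then show ?thesis
    unfolding finite_extension_def using ring_extension_update[OF Rm_subring A_sub_Rm] ER G(2)
    by (intro conjI exI[of _ ?E]) auto
qed

end

text \<open>The fraction field of \<open>B\<close> contains both rings. There \<open>B\<close> lies
  in the integral closure of \<open>A\<close>, and this closure is all that the polynomial argument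
  needs to know about \<open>B\<close>.\<close>

theorem invertible_extension_imp_conductor_condition:
  assumes A: "noetherian_domain A" and I: "ideal I A" "I \<noteq> {\<zero>\<^bsub>A\<^esub>}"
    and B: "domain B" and int: "integral_extension A B \<phi>"
    and inv: "invertible_ideal B (extended_ideal B \<phi> I)"
  shows "conductor_condition A I"
proof -
  interpret A: noetherian_domain A by (rule A)
  interpret B: "domain" B by (rule B)
  let ?L = "fraction_field B" and ?e = "to_fraction_field B"
  interpret L: field ?L by (rule B.field_fraction_field)
  have ext: "ring_hom_ring A B \<phi>" "inj_on \<phi> (carrier A)" using int by (auto simp: integral_extension_def ring_extension_def)
  note \<phi>h = ring_hom_ring.homh[OF ext(1)]
  note eh = B.to_fraction_field_hom and ei = B.to_fraction_field_inj
  have \<phi>c: "\<phi> x \<in> carrier B" if "x \<in> carrier A" for x using ring_hom_closed[OF \<phi>h that] .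
  let ?IB = "extended_ideal B \<phi> I"
  have Ic: "\<phi> ` I \<subseteq> carrier B" using \<phi>c ideal.Icarr[OF I(1)] by blast
  have idB: "ideal ?IB B" unfolding extended_ideal_def by (rule B.genideal_ideal[OF Ic])
  interpret eB: embedded_ideal B ?L ?e ?IB
    by (intro embedded_ideal.intro embedded_ideal_axioms.intro B L.field_axioms eh ei idB)
  have inj: "inj_on (?e \<circ> \<phi>) (carrier A)"
    using ext(2) \<phi>c by (intro comp_inj_on inj_on_subset[OF ei]) auto
  interpret eA: embedded_ideal A ?L "?e \<circ> \<phi>" I
    by (intro embedded_ideal.intro embedded_ideal_axioms.intro A.domain_axioms L.field_axioms
        ring_hom_trans[OF \<phi>h eh] inj I(1))
  let ?C = "{u. integral_over ?L ((?e \<circ> \<phi>) ` carrier A) u}"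
  have eint: "?e b \<in> ?C" if b: "b \<in> carrier B" for b
  proof -
    have "integral_over B (\<phi> ` carrier A) b"
      using B.integral_element_iff[OF b, of \<phi> A] int b \<phi>c by (auto simp: integral_extension_def)
    from ring_hom_integral_over[OF eh B.ring_axioms L.ring_axioms _ this] \<phi>c show ?thesis
      by (simp add: image_comp image_subset_iff)
  qed
  have "\<one>\<^bsub>?L\<^esub> \<in> ideal_prod ?L (?e ` ?IB) eB.inverse_ideal" by (rule eB.invertible_imp_one_in_prod[OF inv])
  \<comment> \<open>An element of \<open>IB\<close> is a combination of elements of \<open>I\<close>
    with coefficients in \<open>B\<close>. Each coefficient is shifted to the other factor
    \<open>y\<close>, which stays an inverse of \<open>I\<close> over the integral closure.\<close>
  moreover have "ideal_prod ?L (?e ` ?IB) eB.inverse_ideal \<subseteq> ideal_prod ?L ((?e \<circ> \<phi>) ` I) (colon ?L ?C ((?e \<circ> \<phi>) ` I))"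
  proof
    let ?P = "ideal_prod ?L ((?e \<circ> \<phi>) ` I) (colon ?L ?C ((?e \<circ> \<phi>) ` I))"
    fix x assume "x \<in> ideal_prod ?L (?e ` ?IB) eB.inverse_ideal"
    then show "x \<in> ?P"
    proof induct
      case (prod i y)
      have yc: "y \<in> carrier ?L" using prod(2) by (simp add: colon_def)
      obtain z where z: "z \<in> ?IB" "i = ?e z" using prod(1) by blast
      have "\<phi> ` I \<noteq> {}" using eA.I_sub(2) by auto
      then have "z \<in> ideal_prod B (carrier B) (\<phi> ` I)"
        using z(1) B.genideal_ideal_prod[OF B.is_cring Ic] unfolding extended_ideal_def by blast
      then have "z \<in> carrier B \<and> ?e z \<otimes>\<^bsub>?L\<^esub> y \<in> ?P"
      proof induct
        case (prod b j)
        then obtain k where k: "k \<in> I" "j = \<phi> k" by blast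
        have c: "b \<in> carrier B" "j \<in> carrier B" using prod Ic by auto
        have "?e b \<otimes>\<^bsub>?L\<^esub> y \<in> colon ?L ?C ((?e \<circ> \<phi>) ` I)"
          unfolding colon_def
        proof (intro CollectI[of "\<lambda>y. y \<in> carrier ?L \<and> _ y"] conjI ballI)
          fix x assume "x \<in> (?e \<circ> \<phi>) ` I"
          then obtain l where l: "l \<in> I" "x = ?e (\<phi> l)" by auto
          have lB: "\<phi> l \<in> ?IB" unfolding extended_ideal_def using B.genideal_self[OF Ic] l(1) by blast
          then obtain r where r: "r \<in> carrier B" "y \<otimes>\<^bsub>?L\<^esub> x = ?e r"
            using \<open>y \<in> eB.inverse_ideal\<close> l(2) by (auto simp: colon_def)
          have xc: "x \<in> carrier ?L" using l lB eB.I_carr_A by simp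
          have "(?e b \<otimes>\<^bsub>?L\<^esub> y) \<otimes>\<^bsub>?L\<^esub> x = ?e (b \<otimes>\<^bsub>B\<^esub> r)"
            using c yc xc r by (simp add: L.m_assoc eB.\<phi>_mult)
          then show "(?e b \<otimes>\<^bsub>?L\<^esub> y) \<otimes>\<^bsub>?L\<^esub> x \<in> ?C" using eint[of "b \<otimes>\<^bsub>B\<^esub> r"] c r by simp
        qed (use c yc in simp)
        then have "?e j \<otimes>\<^bsub>?L\<^esub> (?e b \<otimes>\<^bsub>?L\<^esub> y) \<in> ?P" using k by (intro ideal_prod.prod) auto
        then show ?case using c yc by (simp add: eB.\<phi>_mult L.m_ac)
      next
        case (sum s t)
        then show ?case using yc by (simp add: eB.\<phi>_add L.l_distr ideal_prod.sum)
      qed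
      then show ?case using z(2) by simp
    qed (rule ideal_prod.sum)
  qed
  ultimately have one: "\<one>\<^bsub>?L\<^esub> \<in> ideal_prod ?L ((?e \<circ> \<phi>) ` I) (colon ?L ?C ((?e \<circ> \<phi>) ` I))" by blast
  obtain G where G: "G \<subseteq> carrier A" "finite G" "I = Idl\<^bsub>A\<^esub> G" using A.finetely_gen[OF I(1)] by blast
  have "\<exists>N. \<one>\<^bsub>?L\<^esub> \<in> ideal_prod ?L ((?e \<circ> \<phi>) ` I) (eA.T N)"
  proof (rule eA.one_in_prod_T_of_integral[OF _ _ eA.generators_image[OF G(2,1,3)] one])
    have "insert \<zero>\<^bsub>A\<^esub> G \<subseteq> I"
      using A.genideal_self[OF G(1)] G(3) additive_subgroup.zero_closed[OF ideal.axioms(1)[OF I(1)]] by blast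
    then show "(?e \<circ> \<phi>) ` insert \<zero>\<^bsub>A\<^esub> G \<subseteq> (?e \<circ> \<phi>) ` I" by (rule image_mono)
  qed (use G in simp)
  then show ?thesis using eA.conductor_conditionI[OF _ I(2)] by blast
qed


section \<open>The Rees algebra\<close>

text \<open>\<open>rees_algebra\<close> is a ring record of its own, not an update of
  \<open>UP A\<close>. So the domain property is carried over from the subring of polynomials
  through equality of the components.\<close>

lemma domain_cong:
  assumes R: "domain R" and eq: "carrier S = carrier R" "monoid.mult S = monoid.mult R" "one S = one R"
    "ring.zero S = ring.zero R" "ring.add S = ring.add R"
  shows "domain S"
proof -
  interpret R: "domain" R by (rule R)
  have "abelian_group S"
  proof (rule abelian_groupI)
    show "\<exists>y\<in>carrier S. y \<oplus>\<^bsub>S\<^esub> x = \<zero>\<^bsub>S\<^esub>" if "x \<in> carrier S" for x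
      using that R.l_neg by (auto simp: eq intro!: bexI[of _ "\<ominus>\<^bsub>R\<^esub> x"])
  qed (auto simp: eq R.a_ac)
  moreover have "comm_monoid S"
    by (rule comm_monoidI) (auto simp: eq R.m_ac)
  ultimately have "cring S"
    by (rule cringI) (auto simp: eq R.l_distr)
  then show ?thesis
    by (intro domain.intro domain_axioms.intro) (use R.integral in \<open>auto simp: eq\<close>)
qed

lemma (in domain) ipow_mult:
  assumes "ideal I R" "x \<in> ipow R I m" "y \<in> ipow R I n"
  shows "x \<otimes> y \<in> ipow R I (m + n)"
proof -
  have sm: "submod R (carrier R) I" and sub: "I \<subseteq> carrier R"
    using assms(1) ideal.Icarr[OF assms(1)] ideal.axioms(1)[OF assms(1)] ideal.I_l_closed[OF assms(1)]
    by (auto simp: submod_def additive_subgroup.a_closed additive_subgroup.zero_closed)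
  interpret SI: subring_ideal R "carrier R" I
    by (intro subring_ideal.intro subring_ideal_axioms.intro domain_axioms carrier_is_subring sm sub)
  have "ideal_pow R (carrier R) I k = ipow R I k" for k
    by (induct k) (simp_all add: ideal_pow_Suc ipow_0 ipow_Suc)
  then show ?thesis using SI.J_mult[of x m y n] assms by simp
qed

locale rees = embedded_ideal A K \<phi> I for A and K (structure) and \<phi> I +
  assumes I_nonzero: "I \<noteq> {\<zero>\<^bsub>A\<^esub>}"
begin

abbreviation "S \<equiv> rees_algebra A I"
abbreviation tm :: "'a \<Rightarrow> nat \<Rightarrow> nat \<Rightarrow> 'a" where "tm a k \<equiv> up_ring.monom (UP A) a k"

interpretation U: UP_domain A "UP A" by intro_locales

declare U.monom_add [simp del] U.monom_mult [simp del] U.monom_zero [simp del] U.monom_one [simp del]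

lemma rees_ops: "monoid.mult S = monoid.mult (UP A)" "one S = one (UP A)" "ring.zero S = ring.zero (UP A)"
    "ring.add S = ring.add (UP A)"
  by (simp_all add: rees_algebra_def)

lemma rees_carrier: "p \<in> carrier S \<longleftrightarrow> p \<in> carrier (UP A) \<and> (\<forall>n. p n \<in> Ipow n)"
  by (auto simp: rees_algebra_def coeff_UP ipow_def)

lemma rees_coeff: "p \<in> carrier S \<Longrightarrow> p n \<in> Ipow n" "p \<in> carrier S \<Longrightarrow> p n \<in> carrier A"
  using rees_carrier Ipow_carr by blast+

lemma Ipow_sub:
  "\<zero>\<^bsub>A\<^esub> \<in> Ipow n" "x \<in> Ipow n \<Longrightarrow> y \<in> Ipow n \<Longrightarrow> x \<oplus>\<^bsub>A\<^esub> y \<in> Ipow n"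
  "a \<in> carrier A \<Longrightarrow> x \<in> Ipow n \<Longrightarrow> a \<otimes>\<^bsub>A\<^esub> x \<in> Ipow n"
  using additive_subgroup.zero_closed[OF ideal.axioms(1)[OF Ipow_ideal]]
    additive_subgroup.a_closed[OF ideal.axioms(1)[OF Ipow_ideal]] ideal.I_l_closed[OF Ipow_ideal] by auto

lemma Ipow_mult: "x \<in> Ipow m \<Longrightarrow> y \<in> Ipow n \<Longrightarrow> x \<otimes>\<^bsub>A\<^esub> y \<in> Ipow (m + n)"
  by (rule A.ipow_mult[OF ideal_I])

lemma Ipow_1: "Ipow (Suc 0) = I"
  using A.ideal_prod_one ideal_I by (simp add: ipow_Suc ipow_0 A.ideal_prod_commute[OF A.oneideal])

lemma mon_apply: "x \<in> carrier A \<Longrightarrow> tm x n = (\<lambda>i. if i = n then x else \<zero>\<^bsub>A\<^esub>)"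
  by (simp add: UP_def)

lemma mon_closed:
  assumes "x \<in> Ipow n"
  shows "tm x n \<in> carrier S"
  unfolding rees_carrier
proof (intro conjI allI)
  have xc: "x \<in> carrier A" using assms Ipow_carr by blast
  show "tm x n \<in> carrier (UP A)" using U.monom_closed[OF xc] .
  show "tm x n k \<in> Ipow k" for k using assms Ipow_sub(1) by (simp add: mon_apply[OF xc])
qed

lemma mon_mult: "x \<in> carrier A \<Longrightarrow> y \<in> carrier A \<Longrightarrow> tm x m \<otimes>\<^bsub>S\<^esub> tm y n = tm (x \<otimes>\<^bsub>A\<^esub> y) (m + n)"
  using U.monom_mult[of x y m n] by (simp add: rees_ops)

lemma mon_add: "x \<in> carrier A \<Longrightarrow> y \<in> carrier A \<Longrightarrow> tm x n \<oplus>\<^bsub>S\<^esub> tm y n = tm (x \<oplus>\<^bsub>A\<^esub> y) n"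
  using U.monom_add[of x y n] by (simp add: rees_ops)

lemma mon_zero: "tm \<zero>\<^bsub>A\<^esub> n = \<zero>\<^bsub>S\<^esub>"
  using U.monom_zero by (simp add: rees_ops)

lemma mon_one: "tm \<one>\<^bsub>A\<^esub> 0 = \<one>\<^bsub>S\<^esub>"
  using U.monom_one by (simp add: rees_ops)

lemma mon_inj: "x \<in> carrier A \<Longrightarrow> y \<in> carrier A \<Longrightarrow> tm x n = tm y n \<longleftrightarrow> x = y"
  by (auto simp: mon_apply dest: fun_cong[of _ _ n])

lemma rees_zero_apply: "\<zero>\<^bsub>S\<^esub> n = \<zero>\<^bsub>A\<^esub>"
  by (simp add: rees_algebra_def UP_def)

lemma rees_add_apply:
  assumes "p \<in> carrier S" "q \<in> carrier S"
  shows "(p \<oplus>\<^bsub>S\<^esub> q) n = p n \<oplus>\<^bsub>A\<^esub> q n"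
proof -
  have c: "p \<in> carrier (UP A)" "q \<in> carrier (UP A)" using assms by (auto simp: rees_carrier)
  then show ?thesis
    using U.coeff_add[OF c, of n] by (simp add: rees_ops coeff_UP U.UP_a_closed)
qed

lemma rees_mult_apply:
  assumes "p \<in> carrier S" "q \<in> carrier S"
  shows "(p \<otimes>\<^bsub>S\<^esub> q) n = (\<Oplus>\<^bsub>A\<^esub>i\<in>{..n}. p i \<otimes>\<^bsub>A\<^esub> q (n - i))"
proof -
  have c: "p \<in> carrier (UP A)" "q \<in> carrier (UP A)" using assms by (auto simp: rees_carrier)
  then show ?thesis
    using U.coeff_mult[OF c, of n] by (simp add: rees_ops coeff_UP U.UP_mult_closed del: U.coeff_mult)
qed

lemma submod_Ipow: "submod A (carrier A) (Ipow n)"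
  unfolding submod_def using Ipow_carr Ipow_sub by blast

lemma rees_domain: "domain S"
proof -
  have "subring (carrier S) (UP A)"
  proof (rule U.P.subringI)
    show "carrier S \<subseteq> carrier (UP A)" by (auto simp: rees_carrier)
    show "\<one>\<^bsub>UP A\<^esub> \<in> carrier S" using mon_closed[of "\<one>\<^bsub>A\<^esub>" 0] mon_one by (simp add: ipow_0 rees_ops)
    fix p assume p: "p \<in> carrier S"
    then have pu: "p \<in> carrier (UP A)" by (simp add: rees_carrier)
    have "(\<ominus>\<^bsub>UP A\<^esub> p) n = \<ominus>\<^bsub>A\<^esub> p n" for n
      using U.coeff_a_inv[OF pu, of n] pu by (simp add: coeff_UP)
    moreover have "\<ominus>\<^bsub>A\<^esub> p n \<in> Ipow n" for n
      using A.submod_neg[OF submod_Ipow A.carrier_is_subring] rees_coeff(1)[OF p] by blast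
    ultimately show "\<ominus>\<^bsub>UP A\<^esub> p \<in> carrier S" using pu by (simp add: rees_carrier)
  next
    fix p q assume pq: "p \<in> carrier S" "q \<in> carrier S"
    then have u: "p \<in> carrier (UP A)" "q \<in> carrier (UP A)" by (auto simp: rees_carrier)
    have "(p \<oplus>\<^bsub>S\<^esub> q) n \<in> Ipow n" for n
      using rees_add_apply[OF pq] Ipow_sub(2) rees_coeff(1) pq by simp
    then show "p \<oplus>\<^bsub>UP A\<^esub> q \<in> carrier S" using u by (simp add: rees_carrier rees_ops)
    have "(p \<otimes>\<^bsub>S\<^esub> q) n \<in> Ipow n" for n
      unfolding rees_mult_apply[OF pq]
    proof (rule A.submod_finsum[OF submod_Ipow])
      show "p i \<otimes>\<^bsub>A\<^esub> q (n - i) \<in> Ipow n" if "i \<in> {..n}" for i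
        using Ipow_mult[OF rees_coeff(1)[OF pq(1), of i] rees_coeff(1)[OF pq(2), of "n - i"]] that by simp
    qed
    then show "p \<otimes>\<^bsub>UP A\<^esub> q \<in> carrier S" using u by (simp add: rees_carrier rees_ops)
  qed
  then have "domain ((UP A)\<lparr>carrier := carrier S\<rparr>)" by (rule domain.subring_is_domain[OF U.UP_domain])
  then show ?thesis by (rule domain_cong) (simp_all add: rees_ops)
qed

sublocale S: "domain" S by (rule rees_domain)

text \<open>Sets \<open>t = 1\<close>. In a fraction of degree zero the powers of \<open>t\<close>
  cancel, so this evaluation identifies the stalks of the blow-up with subrings of
  \<open>K\<close>.\<close>

definition "ev p = UnivPoly.eval A K \<phi> \<one> p"

lemma ev_hom: "ev \<in> ring_hom S K" and ev_mon: "x \<in> carrier A \<Longrightarrow> ev (tm x n) = \<phi> x"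
proof -
  interpret UK: UP_pre_univ_prop A K \<phi> "UP A"
    by (intro UP_pre_univ_prop.intro ring_hom_cring.intro ring_hom_cring_axioms.intro
        A.is_cring K.is_cring hom U.UP_cring_axioms)
  have h: "UnivPoly.eval A K \<phi> \<one> \<in> ring_hom (UP A) K" by (rule UK.eval_ring_hom) simp
  show "ev \<in> ring_hom S K"
    by (rule ring_hom_memI)
      (auto simp: ev_def rees_carrier rees_ops ring_hom_closed[OF h] ring_hom_mult[OF h] ring_hom_add[OF h] ring_hom_one[OF h])
  show "ev (tm x n) = \<phi> x" if "x \<in> carrier A"
    using UK.eval_monom[OF that K.one_closed, of n] that by (simp add: ev_def)
qed

subsection \<open>Homogeneous primes\<close>

abbreviation "G \<equiv> rees_part A I"
abbreviation "Pts \<equiv> proj_points S G"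

lemma G_iff: "G n = {tm x n | x. x \<in> Ipow n}"
  by (auto simp: rees_part_def ipow_def)

lemma mon_in_G: "x \<in> Ipow n \<Longrightarrow> tm x n \<in> G n"
  by (auto simp: G_iff)

lemma rees_sum_mon:
  assumes p: "p \<in> carrier S" and Q: "ideal Q S" and comp: "\<And>n. tm (p n) n \<in> Q"
  shows "p \<in> Q"
proof -
  have pu: "p \<in> carrier (UP A)" using p by (simp add: rees_carrier)
  have fs: "finsum (UP A) (\<lambda>i. tm (p i) i) F \<in> Q" if "finite F" for F
    using that
  proof induct
    case empty
    then show ?case using additive_subgroup.zero_closed[OF ideal.axioms(1)[OF Q]] by (simp add: rees_ops)
  next
    case (insert x F)
    then have "finsum (UP A) (\<lambda>i. tm (p i) i) (insert x F) = tm (p x) x \<oplus>\<^bsub>S\<^esub> finsum (UP A) (\<lambda>i. tm (p i) i) F"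
      using rees_coeff(2)[OF p] by (simp add: U.P.finsum_insert rees_ops)
    then show ?case using additive_subgroup.a_closed[OF ideal.axioms(1)[OF Q] comp insert(3)] by simp
  qed
  have "(\<Oplus>\<^bsub>UP A\<^esub>i\<in>{..deg A p}. tm (up_ring.coeff (UP A) p i) i) = p" by (rule U.up_repr[OF pu])
  then show ?thesis using fs[of "{..deg A p}"] pu by (simp add: coeff_UP)
qed

text \<open>The elements all of whose components lie in \<open>Q\<close> form an ideal; if
  \<open>Q\<close> is generated by homogeneous elements, this ideal contains them and hence all of
  \<open>Q\<close>. Conversely an element is the sum of its components.\<close>

lemma homogeneous_prime_iff:
  "homogeneous_prime S G Q \<longleftrightarrow> primeideal Q S \<and> (\<forall>p\<in>Q. \<forall>n. tm (p n) n \<in> Q)"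
proof
  assume hp: "homogeneous_prime S G Q"
  then have Q: "primeideal Q S" and gen: "Q = Idl\<^bsub>S\<^esub> (Q \<inter> (\<Union>n. G n))" by (auto simp: homogeneous_prime_def)
  note Qi = primeideal.axioms(1)[OF Q]
  note Qa = ideal.axioms(1)[OF Qi]
  let ?D = "{p \<in> carrier S. \<forall>n. tm (p n) n \<in> Q}"
  have D: "ideal ?D S"
  proof (rule S.idealI_cring)
    show "\<zero>\<^bsub>S\<^esub> \<in> ?D"
      using additive_subgroup.zero_closed[OF Qa] mon_zero by (simp add: rees_zero_apply)
    fix p q assume pq: "p \<in> ?D" "q \<in> ?D"
    show "p \<oplus>\<^bsub>S\<^esub> q \<in> ?D"
      using pq additive_subgroup.a_closed[OF Qa] rees_coeff(2)
      by (auto simp: rees_add_apply mon_add[symmetric])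
  next
    fix a p assume a: "a \<in> carrier S" and p: "p \<in> ?D"
    have pc: "p \<in> carrier S" using p by blast
    have "tm ((a \<otimes>\<^bsub>S\<^esub> p) n) n \<in> Q" for n
    proof -
      have "(\<Oplus>\<^bsub>A\<^esub>i\<in>F. a i \<otimes>\<^bsub>A\<^esub> p (n - i)) \<in> carrier A \<and> tm (\<Oplus>\<^bsub>A\<^esub>i\<in>F. a i \<otimes>\<^bsub>A\<^esub> p (n - i)) n \<in> Q"
        if "finite F" "F \<subseteq> {..n}" for F
        using that
      proof induct
        case empty
        then show ?case using additive_subgroup.zero_closed[OF Qa] mon_zero by simp
      next
        case (insert i F)
        have c: "a i \<in> carrier A" "p (n - i) \<in> carrier A" using rees_coeff(2) a pc by auto
        have "tm (a i) i \<otimes>\<^bsub>S\<^esub> tm (p (n - i)) (n - i) \<in> Q"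
          using ideal.I_l_closed[OF Qi, of "tm (p (n - i)) (n - i)" "tm (a i) i"] p mon_closed[OF rees_coeff(1)[OF a]] by blast
        then have t: "tm (a i \<otimes>\<^bsub>A\<^esub> p (n - i)) n \<in> Q" using mon_mult[OF c, of i "n - i"] insert(4) by simp
        have "(\<lambda>i. a i \<otimes>\<^bsub>A\<^esub> p (n - i)) \<in> F \<rightarrow> carrier A" using rees_coeff(2) a pc by auto
        then have eq: "(\<Oplus>\<^bsub>A\<^esub>i\<in>insert i F. a i \<otimes>\<^bsub>A\<^esub> p (n - i)) = a i \<otimes>\<^bsub>A\<^esub> p (n - i) \<oplus>\<^bsub>A\<^esub> (\<Oplus>\<^bsub>A\<^esub>i\<in>F. a i \<otimes>\<^bsub>A\<^esub> p (n - i))"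
          using insert(1,2) c by (simp add: A.finsum_insert)
        have IH: "(\<Oplus>\<^bsub>A\<^esub>i\<in>F. a i \<otimes>\<^bsub>A\<^esub> p (n - i)) \<in> carrier A" "tm (\<Oplus>\<^bsub>A\<^esub>i\<in>F. a i \<otimes>\<^bsub>A\<^esub> p (n - i)) n \<in> Q"
          using insert(3,4) by auto
        show ?case
          unfolding eq using additive_subgroup.a_closed[OF Qa t IH(2)] c IH(1) by (simp add: mon_add)
      qed
      then show ?thesis unfolding rees_mult_apply[OF a pc] by blast
    qed
    then show "a \<otimes>\<^bsub>S\<^esub> p \<in> ?D" using a pc by simp
  qed auto
  have sub: "Q \<inter> (\<Union>n. G n) \<subseteq> ?D"
  proof
    fix p assume "p \<in> Q \<inter> (\<Union>n. G n)"
    then obtain x n where x: "x \<in> Ipow n" "p = tm x n" "p \<in> Q" by (auto simp: G_iff)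
    have "tm (p k) k \<in> Q" for k
      using x additive_subgroup.zero_closed[OF Qa] mon_zero by (simp add: mon_apply[OF Ipow_carr[OF x(1)]])
    then show "p \<in> ?D" using x mon_closed by simp
  qed
  have "Q \<subseteq> ?D" by (rule order_trans[OF equalityD1[OF gen] S.genideal_minimal[OF D sub]])
  then show "primeideal Q S \<and> (\<forall>p\<in>Q. \<forall>n. tm (p n) n \<in> Q)" using Q by blast
next
  assume *: "primeideal Q S \<and> (\<forall>p\<in>Q. \<forall>n. tm (p n) n \<in> Q)"
  then have Qi: "ideal Q S" by (simp add: primeideal.axioms(1))
  have sub: "Q \<inter> (\<Union>n. G n) \<subseteq> carrier S" using ideal.Icarr[OF Qi] by blast
  have "Q \<subseteq> Idl\<^bsub>S\<^esub> (Q \<inter> (\<Union>n. G n))"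
  proof
    fix p assume p: "p \<in> Q"
    then have pc: "p \<in> carrier S" by (rule ideal.Icarr[OF Qi])
    have "tm (p n) n \<in> Idl\<^bsub>S\<^esub> (Q \<inter> (\<Union>n. G n))" for n
      using S.genideal_self[OF sub] * p mon_in_G[OF rees_coeff(1)[OF pc]] by blast
    then show "p \<in> Idl\<^bsub>S\<^esub> (Q \<inter> (\<Union>n. G n))" by (rule rees_sum_mon[OF pc S.genideal_ideal[OF sub]])
  qed
  moreover have "Idl\<^bsub>S\<^esub> (Q \<inter> (\<Union>n. G n)) \<subseteq> Q" by (rule S.genideal_minimal[OF Qi]) blast
  ultimately show "homogeneous_prime S G Q" using * by (auto simp: homogeneous_prime_def)
qed

text \<open>The part of degree \<open>Suc n\<close> consists of sums of products of an element of
  degree \<open>n\<close> with one of degree one. So the irrelevant ideal is generated in degree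
  one.\<close>

lemma irrelevant_sub_iff:
  assumes Q: "primeideal Q S"
  shows "irrelevant_ideal S G \<subseteq> Q \<longleftrightarrow> (\<forall>a\<in>I. tm a (Suc 0) \<in> Q)"
proof
  note Qi = primeideal.axioms(1)[OF Q]
  have sub: "(\<Union>n\<in>{0<..}. G n) \<subseteq> carrier S" using mon_closed by (auto simp: G_iff)
  assume "irrelevant_ideal S G \<subseteq> Q"
  then show "\<forall>a\<in>I. tm a (Suc 0) \<in> Q"
    using S.genideal_self[OF sub] mon_in_G[of _ "Suc 0"] Ipow_1 unfolding irrelevant_ideal_def by blast
next
  note Qi = primeideal.axioms(1)[OF Q]
  assume a: "\<forall>a\<in>I. tm a (Suc 0) \<in> Q"
  have "x \<in> carrier A \<and> tm x (Suc n) \<in> Q" if "x \<in> ideal_prod A (Ipow n) I" for x n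
    using that
  proof induct
    case (prod i j)
    have c: "i \<in> carrier A" "j \<in> carrier A" using prod Ipow_carr I_carr_A by auto
    have "tm i n \<otimes>\<^bsub>S\<^esub> tm j (Suc 0) \<in> Q"
      using ideal.I_l_closed[OF Qi] a prod mon_closed by blast
    then show ?case using mon_mult[OF c, of n "Suc 0"] c by simp
  next
    case (sum s t)
    then show ?case
      using additive_subgroup.a_closed[OF ideal.axioms(1)[OF Qi], of "tm s (Suc n)" "tm t (Suc n)"] mon_add[of s t "Suc n"] by simp
  qed
  then have "(\<Union>n\<in>{0<..}. G n) \<subseteq> Q"
    by (auto simp: G_iff ipow_Suc gr0_conv_Suc)
  then show "irrelevant_ideal S G \<subseteq> Q" unfolding irrelevant_ideal_def by (rule S.genideal_minimal[OF Qi])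
qed

lemma Pts_iff:
  "Q \<in> Pts \<longleftrightarrow> primeideal Q S \<and> (\<forall>p\<in>Q. \<forall>n. tm (p n) n \<in> Q) \<and> (\<exists>a\<in>I. tm a (Suc 0) \<notin> Q)"
  unfolding proj_points_def mem_Collect_eq homogeneous_prime_iff using irrelevant_sub_iff by blast

lemma PtsD:
  assumes "Q \<in> Pts"
  shows "primeideal Q S" "\<And>p n. p \<in> Q \<Longrightarrow> tm (p n) n \<in> Q" "\<exists>a\<in>I. tm a (Suc 0) \<notin> Q"
    "\<And>x n. x \<in> Q \<Longrightarrow> x \<in> carrier S" "\<zero>\<^bsub>S\<^esub> \<in> Q"
proof -
  note c = assms[unfolded Pts_iff]
  note * = conjunct1[OF c] conjunct1[OF conjunct2[OF c]] conjunct2[OF conjunct2[OF c]]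
  show "primeideal Q S" by (rule *(1))
  show "tm (p n) n \<in> Q" if "p \<in> Q" for p n using *(2) that by simp
  show "\<exists>a\<in>I. tm a (Suc 0) \<notin> Q" by (rule *(3))
  show "\<And>x n. x \<in> Q \<Longrightarrow> x \<in> carrier S" by (rule ideal.Icarr[OF primeideal.axioms(1)[OF *(1)]])
  show "\<zero>\<^bsub>S\<^esub> \<in> Q" by (rule additive_subgroup.zero_closed[OF ideal.axioms(1)[OF primeideal.axioms(1)[OF *(1)]]])
qed

lemma Pts_mult_iff:
  assumes Q: "Q \<in> Pts" and x: "x \<in> Ipow m" and y: "y \<in> Ipow n"
  shows "tm (x \<otimes>\<^bsub>A\<^esub> y) (m + n) \<in> Q \<longleftrightarrow> tm x m \<in> Q \<or> tm y n \<in> Q"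
proof -
  note Qp = PtsD(1)[OF Q]
  have "tm (x \<otimes>\<^bsub>A\<^esub> y) (m + n) = tm x m \<otimes>\<^bsub>S\<^esub> tm y n" using mon_mult x y Ipow_carr by simp
  then show ?thesis
    using primeideal.I_prime[OF Qp, of "tm x m" "tm y n"] mon_closed x y
      ideal.I_l_closed[OF primeideal.axioms(1)[OF Qp]] ideal.I_r_closed[OF primeideal.axioms(1)[OF Qp]] by auto
qed

lemma Pts_one: "Q \<in> Pts \<Longrightarrow> tm \<one>\<^bsub>A\<^esub> 0 \<notin> Q"
  using primeideal_one_notin[OF PtsD(1)] mon_one by simp

text \<open>The generic point. It lies in every nonempty open set, and sections are later compared
  through their germs there.\<close>

lemma zero_in_Pts: "{\<zero>\<^bsub>S\<^esub>} \<in> Pts"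
proof -
  have "\<zero>\<^bsub>A\<^esub> \<in> I" using additive_subgroup.zero_closed[OF ideal.axioms(1)[OF ideal_I]] .
  then obtain a where a: "a \<in> I" "a \<noteq> \<zero>\<^bsub>A\<^esub>" using I_nonzero by blast
  have "tm a (Suc 0) \<noteq> tm \<zero>\<^bsub>A\<^esub> (Suc 0)" using a mon_inj[of a "\<zero>\<^bsub>A\<^esub>" "Suc 0"] I_carr_A A.zero_closed by blast
  then have "\<exists>a\<in>I. tm a (Suc 0) \<notin> {\<zero>\<^bsub>S\<^esub>}" using a(1) unfolding mon_zero by blast
  moreover have "tm (\<zero>\<^bsub>S\<^esub> n) n = \<zero>\<^bsub>S\<^esub>" for n
    by (subst rees_zero_apply) (rule mon_zero)
  ultimately show ?thesis unfolding Pts_iff using S.zeroprimeideal by simp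
qed

subsection \<open>The topology and the stalks of the blow-up\<close>

abbreviation "TX \<equiv> subtopology (zariski_topology S) Pts"

lemma Pts_spectrum: "Pts \<subseteq> prime_spectrum S"
  using PtsD(1) by (auto simp: prime_spectrum_def)

lemma openin_TX: "openin TX V \<longleftrightarrow> (\<exists>E\<subseteq>carrier S. V = {Q \<in> Pts. \<not> E \<subseteq> Q})"
proof
  assume "openin TX V"
  then obtain E where "E \<subseteq> carrier S" "V = (prime_spectrum S - {P \<in> prime_spectrum S. E \<subseteq> P}) \<inter> Pts"
    by (auto simp: openin_subtopology openin_zariski_topology zariski_open_def)
  then show "\<exists>E\<subseteq>carrier S. V = {Q \<in> Pts. \<not> E \<subseteq> Q}" using Pts_spectrum by auto
next
  assume "\<exists>E\<subseteq>carrier S. V = {Q \<in> Pts. \<not> E \<subseteq> Q}"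
  then obtain E where E: "E \<subseteq> carrier S" "V = {Q \<in> Pts. \<not> E \<subseteq> Q}" by blast
  then have "V = (prime_spectrum S - {P \<in> prime_spectrum S. E \<subseteq> P}) \<inter> Pts" using Pts_spectrum by auto
  then show "openin TX V"
    using E(1) by (auto simp: openin_subtopology openin_zariski_topology zariski_open_def)
qed

lemma topspace_TX: "topspace TX = Pts"
proof
  show "topspace TX \<subseteq> Pts" by simp
  have "Pts = {Q \<in> Pts. \<not> {\<one>\<^bsub>S\<^esub>} \<subseteq> Q}" using primeideal_one_notin[OF PtsD(1)] by auto
  then have "openin TX Pts" unfolding openin_TX by (intro exI[of _ "{\<one>\<^bsub>S\<^esub>}"]) simp
  then show "Pts \<subseteq> topspace TX" by (rule openin_subset)
qed

definition "Dplus x n = {Q \<in> Pts. tm x n \<notin> Q}"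

lemma openin_Dplus: "x \<in> Ipow n \<Longrightarrow> openin TX (Dplus x n)"
  unfolding openin_TX Dplus_def using mon_closed by (intro exI[of _ "{tm x n}"]) auto

text \<open>An element outside \<open>Q\<close> has a homogeneous component outside
  \<open>Q\<close>. A point that contains the element contains all its components, which gives the
  inclusion.\<close>

lemma Dplus_basis:
  assumes V: "openin TX V" and Q: "Q \<in> V"
  shows "\<exists>n. \<exists>x\<in>Ipow n. Q \<in> Dplus x n \<and> Dplus x n \<subseteq> V"
proof -
  obtain E where E: "E \<subseteq> carrier S" "V = {Q \<in> Pts. \<not> E \<subseteq> Q}" using V openin_TX by blast
  have QP: "Q \<in> Pts" using Q E by blast
  obtain e where e: "e \<in> E" "e \<notin> Q" using Q E by blast
  have ec: "e \<in> carrier S" using e E by blast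
  obtain n where n: "tm (e n) n \<notin> Q"
    using rees_sum_mon[OF ec primeideal.axioms(1)[OF PtsD(1)[OF QP]]] e(2) by blast
  have "Dplus (e n) n \<subseteq> V" using PtsD(2) e(1) unfolding Dplus_def E(2) by blast
  then show ?thesis using n QP rees_coeff(1)[OF ec] by (auto simp: Dplus_def)
qed

lemma zero_in_open:
  assumes V: "openin TX V" and Q: "Q \<in> V"
  shows "{\<zero>\<^bsub>S\<^esub>} \<in> V"
proof -
  obtain n x where x: "x \<in> Ipow n" "Q \<in> Dplus x n" "Dplus x n \<subseteq> V" using Dplus_basis[OF assms] by blast
  then have "tm x n \<notin> {\<zero>\<^bsub>S\<^esub>}" using PtsD(5)[of Q] by (auto simp: Dplus_def)
  then show ?thesis using x(3) zero_in_Pts by (auto simp: Dplus_def)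
qed

abbreviation "TS Q \<equiv> (\<Union>n. G n) - Q"
abbreviation "fr Q \<equiv> fraction S (TS Q)"
abbreviation "OX Q \<equiv> homogeneous_localization S G Q"

lemma TS_iff: "s \<in> TS Q \<longleftrightarrow> (\<exists>n. \<exists>x\<in>Ipow n. s = tm x n \<and> tm x n \<notin> Q)"
  by (auto simp: G_iff)

lemma mult_subset_TS:
  assumes Q: "Q \<in> Pts"
  shows "mult_subset S (TS Q)"
proof
  show "TS Q \<subseteq> carrier S" using mon_closed by (auto simp: G_iff)
  show "\<one>\<^bsub>S\<^esub> \<in> TS Q" using Pts_one[OF Q] mon_one unfolding TS_iff by (metis A.one_closed ipow_0)
  fix s t assume "s \<in> TS Q" "t \<in> TS Q"
  then obtain m n x y where *: "x \<in> Ipow m" "s = tm x m" "tm x m \<notin> Q" "y \<in> Ipow n" "t = tm y n" "tm y n \<notin> Q"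
    unfolding TS_iff by blast
  then have "s \<otimes>\<^bsub>S\<^esub> t = tm (x \<otimes>\<^bsub>A\<^esub> y) (m + n)" using mon_mult Ipow_carr by simp
  then show "s \<otimes>\<^bsub>S\<^esub> t \<in> TS Q" unfolding TS_iff using Pts_mult_iff[OF Q] * Ipow_mult by metis
qed

lemma mult_subset_hom_TS:
  assumes Q: "Q \<in> Pts"
  shows "mult_subset_hom S (TS Q) K ev"
proof (intro mult_subset_hom.intro mult_subset_hom_axioms.intro mult_subset_TS[OF Q] K.field_axioms ev_hom)
  fix s assume "s \<in> TS Q"
  then obtain n x where x: "x \<in> Ipow n" "s = tm x n" "tm x n \<notin> Q" unfolding TS_iff by blast
  have "x \<noteq> \<zero>\<^bsub>A\<^esub>" using x(3) mon_zero PtsD(5)[OF Q] by auto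
  then show "ev s \<noteq> \<zero>" using x \<phi>_eq_zero ev_mon Ipow_carr by simp
qed

text \<open>The element of \<open>K\<close> that a germ at \<open>Q\<close> represents. The right
  side is the same map for all points, so values at different points can be compared.\<close>

definition "germ Q = fraction_eval S K ev"

lemma OX_carrier: "carrier (OX Q) = {fr Q (tm x n) (tm g n) | n x g. x \<in> Ipow n \<and> g \<in> Ipow n \<and> tm g n \<notin> Q}"
proof -
  have "carrier (OX Q) = {fr Q a f | n a f. a \<in> G n \<and> f \<in> G n - Q}"
    by (simp add: homogeneous_localization_def Let_def)
  also have "\<dots> = {fr Q (tm x n) (tm g n) | n x g. x \<in> Ipow n \<and> g \<in> Ipow n \<and> tm g n \<notin> Q}"
    unfolding G_iff by blast
  finally show ?thesis .
qed

lemma OX_ops: "monoid.mult (OX Q) = monoid.mult (localization S (TS Q))" "one (OX Q) = one (localization S (TS Q))"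
  "ring.zero (OX Q) = ring.zero (localization S (TS Q))" "ring.add (OX Q) = ring.add (localization S (TS Q))"
  by (simp_all add: homogeneous_localization_def Let_def)

context
  fixes Q assumes Q: "Q \<in> Pts"
begin

interpretation M: mult_subset_hom S "TS Q" K ev by (rule mult_subset_hom_TS[OF Q])

declare M.S_closed [simp del]

lemma denominator:
  assumes "g \<in> Ipow n" "tm g n \<notin> Q"
  shows "tm g n \<in> TS Q" "\<phi> g \<in> carrier K" "\<phi> g \<noteq> \<zero>" "g \<in> carrier A"
proof -
  show t: "tm g n \<in> TS Q" unfolding TS_iff using assms by blast
  show gc: "g \<in> carrier A" using assms Ipow_carr by blast
  then show "\<phi> g \<in> carrier K" by simp
  show "\<phi> g \<noteq> \<zero>" using M.h_nonzero[OF t] ev_mon[OF gc] by simp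
qed

lemma germ_frac:
  assumes "x \<in> Ipow n" "g \<in> Ipow n" "tm g n \<notin> Q"
  shows "germ Q (fr Q (tm x n) (tm g n)) = \<phi> x \<otimes> inv \<phi> g"
  using M.fraction_eval[OF mon_closed[OF assms(1)] denominator(1)[OF assms(2,3)]] assms Ipow_carr
  by (simp add: germ_def ev_mon)

text \<open>Equality in \<open>K\<close> gives x h = y g in \<open>A\<close> by
  cross-multiplication. Both sides belong to the degree \<open>m + n\<close>, so the equation also
  holds between the monomials of \<open>S\<close>.\<close>

lemma germ_inj: "inj_on (germ Q) (carrier (OX Q))"
proof (rule inj_onI)
  fix X1 X2 assume "X1 \<in> carrier (OX Q)" "X2 \<in> carrier (OX Q)" and eq: "germ Q X1 = germ Q X2"
  then obtain m n x g y h where *: "x \<in> Ipow m" "g \<in> Ipow m" "tm g m \<notin> Q" "X1 = fr Q (tm x m) (tm g m)"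
    "y \<in> Ipow n" "h \<in> Ipow n" "tm h n \<notin> Q" "X2 = fr Q (tm y n) (tm h n)"
    unfolding OX_carrier by blast
  have c: "x \<in> carrier A" "y \<in> carrier A" using * Ipow_carr by auto
  note dg = denominator[OF *(2,3)] and dh = denominator[OF *(6,7)]
  have "\<phi> x \<otimes> inv \<phi> g = \<phi> y \<otimes> inv \<phi> h" using eq germ_frac * by simp
  then have "\<phi> (x \<otimes>\<^bsub>A\<^esub> h) = \<phi> (y \<otimes>\<^bsub>A\<^esub> g)" using c dg dh K.frac_eq_iff by (simp add: \<phi>_mult)
  then have "x \<otimes>\<^bsub>A\<^esub> h = y \<otimes>\<^bsub>A\<^esub> g" using \<phi>_eq c dg dh by simp
  then have "h \<otimes>\<^bsub>A\<^esub> x = g \<otimes>\<^bsub>A\<^esub> y" using c dg(4) dh(4) by (simp add: A.m_comm)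
  then have "tm h n \<otimes>\<^bsub>S\<^esub> tm x m = tm g m \<otimes>\<^bsub>S\<^esub> tm y n"
    using c dg(4) dh(4) mon_mult by (simp add: add.commute)
  then show "X1 = X2" unfolding *(4,8) using mon_closed * dg(1) dh(1) by (intro M.fraction_eqI) auto
qed

lemma OX_add:
  assumes "x \<in> Ipow m" "g \<in> Ipow m" "tm g m \<notin> Q" "y \<in> Ipow n" "h \<in> Ipow n" "tm h n \<notin> Q"
  shows "fr Q (tm x m) (tm g m) \<oplus>\<^bsub>OX Q\<^esub> fr Q (tm y n) (tm h n) =
    fr Q (tm (h \<otimes>\<^bsub>A\<^esub> x \<oplus>\<^bsub>A\<^esub> g \<otimes>\<^bsub>A\<^esub> y) (m + n)) (tm (g \<otimes>\<^bsub>A\<^esub> h) (m + n))"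
  using assms mon_closed denominator Ipow_carr
  by (simp add: OX_ops M.add_fraction mon_mult mon_add[symmetric] add.commute)

lemma OX_mult:
  assumes "x \<in> Ipow m" "g \<in> Ipow m" "tm g m \<notin> Q" "y \<in> Ipow n" "h \<in> Ipow n" "tm h n \<notin> Q"
  shows "fr Q (tm x m) (tm g m) \<otimes>\<^bsub>OX Q\<^esub> fr Q (tm y n) (tm h n) =
    fr Q (tm (x \<otimes>\<^bsub>A\<^esub> y) (m + n)) (tm (g \<otimes>\<^bsub>A\<^esub> h) (m + n))"
  using assms mon_closed denominator Ipow_carr
  by (simp add: OX_ops M.mult_fraction mon_mult)

lemma OX_closed:
  assumes "z \<in> carrier (OX Q)" "w \<in> carrier (OX Q)"
  shows "z \<oplus>\<^bsub>OX Q\<^esub> w \<in> carrier (OX Q)" "z \<otimes>\<^bsub>OX Q\<^esub> w \<in> carrier (OX Q)"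
proof -
  obtain m n x g y h where *: "x \<in> Ipow m" "g \<in> Ipow m" "tm g m \<notin> Q" "z = fr Q (tm x m) (tm g m)"
    "y \<in> Ipow n" "h \<in> Ipow n" "tm h n \<notin> Q" "w = fr Q (tm y n) (tm h n)"
    using assms unfolding OX_carrier by blast
  have gh: "g \<otimes>\<^bsub>A\<^esub> h \<in> Ipow (m + n)" "tm (g \<otimes>\<^bsub>A\<^esub> h) (m + n) \<notin> Q" "x \<otimes>\<^bsub>A\<^esub> y \<in> Ipow (m + n)"
    using Ipow_mult * Pts_mult_iff[OF Q] by auto
  have "h \<otimes>\<^bsub>A\<^esub> x \<oplus>\<^bsub>A\<^esub> g \<otimes>\<^bsub>A\<^esub> y \<in> Ipow (m + n)"
    using Ipow_mult[OF *(6,1)] Ipow_mult[OF *(2,5)] Ipow_sub(2) by (simp add: add.commute)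
  then show "z \<oplus>\<^bsub>OX Q\<^esub> w \<in> carrier (OX Q)"
    unfolding *(4,8) OX_add[OF *(1-3,5-7)] OX_carrier using gh by blast
  show "z \<otimes>\<^bsub>OX Q\<^esub> w \<in> carrier (OX Q)"
    unfolding *(4,8) OX_mult[OF *(1-3,5-7)] OX_carrier using gh by blast
qed

lemma OX_sub: "carrier (OX Q) \<subseteq> carrier (localization S (TS Q))"
proof
  fix z assume "z \<in> carrier (OX Q)"
  then obtain n x g where *: "x \<in> Ipow n" "g \<in> Ipow n" "tm g n \<notin> Q" "z = fr Q (tm x n) (tm g n)"
    unfolding OX_carrier by blast
  show "z \<in> carrier (localization S (TS Q))"
    unfolding *(4) by (rule M.fraction_closed[OF mon_closed[OF *(1)] denominator(1)[OF *(2,3)]])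
qed

lemma OX_one: "\<one>\<^bsub>OX Q\<^esub> \<in> carrier (OX Q)"
proof -
  have one: "\<one>\<^bsub>A\<^esub> \<in> Ipow 0" by (simp add: ipow_0)
  have "fr Q (tm \<one>\<^bsub>A\<^esub> 0) (tm \<one>\<^bsub>A\<^esub> 0) \<in> carrier (OX Q)"
    unfolding OX_carrier using Pts_one[OF Q] one by blast
  then show ?thesis unfolding OX_ops M.one_localization mon_one .
qed

lemma germ_hom: "germ Q \<in> ring_hom (OX Q) K"
proof (rule ring_hom_memI)
  note h = M.fraction_eval_hom
  fix z w assume z: "z \<in> carrier (OX Q)" and w: "w \<in> carrier (OX Q)"
  note zc = subsetD[OF OX_sub z] and wc = subsetD[OF OX_sub w]
  show "germ Q (z \<otimes>\<^bsub>OX Q\<^esub> w) = germ Q z \<otimes> germ Q w" unfolding OX_ops germ_def by (rule ring_hom_mult[OF h zc wc])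
  show "germ Q (z \<oplus>\<^bsub>OX Q\<^esub> w) = germ Q z \<oplus> germ Q w" unfolding OX_ops germ_def by (rule ring_hom_add[OF h zc wc])
next
  note h = M.fraction_eval_hom
  show "germ Q z \<in> carrier K" if "z \<in> carrier (OX Q)" for z
    unfolding germ_def by (rule ring_hom_closed[OF h subsetD[OF OX_sub that]])
  show "germ Q \<one>\<^bsub>OX Q\<^esub> = \<one>" unfolding OX_ops germ_def by (rule ring_hom_one[OF h])
qed

end

end


section \<open>Isomorphisms of spaces of local families\<close>

text \<open>Sections are families of germs. So an isomorphism amounts to a homeomorphism with ring
  isomorphisms of the stalks, such that locally the families in \<open>C\<close> and
  \<open>C'\<close> correspond to each other. Extensionality allows families that agree on an open
  set to be identified as functions.\<close>

lemma local_family_space_iso: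
  assumes hom: "homeomorphic_map T T' f"
    and \<theta>: "\<And>p. p \<in> topspace T \<Longrightarrow> \<theta> p \<in> ring_hom (L' (f p)) (L p)"
      "\<And>p. p \<in> topspace T \<Longrightarrow> bij_betw (\<theta> p) (carrier (L' (f p))) (carrier (L p))"
    and fwd: "\<And>V c p. openin T' V \<Longrightarrow> c \<in> C' V \<Longrightarrow> p \<in> topspace T \<Longrightarrow> f p \<in> V \<Longrightarrow>
      \<exists>W d. openin T W \<and> p \<in> W \<and> d \<in> C W \<and> (\<forall>x\<in>W. f x \<in> V \<and> d x = \<theta> x (c (f x)))"
    and bwd: "\<And>V c p. openin T V \<Longrightarrow> c \<in> C V \<Longrightarrow> p \<in> V \<Longrightarrow>
      \<exists>W d. openin T' W \<and> f p \<in> W \<and> d \<in> C' W \<and>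
        (\<forall>x\<in>topspace T. f x \<in> W \<longrightarrow> x \<in> V \<and> d (f x) \<in> carrier (L' (f x)) \<and> \<theta> x (d (f x)) = c x)"
    and ext: "\<And>V d. d \<in> C V \<Longrightarrow> d \<in> extensional V" "\<And>V d. d \<in> C' V \<Longrightarrow> d \<in> extensional V"
  shows "isomorphic_ringed_spaces (local_family_space T L C) (local_family_space T' L' C')"
proof -
  let ?M = "local_family_space T L C" and ?N = "local_family_space T' L' C'"
  let ?pre = "\<lambda>V. f -` V \<inter> topspace T"
  \<comment> \<open>Pulls a family back along \<open>f\<close> and transports each germ by the map
    of the stalks.\<close>
  define F where "F = (\<lambda>V s. \<lambda>p\<in>?pre V. \<theta> p (s (f p)))"
  have surj: "f ` topspace T = topspace T'" and inj: "inj_on f (topspace T)"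
    using hom homeomorphic_imp_surjective_map homeomorphic_imp_injective_map by blast+
  have top: "space_topology ?M = T" "space_topology ?N = T'" by (simp_all add: local_family_space_def)
  have secM: "carrier (sections ?M U) = {s \<in> (\<Pi>\<^sub>E p\<in>U. carrier (L p)).
             \<forall>p\<in>U. \<exists>V. openin T V \<and> p \<in> V \<and> V \<subseteq> U \<and> restrict s V \<in> C V}" for U
    by (simp add: local_family_space_def)
  have secN: "carrier (sections ?N U) = {s \<in> (\<Pi>\<^sub>E p\<in>U. carrier (L' p)).
             \<forall>p\<in>U. \<exists>V. openin T' V \<and> p \<in> V \<and> V \<subseteq> U \<and> restrict s V \<in> C' V}" for U
    by (simp add: local_family_space_def)
  have F_sec: "F V s \<in> carrier (sections ?M (?pre V))" if s: "s \<in> carrier (sections ?N V)" for V s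
  proof -
    have s1: "s y \<in> carrier (L' y)" if "y \<in> V" for y using s that unfolding secN by auto
    have "F V s \<in> (\<Pi>\<^sub>E p\<in>?pre V. carrier (L p))"
      using ring_hom_closed[OF \<theta>(1)] s1 by (auto simp: F_def)
    moreover have "\<exists>W. openin T W \<and> p \<in> W \<and> W \<subseteq> ?pre V \<and> restrict (F V s) W \<in> C W" if p: "p \<in> ?pre V" for p
    proof -
      have "f p \<in> V" using p by simp
      then obtain V0 where V0: "openin T' V0" "f p \<in> V0" "V0 \<subseteq> V" "restrict s V0 \<in> C' V0"
        using s unfolding secN by blast
      obtain W d where W: "openin T W" "p \<in> W" "d \<in> C W" "\<And>x. x \<in> W \<Longrightarrow> f x \<in> V0 \<and> d x = \<theta> x (restrict s V0 (f x))"
        using fwd[OF V0(1,4) _ V0(2)] p by blast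
      have Wpre: "W \<subseteq> ?pre V" using W(4) V0(3) openin_subset[OF W(1)] by auto
      have "restrict (F V s) W = d"
      proof (rule extensionalityI[OF restrict_extensional ext(1)[OF W(3)]])
        show "restrict (F V s) W x = d x" if "x \<in> W" for x using W(4)[OF that] Wpre that by (auto simp: F_def)
      qed
      then show ?thesis using W Wpre by blast
    qed
    ultimately show ?thesis unfolding secM by blast
  qed
  have F_iso: "F V \<in> ring_iso (sections ?N V) (sections ?M (?pre V))" if V: "openin T' V" for V
  proof -
    have VT: "V \<subseteq> topspace T'" by (rule openin_subset[OF V])
    have s1: "s y \<in> carrier (L' y)" if "s \<in> carrier (sections ?N V)" "y \<in> V" for s y
      using that unfolding secN by auto
    have "F V \<in> ring_hom (sections ?N V) (sections ?M (?pre V))"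
    proof (rule ring_hom_memI)
      fix s t assume st: "s \<in> carrier (sections ?N V)" "t \<in> carrier (sections ?N V)"
      show "F V (s \<otimes>\<^bsub>sections ?N V\<^esub> t) = F V s \<otimes>\<^bsub>sections ?M (?pre V)\<^esub> F V t"
      proof
        fix p
        show "F V (s \<otimes>\<^bsub>sections ?N V\<^esub> t) p = (F V s \<otimes>\<^bsub>sections ?M (?pre V)\<^esub> F V t) p"
          using ring_hom_mult[OF \<theta>(1)[of p] s1[OF st(1)] s1[OF st(2)]]
          by (simp add: local_family_space_def F_def)
      qed
      show "F V (s \<oplus>\<^bsub>sections ?N V\<^esub> t) = F V s \<oplus>\<^bsub>sections ?M (?pre V)\<^esub> F V t"
      proof
        fix p
        show "F V (s \<oplus>\<^bsub>sections ?N V\<^esub> t) p = (F V s \<oplus>\<^bsub>sections ?M (?pre V)\<^esub> F V t) p"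
          using ring_hom_add[OF \<theta>(1)[of p] s1[OF st(1)] s1[OF st(2)]]
          by (simp add: local_family_space_def F_def)
      qed
    next
      show "F V \<one>\<^bsub>sections ?N V\<^esub> = \<one>\<^bsub>sections ?M (?pre V)\<^esub>"
      proof
        fix p
        show "F V \<one>\<^bsub>sections ?N V\<^esub> p = \<one>\<^bsub>sections ?M (?pre V)\<^esub> p"
          using ring_hom_one[OF \<theta>(1)[of p]] by (simp add: local_family_space_def F_def)
      qed
    qed (rule F_sec)
    moreover have "bij_betw (F V) (carrier (sections ?N V)) (carrier (sections ?M (?pre V)))"
      unfolding bij_betw_def
    proof (intro conjI)
      show "inj_on (F V) (carrier (sections ?N V))"
      proof (rule inj_onI)
        fix s t assume st: "s \<in> carrier (sections ?N V)" "t \<in> carrier (sections ?N V)" "F V s = F V t"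
        show "s = t"
        proof (rule PiE_ext)
          show "s \<in> (\<Pi>\<^sub>E p\<in>V. carrier (L' p))" "t \<in> (\<Pi>\<^sub>E p\<in>V. carrier (L' p))"
            using st(1,2) unfolding secN by blast+
          fix y assume y: "y \<in> V"
          then obtain x where x: "x \<in> topspace T" "y = f x" using surj VT by blast
          have "\<theta> x (s (f x)) = \<theta> x (t (f x))"
            using fun_cong[OF st(3), of x] x y by (simp add: F_def)
          then show "s y = t y"
            using inj_onD[OF bij_betw_imp_inj_on[OF \<theta>(2)[OF x(1)]]] s1[OF st(1) y] s1[OF st(2) y] x(2) by simp
        qed
      qed
      show "F V ` carrier (sections ?N V) = carrier (sections ?M (?pre V))"
      proof
        show "F V ` carrier (sections ?N V) \<subseteq> carrier (sections ?M (?pre V))" using F_sec by blast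
        show "carrier (sections ?M (?pre V)) \<subseteq> F V ` carrier (sections ?N V)"
        proof
          fix u assume u: "u \<in> carrier (sections ?M (?pre V))"
          have u1: "u x \<in> carrier (L x)" if "x \<in> ?pre V" for x using u that unfolding secM by auto
          have uext: "u \<in> extensional (?pre V)" using u unfolding secM by (auto simp: PiE_def)
          define g where "g = inv_into (topspace T) f"
          have g: "g (f x) = x" if "x \<in> topspace T" for x using inj that by (simp add: g_def)
          \<comment> \<open>The inverse transport, germ by germ. That it is locally a family in
            \<open>C'\<close> is the content of \<open>bwd\<close>, together with the injectivity of
            the stalk maps.\<close>
          define s where "s = (\<lambda>y\<in>V. inv_into (carrier (L' y)) (\<theta> (g y)) (u (g y)))"
          have sf: "s (f x) \<in> carrier (L' (f x)) \<and> \<theta> x (s (f x)) = u x" if x: "x \<in> ?pre V" for x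
          proof -
            have im: "\<theta> x ` carrier (L' (f x)) = carrier (L x)" using bij_betw_imp_surj_on[OF \<theta>(2)] x by simp
            have ux: "u x \<in> \<theta> x ` carrier (L' (f x))" unfolding im by (rule u1[OF x])
            have "s (f x) = inv_into (carrier (L' (f x))) (\<theta> x) (u x)" using x g by (simp add: s_def)
            then show ?thesis using inv_into_into[OF ux] f_inv_into_f[OF ux] by simp
          qed
          have "s \<in> carrier (sections ?N V)"
            unfolding secN
          proof (intro CollectI conjI ballI)
            have "s y \<in> carrier (L' y)" if y: "y \<in> V" for y
            proof -
              obtain x where x: "x \<in> topspace T" "y = f x" using surj VT y by blast
              then show ?thesis using sf[of x] y by simp
            qed
            then show "s \<in> (\<Pi>\<^sub>E p\<in>V. carrier (L' p))" by (auto simp: s_def)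
            fix y assume y: "y \<in> V"
            then obtain x where x: "x \<in> topspace T" "y = f x" using surj VT by blast
            then obtain V0 where V0: "openin T V0" "x \<in> V0" "V0 \<subseteq> ?pre V" "restrict u V0 \<in> C V0"
              using u y unfolding secM by blast
            obtain W d where W: "openin T' W" "f x \<in> W" "d \<in> C' W"
              and Wd: "\<And>x. x \<in> topspace T \<Longrightarrow> f x \<in> W \<Longrightarrow> x \<in> V0 \<and> d (f x) \<in> carrier (L' (f x)) \<and> \<theta> x (d (f x)) = restrict u V0 x"
              using bwd[OF V0(1,4,2)] by blast
            have WT: "W \<subseteq> topspace T'" by (rule openin_subset[OF W(1)])
            have WV: "W \<subseteq> V"
            proof
              fix z assume z: "z \<in> W"
              then obtain x' where x': "x' \<in> topspace T" "z = f x'" using WT surj by blast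
              then show "z \<in> V" using Wd[of x'] z V0(3) by blast
            qed
            have "restrict s W = d"
            proof (rule extensionalityI[OF restrict_extensional ext(2)[OF W(3)]])
              fix z assume z: "z \<in> W"
              then obtain x' where x': "x' \<in> topspace T" "z = f x'" using WT surj by blast
              have d: "x' \<in> V0" "d z \<in> carrier (L' z)" "\<theta> x' (d z) = u x'" using Wd[OF x'(1)] z x'(2) by auto
              have "x' \<in> ?pre V" using d(1) V0(3) by blast
              then have "s z \<in> carrier (L' z)" "\<theta> x' (s z) = \<theta> x' (d z)" using sf x'(2) d(3) by auto
              then have "s z = d z"
                using inj_onD[OF bij_betw_imp_inj_on[OF \<theta>(2)[OF x'(1)]]] d(2) x'(2) by simp
              then show "restrict s W z = d z" using z by simp
            qed
            then show "\<exists>W. openin T' W \<and> y \<in> W \<and> W \<subseteq> V \<and> restrict s W \<in> C' W"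
              using W WV x(2) by blast
          qed
          moreover have "F V s = u"
          proof (rule extensionalityI[of _ "?pre V"])
            show "F V s \<in> extensional (?pre V)" by (simp add: F_def)
            show "F V s x = u x" if "x \<in> ?pre V" for x using sf[OF that] that by (simp add: F_def)
          qed (rule uext)
          ultimately show "u \<in> F V ` carrier (sections ?N V)" by blast
        qed
      qed
    qed
    ultimately show ?thesis by (simp add: ring_iso_def)
  qed
  have F_res: "F W (restriction ?N V W s) = restriction ?M (?pre V) (?pre W) (F V s)"
    if "W \<subseteq> V" for V W s
  proof
    show "F W (restriction ?N V W s) p = restriction ?M (?pre V) (?pre W) (F V s) p" for p
      using that by (auto simp: F_def local_family_space_def)
  qed
  have "ringed_space_iso ?M ?N f F"
    unfolding ringed_space_iso_def top using hom F_iso F_res by blast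
  then show ?thesis unfolding isomorphic_ringed_spaces_def by blast
qed

text \<open>Two rings with injective maps to \<open>K\<close> and the same image are isomorphic. The
  third claim computes the isomorphism from equality of values in \<open>K\<close>. \<open>L\<close>
  is described by closure properties, as it will be the degree zero part of a localization.\<close>

lemma stalk_iso:
  assumes g: "g \<in> ring_hom L K" "inj_on g (carrier L)" and e: "e \<in> ring_hom L' K" "inj_on e (carrier L')"
    and im: "e ` carrier L' = g ` carrier L"
    and cl: "\<And>x y. x \<in> carrier L \<Longrightarrow> y \<in> carrier L \<Longrightarrow> x \<oplus>\<^bsub>L\<^esub> y \<in> carrier L"
      "\<And>x y. x \<in> carrier L \<Longrightarrow> y \<in> carrier L \<Longrightarrow> x \<otimes>\<^bsub>L\<^esub> y \<in> carrier L" "\<one>\<^bsub>L\<^esub> \<in> carrier L"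
  defines "\<theta> \<equiv> \<lambda>x. inv_into (carrier L) g (e x)"
  shows "\<theta> \<in> ring_hom L' L" "bij_betw \<theta> (carrier L') (carrier L)"
    "\<And>x d. x \<in> carrier L' \<Longrightarrow> d \<in> carrier L \<Longrightarrow> g d = e x \<Longrightarrow> \<theta> x = d"
proof -
  show eq: "\<And>x d. x \<in> carrier L' \<Longrightarrow> d \<in> carrier L \<Longrightarrow> g d = e x \<Longrightarrow> \<theta> x = d"
    unfolding \<theta>_def using g(2) by (metis inv_into_f_f)
  have \<theta>: "\<theta> x \<in> carrier L" "g (\<theta> x) = e x" if "x \<in> carrier L'" for x
  proof -
    have "e x \<in> g ` carrier L" using im that by blast
    then show "\<theta> x \<in> carrier L" "g (\<theta> x) = e x" unfolding \<theta>_def by (auto intro: inv_into_into f_inv_into_f)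
  qed
  have th: "\<theta> z = inv_into (carrier L) g (e z)" for z by (simp add: \<theta>_def)
  show "\<theta> \<in> ring_hom L' L"
  proof (rule ring_hom_memI)
    fix x y assume x: "x \<in> carrier L'" and y: "y \<in> carrier L'"
    have "inv_into (carrier L) g (g (\<theta> x \<otimes>\<^bsub>L\<^esub> \<theta> y)) = \<theta> x \<otimes>\<^bsub>L\<^esub> \<theta> y"
      using g(2) cl(2) \<theta> x y by (intro inv_into_f_f) auto
    then show "\<theta> (x \<otimes>\<^bsub>L'\<^esub> y) = \<theta> x \<otimes>\<^bsub>L\<^esub> \<theta> y"
      using ring_hom_mult[OF e(1) x y] ring_hom_mult[OF g(1), of "\<theta> x" "\<theta> y"] \<theta> x y th[of "x \<otimes>\<^bsub>L'\<^esub> y"] by simp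
    have "inv_into (carrier L) g (g (\<theta> x \<oplus>\<^bsub>L\<^esub> \<theta> y)) = \<theta> x \<oplus>\<^bsub>L\<^esub> \<theta> y"
      using g(2) cl(1) \<theta> x y by (intro inv_into_f_f) auto
    then show "\<theta> (x \<oplus>\<^bsub>L'\<^esub> y) = \<theta> x \<oplus>\<^bsub>L\<^esub> \<theta> y"
      using ring_hom_add[OF e(1) x y] ring_hom_add[OF g(1), of "\<theta> x" "\<theta> y"] \<theta> x y th[of "x \<oplus>\<^bsub>L'\<^esub> y"] by simp
  next
    have "inv_into (carrier L) g (g \<one>\<^bsub>L\<^esub>) = \<one>\<^bsub>L\<^esub>" using g(2) cl(3) by (intro inv_into_f_f)
    then show "\<theta> \<one>\<^bsub>L'\<^esub> = \<one>\<^bsub>L\<^esub>" using ring_hom_one[OF e(1)] ring_hom_one[OF g(1)] by (simp add: \<theta>_def)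
  qed (rule \<theta>(1))
  show "bij_betw \<theta> (carrier L') (carrier L)"
    unfolding bij_betw_def
  proof (intro conjI inj_onI equalityI subsetI)
    fix x y assume xy: "x \<in> carrier L'" "y \<in> carrier L'" "\<theta> x = \<theta> y"
    have "e x = e y" using \<theta>(2)[OF xy(1)] \<theta>(2)[OF xy(2)] xy(3) by simp
    then show "x = y" using inj_onD[OF e(2)] xy(1,2) by blast
  next
    fix z assume "z \<in> \<theta> ` carrier L'" then show "z \<in> carrier L" using \<theta>(1) by blast
  next
    fix z assume z: "z \<in> carrier L"
    then obtain x where x: "x \<in> carrier L'" "g z = e x" using im by (metis imageE imageI)
    then show "z \<in> \<theta> ` carrier L'" using eq[OF x(1) z x(2)] by blast
  qed
qed


lemma (in cring) openin_zariski_iff: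
  "openin (zariski_topology R) V \<longleftrightarrow> (\<exists>E\<subseteq>carrier R. V = {p. primeideal p R \<and> \<not> E \<subseteq> p})"
  unfolding openin_zariski_topology zariski_open_def prime_spectrum_def
  by (intro ex_cong1 conj_cong refl) auto

lemma (in cring) topspace_zariski: "topspace (zariski_topology R) = prime_spectrum R"
proof
  show "topspace (zariski_topology R) \<subseteq> prime_spectrum R"
    unfolding topspace_def openin_zariski_iff prime_spectrum_def by auto
  have "openin (zariski_topology R) (prime_spectrum R)"
    unfolding openin_zariski_iff prime_spectrum_def
    using primeideal_one_notin[of _ R] by (intro exI[of _ "{\<one>}"]) auto
  then show "prime_spectrum R \<subseteq> topspace (zariski_topology R)" by (rule openin_subset)
qed

section \<open>Points of the blow-up that come from primes of a subring of \<open>K\<close>\<close>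

context rees
begin

text \<open>The monomial k t^n, for an element k of I^n that is given inside
  \<open>K\<close>.\<close>

definition "tk k n = tm (inv_into (carrier A) \<phi> k) n"

lemma tk_image: "x \<in> carrier A \<Longrightarrow> tk (\<phi> x) n = tm x n"
  using inj by (simp add: tk_def)

lemma J_cases:
  assumes "k \<in> J n"
  obtains x where "x \<in> Ipow n" "k = \<phi> x" "tk k n = tm x n" "x \<in> carrier A"
  using assms Ipow_carr tk_image unfolding J_image by blast

lemma tk_mult_iff:
  assumes Q: "Q \<in> Pts" and k: "k \<in> J m" and l: "l \<in> J n"
  shows "tk (k \<otimes> l) (m + n) \<in> Q \<longleftrightarrow> tk k m \<in> Q \<or> tk l n \<in> Q"
proof -
  obtain x where x: "x \<in> Ipow m" "k = \<phi> x" "tk k m = tm x m" "x \<in> carrier A" using J_cases[OF k] .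
  obtain y where y: "y \<in> Ipow n" "l = \<phi> y" "tk l n = tm y n" "y \<in> carrier A" using J_cases[OF l] .
  have "tk (k \<otimes> l) (m + n) = tm (x \<otimes>\<^bsub>A\<^esub> y) (m + n)"
    using tk_image[of "x \<otimes>\<^bsub>A\<^esub> y" "m + n"] x y by (simp add: \<phi>_mult)
  then show ?thesis using Pts_mult_iff[OF Q x(1) y(1)] x(3) y(3) by simp
qed

lemma tk_add:
  assumes Q: "Q \<in> Pts" and k: "k \<in> J n" "tk k n \<in> Q" and l: "l \<in> J n" "tk l n \<in> Q"
  shows "tk (k \<oplus> l) n \<in> Q"
proof -
  obtain x where x: "x \<in> Ipow n" "k = \<phi> x" "tk k n = tm x n" "x \<in> carrier A" using J_cases[OF k(1)] .
  obtain y where y: "y \<in> Ipow n" "l = \<phi> y" "tk l n = tm y n" "y \<in> carrier A" using J_cases[OF l(1)] .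
  have "tk (k \<oplus> l) n = tm x n \<oplus>\<^bsub>S\<^esub> tm y n"
    using tk_image[of "x \<oplus>\<^bsub>A\<^esub> y" n] x y by (simp add: \<phi>_add mon_add)
  then show ?thesis
    using additive_subgroup.a_closed[OF ideal.axioms(1)[OF primeideal.axioms(1)[OF PtsD(1)[OF Q]]]] x(3) y(3) k(2) l(2) by simp
qed

lemma tk_zero: "Q \<in> Pts \<Longrightarrow> tk \<zero> n \<in> Q"
  using tk_image[of "\<zero>\<^bsub>A\<^esub>" n] PtsD(5)[of Q] by (simp add: \<phi>_zero mon_zero)

lemma tk_pow:
  assumes Q: "Q \<in> Pts" and c: "c \<in> \<phi> ` I" "tk c (Suc 0) \<notin> Q"
  shows "tk (c [^] n) n \<notin> Q"
proof (induct n)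
  case 0
  then show ?case using Pts_one[OF Q] tk_image[of "\<one>\<^bsub>A\<^esub>" 0] by (simp add: \<phi>_one)
next
  case (Suc n)
  have "c \<in> J (Suc 0)" using c(1) J_1 by simp
  then show ?case using tk_mult_iff[OF Q J_pow[OF c(1), of n], of c "Suc 0"] Suc c by simp
qed

lemma Pts_generator: "Q \<in> Pts \<Longrightarrow> \<exists>c\<in>\<phi> ` I. tk c (Suc 0) \<notin> Q"
  using PtsD(3)[of Q] tk_image I_carr_A by fastforce

text \<open>If y I is contained in \<open>R\<close>, then t -> y t maps the Rees algebra to
  \<open>R[t]\<close>, and this is the preimage of \<open>q[t]\<close>. Taking all degrees
  separately makes it homogeneous.\<close>

definition "point q y = {p \<in> carrier S. \<forall>n. \<phi> (p n) \<otimes> y [^] n \<in> q}"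

lemma \<phi>_mult_conv:
  assumes p: "p \<in> carrier S" and p': "p' \<in> carrier S" and y: "y \<in> carrier K"
  shows "\<phi> ((p \<otimes>\<^bsub>S\<^esub> p') n) \<otimes> y [^] n = (\<Oplus>i\<in>{..n}. (\<phi> (p i) \<otimes> y [^] i) \<otimes> (\<phi> (p' (n - i)) \<otimes> y [^] (n - i)))"
proof -
  have c: "p i \<in> carrier A" "p' i \<in> carrier A" for i using rees_coeff(2) p p' by blast+
  have "\<phi> ((p \<otimes>\<^bsub>S\<^esub> p') n) = (\<Oplus>i\<in>{..n}. \<phi> (p i) \<otimes> \<phi> (p' (n - i)))"
    unfolding rees_mult_apply[OF p p']
    using c by (subst ring_hom_ring.hom_finsum[OF ring_hom_ring_\<phi>]) (auto intro!: K.finsum_cong' simp: \<phi>_mult)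
  then have "\<phi> ((p \<otimes>\<^bsub>S\<^esub> p') n) \<otimes> y [^] n = (\<Oplus>i\<in>{..n}. \<phi> (p i) \<otimes> \<phi> (p' (n - i)) \<otimes> y [^] n)"
    using c y by (simp add: K.finsum_ldistr)
  also have "\<dots> = (\<Oplus>i\<in>{..n}. (\<phi> (p i) \<otimes> y [^] i) \<otimes> (\<phi> (p' (n - i)) \<otimes> y [^] (n - i)))"
  proof (rule K.finsum_cong')
    fix i assume "i \<in> {..n}"
    then have "y [^] n = y [^] i \<otimes> y [^] (n - i)" using y by (simp add: K.nat_pow_mult)
    then show "\<phi> (p i) \<otimes> \<phi> (p' (n - i)) \<otimes> y [^] n = (\<phi> (p i) \<otimes> y [^] i) \<otimes> (\<phi> (p' (n - i)) \<otimes> y [^] (n - i))"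
      using c y by (simp add: K.m_ac)
  qed (use c y in auto)
  finally show ?thesis .
qed

context
  fixes R y c q
  assumes R: "subring R K" "\<phi> ` carrier A \<subseteq> R" and y: "y \<in> colon K R (\<phi> ` I)" and c: "c \<in> \<phi> ` I"
    and q: "primeideal q (K\<lparr>carrier := R\<rparr>)" and yc: "y \<otimes> c \<notin> q"
begin

lemma point_y [simp]: "y \<in> carrier K" using y by (simp add: colon_def)

text \<open>I^n is spanned by products of \<open>n\<close> elements of \<open>I\<close>, each of
  which absorbs one factor \<open>y\<close>; in degree zero the claim is that \<open>A\<close> lies
  in \<open>R\<close>.\<close>

lemma point_value: "k \<in> J n \<Longrightarrow> k \<otimes> y [^] n \<in> R"
proof (induct n arbitrary: k)
  case 0
  then show ?case using R A_carr by auto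
next
  case (Suc n)
  note Rs = subringE[OF R(1)]
  from Suc(2) have "k \<in> ideal_prod K (J n) (\<phi> ` I)" by (simp add: ideal_pow_Suc)
  then have "k \<in> carrier K \<and> k \<otimes> y [^] Suc n \<in> R"
  proof induct
    case (prod i j)
    have cc: "i \<in> carrier K" "j \<in> carrier K" using prod J_carr I_carr by auto
    have "(i \<otimes> y [^] n) \<otimes> (y \<otimes> j) \<in> R"
      using Rs(6)[OF Suc(1)[OF prod(1)]] prod(2) y by (auto simp: colon_def)
    then show ?case using cc by (simp add: K.m_ac)
  next
    case (sum s t)
    then show ?case using Rs(7) by (simp add: K.l_distr)
  qed
  then show ?case by blast
qed

lemma mon_point_iff:
  assumes "x \<in> Ipow n"
  shows "tm x n \<in> point q y \<longleftrightarrow> \<phi> x \<otimes> y [^] n \<in> q"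
proof -
  have xc: "x \<in> carrier A" using assms Ipow_carr by blast
  have "\<zero> \<in> q" using submodD(2)[OF K.submod_subring_ideal(1)[OF R(1) primeideal.axioms(1)[OF q]]] .
  then show ?thesis using mon_closed[OF assms] by (auto simp: point_def mon_apply[OF xc] \<phi>_zero)
qed

text \<open>A product in the Rees algebra becomes a convolution of the sequences p_i y^i, so
  primality is Gauss's lemma \<open>convolution_prime\<close>. That y c is outside \<open>q\<close>
  means that c t is outside the point.\<close>

lemma point_in_Pts: "point q y \<in> Pts"
proof -
  note qm = K.submod_subring_ideal[OF R(1) primeideal.axioms(1)[OF q]]
  note qs = submodD[OF qm(1)]
  have val: "\<phi> (p n) \<otimes> y [^] n \<in> R" if "p \<in> carrier S" for p n
    by (rule point_value) (use rees_coeff(1)[OF that] in \<open>simp add: J_image\<close>)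
  have "primeideal (point q y) S"
  proof (rule primeidealI)
    show "cring S" by (rule S.is_cring)
    show "ideal (point q y) S"
    proof (rule S.idealI_cring)
      show "point q y \<subseteq> carrier S" by (auto simp: point_def)
      show "\<zero>\<^bsub>S\<^esub> \<in> point q y" unfolding point_def using qs(2) by (simp add: rees_zero_apply \<phi>_zero)
    next
      fix p p' assume "p \<in> point q y" "p' \<in> point q y"
      then have *: "p \<in> carrier S" "p' \<in> carrier S" "\<And>n. \<phi> (p n) \<otimes> y [^] n \<in> q" "\<And>n. \<phi> (p' n) \<otimes> y [^] n \<in> q"
        by (auto simp: point_def)
      have "\<phi> ((p \<oplus>\<^bsub>S\<^esub> p') n) \<otimes> y [^] n = \<phi> (p n) \<otimes> y [^] n \<oplus> \<phi> (p' n) \<otimes> y [^] n" for n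
        using rees_coeff(2) * by (simp add: rees_add_apply \<phi>_add K.l_distr)
      then show "p \<oplus>\<^bsub>S\<^esub> p' \<in> point q y" using * qs(3) by (simp add: point_def)
    next
      fix a p assume a: "a \<in> carrier S" and "p \<in> point q y"
      then have p: "p \<in> carrier S" "\<And>n. \<phi> (p n) \<otimes> y [^] n \<in> q" by (auto simp: point_def)
      have "\<phi> ((a \<otimes>\<^bsub>S\<^esub> p) n) \<otimes> y [^] n \<in> q" for n
        unfolding \<phi>_mult_conv[OF a p(1) point_y]
        by (rule K.submod_finsum[OF qm(1)]) (rule qs(4)[OF val[OF a] p(2)])
      then show "a \<otimes>\<^bsub>S\<^esub> p \<in> point q y" using a p by (simp add: point_def)
    qed
    have o: "\<phi> (\<one>\<^bsub>S\<^esub> 0) \<otimes> y [^] (0::nat) = \<one>"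
      using mon_one mon_apply[OF A.one_closed, of 0] by (metis (full_types) K.l_one K.nat_pow_0 K.one_closed \<phi>_one)
    have "\<one>\<^bsub>S\<^esub> \<notin> point q y"
    proof
      assume "\<one>\<^bsub>S\<^esub> \<in> point q y"
      then have "\<forall>n. \<phi> (\<one>\<^bsub>S\<^esub> n) \<otimes> y [^] n \<in> q" by (simp add: point_def)
      then have "\<phi> (\<one>\<^bsub>S\<^esub> 0) \<otimes> y [^] (0::nat) \<in> q" by (rule spec)
      then show False unfolding o using primeideal_one_notin[OF q] by simp
    qed
    then show "carrier S \<noteq> point q y" using S.one_closed by blast
  next
    fix p p' assume p: "p \<in> carrier S" and p': "p' \<in> carrier S" and pp: "p \<otimes>\<^bsub>S\<^esub> p' \<in> point q y"
    have "(\<forall>i. \<phi> (p i) \<otimes> y [^] i \<in> q) \<or> (\<forall>i. \<phi> (p' i) \<otimes> y [^] i \<in> q)"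
    proof (rule K.convolution_prime[OF R(1) q val[OF p] val[OF p']])
      show "(\<Oplus>i\<in>{..n}. (\<phi> (p i) \<otimes> y [^] i) \<otimes> (\<phi> (p' (n - i)) \<otimes> y [^] (n - i))) \<in> q" for n
        unfolding \<phi>_mult_conv[OF p p' point_y, symmetric] using pp by (simp add: point_def)
    qed
    then show "p \<in> point q y \<or> p' \<in> point q y" using p p' by (auto simp: point_def)
  qed
  moreover have "tm (p n) n \<in> point q y" if "p \<in> point q y" for p n
    using that mon_point_iff[of "p n" n] rees_coeff(1)[of p n] by (simp add: point_def)
  moreover obtain a where a: "a \<in> I" "c = \<phi> a" using c by blast
  then have "tm a (Suc 0) \<notin> point q y"
    using mon_point_iff[of a "Suc 0"] yc I_carr_A[OF a(1)] Ipow_1 by (simp add: K.m_comm)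
  ultimately show ?thesis unfolding Pts_iff using a(1) by blast
qed

lemma tk_point_iff: "k \<in> J n \<Longrightarrow> tk k n \<in> point q y \<longleftrightarrow> k \<otimes> y [^] n \<in> q"
  using mon_point_iff by (metis J_cases)

end

lemma Pts_eqI:
  assumes P: "P \<in> Pts" and Q: "Q \<in> Pts" and eq: "\<And>k n. k \<in> J n \<Longrightarrow> tk k n \<in> P \<longleftrightarrow> tk k n \<in> Q"
  shows "P = Q"
proof -
  have sub: "P \<subseteq> Q" if P: "P \<in> Pts" and Q: "Q \<in> Pts" and eq: "\<And>k n. k \<in> J n \<Longrightarrow> tk k n \<in> P \<Longrightarrow> tk k n \<in> Q" for P Q
  proof
    fix p assume p: "p \<in> P"
    have pc: "p \<in> carrier S" by (rule PtsD(4)[OF P p])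
    show "p \<in> Q"
    proof (rule rees_sum_mon[OF pc primeideal.axioms(1)[OF PtsD(1)[OF Q]]])
      fix n
      have "\<phi> (p n) \<in> J n" using rees_coeff(1)[OF pc] by (simp add: J_image)
      then show "tm (p n) n \<in> Q" using eq[of "\<phi> (p n)" n] PtsD(2)[OF P p] tk_image rees_coeff(2)[OF pc] by simp
    qed
  qed
  show ?thesis using sub[OF P Q] sub[OF Q P] eq by blast
qed

subsection \<open>The blow-up is the spectrum of \<open>R\<close>\<close>

context
  fixes R m
  assumes R: "subring R K" "\<phi> ` carrier A \<subseteq> R" and R_J: "\<forall>r\<in>R. \<forall>k\<in>J m. r \<otimes> k \<in> J m"
    and one: "\<one> \<in> ideal_prod K (\<phi> ` I) (colon K R (\<phi> ` I))"
begin

abbreviation "B \<equiv> K\<lparr>carrier := R\<rparr>"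
abbreviation "Y \<equiv> colon K R (\<phi> ` I)"

lemma RJ: "r \<in> R \<Longrightarrow> k \<in> J m \<Longrightarrow> r \<otimes> k \<in> J m" using R_J by blast

lemma R_carr: "r \<in> R \<Longrightarrow> r \<in> carrier K" using subringE(1)[OF R(1)] by blast

lemma Y_carr: "y \<in> Y \<Longrightarrow> y \<in> carrier K" by (simp add: colon_def)

lemma YI: "y \<in> Y \<Longrightarrow> c \<in> \<phi> ` I \<Longrightarrow> y \<otimes> c \<in> R" by (auto simp: colon_def)

lemma cring_B: "cring B" by (rule K.subring_of_embedding[OF R(1)])

lemma prime_mult:
  assumes q: "primeideal q B" and r: "r \<in> R" and s: "s \<in> R"
  shows "r \<otimes> s \<in> q \<longleftrightarrow> r \<in> q \<or> s \<in> q"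
  using primeideal.I_prime[OF q, of r s] ideal.I_l_closed[OF primeideal.axioms(1)[OF q], of s r]
    ideal.I_r_closed[OF primeideal.axioms(1)[OF q], of r s] r s by auto

lemma prime_pow: "primeideal q B \<Longrightarrow> r \<in> R \<Longrightarrow> r \<notin> q \<Longrightarrow> r [^] (n::nat) \<in> R \<and> r [^] n \<notin> q"
proof (induct n)
  case 0
  then show ?case using primeideal_one_notin[of q B] subringE(3)[OF R(1)] by simp
next
  case (Suc n)
  then show ?case using prime_mult[of q "r [^] n" r] subringE(6)[OF R(1), of "r [^] n" r] by simp
qed

lemma local_generator:
  assumes q: "primeideal q B"
  shows "\<exists>y\<in>Y. \<exists>c\<in>\<phi> ` I. y \<otimes> c \<notin> q"
proof (rule ccontr)
  assume no: "\<not> ?thesis"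
  have "z \<in> q" if "z \<in> ideal_prod K (\<phi> ` I) Y" for z
    using that
  proof induct
    case (prod i y)
    then have "y \<otimes> i \<in> q" using no by blast
    then show ?case using prod I_carr Y_carr by (simp add: K.m_comm)
  next
    case (sum s t)
    then show ?case using submodD(3)[OF K.submod_subring_ideal(1)[OF R(1) primeideal.axioms(1)[OF q]]] by blast
  qed
  from this[OF one] show False using primeideal_one_notin[OF q] by simp
qed

text \<open>An element of \<open>R\<close> need not act on the Rees algebra, but by
  \<open>R_J\<close> it maps I^m into itself. So whether it vanishes at \<open>Q\<close> is tested
  in degree \<open>m\<close>.\<close>

definition "spec_pt Q = {z \<in> R. \<forall>k\<in>J m. tk (z \<otimes> k) m \<in> Q}"

text \<open>Test elements \<open>k\<close> and \<open>l\<close> for the two factors are multiplied: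
  (z w k) l = (z k)(w l) is an identity in degree \<open>m + m\<close>, where primality of
  \<open>Q\<close> decides.\<close>

lemma spec_pt_mult:
  assumes Q: "Q \<in> Pts" and z: "z \<in> R" "z \<notin> spec_pt Q" and w: "w \<in> R" "w \<notin> spec_pt Q"
  shows "z \<otimes> w \<notin> spec_pt Q"
proof
  assume zw: "z \<otimes> w \<in> spec_pt Q"
  obtain k where k: "k \<in> J m" "tk (z \<otimes> k) m \<notin> Q" using z by (auto simp: spec_pt_def)
  obtain l where l: "l \<in> J m" "tk (w \<otimes> l) m \<notin> Q" using w by (auto simp: spec_pt_def)
  note c = R_carr[OF z(1)] R_carr[OF w(1)] J_carr[OF k(1)] J_carr[OF l(1)]
  have "tk ((z \<otimes> w) \<otimes> k) m \<in> Q" using zw k by (simp add: spec_pt_def)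
  moreover have "(z \<otimes> w) \<otimes> k \<in> J m" using RJ[OF subringE(6)[OF R(1) z(1) w(1)] k(1)] .
  ultimately have "tk (((z \<otimes> w) \<otimes> k) \<otimes> l) (m + m) \<in> Q" using tk_mult_iff[OF Q] l(1) by blast
  moreover have "((z \<otimes> w) \<otimes> k) \<otimes> l = (z \<otimes> k) \<otimes> (w \<otimes> l)" using c by (simp add: K.m_ac)
  ultimately show False using tk_mult_iff[OF Q RJ[OF z(1) k(1)] RJ[OF w(1) l(1)]] k(2) l(2) by simp
qed

lemma spec_pt_prime:
  assumes Q: "Q \<in> Pts"
  shows "primeideal (spec_pt Q) B"
proof (rule primeidealI[OF _ cring_B])
  show "ideal (spec_pt Q) B"
  proof (rule K.ideal_subringI[OF R(1)])
    show "spec_pt Q \<subseteq> R" by (auto simp: spec_pt_def)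
    show "submod K R (spec_pt Q)"
      unfolding submod_def
    proof (intro conjI ballI)
      show "spec_pt Q \<subseteq> carrier K" using R_carr by (auto simp: spec_pt_def)
      show "\<zero> \<in> spec_pt Q" using subringE(2)[OF R(1)] J_carr tk_zero[OF Q] by (simp add: spec_pt_def)
    next
      fix z w assume "z \<in> spec_pt Q" "w \<in> spec_pt Q"
      then have zw: "z \<in> R" "w \<in> R" "\<And>k. k \<in> J m \<Longrightarrow> tk (z \<otimes> k) m \<in> Q" "\<And>k. k \<in> J m \<Longrightarrow> tk (w \<otimes> k) m \<in> Q"
        by (auto simp: spec_pt_def)
      have "tk ((z \<oplus> w) \<otimes> k) m \<in> Q" if k: "k \<in> J m" for k
        using tk_add[OF Q RJ[OF zw(1) k] zw(3)[OF k] RJ[OF zw(2) k] zw(4)[OF k]] R_carr zw J_carr[OF k]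
        by (simp add: K.l_distr)
      then show "z \<oplus> w \<in> spec_pt Q" using zw subringE(7)[OF R(1)] by (simp add: spec_pt_def)
    next
      fix r z assume r: "r \<in> R" and z: "z \<in> spec_pt Q"
      have zR: "z \<in> R" using z by (simp add: spec_pt_def)
      have "tk ((r \<otimes> z) \<otimes> k) m \<in> Q" if k: "k \<in> J m" for k
      proof -
        have "tk (z \<otimes> (r \<otimes> k)) m \<in> Q" using z RJ[OF r k] by (simp add: spec_pt_def)
        then show ?thesis using R_carr[OF r] R_carr[OF zR] J_carr[OF k] by (simp add: K.m_ac)
      qed
      then show "r \<otimes> z \<in> spec_pt Q" using r zR subringE(6)[OF R(1)] by (simp add: spec_pt_def)
    qed
  qed
  obtain c where c: "c \<in> \<phi> ` I" "tk c (Suc 0) \<notin> Q" using Pts_generator[OF Q] by blast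
  have "\<one> \<notin> spec_pt Q"
  proof
    assume "\<one> \<in> spec_pt Q"
    then have "tk (\<one> \<otimes> c [^] m) m \<in> Q" using J_pow[OF c(1), of m] by (simp add: spec_pt_def)
    then show False using tk_pow[OF Q c, of m] I_carr[OF c(1)] by simp
  qed
  then show "carrier B \<noteq> spec_pt Q" using subringE(3)[OF R(1)] by auto
  show "z \<in> spec_pt Q \<or> w \<in> spec_pt Q" if "z \<in> carrier B" "w \<in> carrier B" "z \<otimes>\<^bsub>B\<^esub> w \<in> spec_pt Q" for z w
    using spec_pt_mult[OF Q, of z w] that by auto
qed

lemma spec_pt_point:
  assumes q: "primeideal q B" and y: "y \<in> Y" and c: "c \<in> \<phi> ` I" and yc: "y \<otimes> c \<notin> q"
  shows "spec_pt (point q y) = q"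
proof -
  note iff = tk_point_iff[OF R y c q yc]
  note ycar = Y_carr[OF y] and ccar = I_carr[OF c]
  note qm = K.submod_subring_ideal[OF R(1) primeideal.axioms(1)[OF q]]
  have "z \<in> spec_pt (point q y) \<longleftrightarrow> z \<in> q" if z: "z \<in> R" for z
  proof
    assume "z \<in> q"
    have "tk (z \<otimes> k) m \<in> point q y" if k: "k \<in> J m" for k
    proof -
      have "(k \<otimes> y [^] m) \<otimes> z \<in> q"
        using submodD(4)[OF qm(1) point_value[OF R y c q yc k] \<open>z \<in> q\<close>] .
      then show ?thesis using iff[OF RJ[OF z k]] R_carr[OF z] J_carr[OF k] ycar by (simp add: K.m_ac)
    qed
    then show "z \<in> spec_pt (point q y)" using z by (simp add: spec_pt_def)
  next
    assume zs: "z \<in> spec_pt (point q y)"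
    \<comment> \<open>The test element c^m is chosen because (z c^m) y^m = z (y c)^m, and y c is
      outside the prime \<open>q\<close>.\<close>
    have cm: "c [^] m \<in> J m" by (rule J_pow[OF c])
    have "tk (z \<otimes> c [^] m) m \<in> point q y" using zs cm by (simp add: spec_pt_def)
    then have "(z \<otimes> c [^] m) \<otimes> y [^] m \<in> q" using iff[OF RJ[OF z cm]] by blast
    moreover have "(z \<otimes> c [^] m) \<otimes> y [^] m = z \<otimes> (y \<otimes> c) [^] m"
      using R_carr[OF z] ycar ccar by (simp add: K.nat_pow_distrib K.m_ac)
    ultimately show "z \<in> q"
      using prime_mult[OF q z, of "(y \<otimes> c) [^] m"] prime_pow[OF q YI[OF y c] yc, of m] by simp
  qed
  moreover have "spec_pt (point q y) \<subseteq> R" by (auto simp: spec_pt_def)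
  ultimately show ?thesis using qm(2) by blast
qed

text \<open>Shows that a local generator of \<open>I\<close> over \<open>R\<close> at the image of
  \<open>Q\<close> is also a local generator of \<open>I\<close> on the blow-up at
  \<open>Q\<close>.\<close>

lemma spec_pt_generator:
  assumes Q: "Q \<in> Pts" and y: "y \<in> Y" and c: "c \<in> \<phi> ` I" and yc: "y \<otimes> c \<notin> spec_pt Q"
  shows "tk c (Suc 0) \<notin> Q"
proof
  assume ct: "tk c (Suc 0) \<in> Q"
  note ycar = Y_carr[OF y] and ccar = I_carr[OF c]
  obtain w where w: "w \<in> J m" "tk ((y \<otimes> c) \<otimes> w) m \<notin> Q" using yc YI[OF y c] by (auto simp: spec_pt_def)
  obtain b where b: "b \<in> \<phi> ` I" "tk b (Suc 0) \<notin> Q" using Pts_generator[OF Q] by blast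
  have bJ: "b \<in> J (Suc 0)" "c \<in> J (Suc 0)" using b(1) c J_1 by auto
  \<comment> \<open>Both y b and y c lie in \<open>R\<close>, so y b w and y c w stay in I^m. The
    right side has the factor c t in \<open>Q\<close>, while both factors on the left are
    outside.\<close>
  have "((y \<otimes> c) \<otimes> w) \<otimes> b = ((y \<otimes> b) \<otimes> w) \<otimes> c"
    using ycar ccar I_carr[OF b(1)] J_carr[OF w(1)] by (simp add: K.m_ac)
  moreover have "tk (((y \<otimes> b) \<otimes> w) \<otimes> c) (m + Suc 0) \<in> Q"
    using tk_mult_iff[OF Q RJ[OF YI[OF y b(1)] w(1)] bJ(2)] ct by blast
  ultimately show False using tk_mult_iff[OF Q RJ[OF YI[OF y c] w(1)] bJ(1)] w(2) b(2) by simp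
qed

text \<open>Rests on the identity (x y^n k) c^n = x ((y c)^n k) in degree \<open>m + n\<close>,
  where c^n t^n is outside \<open>Q\<close> and (y c)^n is outside the prime of \<open>R\<close>. It
  makes \<open>Q\<close> recoverable from its image, as the point given by \<open>y\<close>.\<close>

lemma tk_spec_pt_iff:
  assumes Q: "Q \<in> Pts" and y: "y \<in> Y" and c: "c \<in> \<phi> ` I" and yc: "y \<otimes> c \<notin> spec_pt Q" and x: "x \<in> J n"
  shows "x \<otimes> y [^] n \<in> spec_pt Q \<longleftrightarrow> tk x n \<in> Q"
proof -
  note ycar = Y_carr[OF y] and ccar = I_carr[OF c] and xc = J_carr[OF x]
  note q = spec_pt_prime[OF Q]
  note val = point_value[OF R y c q yc x]
  have cn: "tk (c [^] n) n \<notin> Q" "c [^] n \<in> J n"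
    using tk_pow[OF Q c spec_pt_generator[OF Q y c yc]] J_pow[OF c] by auto
  have ycn: "(y \<otimes> c) [^] n \<in> R" "(y \<otimes> c) [^] n \<notin> spec_pt Q" using prime_pow[OF q YI[OF y c] yc, of n] by auto
  have eq: "((x \<otimes> y [^] n) \<otimes> k) \<otimes> c [^] n = x \<otimes> ((y \<otimes> c) [^] n \<otimes> k)" if "k \<in> J m" for k
    using ycar ccar xc J_carr[OF that] by (simp add: K.nat_pow_distrib K.m_ac)
  have iff: "tk ((x \<otimes> y [^] n) \<otimes> k) m \<in> Q \<longleftrightarrow> tk x n \<in> Q \<or> tk ((y \<otimes> c) [^] n \<otimes> k) m \<in> Q" if k: "k \<in> J m" for k
    using tk_mult_iff[OF Q RJ[OF val k] cn(2)] tk_mult_iff[OF Q x RJ[OF ycn(1) k]] eq[OF k] cn(1) by (simp add: add.commute)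
  show ?thesis
  proof
    assume "tk x n \<in> Q"
    then show "x \<otimes> y [^] n \<in> spec_pt Q" using val iff by (simp add: spec_pt_def)
  next
    assume *: "x \<otimes> y [^] n \<in> spec_pt Q"
    obtain w where w: "w \<in> J m" "tk ((y \<otimes> c) [^] n \<otimes> w) m \<notin> Q" using ycn by (auto simp: spec_pt_def)
    then show "tk x n \<in> Q" using * iff[OF w(1)] by (simp add: spec_pt_def)
  qed
qed

lemma point_spec_pt:
  assumes Q: "Q \<in> Pts" and y: "y \<in> Y" and c: "c \<in> \<phi> ` I" and yc: "y \<otimes> c \<notin> spec_pt Q"
  shows "point (spec_pt Q) y = Q"
  by (rule Pts_eqI[OF point_in_Pts[OF R y c spec_pt_prime[OF Q] yc] Q])
    (simp add: tk_point_iff[OF R y c spec_pt_prime[OF Q] yc] tk_spec_pt_iff[OF Q y c yc])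

lemma spec_pt_inj: "inj_on spec_pt Pts"
proof (rule inj_onI)
  fix P Q assume P: "P \<in> Pts" and Q: "Q \<in> Pts" and eq: "spec_pt P = spec_pt Q"
  obtain y c where y: "y \<in> Y" "c \<in> \<phi> ` I" "y \<otimes> c \<notin> spec_pt Q" using local_generator[OF spec_pt_prime[OF Q]] by blast
  have ycP: "y \<otimes> c \<notin> spec_pt P" unfolding eq by (rule y(3))
  have "P = point (spec_pt P) y" by (rule point_spec_pt[OF P y(1,2) ycP, symmetric])
  also have "\<dots> = point (spec_pt Q) y" unfolding eq ..
  also have "\<dots> = Q" by (rule point_spec_pt[OF Q y])
  finally show "P = Q" .
qed

lemma spec_pt_surj: "spec_pt ` Pts = prime_spectrum B"
proof
  show "spec_pt ` Pts \<subseteq> prime_spectrum B" using spec_pt_prime by (auto simp: prime_spectrum_def)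
  show "prime_spectrum B \<subseteq> spec_pt ` Pts"
  proof
    fix q assume "q \<in> prime_spectrum B"
    then have q: "primeideal q B" by (simp add: prime_spectrum_def)
    obtain y c where y: "y \<in> Y" "c \<in> \<phi> ` I" "y \<otimes> c \<notin> q" using local_generator[OF q] by blast
    show "q \<in> spec_pt ` Pts" 
      by (rule image_eqI[where x = "point q y"]) (rule spec_pt_point[OF q y, symmetric], rule point_in_Pts[OF R y(1,2) q y(3)])
  qed
qed

abbreviation "TB \<equiv> zariski_topology B"

lemma openin_TB: "openin TB V \<longleftrightarrow> (\<exists>E\<subseteq>R. V = {q. primeideal q B \<and> \<not> E \<subseteq> q})"
  using cring.openin_zariski_iff[OF cring_B] by simp

lemma topspace_TB: "topspace TB = prime_spectrum B"
  by (rule cring.topspace_zariski[OF cring_B])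

lemma spec_pt_continuous:
  assumes V: "openin TB V"
  shows "openin TX {Q \<in> Pts. spec_pt Q \<in> V}"
proof -
  obtain E where E: "E \<subseteq> R" "V = {q. primeideal q B \<and> \<not> E \<subseteq> q}" using V openin_TB by blast
  let ?F = "{tk (z \<otimes> k) m | z k. z \<in> E \<and> k \<in> J m}"
  have "?F \<subseteq> carrier S"
  proof
    fix p assume "p \<in> ?F"
    then obtain z k where zk: "z \<in> E" "k \<in> J m" "p = tk (z \<otimes> k) m" by blast
    have "z \<otimes> k \<in> J m" using RJ zk E(1) by blast
    then show "p \<in> carrier S" using zk(3) by (elim J_cases) (simp add: mon_closed)
  qed
  moreover have "spec_pt Q \<in> V \<longleftrightarrow> \<not> ?F \<subseteq> Q" if Q: "Q \<in> Pts" for Q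
  proof -
    have "spec_pt Q \<in> V \<longleftrightarrow> \<not> E \<subseteq> spec_pt Q" unfolding E(2) using spec_pt_prime[OF Q] by simp
    moreover have "?F \<subseteq> Q" if "E \<subseteq> spec_pt Q" using that unfolding spec_pt_def by auto
    moreover have "E \<subseteq> spec_pt Q" if F: "?F \<subseteq> Q"
    proof
      fix z assume z: "z \<in> E"
      then have "tk (z \<otimes> k) m \<in> Q" if "k \<in> J m" for k using subsetD[OF F] that by blast
      then show "z \<in> spec_pt Q" using z E(1) unfolding spec_pt_def by blast
    qed
    ultimately show ?thesis by blast
  qed
  then have "{Q \<in> Pts. spec_pt Q \<in> V} = {Q \<in> Pts. \<not> ?F \<subseteq> Q}" by (rule Collect_cong[OF conj_cong[OF refl]])
  ultimately show ?thesis unfolding openin_TX by blast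
qed

lemma spec_pt_Dplus:
  assumes x: "x \<in> J n"
  shows "openin TB {spec_pt Q | Q. Q \<in> Pts \<and> tk x n \<notin> Q}"
proof -
  \<comment> \<open>Where y c is outside \<open>q\<close>, the point over \<open>q\<close> is
    \<open>point q y\<close>, and x t^n is outside this point exactly if x y^n is outside
    \<open>q\<close>. The factor y c restricts each pair to the open set on which this description
    is valid.\<close>
  let ?E = "{(y \<otimes> c) \<otimes> (x \<otimes> y [^] n) | y c. y \<in> Y \<and> c \<in> \<phi> ` I \<and> x \<otimes> y [^] n \<in> R}"
  have ER: "?E \<subseteq> R" using YI subringE(6)[OF R(1)] by blast
  have "{spec_pt Q | Q. Q \<in> Pts \<and> tk x n \<notin> Q} = {q. primeideal q B \<and> \<not> ?E \<subseteq> q}"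
  proof (intro equalityI subsetI)
    fix q assume "q \<in> {spec_pt Q | Q. Q \<in> Pts \<and> tk x n \<notin> Q}"
    then obtain Q where Q: "Q \<in> Pts" "tk x n \<notin> Q" "q = spec_pt Q" by blast
    note qp = spec_pt_prime[OF Q(1)]
    obtain y c where y: "y \<in> Y" "c \<in> \<phi> ` I" "y \<otimes> c \<notin> spec_pt Q" using local_generator[OF qp] by blast
    have v: "x \<otimes> y [^] n \<in> R" by (rule point_value[OF R y(1,2) qp y(3) x])
    have "x \<otimes> y [^] n \<notin> spec_pt Q" using tk_spec_pt_iff[OF Q(1) y x] Q(2) by blast
    then have "(y \<otimes> c) \<otimes> (x \<otimes> y [^] n) \<notin> spec_pt Q" using prime_mult[OF qp YI[OF y(1,2)] v] y(3) by blast
    moreover have "(y \<otimes> c) \<otimes> (x \<otimes> y [^] n) \<in> ?E" using y(1,2) v by blast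
    ultimately show "q \<in> {q. primeideal q B \<and> \<not> ?E \<subseteq> q}" using qp Q(3) by blast
  next
    fix q assume "q \<in> {q. primeideal q B \<and> \<not> ?E \<subseteq> q}"
    then have q: "primeideal q B" and "\<not> ?E \<subseteq> q" by auto
    then obtain y c where y: "y \<in> Y" "c \<in> \<phi> ` I" "x \<otimes> y [^] n \<in> R" "(y \<otimes> c) \<otimes> (x \<otimes> y [^] n) \<notin> q" by blast
    have nq: "y \<otimes> c \<notin> q" "x \<otimes> y [^] n \<notin> q" using prime_mult[OF q YI[OF y(1,2)] y(3)] y(4) by blast+
    have "tk x n \<notin> point q y" using tk_point_iff[OF R y(1,2) q nq(1) x] nq(2) by blast
    then show "q \<in> {spec_pt Q | Q. Q \<in> Pts \<and> tk x n \<notin> Q}"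
      using spec_pt_point[OF q y(1,2) nq(1)] point_in_Pts[OF R y(1,2) q nq(1)] by blast
  qed
  then show ?thesis unfolding openin_TB using ER by blast
qed

lemma spec_pt_open:
  assumes V: "openin TX V"
  shows "openin TB (spec_pt ` V)"
proof (subst openin_subopen, intro ballI)
  fix q assume "q \<in> spec_pt ` V"
  then obtain Q where Q: "Q \<in> V" "q = spec_pt Q" by blast
  obtain n x where x: "x \<in> Ipow n" "Q \<in> Dplus x n" "Dplus x n \<subseteq> V" using Dplus_basis[OF V Q(1)] by blast
  have xJ: "\<phi> x \<in> J n" and t: "tk (\<phi> x) n = tm x n" using x(1) tk_image Ipow_carr by (auto simp: J_image)
  have "{spec_pt Q | Q. Q \<in> Pts \<and> tk (\<phi> x) n \<notin> Q} \<subseteq> spec_pt ` V" using x(3) t by (auto simp: Dplus_def)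
  moreover have "q \<in> {spec_pt Q | Q. Q \<in> Pts \<and> tk (\<phi> x) n \<notin> Q}" using x(2) t Q(2) by (auto simp: Dplus_def)
  ultimately show "\<exists>T. openin TB T \<and> q \<in> T \<and> T \<subseteq> spec_pt ` V" using spec_pt_Dplus[OF xJ] by blast
qed

lemma spec_pt_homeomorphic: "homeomorphic_map TX TB spec_pt"
proof (rule bijective_open_imp_homeomorphic_map)
  show "continuous_map TX TB spec_pt"
    unfolding continuous_map_def topspace_TX topspace_TB using spec_pt_surj spec_pt_continuous by auto
  show "open_map TX TB spec_pt" unfolding open_map_def using spec_pt_open by blast
  show "spec_pt ` topspace TX = topspace TB" unfolding topspace_TX topspace_TB by (rule spec_pt_surj)
  show "inj_on spec_pt (topspace TX)" unfolding topspace_TX by (rule spec_pt_inj)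
qed

end

end


section \<open>Comparison of the stalks and of the structure sheaves\<close>

lemma (in field) frac_cancel:
  assumes "a \<in> carrier R" "s \<in> carrier R" "k \<in> carrier R" "s \<otimes> k \<noteq> \<zero>"
  shows "(a \<otimes> k) \<otimes> inv (s \<otimes> k) = a \<otimes> inv s"
proof -
  have "s \<noteq> \<zero>" using assms by auto
  then show ?thesis using assms by (subst frac_eq_iff) (simp_all add: m_ac)
qed

context rees
begin

context
  fixes R m
  assumes R: "subring R K" "\<phi> ` carrier A \<subseteq> R" and R_J: "\<forall>r\<in>R. \<forall>k\<in>J m. r \<otimes> k \<in> J m"
    and one: "\<one> \<in> ideal_prod K (\<phi> ` I) (colon K R (\<phi> ` I))"
begin

private abbreviation "BB \<equiv> K\<lparr>carrier := R\<rparr>"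
private abbreviation "TBB \<equiv> zariski_topology BB"
private abbreviation "pt \<equiv> spec_pt R m"
private abbreviation "frB q \<equiv> fraction BB (R - q)"

private lemmas loc = R R_J one

private lemma R_mult_J: "r \<in> R \<Longrightarrow> k \<in> J m \<Longrightarrow> r \<otimes> k \<in> J m" using R_J by blast

private lemma R_carrier: "r \<in> R \<Longrightarrow> r \<in> carrier K" using subringE(1)[OF R(1)] by blast

lemma spec_mult_subset_hom:
  assumes q: "primeideal q BB"
  shows "mult_subset_hom BB (R - q) K id"
proof -
  have M: "mult_subset BB (R - q)" using cring.mult_subset_prime[OF K.subring_of_embedding[OF R(1)] q] by simp
  have "\<zero> \<in> q" using submodD(2)[OF K.submod_subring_ideal(1)[OF R(1) primeideal.axioms(1)[OF q]]] .
  moreover have "id \<in> ring_hom BB K" using R_carrier by (intro ring_hom_memI) auto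
  ultimately show ?thesis
    by (intro mult_subset_hom.intro mult_subset_hom_axioms.intro M K.field_axioms) auto
qed

definition "germB = fraction_eval BB K id"

context
  fixes q assumes q: "primeideal q BB"
begin

interpretation M: mult_subset_hom BB "R - q" K id by (rule spec_mult_subset_hom[OF q])

declare M.S_closed [simp del]

lemma germB_frac:
  assumes "a \<in> R" "s \<in> R" "s \<notin> q"
  shows "germB (frB q a s) = a \<otimes> inv s" "frB q a s \<in> carrier (localization BB (R - q))" "s \<noteq> \<zero>"
proof -
  have s: "s \<in> R - q" using assms by blast
  show "germB (frB q a s) = a \<otimes> inv s" using M.fraction_eval[of a s] assms(1) s by (simp add: germB_def)
  show "frB q a s \<in> carrier (localization BB (R - q))" using M.fraction_closed[of a s] assms(1) s by simp
  show "s \<noteq> \<zero>" using M.h_nonzero[OF s] by simp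
qed

lemma germB_hom: "germB \<in> ring_hom (localization BB (R - q)) K"
  unfolding germB_def by (rule M.fraction_eval_hom)

lemma locB_cases:
  assumes "x \<in> carrier (localization BB (R - q))"
  obtains a s where "a \<in> R" "s \<in> R" "s \<notin> q" "x = frB q a s"
proof -
  obtain a s where "a \<in> carrier BB" "s \<in> R - q" "x = frB q a s" using assms by (rule M.localization_cases)
  then show thesis using that[of a s] by simp
qed

lemma germB_inj: "inj_on germB (carrier (localization BB (R - q)))"
proof (rule inj_onI)
  fix x y assume x: "x \<in> carrier (localization BB (R - q))" and y: "y \<in> carrier (localization BB (R - q))" and eq: "germB x = germB y"
  obtain a s where a: "a \<in> R" "s \<in> R" "s \<notin> q" "x = frB q a s" using locB_cases[OF x] .
  obtain b t where b: "b \<in> R" "t \<in> R" "t \<notin> q" "y = frB q b t" using locB_cases[OF y] .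
  have "a \<otimes> inv s = b \<otimes> inv t" using eq germB_frac(1)[OF a(1-3)] germB_frac(1)[OF b(1-3)] a(4) b(4) by simp
  then have "a \<otimes> t = b \<otimes> s"
    using K.frac_eq_iff R_carrier a b germB_frac(3)[OF a(1-3)] germB_frac(3)[OF b(1-3)] by simp
  then have "t \<otimes>\<^bsub>BB\<^esub> a = s \<otimes>\<^bsub>BB\<^esub> b" using R_carrier a b by (simp add: K.m_comm)
  then show "x = y" unfolding a(4) b(4) using a b by (intro M.fraction_eqI) auto
qed

end

text \<open>A fraction a/s over \<open>R\<close> is expanded by some k in I^m for which s k t^m is
  outside \<open>Q\<close>. A fraction x/g of degree \<open>n\<close> is expanded by y^n, where
  \<open>y\<close> comes from a local generator at the image of \<open>Q\<close>.\<close>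

lemma stalks_eq:
  assumes Q: "Q \<in> Pts"
  shows "germB ` carrier (localization BB (R - pt Q)) = germ Q ` carrier (OX Q)"
proof (intro equalityI subsetI)
  note q = spec_pt_prime[OF loc Q]
  fix z assume "z \<in> germB ` carrier (localization BB (R - pt Q))"
  then obtain w where w: "w \<in> carrier (localization BB (R - pt Q))" "z = germB w" by blast
  obtain a s where as: "a \<in> R" "s \<in> R" "s \<notin> pt Q" "w = frB (pt Q) a s" using locB_cases[OF q w(1)] .
  have "z = a \<otimes> inv s" unfolding w(2) as(4) by (rule germB_frac(1)[OF q as(1-3)])
  note a = as(1-3) this
  obtain k where k: "k \<in> J m" "tk (s \<otimes> k) m \<notin> Q" using a by (auto simp: spec_pt_def[OF loc])
  obtain x where x: "x \<in> Ipow m" "a \<otimes> k = \<phi> x" "tk (a \<otimes> k) m = tm x m" "x \<in> carrier A" using J_cases[OF R_mult_J[OF a(1) k(1)]] .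
  obtain g where g: "g \<in> Ipow m" "s \<otimes> k = \<phi> g" "tk (s \<otimes> k) m = tm g m" "g \<in> carrier A" using J_cases[OF R_mult_J[OF a(2) k(1)]] .
  have gQ: "tm g m \<notin> Q" using g(3) k(2) by simp
  have "s \<otimes> k \<noteq> \<zero>" unfolding g(2) by (rule denominator(3)[OF Q g(1) gQ])
  from K.frac_cancel[OF R_carrier[OF a(1)] R_carrier[OF a(2)] J_carr[OF k(1)] this]
  have "z = \<phi> x \<otimes> inv \<phi> g" unfolding a(4) x(2) g(2) by (rule sym)
  then have "z = germ Q (fr Q (tm x m) (tm g m))" using germ_frac[OF Q x(1) g(1) gQ] by simp
  moreover have "fr Q (tm x m) (tm g m) \<in> carrier (OX Q)" unfolding OX_carrier using x(1) g(1) gQ by blast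
  ultimately show "z \<in> germ Q ` carrier (OX Q)" by blast
next
  note q = spec_pt_prime[OF loc Q]
  fix z assume "z \<in> germ Q ` carrier (OX Q)"
  then obtain n x g where xg: "x \<in> Ipow n" "g \<in> Ipow n" "tm g n \<notin> Q" "z = germ Q (fr Q (tm x n) (tm g n))"
    unfolding OX_carrier by blast
  have "z = \<phi> x \<otimes> inv \<phi> g" unfolding xg(4) by (rule germ_frac[OF Q xg(1-3)])
  note x = xg(1-3) this
  obtain y c where y: "y \<in> colon K R (\<phi> ` I)" "c \<in> \<phi> ` I" "y \<otimes> c \<notin> pt Q" using local_generator[OF loc q] by blast
  have J: "\<phi> x \<in> J n" "\<phi> g \<in> J n" using x by (auto simp: J_image)
  have g: "\<phi> g \<otimes> y [^] n \<notin> pt Q"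
    using tk_spec_pt_iff[OF loc Q y J(2)] tk_image[OF Ipow_carr[OF x(2)], of n] x(3) by simp
  note v = point_value[OF R y(1,2) q y(3) J(1)] point_value[OF R y(1,2) q y(3) J(2)]
  have yc: "y \<in> carrier K" using y by (simp add: colon_def)
  have "z = (\<phi> x \<otimes> y [^] n) \<otimes> inv (\<phi> g \<otimes> y [^] n)"
    unfolding x(4) using K.frac_cancel[OF J_carr[OF J(1)] J_carr[OF J(2)] _ germB_frac(3)[OF q v g]] yc by simp
  then have "z = germB (frB (pt Q) (\<phi> x \<otimes> y [^] n) (\<phi> g \<otimes> y [^] n))" using germB_frac(1)[OF q v g] by simp
  then show "z \<in> germB ` carrier (localization BB (R - pt Q))" using germB_frac(2)[OF q v g] by blast
qed

lemma blow_up_iso_Spec: "isomorphic_ringed_spaces (blow_up A I) (Spec BB)"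
proof -
  \<comment> \<open>The two stalks have the same image in \<open>K\<close>, and this is the passage
    from one to the other through it.\<close>
  define \<theta> where "\<theta> = (\<lambda>Q x. inv_into (carrier (OX Q)) (germ Q) (germB x))"
  have st: "\<theta> Q \<in> ring_hom (localization BB (R - pt Q)) (OX Q)"
      "bij_betw (\<theta> Q) (carrier (localization BB (R - pt Q))) (carrier (OX Q))"
      "\<And>x d. x \<in> carrier (localization BB (R - pt Q)) \<Longrightarrow> d \<in> carrier (OX Q) \<Longrightarrow> germ Q d = germB x \<Longrightarrow> \<theta> Q x = d"
    if Q: "Q \<in> Pts" for Q
  proof -
    note q = spec_pt_prime[OF loc Q]
    note s = stalk_iso[OF germ_hom[OF Q] germ_inj[OF Q] germB_hom[OF q] germB_inj[OF q] stalks_eq[OF Q]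
        OX_closed(1)[OF Q] OX_closed(2)[OF Q] OX_one[OF Q]]
    show "\<theta> Q \<in> ring_hom (localization BB (R - pt Q)) (OX Q)" unfolding \<theta>_def by (rule s(1))
    show "bij_betw (\<theta> Q) (carrier (localization BB (R - pt Q))) (carrier (OX Q))" unfolding \<theta>_def by (rule s(2))
    show "\<And>x d. x \<in> carrier (localization BB (R - pt Q)) \<Longrightarrow> d \<in> carrier (OX Q) \<Longrightarrow> germ Q d = germB x \<Longrightarrow> \<theta> Q x = d"
      unfolding \<theta>_def by (rule s(3))
  qed
  let ?C = "\<lambda>V. {\<lambda>p\<in>V. fraction S ((\<Union>n. G n) - p) a f | n a f. a \<in> G n \<and> f \<in> G n \<and> (\<forall>p\<in>V. f \<notin> p)}"
  let ?C' = "\<lambda>V. {\<lambda>p\<in>V. fraction BB (carrier BB - p) a f | a f. a \<in> carrier BB \<and> f \<in> carrier BB \<and> (\<forall>p\<in>V. f \<notin> p)}"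
  have "isomorphic_ringed_spaces (local_family_space TX OX ?C) (local_family_space TBB (\<lambda>p. localization BB (carrier BB - p)) ?C')"
  proof (rule local_family_space_iso[where f = pt and \<theta> = \<theta>])
    show "homeomorphic_map TX TBB pt" by (rule spec_pt_homeomorphic[OF loc])
    show "\<theta> p \<in> ring_hom (localization BB (carrier BB - pt p)) (OX p)" if "p \<in> topspace TX" for p
      using st(1)[of p] that unfolding topspace_TX by simp
    show "bij_betw (\<theta> p) (carrier (localization BB (carrier BB - pt p))) (carrier (OX p))" if "p \<in> topspace TX" for p
      using st(2)[of p] that unfolding topspace_TX by simp
    show "d \<in> ?C V \<Longrightarrow> d \<in> extensional V" for V d by auto
    show "d \<in> ?C' V \<Longrightarrow> d \<in> extensional V" for V d by auto
  next
    fix V c Q assume V: "openin TBB V" and c: "c \<in> ?C' V" and "Q \<in> topspace TX" and QV: "pt Q \<in> V"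
    then have Q: "Q \<in> Pts" unfolding topspace_TX by simp
    obtain a s where a: "a \<in> R" "s \<in> R" "\<And>p. p \<in> V \<Longrightarrow> s \<notin> p" "c = (\<lambda>p\<in>V. frB p a s)" using c by auto
    have "s \<notin> pt Q" using a(3) QV by blast
    then obtain k where k: "k \<in> J m" "tk (s \<otimes> k) m \<notin> Q" using a by (auto simp: spec_pt_def[OF loc])
    obtain x where x: "x \<in> Ipow m" "a \<otimes> k = \<phi> x" "tk (a \<otimes> k) m = tm x m" "x \<in> carrier A" using J_cases[OF R_mult_J[OF a(1) k(1)]] .
    obtain g where g: "g \<in> Ipow m" "s \<otimes> k = \<phi> g" "tk (s \<otimes> k) m = tm g m" "g \<in> carrier A" using J_cases[OF R_mult_J[OF a(2) k(1)]] .
    \<comment> \<open>The element \<open>k\<close> was found for the point \<open>Q\<close> alone.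
      It serves at every point of \<open>Dplus g m\<close>, where s k t^m is still outside the
      prime.\<close>
    define W where "W = {Q \<in> Pts. pt Q \<in> V} \<inter> Dplus g m"
    define d where "d = (\<lambda>p\<in>W. fr p (tm x m) (tm g m))"
    have Wo: "openin TX W" unfolding W_def by (rule openin_Int[OF spec_pt_continuous[OF loc V] openin_Dplus[OF g(1)]])
    have QW: "Q \<in> W" using Q QV k(2) g(3) by (simp add: W_def Dplus_def)
    have dC: "d \<in> ?C W"
      unfolding d_def using mon_in_G[OF x(1)] mon_in_G[OF g(1)] by (auto simp: W_def Dplus_def)
    have main: "pt p \<in> V \<and> d p = \<theta> p (c (pt p))" if p: "p \<in> W" for p
    proof -
      have pP: "p \<in> Pts" "pt p \<in> V" "tm g m \<notin> p" using p by (auto simp: W_def Dplus_def)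
      note q = spec_pt_prime[OF loc pP(1)]
      have s: "s \<notin> pt p" by (rule a(3)[OF pP(2)])
      have dp: "d p = fr p (tm x m) (tm g m)" and cp: "c (pt p) = frB (pt p) a s" using p pP a(4) by (auto simp: d_def)
      have "germ p (d p) = germB (c (pt p))"
      proof -
        have "s \<otimes> k \<noteq> \<zero>" unfolding g(2) by (rule denominator(3)[OF pP(1) g(1) pP(3)])
        from K.frac_cancel[OF R_carrier[OF a(1)] R_carrier[OF a(2)] J_carr[OF k(1)] this]
        show ?thesis
          unfolding dp cp germ_frac[OF pP(1) x(1) g(1) pP(3)] germB_frac(1)[OF q a(1,2) s] x(2) g(2) .
      qed
      moreover have "d p \<in> carrier (OX p)" unfolding dp OX_carrier using x(1) g(1) pP(3) by blast
      moreover have "c (pt p) \<in> carrier (localization BB (R - pt p))" unfolding cp by (rule germB_frac(2)[OF q a(1,2) s])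
      ultimately have "\<theta> p (c (pt p)) = d p" using st(3)[OF pP(1)] by blast
      then show ?thesis using pP(2) by simp
    qed
    show "\<exists>W d. openin TX W \<and> Q \<in> W \<and> d \<in> ?C W \<and> (\<forall>x\<in>W. pt x \<in> V \<and> d x = \<theta> x (c (pt x)))"
      by (intro exI[of _ W] exI[of _ d] conjI ballI Wo QW dC) (use main in blast)+
  next
    fix V c Q assume V: "openin TX V" and c: "c \<in> ?C V" and QV: "Q \<in> V"
    have VP: "V \<subseteq> Pts" using openin_subset[OF V] unfolding topspace_TX .
    then have Q: "Q \<in> Pts" using QV by blast
    note qQ = spec_pt_prime[OF loc Q]
    obtain n x g where x: "x \<in> Ipow n" "g \<in> Ipow n" "\<And>p. p \<in> V \<Longrightarrow> tm g n \<notin> p" "c = (\<lambda>p\<in>V. fr p (tm x n) (tm g n))"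
    proof -
      obtain n a f where a: "c = (\<lambda>p\<in>V. fraction S ((\<Union>n. G n) - p) a f)" "a \<in> G n" "f \<in> G n" "\<forall>p\<in>V. f \<notin> p"
        using c by blast
      obtain x g where "x \<in> Ipow n" "a = tm x n" "g \<in> Ipow n" "f = tm g n" using a(2,3) unfolding G_iff by blast
      then show thesis using a(1,4) by (intro that[of x n g]) auto
    qed
    obtain y b where y: "y \<in> colon K R (\<phi> ` I)" "b \<in> \<phi> ` I" "y \<otimes> b \<notin> pt Q" using local_generator[OF loc qQ] by blast
    have J: "\<phi> x \<in> J n" "\<phi> g \<in> J n" using x by (auto simp: J_image)
    note v = point_value[OF R y(1,2) qQ y(3) J(1)] point_value[OF R y(1,2) qQ y(3) J(2)]
    have yc: "y \<in> carrier K" using y by (simp add: colon_def)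
    have yb: "y \<otimes> b \<in> R" using y by (auto simp: colon_def)
    \<comment> \<open>Both factors are needed at all points of the neighbourhood: y b outside the
      prime makes the description by \<open>y\<close> valid, and the second factor is the new
      denominator.\<close>
    let ?e = "(y \<otimes> b) \<otimes> (\<phi> g \<otimes> y [^] n)"
    have eR: "?e \<in> R" using subringE(6)[OF R(1) yb v(2)] .
    define W where "W = {q. primeideal q BB \<and> \<not> {?e} \<subseteq> q} \<inter> pt ` V"
    define d where "d = (\<lambda>q\<in>W. frB q (\<phi> x \<otimes> y [^] n) (\<phi> g \<otimes> y [^] n))"
    have "openin TBB {q. primeideal q BB \<and> \<not> {?e} \<subseteq> q}" unfolding openin_TB[OF loc] using eR by blast
    then have Wo: "openin TBB W" unfolding W_def by (rule openin_Int[OF _ spec_pt_open[OF loc V]])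
    have W: "primeideal q BB \<and> y \<otimes> b \<notin> q \<and> \<phi> g \<otimes> y [^] n \<notin> q" if "q \<in> W" for q
    proof -
      have q: "primeideal q BB" "?e \<notin> q" using that by (auto simp: W_def)
      then show ?thesis using prime_mult[OF loc q(1) yb v(2)] by blast
    qed
    have "tk (\<phi> g) n \<notin> Q" using x(3)[OF QV] tk_image[OF Ipow_carr[OF x(2)], of n] by simp
    then have "\<phi> g \<otimes> y [^] n \<notin> pt Q" using tk_spec_pt_iff[OF loc Q y J(2)] by blast
    then have "?e \<notin> pt Q" using prime_mult[OF loc qQ yb v(2)] y(3) by blast
    then have QW: "pt Q \<in> W" using qQ QV by (simp add: W_def)
    have dC: "d \<in> ?C' W" unfolding d_def using v W by auto
    have main: "p \<in> V \<and> d (pt p) \<in> carrier (localization BB (carrier BB - pt p)) \<and> \<theta> p (d (pt p)) = c p"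
      if p: "p \<in> topspace TX" "pt p \<in> W" for p
    proof -
      have pP: "p \<in> Pts" using p(1) unfolding topspace_TX .
      obtain p' where p': "p' \<in> V" "pt p = pt p'" using p(2) by (auto simp: W_def)
      have pV: "p \<in> V" using inj_onD[OF spec_pt_inj[OF loc] p'(2) pP] p'(1) VP by blast
      note q = spec_pt_prime[OF loc pP]
      have gq: "\<phi> g \<otimes> y [^] n \<notin> pt p" using W[OF p(2)] by blast
      have dp: "d (pt p) = frB (pt p) (\<phi> x \<otimes> y [^] n) (\<phi> g \<otimes> y [^] n)" and cp: "c p = fr p (tm x n) (tm g n)"
        using p(2) pV x(4) by (auto simp: d_def)
      have gp: "tm g n \<notin> p" by (rule x(3)[OF pV])
      have "germ p (c p) = germB (d (pt p))"
        unfolding dp cp germ_frac[OF pP x(1,2) gp] germB_frac(1)[OF q v gq]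
        using K.frac_cancel[OF J_carr[OF J(1)] J_carr[OF J(2)] _ germB_frac(3)[OF q v gq]] yc by simp
      moreover have "c p \<in> carrier (OX p)" unfolding cp OX_carrier using x(1,2) gp by blast
      moreover have dc: "d (pt p) \<in> carrier (localization BB (R - pt p))" unfolding dp by (rule germB_frac(2)[OF q v gq])
      ultimately have "\<theta> p (d (pt p)) = c p" using st(3)[OF pP] by blast
      then show ?thesis using pV dc by simp
    qed
    show "\<exists>W d. openin TBB W \<and> pt Q \<in> W \<and> d \<in> ?C' W \<and>
        (\<forall>x\<in>topspace TX. pt x \<in> W \<longrightarrow> x \<in> V \<and> d (pt x) \<in> carrier (localization BB (carrier BB - pt x)) \<and> \<theta> x (d (pt x)) = c x)"
      by (intro exI[of _ W] exI[of _ d] conjI ballI impI Wo QW dC) (use main in blast)+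
  qed
  then show ?thesis unfolding blow_up_def Proj_def Spec_def .
qed

end

end


section \<open>Global sections of the blow-up are integral\<close>

context subring_ideal
begin

text \<open>\<open>M d\<close> stands for the monomials of degree \<open>d\<close> in the elements
  of \<open>Z\<close>. In a monomial of large degree some element has a large exponent, and that
  power is carried by \<open>k\<close> into the right power of \<open>I\<close>. The induction on
  \<open>Z\<close> replaces the pigeonhole principle.\<close>

lemma generating_powers:
  assumes "finite Z" "Z \<subseteq> I" and k: "k \<in> carrier R"
    and "\<forall>z\<in>Z. \<exists>n. \<forall>j\<ge>n. k \<otimes> z [^] j \<in> J j"
  shows "\<exists>(N::nat) M. (\<forall>d. M d \<subseteq> J d) \<and> \<one> \<in> M 0 \<and> (\<forall>z\<in>Z. \<forall>d. \<forall>w\<in>M d. z \<otimes> w \<in> M (Suc d)) \<and>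
    (\<forall>d\<ge>N. \<forall>w\<in>M d. k \<otimes> w \<in> J d)"
  using assms(1,2,4)
proof (induct Z)
  case empty
  \<comment> \<open>Without variables the only monomial is \<open>1\<close>, in degree zero; the
    threshold \<open>1\<close> makes the last condition vacuous.\<close>
  show ?case
    by (rule exI[of _ 1], rule exI[of _ "\<lambda>d. if d = 0 then {\<one>} else {}"]) (use A_sub(3) in auto)
next
  case (insert z Z)
  have z: "z \<in> I" using insert(4) by simp
  then have zc: "z \<in> carrier R" by simp
  have Zc: "x \<in> carrier R" if "x \<in> Z" for x using insert(4) that by auto
  obtain n where n: "\<And>j. n \<le> j \<Longrightarrow> k \<otimes> z [^] j \<in> J j" using insert(5) by auto
  have "\<exists>(N::nat) M. (\<forall>d. M d \<subseteq> J d) \<and> \<one> \<in> M 0 \<and> (\<forall>z\<in>Z. \<forall>d. \<forall>w\<in>M d. z \<otimes> w \<in> M (Suc d)) \<and>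
    (\<forall>d\<ge>N. \<forall>w\<in>M d. k \<otimes> w \<in> J d)" using insert by simp
  then obtain N :: nat and M where NM: "(\<forall>d. M d \<subseteq> J d) \<and> \<one> \<in> M 0 \<and> (\<forall>z\<in>Z. \<forall>d. \<forall>w\<in>M d. z \<otimes> w \<in> M (Suc d)) \<and>
    (\<forall>d\<ge>N. \<forall>w\<in>M d. k \<otimes> w \<in> J d)"
    by (elim exE) (rule that)
  note M = NM[THEN conjunct1, rule_format] NM[THEN conjunct2, THEN conjunct1]
    NM[THEN conjunct2, THEN conjunct2, THEN conjunct1, rule_format] NM[THEN conjunct2, THEN conjunct2, THEN conjunct2, rule_format]
  have Mc: "w \<in> carrier R" if "w \<in> M d" for w d using M(1)[of d] that J_carr by blast
  define M' where "M' d = {z [^] i \<otimes> w | i e w. w \<in> M e \<and> i + e = d}" for d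
  have M'I: "z [^] i \<otimes> w \<in> M' d" if "w \<in> M e" "i + e = d" for i e w d using that unfolding M'_def by blast
  show ?case
  \<comment> \<open>In a degree of at least \<open>n + N\<close>, either the exponent of
    \<open>z\<close> reaches \<open>n\<close> or the remaining monomial has a degree of at least
    \<open>N\<close>.\<close>
  proof (intro exI[of _ "n + N"] exI[of _ M'] conjI allI ballI impI)
    show "M' d \<subseteq> J d" for d
    proof
      fix v assume "v \<in> M' d"
      then obtain i e w where v: "v = z [^] i \<otimes> w" "w \<in> M e" "i + e = d" unfolding M'_def by blast
      show "v \<in> J d" using J_mult[OF J_pow[OF z, of i], of w e] M(1)[of e] v by auto
    qed
    have "z [^] (0::nat) \<otimes> \<one> \<in> M' 0" by (rule M'I[OF M(2)]) simp
    then show "\<one> \<in> M' 0" by simp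
  next
    fix x d v assume x: "x \<in> insert z Z" and "v \<in> M' d"
    then obtain i e w where v: "v = z [^] i \<otimes> w" "w \<in> M e" "i + e = d" unfolding M'_def by blast
    note wc = Mc[OF v(2)]
    show "x \<otimes> v \<in> M' (Suc d)"
    proof (cases "x = z")
      case True
      have "x \<otimes> v = z [^] Suc i \<otimes> w" unfolding v(1) True using zc wc by (simp add: m_ac)
      then show ?thesis using M'I[OF v(2), of "Suc i" "Suc d"] v(3) by simp
    next
      case False
      then have xZ: "x \<in> Z" using x by simp
      have "x \<otimes> v = z [^] i \<otimes> (x \<otimes> w)" unfolding v(1) using zc wc Zc[OF xZ] by (simp add: m_ac)
      then show ?thesis using M'I[OF M(3)[OF xZ v(2)], of i "Suc d"] v(3) by simp
    qed
  next
    fix d v assume d: "n + N \<le> d" and "v \<in> M' d"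
    then obtain i e w where v: "v = z [^] i \<otimes> w" "w \<in> M e" "i + e = d" unfolding M'_def by blast
    note wc = Mc[OF v(2)]
    show "k \<otimes> v \<in> J d"
    proof (cases "n \<le> i")
      case True
      have "(k \<otimes> z [^] i) \<otimes> w \<in> J (i + e)" using J_mult[OF n[OF True]] v(2) M(1)[of e] by blast
      then show ?thesis using v k zc wc by (simp add: m_assoc)
    next
      case False
      then have "N \<le> e" using d v(3) by simp
      then have "z [^] i \<otimes> (k \<otimes> w) \<in> J (i + e)" using J_mult[OF J_pow[OF z, of i]] M(4)[OF _ v(2)] by blast
      moreover have "k \<otimes> v = z [^] i \<otimes> (k \<otimes> w)" unfolding v(1) using k zc wc by (simp add: m_ac)
      ultimately show ?thesis using v(3) by simp
    qed
  qed
qed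

text \<open>I^N is spanned over \<open>A\<close> by the monomials of degree \<open>N\<close>, on
  which \<open>k\<close> acts well by \<open>generating_powers\<close>. This turns information about
  powers of single generators into a multiplier of I^N.\<close>

lemma power_stable:
  assumes Z: "finite Z" "Z \<subseteq> I" "I \<subseteq> ideal_prod R A Z" and k: "k \<in> carrier R"
    and pow: "\<forall>z\<in>Z. \<exists>n. \<forall>j\<ge>n. k \<otimes> z [^] j \<in> J j"
  shows "\<exists>N. \<forall>w\<in>J N. k \<otimes> w \<in> J N"
proof -
  from generating_powers[OF Z(1,2) k pow]
  obtain N :: nat and M where NM: "(\<forall>d. M d \<subseteq> J d) \<and> \<one> \<in> M 0 \<and> (\<forall>z\<in>Z. \<forall>d. \<forall>w\<in>M d. z \<otimes> w \<in> M (Suc d)) \<and>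
    (\<forall>d\<ge>N. \<forall>w\<in>M d. k \<otimes> w \<in> J d)"
    by (elim exE) (rule that)
  note M = NM[THEN conjunct1, rule_format] NM[THEN conjunct2, THEN conjunct1]
    NM[THEN conjunct2, THEN conjunct2, THEN conjunct1, rule_format] NM[THEN conjunct2, THEN conjunct2, THEN conjunct2, rule_format]
  have Mc: "w \<in> carrier R" if "w \<in> M d" for w d using M(1)[of d] that J_carr by blast
  have Zc: "Z \<subseteq> carrier R" using Z(2) I_sub(1) by blast
  \<comment> \<open>Allows the degree to be split: \<open>n\<close> factors are already arbitrary
    elements of \<open>I\<close>, the other \<open>d\<close> still form a monomial. Replacing
    factors one by one leads from monomials to all of I^N.\<close>
  define G where "G n = {v \<in> carrier R. \<forall>d. \<forall>w\<in>M d. N \<le> d + n \<longrightarrow> k \<otimes> v \<otimes> w \<in> J (n + d)}" for n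
  have GD: "v \<in> carrier R" "\<And>d w. w \<in> M d \<Longrightarrow> N \<le> d + n \<Longrightarrow> k \<otimes> v \<otimes> w \<in> J (n + d)" if "v \<in> G n" for v n
    using that by (auto simp: G_def)
  have G_add: "u \<oplus> v \<in> G n" if u: "u \<in> G n" and v: "v \<in> G n" for u v n
    unfolding G_def
  proof (intro CollectI conjI allI ballI impI)
    fix d w assume w: "w \<in> M d" "N \<le> d + n"
    have "k \<otimes> (u \<oplus> v) \<otimes> w = k \<otimes> u \<otimes> w \<oplus> k \<otimes> v \<otimes> w"
      using GD(1)[OF u] GD(1)[OF v] k Mc[OF w(1)] by (simp add: l_distr r_distr)
    then show "k \<otimes> (u \<oplus> v) \<otimes> w \<in> J (n + d)" using J_sub(3)[OF GD(2)[OF u w] GD(2)[OF v w]] by simp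
  qed (use GD(1)[OF u] GD(1)[OF v] in simp)
  have G_Z: "v \<otimes> (a \<otimes> z) \<in> G (Suc n)" if v: "v \<in> G n" and a: "a \<in> A" and z: "z \<in> Z" for v a z n
    unfolding G_def
  proof (intro CollectI conjI allI ballI impI)
    note c = GD(1)[OF v] A_carr[OF a] subsetD[OF Zc z]
    fix d w assume w: "w \<in> M d" "N \<le> d + Suc n"
    have "k \<otimes> v \<otimes> (z \<otimes> w) \<in> J (n + Suc d)" by (rule GD(2)[OF v M(3)[OF z w(1)]]) (use w(2) in simp)
    then have "a \<otimes> (k \<otimes> v \<otimes> (z \<otimes> w)) \<in> J (n + Suc d)" using J_sub(4)[OF a] by blast
    moreover have "k \<otimes> (v \<otimes> (a \<otimes> z)) \<otimes> w = a \<otimes> (k \<otimes> v \<otimes> (z \<otimes> w))"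
      using k c Mc[OF w(1)] by (simp add: m_ac)
    ultimately show "k \<otimes> (v \<otimes> (a \<otimes> z)) \<otimes> w \<in> J (Suc n + d)" by simp
  qed (use GD(1)[OF v] A_carr[OF a] Zc z in auto)
  have G_I: "v \<otimes> i \<in> G (Suc n)" if v: "v \<in> G n" and "i \<in> ideal_prod R A Z" for v i n
    using that(2)
  proof induct
    case (prod a z)
    then show ?case by (rule G_Z[OF v])
  next
    case (sum x y)
    then have "x \<in> carrier R" "y \<in> carrier R" using ideal_prod_closed[OF A_sub(1) Zc] by auto
    then show ?case using G_add[OF sum(2,4)] GD(1)[OF v] by (simp add: r_distr)
  qed
  have JG: "J n \<subseteq> G n" for n
  proof (induct n)
    case 0
    have "k \<otimes> v \<otimes> w \<in> J d" if v: "v \<in> A" and w: "w \<in> M d" "N \<le> d" for v d w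
      using J_sub(4)[OF v M(4)[OF w(2,1)]] k A_carr[OF v] Mc[OF w(1)] by (simp add: m_ac)
    then show ?case by (auto simp: G_def)
  next
    case (Suc n)
    show ?case
    proof
      fix v assume "v \<in> J (Suc n)"
      then have "v \<in> ideal_prod R (J n) I" by (simp add: ideal_pow_Suc)
      then show "v \<in> G (Suc n)"
      proof induct
        case (prod u i)
        show ?case using G_I[of u n i] Suc prod Z(3) by blast
      next
        case (sum u v)
        then show ?case by (intro G_add)
      qed
    qed
  qed
  have "k \<otimes> v \<in> J N" if v: "v \<in> J N" for v
  proof -
    have "k \<otimes> v \<otimes> \<one> \<in> J (N + 0)" using JG v by (intro GD(2)[OF _ M(2)]) auto
    then show ?thesis using k J_carr[OF v] by simp
  qed
  then show ?thesis by blast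
qed

end

context rees
begin

text \<open>On the chart where \<open>a\<close> generates \<open>I\<close>, a regular function lies
  in the coordinate ring: if \<open>k\<close> did not, its denominators would form a proper ideal in
  some prime \<open>q\<close>. But \<open>k\<close> is a fraction x/g at the point of
  \<open>q\<close>, and g a^(-n) is a denominator outside \<open>q\<close>.\<close>

lemma germ_imp_power:
  assumes k: "k \<in> carrier K" and germ: "\<forall>Q\<in>Pts. k \<in> germ Q ` carrier (OX Q)" and a: "a \<in> \<phi> ` I" "a \<noteq> \<zero>"
  shows "\<exists>n. k \<otimes> a [^] (n::nat) \<in> J n"
proof (rule ccontr)
  assume not: "\<not> ?thesis"
  have ac: "a \<in> carrier K" using a(1) I_carr by blast
  \<comment> \<open>The ring A[I/a], the coordinate ring of the chart, as a subring of
    \<open>K\<close>.\<close>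
  define R where "R = {u \<in> carrier K. \<exists>n::nat. u \<otimes> a [^] n \<in> J n}"
  have RI: "u \<in> R" if "u \<in> carrier K" "u \<otimes> a [^] (n::nat) \<in> J n" for u n using that unfolding R_def by blast
  have RD: "\<exists>n. u \<in> carrier K \<and> (\<forall>j\<ge>n. u \<otimes> a [^] j \<in> J j)" if u: "u \<in> R" for u
  proof -
    obtain n :: nat where n: "u \<in> carrier K" "u \<otimes> a [^] n \<in> J n" using u unfolding R_def by blast
    have "u \<otimes> a [^] j \<in> J j" if "n \<le> j" for j
    proof -
      have "(u \<otimes> a [^] n) \<otimes> a [^] (j - n) \<in> J (n + (j - n))" by (rule J_mult[OF n(2) J_pow[OF a(1)]])
      moreover have "a [^] j = a [^] n \<otimes> a [^] (j - n)" using K.nat_pow_mult[OF ac, of n "j - n"] that by simp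
      ultimately show ?thesis using that n(1) ac by (simp add: K.m_assoc)
    qed
    then show ?thesis using n(1) by blast
  qed
  have AR: "\<phi> ` carrier A \<subseteq> R" using RI[of _ 0] by auto
  have Rs: "subring R K"
  proof (rule K.subringI)
    show "R \<subseteq> carrier K" by (auto simp: R_def)
    show "\<one> \<in> R" using AR A_sub(3) by blast
    fix u v assume "u \<in> R" "v \<in> R"
    then obtain m n where u: "u \<in> carrier K" "\<And>j. j \<ge> m \<Longrightarrow> u \<otimes> a [^] j \<in> J j" and v: "v \<in> carrier K" "\<And>j. j \<ge> n \<Longrightarrow> v \<otimes> a [^] j \<in> J j"
      using RD by blast
    have "(u \<otimes> a [^] m) \<otimes> (v \<otimes> a [^] n) \<in> J (m + n)" using J_mult[OF u(2) v(2)] by blast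
    moreover have "(u \<otimes> a [^] m) \<otimes> (v \<otimes> a [^] n) = (u \<otimes> v) \<otimes> a [^] (m + n)"
      using u(1) v(1) ac by (simp add: K.m_ac K.nat_pow_mult[symmetric])
    ultimately show "u \<otimes> v \<in> R" using RI[of "u \<otimes> v" "m + n"] u(1) v(1) by simp
    have "u \<otimes> a [^] (m + n) \<oplus> v \<otimes> a [^] (m + n) \<in> J (m + n)" using J_sub(3)[OF u(2) v(2), of "m + n"] by simp
    then show "u \<oplus> v \<in> R" using RI[of "u \<oplus> v" "m + n"] u(1) v(1) ac by (simp add: K.l_distr)
  next
    fix u assume "u \<in> R"
    then obtain m where u: "u \<in> carrier K" "u \<otimes> a [^] m \<in> J m" using RD by blast
    show "\<ominus> u \<in> R" using RI[of "\<ominus> u" m] K.submod_neg[OF J_submod subring_A u(2)] u(1) ac by (simp add: K.l_minus)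
  qed
  note RE = subringE[OF Rs]
  have Rc: "r \<in> carrier K" if "r \<in> R" for r using RE(1) that by blast
  note ai = K.nonzero_inv[OF ac a(2)]
  have y: "inv a \<in> colon K R (\<phi> ` I)"
    unfolding colon_def
  proof (intro CollectI[of "\<lambda>y. y \<in> carrier K \<and> _ y"] conjI ballI)
    fix i assume i: "i \<in> \<phi> ` I"
    have "(inv a \<otimes> i) \<otimes> a [^] Suc 0 = i" using K.mult_inv_cancel(2)[OF I_carr[OF i] ac a(2)] I_carr[OF i] ac ai by (simp add: K.m_comm)
    then show "inv a \<otimes> i \<in> R" using RI[of "inv a \<otimes> i" "Suc 0"] i J_1 I_carr[OF i] ai by simp
  qed (rule ai)
  interpret B: cring "K\<lparr>carrier := R\<rparr>" by (rule K.subring_of_embedding[OF Rs])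
  \<comment> \<open>The ideal of denominators of \<open>k\<close> in \<open>R\<close>; it contains
    \<open>1\<close> only if \<open>k\<close> is in \<open>R\<close>.\<close>
  define D where "D = {z \<in> R. z \<otimes> k \<in> R}"
  have "ideal D (K\<lparr>carrier := R\<rparr>)"
  proof (rule B.idealI_cring)
    show "\<zero>\<^bsub>K\<lparr>carrier := R\<rparr>\<^esub> \<in> D" using RE(2) k by (simp add: D_def)
    show "x \<oplus>\<^bsub>K\<lparr>carrier := R\<rparr>\<^esub> z \<in> D" if "x \<in> D" "z \<in> D" for x z
      using that RE(7) k Rc by (simp add: D_def K.l_distr)
    show "b \<otimes>\<^bsub>K\<lparr>carrier := R\<rparr>\<^esub> x \<in> D" if "b \<in> carrier (K\<lparr>carrier := R\<rparr>)" "x \<in> D" for b x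
      using that RE(6) k Rc by (simp add: D_def K.m_assoc)
  qed (auto simp: D_def)
  moreover have "k \<notin> R"
  proof
    assume "k \<in> R"
    from RD[OF this] show False using not by blast
  qed
  then have "\<one>\<^bsub>K\<lparr>carrier := R\<rparr>\<^esub> \<notin> D" using k by (simp add: D_def)
  ultimately obtain q where q: "primeideal q (K\<lparr>carrier := R\<rparr>)" "D \<subseteq> q" using B.exists_prime_ideal by blast
  have ya: "inv a \<otimes> a \<notin> q" using primeideal_one_notin[OF q(1)] ai by simp
  have Q: "point q (inv a) \<in> Pts" by (rule point_in_Pts[OF Rs AR y a(1) q(1) ya])
  then have "k \<in> germ (point q (inv a)) ` carrier (OX (point q (inv a)))" using germ by blast
  then obtain n x g where xg: "x \<in> Ipow n" "g \<in> Ipow n" "tm g n \<notin> point q (inv a)"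
      "k = germ (point q (inv a)) (fr (point q (inv a)) (tm x n) (tm g n))"
    unfolding OX_carrier by blast
  have k_eq: "k = \<phi> x \<otimes> inv \<phi> g" unfolding xg(4) by (rule germ_frac[OF Q xg(1-3)])
  have c: "\<phi> x \<in> carrier K" using Ipow_carr[OF xg(1)] by simp
  note g = denominator(2,3)[OF Q xg(2,3)]
  have J: "\<phi> x \<in> J n" "\<phi> g \<in> J n" using xg by (auto simp: J_image)
  note v = point_value[OF Rs AR y a(1) q(1) ya J(1)] point_value[OF Rs AR y a(1) q(1) ya J(2)]
  have kg: "k \<otimes> \<phi> g = \<phi> x" unfolding k_eq by (rule K.mult_inv_cancel(2)[OF c g])
  have "(\<phi> g \<otimes> inv a [^] n) \<otimes> k = (k \<otimes> \<phi> g) \<otimes> inv a [^] n"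
    using k g(1) ai(1) by (simp add: K.m_ac)
  then have "(\<phi> g \<otimes> inv a [^] n) \<otimes> k = \<phi> x \<otimes> inv a [^] n" by (simp only: kg)
  then have "\<phi> g \<otimes> inv a [^] n \<in> D" using v by (simp add: D_def)
  then have "\<phi> g \<otimes> inv a [^] n \<in> q" using q(2) by blast
  then show False using mon_point_iff[OF Rs AR y a(1) q(1) ya xg(2)] xg(3) by blast
qed

text \<open>Membership in A[I/z] for each of finitely many generators z of \<open>I\<close> makes
  \<open>k\<close> a multiplier of some I^N, and such multipliers are integral by
  \<open>Rm_integral\<close>.\<close>

lemma germ_imp_integral:
  assumes noeth: "noetherian_ring A" and k: "k \<in> carrier K" and germ: "\<forall>Q\<in>Pts. k \<in> germ Q ` carrier (OX Q)"
  shows "integral_over K (\<phi> ` carrier A) k"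
proof -
  obtain E where E: "E \<subseteq> carrier A" "finite E" "I = Idl\<^bsub>A\<^esub> E"
    using noetherian_ring.finetely_gen[OF noeth ideal_I] by blast
  let ?Z = "\<phi> ` insert \<zero>\<^bsub>A\<^esub> E"
  have ZI: "?Z \<subseteq> \<phi> ` I"
    using A.genideal_self[OF E(1)] E(3) additive_subgroup.zero_closed[OF ideal.axioms(1)[OF ideal_I]] by blast
  have "\<exists>n. \<forall>j\<ge>n. k \<otimes> z [^] j \<in> J j" if z: "z \<in> ?Z" for z
  proof (cases "z = \<zero>")
    case True
    \<comment> \<open>The threshold is \<open>1\<close>, since the zeroth power of zero is
      \<open>1\<close>.\<close>
    then show ?thesis using k J_sub(2) by (intro exI[of _ 1]) (auto simp: K.nat_pow_zero)
  next
    case False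
    have zI: "z \<in> \<phi> ` I" using z ZI by blast
    have zc: "z \<in> carrier K" using zI I_carr by blast
    obtain n :: nat where n: "k \<otimes> z [^] n \<in> J n" using germ_imp_power[OF k germ zI False] by blast
    have "k \<otimes> z [^] j \<in> J j" if "n \<le> j" for j
    proof -
      have "(k \<otimes> z [^] n) \<otimes> z [^] (j - n) \<in> J (n + (j - n))" by (rule J_mult[OF n J_pow[OF zI]])
      moreover have "z [^] j = z [^] n \<otimes> z [^] (j - n)" using K.nat_pow_mult[OF zc, of n "j - n"] that by simp
      ultimately show ?thesis using that k zc by (simp add: K.m_assoc)
    qed
    then show ?thesis by blast
  qed
  then obtain N where "\<forall>w\<in>J N. k \<otimes> w \<in> J N"
    using power_stable[OF _ ZI generators_image[OF E(2,1,3)] k] E(2) by blast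
  then have "k \<in> Rm N" using k by (simp add: Rm_iff)
  then show ?thesis by (rule Rm_integral[OF noeth I_nonzero])
qed

end


section \<open>From an affine blow-up to the conductor condition\<close>

lemma local_family_carrier:
  "s \<in> carrier (sections (local_family_space T L C) U) \<longleftrightarrow> s \<in> (\<Pi>\<^sub>E p\<in>U. carrier (L p)) \<and>
    (\<forall>p\<in>U. \<exists>V. openin T V \<and> p \<in> V \<and> V \<subseteq> U \<and> restrict s V \<in> C V)"
  by (simp add: local_family_space_def)

context rees
begin

abbreviation "\<eta> \<equiv> {\<zero>\<^bsub>S\<^esub>}"
abbreviation "SX \<equiv> sections (blow_up A I)"

lemma space_blow_up: "space_topology (blow_up A I) = TX"
  by (simp add: blow_up_def Proj_def local_family_space_def)

lemma SX_ops: "s \<otimes>\<^bsub>SX U\<^esub> t = (\<lambda>p\<in>U. s p \<otimes>\<^bsub>OX p\<^esub> t p)" "s \<oplus>\<^bsub>SX U\<^esub> t = (\<lambda>p\<in>U. s p \<oplus>\<^bsub>OX p\<^esub> t p)"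
    "\<one>\<^bsub>SX U\<^esub> = (\<lambda>p\<in>U. \<one>\<^bsub>OX p\<^esub>)" "restriction (blow_up A I) V U s = restrict s U"
  by (simp_all add: blow_up_def Proj_def local_family_space_def)

lemmas SX_carrier = local_family_carrier[of _ TX "homogeneous_localization S G"
  "\<lambda>V. {\<lambda>p\<in>V. fr p a f | n a f. a \<in> G n \<and> f \<in> G n \<and> (\<forall>p\<in>V. f \<notin> p)}", folded Proj_def, folded blow_up_def]

lemma SX_local:
  assumes s: "s \<in> carrier (SX U)" and Q: "Q \<in> U"
  obtains V n x g where "openin TX V" "Q \<in> V" "V \<subseteq> U" "x \<in> Ipow n" "g \<in> Ipow n"
    "\<And>p. p \<in> V \<Longrightarrow> tm g n \<notin> p \<and> s p = fr p (tm x n) (tm g n)"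
proof -
  have "\<exists>V. openin TX V \<and> Q \<in> V \<and> V \<subseteq> U \<and> restrict s V \<in> {\<lambda>p\<in>V. fr p a f | n a f. a \<in> G n \<and> f \<in> G n \<and> (\<forall>p\<in>V. f \<notin> p)}"
    by (rule bspec[OF conjunct2[OF SX_carrier[THEN iffD1, OF s]] Q])
  then obtain V where V0: "openin TX V" "Q \<in> V" "V \<subseteq> U"
    and "restrict s V \<in> {\<lambda>p\<in>V. fr p a f | n a f. a \<in> G n \<and> f \<in> G n \<and> (\<forall>p\<in>V. f \<notin> p)}"
    by (elim exE conjE) (rule that)
  from this(4) obtain n a f where "restrict s V = (\<lambda>p\<in>V. fr p a f)" "a \<in> G n" "f \<in> G n" "\<forall>p\<in>V. f \<notin> p"
    unfolding mem_Collect_eq by (elim exE conjE) (rule that)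
  note V = V0 this
  obtain x g where xg: "x \<in> Ipow n" "a = tm x n" "g \<in> Ipow n" "f = tm g n" using V(5,6) unfolding G_iff by blast
  have "s p = fr p a f" if "p \<in> V" for p using fun_cong[OF V(4), of p] that by simp
  then show thesis using V(7) xg(2,4) by (intro that[OF V(1-3) xg(1,3)]) auto
qed

text \<open>Near \<open>Q\<close> a section is one fraction x/g, whose value in \<open>K\<close> is
  the same at all points of the neighbourhood. The generic point is one of them, so the section is
  determined by a single element of \<open>K\<close>.\<close>

lemma SX_value:
  assumes s: "s \<in> carrier (SX U)" and U: "openin TX U" and Q: "Q \<in> U"
  shows "s Q \<in> carrier (OX Q)" "\<eta> \<in> U" "germ Q (s Q) = germ \<eta> (s \<eta>)"
proof -
  show "s Q \<in> carrier (OX Q)" by (rule PiE_mem[OF conjunct1[OF SX_carrier[THEN iffD1, OF s]] Q])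
  show "\<eta> \<in> U" by (rule zero_in_open[OF U Q])
  obtain V n x g where V: "openin TX V" "Q \<in> V" "V \<subseteq> U" "x \<in> Ipow n" "g \<in> Ipow n"
    "\<And>p. p \<in> V \<Longrightarrow> tm g n \<notin> p \<and> s p = fr p (tm x n) (tm g n)" by (rule SX_local[OF s Q]) (rule that)
  have p: "germ p (s p) = \<phi> x \<otimes> inv \<phi> g" if "p \<in> V" for p
  proof -
    have "p \<in> Pts" using openin_subset[OF V(1)] that unfolding topspace_TX by blast
    then show ?thesis using germ_frac[OF _ V(4,5), of p] V(6)[OF that] by simp
  qed
  show "germ Q (s Q) = germ \<eta> (s \<eta>)" using p[OF V(2)] p[OF zero_in_open[OF V(1,2)]] by simp
qed

section \<open>The ring homomorphism from \<open>D\<close> to \<open>K\<close> for a blow-up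
  isomorphic to Spec D\<close>

context
  fixes D f F
  assumes D: "cring D" and iso: "ringed_space_iso (blow_up A I) (Spec D) f F"
begin

private abbreviation "TD \<equiv> zariski_topology D"
private abbreviation "SD \<equiv> sections (Spec D)"
private abbreviation "lf p \<equiv> fraction D (carrier D - p)"
private abbreviation "LD p \<equiv> localization D (carrier D - p)"
private abbreviation "pre V \<equiv> f -` V \<inter> Pts"
private abbreviation "spD \<equiv> prime_spectrum D"

interpretation D: cring D by (rule D)

lemma space_Spec: "space_topology (Spec D) = TD"
  by (simp add: Spec_def local_family_space_def)

lemma SD_ops: "s \<otimes>\<^bsub>SD U\<^esub> t = (\<lambda>p\<in>U. s p \<otimes>\<^bsub>LD p\<^esub> t p)" "s \<oplus>\<^bsub>SD U\<^esub> t = (\<lambda>p\<in>U. s p \<oplus>\<^bsub>LD p\<^esub> t p)"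
    "\<one>\<^bsub>SD U\<^esub> = (\<lambda>p\<in>U. \<one>\<^bsub>LD p\<^esub>)" "restriction (Spec D) V U s = restrict s U"
  by (simp_all add: Spec_def local_family_space_def)

lemmas SD_carrier = local_family_carrier[of _ TD "\<lambda>p. localization D (carrier D - p)"
  "\<lambda>V. {\<lambda>p\<in>V. lf p a f | a f. a \<in> carrier D \<and> f \<in> carrier D \<and> (\<forall>p\<in>V. f \<notin> p)}", folded Spec_def]

lemma openin_TD_prime: "openin TD V \<Longrightarrow> p \<in> V \<Longrightarrow> primeideal p D"
  using openin_subset[of TD V] unfolding D.topspace_zariski prime_spectrum_def by blast

lemma homeo: "homeomorphic_map TX TD f"
  using iso unfolding ringed_space_iso_def space_blow_up space_Spec by blast

lemma F_iso: "openin TD V \<Longrightarrow> F V \<in> ring_iso (SD V) (SX (pre V))"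
  using iso unfolding ringed_space_iso_def space_blow_up space_Spec topspace_TX by blast

lemma F_hom: "openin TD V \<Longrightarrow> F V \<in> ring_hom (SD V) (SX (pre V))"
  using F_iso by (simp add: ring_iso_def)

lemma F_restrict:
  "openin TD V \<Longrightarrow> openin TD W \<Longrightarrow> W \<subseteq> V \<Longrightarrow> s \<in> carrier (SD V) \<Longrightarrow> F W (restrict s W) = restrict (F V s) (pre W)"
  using iso unfolding ringed_space_iso_def space_blow_up space_Spec topspace_TX SX_ops SD_ops by blast

lemma pre_open: "openin TD V \<Longrightarrow> openin TX (pre V)"
proof -
  assume "openin TD V"
  then have "openin TX {x \<in> topspace TX. f x \<in> V}"
    using homeomorphic_imp_continuous_map[OF homeo] by (intro openin_continuous_map_preimage)
  moreover have "{x \<in> topspace TX. f x \<in> V} = pre V" unfolding topspace_TX by auto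
  ultimately show ?thesis by simp
qed

lemma point_over:
  assumes "primeideal p D"
  obtains P where "P \<in> Pts" "f P = p"
proof -
  have "p \<in> f ` Pts"
    using homeomorphic_imp_surjective_map[OF homeo] assms unfolding topspace_TX D.topspace_zariski prime_spectrum_def by simp
  then show thesis using that by blast
qed

lemma eta_in_pre:
  assumes V: "openin TD V" "p \<in> V"
  shows "\<eta> \<in> pre V"
proof -
  obtain P where "P \<in> Pts" "f P = p" using point_over[OF openin_TD_prime[OF V]] .
  then show ?thesis using zero_in_open[OF pre_open[OF V(1)], of P] V(2) by simp
qed

lemma top_open: "openin TD spD"
  using openin_topspace[of TD] unfolding D.topspace_zariski .

lemma pre_top: "pre spD = Pts"
  using homeomorphic_imp_surjective_map[OF homeo] unfolding topspace_TX D.topspace_zariski by auto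

definition "sec V a = (\<lambda>p\<in>V. fraction D (carrier D - p) a \<one>\<^bsub>D\<^esub>)"

lemma sec_closed:
  assumes V: "openin TD V" and a: "a \<in> carrier D"
  shows "sec V a \<in> carrier (SD V)"
proof -
  have "lf p a \<one>\<^bsub>D\<^esub> \<in> carrier (LD p)" if p: "p \<in> V" for p
  proof -
    interpret M: mult_subset D "carrier D - p" by (rule D.mult_subset_prime[OF openin_TD_prime[OF V p]])
    show ?thesis by (rule M.fraction_closed[OF a M.one_in_S])
  qed
  moreover have "restrict (sec V a) V \<in> {\<lambda>p\<in>V. lf p a f | a f. a \<in> carrier D \<and> f \<in> carrier D \<and> (\<forall>p\<in>V. f \<notin> p)}"
  proof -
    have "restrict (sec V a) V = (\<lambda>p\<in>V. lf p a \<one>\<^bsub>D\<^esub>)" by (auto simp: sec_def)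
    then show ?thesis using a primeideal_one_notin[OF openin_TD_prime[OF V]] by blast
  qed
  ultimately show ?thesis
    unfolding SD_carrier using V by (intro conjI ballI exI[of _ V] order_refl) (simp_all add: sec_def)
qed

lemma sec_hom:
  assumes V: "openin TD V" and ab: "a \<in> carrier D" "b \<in> carrier D"
  shows "sec V (a \<otimes>\<^bsub>D\<^esub> b) = sec V a \<otimes>\<^bsub>SD V\<^esub> sec V b" "sec V (a \<oplus>\<^bsub>D\<^esub> b) = sec V a \<oplus>\<^bsub>SD V\<^esub> sec V b"
    "sec V \<one>\<^bsub>D\<^esub> = \<one>\<^bsub>SD V\<^esub>"
proof -
  have *: "lf p (a \<otimes>\<^bsub>D\<^esub> b) \<one>\<^bsub>D\<^esub> = lf p a \<one>\<^bsub>D\<^esub> \<otimes>\<^bsub>LD p\<^esub> lf p b \<one>\<^bsub>D\<^esub>"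
      "lf p (a \<oplus>\<^bsub>D\<^esub> b) \<one>\<^bsub>D\<^esub> = lf p a \<one>\<^bsub>D\<^esub> \<oplus>\<^bsub>LD p\<^esub> lf p b \<one>\<^bsub>D\<^esub>" "lf p \<one>\<^bsub>D\<^esub> \<one>\<^bsub>D\<^esub> = \<one>\<^bsub>LD p\<^esub>" if p: "p \<in> V" for p
  proof -
    interpret M: mult_subset D "carrier D - p" by (rule D.mult_subset_prime[OF openin_TD_prime[OF V p]])
    show "lf p (a \<otimes>\<^bsub>D\<^esub> b) \<one>\<^bsub>D\<^esub> = lf p a \<one>\<^bsub>D\<^esub> \<otimes>\<^bsub>LD p\<^esub> lf p b \<one>\<^bsub>D\<^esub>"
      using M.mult_fraction[OF ab M.one_in_S M.one_in_S] by simp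
    show "lf p (a \<oplus>\<^bsub>D\<^esub> b) \<one>\<^bsub>D\<^esub> = lf p a \<one>\<^bsub>D\<^esub> \<oplus>\<^bsub>LD p\<^esub> lf p b \<one>\<^bsub>D\<^esub>"
      using M.add_fraction[OF ab M.one_in_S M.one_in_S] ab by simp
    show "lf p \<one>\<^bsub>D\<^esub> \<one>\<^bsub>D\<^esub> = \<one>\<^bsub>LD p\<^esub>" by (rule M.one_localization[symmetric])
  qed
  then show "sec V (a \<otimes>\<^bsub>D\<^esub> b) = sec V a \<otimes>\<^bsub>SD V\<^esub> sec V b" "sec V (a \<oplus>\<^bsub>D\<^esub> b) = sec V a \<oplus>\<^bsub>SD V\<^esub> sec V b"
      "sec V \<one>\<^bsub>D\<^esub> = \<one>\<^bsub>SD V\<^esub>"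
    unfolding SD_ops by (auto simp: sec_def intro!: restrict_ext)
qed

text \<open>The composite of \<open>D\<close> with the global sections, the stalk at the generic
  point and its embedding in \<open>K\<close>. It is the link between \<open>A\<close> and
  \<open>D\<close>, which is not given as an \<open>A\<close>-algebra.\<close>

definition "kap a = germ \<eta> (F (prime_spectrum D) (sec (prime_spectrum D) a) \<eta>)"

lemma F_sec_closed: "openin TD V \<Longrightarrow> a \<in> carrier D \<Longrightarrow> F V (sec V a) \<in> carrier (SX (pre V))"
  using ring_hom_closed[OF F_hom sec_closed] .

lemma kap_restrict:
  assumes V: "openin TD V" "p \<in> V" and a: "a \<in> carrier D"
  shows "germ \<eta> (F V (sec V a) \<eta>) = kap a"
proof -
  have sub: "V \<subseteq> spD" using openin_TD_prime[OF V(1)] by (auto simp: prime_spectrum_def)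
  have "restrict (sec spD a) V = sec V a" using sub by (auto simp: sec_def fun_eq_iff)
  then have "F V (sec V a) = restrict (F spD (sec spD a)) (pre V)"
    using F_restrict[OF top_open V(1) sub sec_closed[OF top_open a]] by simp
  then show ?thesis using eta_in_pre[OF V] by (simp add: kap_def)
qed

lemma kap_hom: "kap \<in> ring_hom D K"
proof (rule ring_hom_memI)
  note h = F_hom[OF top_open] and g = germ_hom[OF zero_in_Pts]
  have ep: "\<eta> \<in> pre spD" unfolding pre_top by (rule zero_in_Pts)
  have c: "F spD (sec spD a) \<eta> \<in> carrier (OX \<eta>)" if "a \<in> carrier D" for a
    by (rule SX_value(1)[OF F_sec_closed[OF top_open that] pre_open[OF top_open] ep])
  show "kap a \<in> carrier K" if "a \<in> carrier D" for a unfolding kap_def by (rule ring_hom_closed[OF g c[OF that]])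
  fix a b assume ab: "a \<in> carrier D" "b \<in> carrier D"
  note s = sec_closed[OF top_open ab(1)] sec_closed[OF top_open ab(2)]
  show "kap (a \<otimes>\<^bsub>D\<^esub> b) = kap a \<otimes> kap b"
    unfolding kap_def sec_hom(1)[OF top_open ab] ring_hom_mult[OF h s] SX_ops restrict_apply'[OF ep]
    by (rule ring_hom_mult[OF g c[OF ab(1)] c[OF ab(2)]])
  show "kap (a \<oplus>\<^bsub>D\<^esub> b) = kap a \<oplus> kap b"
    unfolding kap_def sec_hom(2)[OF top_open ab] ring_hom_add[OF h s] SX_ops restrict_apply'[OF ep]
    by (rule ring_hom_add[OF g c[OF ab(1)] c[OF ab(2)]])
next
  have ep: "\<eta> \<in> pre spD" unfolding pre_top by (rule zero_in_Pts)
  show "kap \<one>\<^bsub>D\<^esub> = \<one>"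
    unfolding kap_def sec_hom(3)[OF top_open D.one_closed D.one_closed] ring_hom_one[OF F_hom[OF top_open]] SX_ops restrict_apply'[OF ep]
    by (rule ring_hom_one[OF germ_hom[OF zero_in_Pts]])
qed

lemma kap_integral:
  assumes "noetherian_ring A" and a: "a \<in> carrier D"
  shows "integral_over K (\<phi> ` carrier A) (kap a)"
proof (rule germ_imp_integral[OF assms(1) ring_hom_closed[OF kap_hom a]], rule ballI)
  fix Q assume Q: "Q \<in> Pts"
  note v = SX_value[OF F_sec_closed[OF top_open a] pre_open[OF top_open], unfolded pre_top, OF Q]
  show "kap a \<in> germ Q ` carrier (OX Q)" unfolding kap_def v(3)[symmetric] using v(1) by (rule imageI)
qed

text \<open>Let \<open>P\<close> lie over \<mm> and let a t be outside \<open>P\<close>. For x in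
  \<open>I\<close> the fraction x/a is a section on the chart of \<open>a\<close>; transported to
  Spec D it is of the form b/g near \<mm>, and comparing germs at the generic point gives the
  equation.\<close>

lemma kap_local:
  assumes m: "primeideal \<mm> D"
  shows "\<exists>a\<in>I. \<phi> a \<noteq> \<zero> \<and> (\<forall>x\<in>I. \<exists>g\<in>carrier D - \<mm>. \<exists>b\<in>carrier D. kap g \<otimes> (\<phi> x \<otimes> inv \<phi> a) = kap b)"
proof -
  obtain P where P: "P \<in> Pts" "f P = \<mm>" using point_over[OF m] .
  obtain a where a: "a \<in> I" "tm a (Suc 0) \<notin> P" using PtsD(3)[OF P(1)] by blast
  have a1: "a \<in> Ipow (Suc 0)" using a(1) Ipow_1 by simp
  define U where "U = Dplus a (Suc 0)"
  have U: "openin TX U" unfolding U_def by (rule openin_Dplus[OF a1])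
  have PU: "P \<in> U" using P(1) a(2) by (simp add: U_def Dplus_def)
  have UP: "U \<subseteq> Pts" by (auto simp: U_def Dplus_def)
  define W where "W = f ` U"
  have W: "openin TD W" using homeomorphic_imp_open_map[OF homeo] U unfolding open_map_def W_def by blast
  have pW: "pre W = U"
    using inj_onD[OF homeomorphic_imp_injective_map[OF homeo, unfolded topspace_TX]] UP unfolding W_def by blast
  have mW: "\<mm> \<in> W" using PU P(2) unfolding W_def by blast
  have "\<exists>g\<in>carrier D - \<mm>. \<exists>b\<in>carrier D. kap g \<otimes> (\<phi> x \<otimes> inv \<phi> a) = kap b" if x: "x \<in> I" for x
  proof -
    have x1: "x \<in> Ipow (Suc 0)" using x Ipow_1 by simp
    define t where "t = (\<lambda>Q\<in>U. fr Q (tm x (Suc 0)) (tm a (Suc 0)))"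
    have t: "t \<in> carrier (SX U)"
      unfolding SX_carrier
    proof (intro conjI ballI)
      show "t \<in> (\<Pi>\<^sub>E p\<in>U. carrier (OX p))"
        unfolding t_def OX_carrier using x1 a1 by (auto simp: U_def Dplus_def)
      fix p assume p: "p \<in> U"
      have "restrict t U = (\<lambda>Q\<in>U. fr Q (tm x (Suc 0)) (tm a (Suc 0)))" by (auto simp: t_def)
      moreover have "\<forall>p\<in>U. tm a (Suc 0) \<notin> p" by (simp add: U_def Dplus_def)
      ultimately have "restrict t U \<in> {\<lambda>p\<in>U. fr p a f | n a f. a \<in> G n \<and> f \<in> G n \<and> (\<forall>p\<in>U. f \<notin> p)}"
        using mon_in_G[OF x1] mon_in_G[OF a1] by blast
      then show "\<exists>V. openin TX V \<and> p \<in> V \<and> V \<subseteq> U \<and> restrict t V \<in> {\<lambda>p\<in>V. fr p a f | n a f. a \<in> G n \<and> f \<in> G n \<and> (\<forall>p\<in>V. f \<notin> p)}"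
        using U p by (intro exI[of _ U] conjI order_refl)
    qed
    have "F W ` carrier (SD W) = carrier (SX U)" using F_iso[OF W] unfolding pW ring_iso_def bij_betw_def by blast
    then have "t \<in> F W ` carrier (SD W)" using t by simp
    then obtain s where s: "s \<in> carrier (SD W)" "t = F W s" by blast
    have "\<exists>V. openin TD V \<and> \<mm> \<in> V \<and> V \<subseteq> W \<and> restrict s V \<in> {\<lambda>p\<in>V. lf p a f | a f. a \<in> carrier D \<and> f \<in> carrier D \<and> (\<forall>p\<in>V. f \<notin> p)}"
      by (rule bspec[OF conjunct2[OF SD_carrier[THEN iffD1, OF s(1)]] mW])
    then obtain V where V0: "openin TD V" "\<mm> \<in> V" "V \<subseteq> W"
      and "restrict s V \<in> {\<lambda>p\<in>V. lf p a f | a f. a \<in> carrier D \<and> f \<in> carrier D \<and> (\<forall>p\<in>V. f \<notin> p)}"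
      by (elim exE conjE) (rule that)
    from this(4) obtain b g where "restrict s V = (\<lambda>p\<in>V. lf p b g)" "b \<in> carrier D" "g \<in> carrier D" "\<forall>p\<in>V. g \<notin> p"
      unfolding mem_Collect_eq by (elim exE conjE) (rule that)
    note V = V0 this
    have ep: "\<eta> \<in> pre V" by (rule eta_in_pre[OF V(1,2)])
    have eU: "\<eta> \<in> U" using ep V(3) pW by blast
    have lfc: "lf p b g \<in> carrier (LD p)" "lf p g \<one>\<^bsub>D\<^esub> \<otimes>\<^bsub>LD p\<^esub> lf p b g = lf p b \<one>\<^bsub>D\<^esub>" if p: "p \<in> V" for p
    proof -
      interpret M: mult_subset D "carrier D - p" by (rule D.mult_subset_prime[OF openin_TD_prime[OF V(1) p]])
      have gS: "g \<in> carrier D - p" using V(6,7) p by blast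
      show "lf p b g \<in> carrier (LD p)" by (rule M.fraction_closed[OF V(5) gS])
      have "lf p (g \<otimes>\<^bsub>D\<^esub> b) (\<one>\<^bsub>D\<^esub> \<otimes>\<^bsub>D\<^esub> g) = lf p b \<one>\<^bsub>D\<^esub>"
        using V(5,6) gS M.one_in_S by (intro M.fraction_eqI) (simp_all add: D.m_comm)
      then show "lf p g \<one>\<^bsub>D\<^esub> \<otimes>\<^bsub>LD p\<^esub> lf p b g = lf p b \<one>\<^bsub>D\<^esub>"
        using M.mult_fraction[OF V(6,5) M.one_in_S gS] by simp
    qed
    have sV: "restrict s V \<in> carrier (SD V)"
      unfolding SD_carrier
    proof (intro conjI ballI)
      show "restrict s V \<in> (\<Pi>\<^sub>E p\<in>V. carrier (LD p))" unfolding V(4) using lfc(1) by auto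
      fix p assume p: "p \<in> V"
      have "restrict (restrict s V) V \<in> {\<lambda>p\<in>V. lf p a f | a f. a \<in> carrier D \<and> f \<in> carrier D \<and> (\<forall>p\<in>V. f \<notin> p)}"
        using V(4-7) by auto
      then show "\<exists>Y. openin TD Y \<and> p \<in> Y \<and> Y \<subseteq> V \<and> restrict (restrict s V) Y \<in> {\<lambda>p\<in>Y. lf p a f | a f. a \<in> carrier D \<and> f \<in> carrier D \<and> (\<forall>p\<in>Y. f \<notin> p)}"
        using V(1) p by (intro exI[of _ V] conjI order_refl)
    qed
    have "sec V g \<otimes>\<^bsub>SD V\<^esub> restrict s V = sec V b"
      unfolding SD_ops V(4) sec_def using lfc(2) by (auto intro!: restrict_ext)
    then have "F V (sec V b) = F V (sec V g) \<otimes>\<^bsub>SX (pre V)\<^esub> F V (restrict s V)"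
      using ring_hom_mult[OF F_hom[OF V(1)] sec_closed[OF V(1,6)] sV] by simp
    then have eq: "F V (sec V b) \<eta> = F V (sec V g) \<eta> \<otimes>\<^bsub>OX \<eta>\<^esub> F V (restrict s V) \<eta>"
      unfolding SX_ops by (simp only: restrict_apply'[OF ep])
    have t\<eta>: "F V (restrict s V) \<eta> = fr \<eta> (tm x (Suc 0)) (tm a (Suc 0))"
      unfolding F_restrict[OF W V(1,3) s(1)] restrict_apply'[OF ep] s(2)[symmetric] t_def restrict_apply'[OF eU] ..
    have "kap b = germ \<eta> (F V (sec V g) \<eta> \<otimes>\<^bsub>OX \<eta>\<^esub> F V (restrict s V) \<eta>)"
      using kap_restrict[OF V(1,2,5)] unfolding eq by simp
    also have "\<dots> = germ \<eta> (F V (sec V g) \<eta>) \<otimes> germ \<eta> (F V (restrict s V) \<eta>)"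
      by (rule ring_hom_mult[OF germ_hom[OF zero_in_Pts] SX_value(1)[OF F_sec_closed[OF V(1,6)] pre_open[OF V(1)] ep]
            SX_value(1)[OF ring_hom_closed[OF F_hom[OF V(1)] sV] pre_open[OF V(1)] ep]])
    also have "\<dots> = kap g \<otimes> (\<phi> x \<otimes> inv \<phi> a)"
      unfolding kap_restrict[OF V(1,2,6)] t\<eta>
      using germ_frac[OF zero_in_Pts x1 a1] eU by (simp add: U_def Dplus_def)
    finally have "kap g \<otimes> (\<phi> x \<otimes> inv \<phi> a) = kap b" by (rule sym)
    then show ?thesis using V(2,5-7) by blast
  qed
  then show ?thesis using a(1) denominator(3)[OF P(1) a1 a(2)] by blast
qed

theorem blow_up_iso_Spec_imp_conductor_condition:
  assumes noeth: "noetherian_ring A"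
  shows "conductor_condition A I"
proof -
  obtain E where E: "E \<subseteq> carrier A" "finite E" "I = Idl\<^bsub>A\<^esub> E"
    using noetherian_ring.finetely_gen[OF noeth ideal_I] by blast
  let ?E = "insert \<zero>\<^bsub>A\<^esub> E"
  have EI: "?E \<subseteq> I"
    using A.genideal_self[OF E(1)] E(3) additive_subgroup.zero_closed[OF ideal.axioms(1)[OF ideal_I]] by blast
  have gen: "\<phi> ` I \<subseteq> ideal_prod K (\<phi> ` carrier A) (\<phi> ` ?E)" by (rule generators_image[OF E(2,1,3)])
  \<comment> \<open>The integral closure of \<open>A\<close> in \<open>K\<close>. It contains the
    images of \<open>A\<close> and \<open>D\<close>, and it is the ring over which \<open>I\<close>
    is shown to be invertible.\<close>
  let ?C = "{u. integral_over K (\<phi> ` carrier A) u}"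
  note Cs = subringE[OF K.subring_integral_closure[OF subring_A]]
  have C: "kap r \<in> ?C" if "r \<in> carrier D" for r using kap_integral[OF noeth that] by simp
  have AC: "\<phi> ` carrier A \<subseteq> ?C" using K.integral_over_self[OF subring_A] by blast
  have Cc: "u \<in> carrier K" if "u \<in> ?C" for u using Cs(1) that by blast
  let ?Y = "colon K ?C (\<phi> ` I)"
  have YD: "y \<in> carrier K" "\<And>i. i \<in> \<phi> ` I \<Longrightarrow> y \<otimes> i \<in> ?C" if "y \<in> ?Y" for y
    using that unfolding colon_def by blast+
  have YI: "y \<in> ?Y" if "y \<in> carrier K" "\<And>i. i \<in> \<phi> ` I \<Longrightarrow> y \<otimes> i \<in> ?C" for y
    using that unfolding colon_def by blast
  define \<aa> where "\<aa> = {r \<in> carrier D. kap r \<in> ideal_prod K (\<phi> ` I) ?Y}"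
  have smult: "z \<in> carrier K \<and> c \<otimes> z \<in> ideal_prod K (\<phi> ` I) ?Y" if c: "c \<in> ?C" and "z \<in> ideal_prod K (\<phi> ` I) ?Y" for c z
    using that(2)
  proof induct
    case (prod i y)
    note k = I_carr[OF prod(1)] YD(1)[OF prod(2)] Cc[OF c]
    have "c \<otimes> y \<in> ?Y"
    proof (rule YI)
      show "c \<otimes> y \<otimes> j \<in> ?C" if j: "j \<in> \<phi> ` I" for j
        using Cs(6)[OF c YD(2)[OF prod(2) j]] k I_carr[OF j] by (simp add: K.m_assoc)
    qed (use k in simp)
    then have "i \<otimes> (c \<otimes> y) \<in> ideal_prod K (\<phi> ` I) ?Y" using prod(1) by (intro ideal_prod.prod)
    then show ?case using k by (simp add: K.m_ac)
  next
    case (sum s t)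
    then show ?case using Cc[OF c] by (simp add: K.r_distr ideal_prod.sum)
  qed
  have "\<one>\<^bsub>D\<^esub> \<in> \<aa>"
  proof (rule ccontr)
    assume not: "\<one>\<^bsub>D\<^esub> \<notin> \<aa>"
    have "ideal \<aa> D"
    proof (rule D.idealI_cring)
      have z: "\<zero> \<in> \<phi> ` I" by (rule I_sub(2))
      have "\<zero> \<in> ?Y" using Cs(2) by (intro YI) auto
      then have "\<zero> \<otimes> \<zero> \<in> ideal_prod K (\<phi> ` I) ?Y" using z by (intro ideal_prod.prod)
      then show "\<zero>\<^bsub>D\<^esub> \<in> \<aa>" by (simp add: \<aa>_def ring_hom_zero[OF kap_hom D.ring_axioms K.ring_axioms])
    next
      show "x \<oplus>\<^bsub>D\<^esub> y \<in> \<aa>" if "x \<in> \<aa>" "y \<in> \<aa>" for x y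
        using that by (simp add: \<aa>_def ring_hom_add[OF kap_hom] ideal_prod.sum)
      show "r \<otimes>\<^bsub>D\<^esub> x \<in> \<aa>" if "r \<in> carrier D" "x \<in> \<aa>" for r x
        using that smult[OF C[OF that(1)]] by (simp add: \<aa>_def ring_hom_mult[OF kap_hom])
    qed (auto simp: \<aa>_def)
    then obtain \<mm> where m: "primeideal \<mm> D" "\<aa> \<subseteq> \<mm>" using D.exists_prime_ideal not by blast
    obtain a where a: "a \<in> I" "\<phi> a \<noteq> \<zero>" "\<forall>x\<in>I. \<exists>g\<in>carrier D - \<mm>. \<exists>b\<in>carrier D. kap g \<otimes> (\<phi> x \<otimes> inv \<phi> a) = kap b"
      using kap_local[OF m(1)] by blast
    have ac: "\<phi> a \<in> carrier K" using I_carr_A[OF a(1)] by simp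
    note ai = K.nonzero_inv[OF ac a(2)]
    \<comment> \<open>A common denominator outside \<mm> for the finitely many generators, obtained
      by multiplication.\<close>
    have fin: "\<exists>g\<in>carrier D - \<mm>. \<forall>x\<in>Z. kap g \<otimes> (\<phi> x \<otimes> inv \<phi> a) \<in> ?C" if "finite Z" "Z \<subseteq> I" for Z
      using that
    proof induct
      case empty
      then show ?case using primeideal_one_notin[OF m(1)] by (intro bexI[of _ "\<one>\<^bsub>D\<^esub>"]) auto
    next
      case (insert x Z)
      then obtain g where g: "g \<in> carrier D" "g \<notin> \<mm>" "\<forall>x\<in>Z. kap g \<otimes> (\<phi> x \<otimes> inv \<phi> a) \<in> ?C" by blast
      obtain h b where h: "h \<in> carrier D" "h \<notin> \<mm>" "b \<in> carrier D" "kap h \<otimes> (\<phi> x \<otimes> inv \<phi> a) = kap b" 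
      proof -
        have "x \<in> I" using insert(4) by simp
        from bspec[OF a(3) this] show thesis by (elim bexE DiffE) (rule that)
      qed
      note k = ring_hom_closed[OF kap_hom g(1)] ring_hom_closed[OF kap_hom h(1)]
      have "kap (g \<otimes>\<^bsub>D\<^esub> h) \<otimes> (\<phi> z \<otimes> inv \<phi> a) \<in> ?C" if z: "z \<in> insert x Z" for z
      proof -
        have zc: "\<phi> z \<otimes> inv \<phi> a \<in> carrier K" 
          using z insert(4) by (intro K.m_closed \<phi>_closed I_carr_A ai(1)) auto
        have e: "kap (g \<otimes>\<^bsub>D\<^esub> h) \<otimes> (\<phi> z \<otimes> inv \<phi> a) = kap g \<otimes> (kap h \<otimes> (\<phi> z \<otimes> inv \<phi> a))"
          "kap (g \<otimes>\<^bsub>D\<^esub> h) \<otimes> (\<phi> z \<otimes> inv \<phi> a) = kap h \<otimes> (kap g \<otimes> (\<phi> z \<otimes> inv \<phi> a))"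
          unfolding ring_hom_mult[OF kap_hom g(1) h(1)]
          by (rule K.m_assoc[OF k zc]) (simp only: K.m_comm[OF k] K.m_assoc[OF k(2,1) zc])
        show ?thesis
        proof (cases "z = x")
          case True
          show ?thesis unfolding True e(1)[unfolded True] h(4) by (rule Cs(6)[OF C[OF g(1)] C[OF h(3)]])
        next
          case False
          then have "z \<in> Z" using z by simp
          then show ?thesis unfolding e(2) using g(3) by (intro Cs(6)[OF C[OF h(1)]]) blast
        qed
      qed
      moreover have "g \<otimes>\<^bsub>D\<^esub> h \<in> carrier D - \<mm>" using g h primeideal.I_prime[OF m(1), of g h] by auto
      ultimately show ?case by blast
    qed
    obtain g where g: "g \<in> carrier D" "g \<notin> \<mm>" "\<And>x. x \<in> ?E \<Longrightarrow> kap g \<otimes> (\<phi> x \<otimes> inv \<phi> a) \<in> ?C"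
      using fin[OF _ EI] E(2) by blast
    note kg = ring_hom_closed[OF kap_hom g(1)]
    \<comment> \<open>So kap g, as the product of \<phi> a and this element, belongs to
      \<open>I\<close> times its inverse. This puts \<open>g\<close> into \<aa> and contradicts the
      choice of \<mm>.\<close>
    have "kap g \<otimes> inv \<phi> a \<in> ?Y"
    proof (rule YI)
      have Ec: "\<phi> ` ?E \<subseteq> carrier K" using E(1) by auto
      fix i assume "i \<in> \<phi> ` I"
      then have "i \<in> ideal_prod K (\<phi> ` carrier A) (\<phi> ` ?E)" using gen by blast
      then have "i \<in> carrier K \<and> kap g \<otimes> inv \<phi> a \<otimes> i \<in> ?C"
      proof induct
        case (prod c z)
        obtain e where e: "e \<in> ?E" "z = \<phi> e" using prod(2) by blast
        have k: "c \<in> carrier K" "z \<in> carrier K" using prod Ec by auto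
        have "c \<otimes> (kap g \<otimes> (z \<otimes> inv \<phi> a)) \<in> ?C" using Cs(6)[OF subsetD[OF AC prod(1)] g(3)[OF e(1)]] unfolding e(2) .
        moreover have "kap g \<otimes> inv \<phi> a \<otimes> (c \<otimes> z) = c \<otimes> (kap g \<otimes> (z \<otimes> inv \<phi> a))" using k kg ai(1) by (simp add: K.m_ac)
        ultimately show ?case using k by simp
      next
        case (sum s t)
        have "kap g \<otimes> inv \<phi> a \<otimes> (s \<oplus> t) = kap g \<otimes> inv \<phi> a \<otimes> s \<oplus> kap g \<otimes> inv \<phi> a \<otimes> t"
          using sum kg ai(1) by (simp add: K.r_distr)
        then show ?case using Cs(7)[OF conjunct2[OF sum(2)] conjunct2[OF sum(4)]] sum by simp
      qed
      then show "kap g \<otimes> inv \<phi> a \<otimes> i \<in> ?C" by blast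
    qed (use kg ai(1) in simp)
    then have "\<phi> a \<otimes> (kap g \<otimes> inv \<phi> a) \<in> ideal_prod K (\<phi> ` I) ?Y" using a(1) by (intro ideal_prod.prod imageI)
    then have "g \<in> \<aa>" unfolding K.mult_inv_cancel(1)[OF kg ac a(2)] \<aa>_def using g(1) by simp
    then show False using m(2) g(2) by blast
  qed
  then have "\<one> \<in> ideal_prod K (\<phi> ` I) ?Y" by (simp add: \<aa>_def ring_hom_one[OF kap_hom])
  then have "\<exists>N. \<one> \<in> ideal_prod K (\<phi> ` I) (T N)"
    using E(2) EI by (intro one_in_prod_T_of_integral[OF _ _ gen]) auto
  then show ?thesis using conductor_conditionI[OF _ I_nonzero] by blast
qed

end

end


section \<open>The equivalence\<close>

context embedded_ideal
begin

lemma conductor_condition_imp_Rm: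
  assumes "conductor_condition A I"
  obtains m where "\<one> \<in> ideal_prod K (\<phi> ` I) (colon K (Rm m) (\<phi> ` I))"
proof -
  obtain m where "\<one> \<in> ideal_prod K (\<phi> ` I) (T m)" using conductor_condition_imp[OF assms] by blast
  then show thesis using ideal_prod_mono[OF order_refl T_sub_colon] by (intro that[of m]) blast
qed

lemma conductor_condition_imp_finite:
  assumes noeth: "noetherian_ring A" and I0: "I \<noteq> {\<zero>\<^bsub>A\<^esub>}" and cc: "conductor_condition A I"
  obtains H where "domain (K\<lparr>carrier := H\<rparr>)" "finite_extension A (K\<lparr>carrier := H\<rparr>) \<phi>"
    "invertible_ideal (K\<lparr>carrier := H\<rparr>) (extended_ideal (K\<lparr>carrier := H\<rparr>) \<phi> I)"
proof -
  obtain m where m: "\<one> \<in> ideal_prod K (\<phi> ` I) (colon K (Rm m) (\<phi> ` I))" by (rule conductor_condition_imp_Rm[OF cc])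
  obtain E where E: "E \<subseteq> carrier A" "finite E" "I = Idl\<^bsub>A\<^esub> E" using noetherian_ring.finetely_gen[OF noeth ideal_I] by blast
  show thesis
    by (rule that[OF K.subring_is_domain[OF Rm_subring] Rm_finite[OF noeth I0] invertible_in_subring[OF Rm_subring A_sub_Rm m E(2,1,3)]])
qed

text \<open>The integral closure contains the multiplier ring \<open>Rm m\<close>, and what carries
  \<open>I\<close> into the smaller ring carries it into the larger one.\<close>

lemma conductor_condition_imp_integral_closure:
  assumes noeth: "noetherian_ring A" and I0: "I \<noteq> {\<zero>\<^bsub>A\<^esub>}" and cc: "conductor_condition A I"
  defines "B \<equiv> K\<lparr>carrier := {u. integral_over K (\<phi> ` carrier A) u}\<rparr>"
  shows "invertible_ideal B (extended_ideal B \<phi> I)"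
proof -
  let ?H = "{u. integral_over K (\<phi> ` carrier A) u}"
  obtain m where m: "\<one> \<in> ideal_prod K (\<phi> ` I) (colon K (Rm m) (\<phi> ` I))" by (rule conductor_condition_imp_Rm[OF cc])
  obtain E where E: "E \<subseteq> carrier A" "finite E" "I = Idl\<^bsub>A\<^esub> E" using noetherian_ring.finetely_gen[OF noeth ideal_I] by blast
  have "colon K (Rm m) (\<phi> ` I) \<subseteq> colon K ?H (\<phi> ` I)"
    using Rm_integral[OF noeth I0, of _ m] unfolding colon_def by blast
  then have "\<one> \<in> ideal_prod K (\<phi> ` I) (colon K ?H (\<phi> ` I))" using ideal_prod_mono[OF order_refl] m by blast
  then show ?thesis
    unfolding B_def using K.integral_over_self[OF subring_A]
    by (intro invertible_in_subring[OF K.subring_integral_closure[OF subring_A] _ _ E(2,1,3)]) auto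
qed

lemma integral_closure_extension:
  defines "B \<equiv> K\<lparr>carrier := {u. integral_over K (\<phi> ` carrier A) u}\<rparr>"
  shows "domain B" "integral_extension A B \<phi>"
proof -
  note H = K.subring_integral_closure[OF subring_A]
  show "domain B" unfolding B_def by (rule K.subring_is_domain[OF H])
  show "integral_extension A B \<phi>"
    unfolding B_def using K.integral_over_self[OF subring_A] by (intro integral_extension_update[OF H]) auto
qed

end

lemma (in domain) normalization_eq:
  "normalization R = (fraction_field R)\<lparr>carrier := {u. integral_over (fraction_field R) (to_fraction_field R ` carrier R) u}\<rparr>"
proof -
  interpret K: field "fraction_field R" by (rule field_fraction_field)
  have "to_fraction_field R \<in> carrier R \<rightarrow> carrier (fraction_field R)"
    using ring_hom_closed[OF to_fraction_field_hom] by blast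
  then have "{x \<in> carrier (fraction_field R). integral_element R (fraction_field R) (to_fraction_field R) x} =
      {u. integral_over (fraction_field R) (to_fraction_field R ` carrier R) u}"
    using K.integral_element_iff[of _ "to_fraction_field R" R] by (auto simp: integral_over_def)
  then show ?thesis by (simp only: normalization_def)
qed

text \<open>The ring witnessing that the blow-up is affine has to live on the type of its sections, into
  which the fraction field is transported.\<close>

lemma conductor_condition_imp_affine:
  fixes A :: "('a, 'm) ring_scheme"
  assumes A: "domain A" and I: "ideal I A" "I \<noteq> {\<zero>\<^bsub>A\<^esub>}" and cc: "conductor_condition A I"
  shows "is_affine (blow_up A I)"
proof -
  note dom = domain.field_fraction_field[OF A] domain.to_fraction_field_hom[OF A] domain.to_fraction_field_inj[OF A]
  let ?K = "fraction_field A" and ?e = "to_fraction_field A"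
  interpret L: field ?K by (rule dom(1))
  \<comment> \<open>Replaces elements of \<open>A\<close> by constant sequences, and the resulting
    set of pairs by a constant function. The only purpose is an injection into the type of the
    sections.\<close>
  define j :: "('a \<times> 'a) set \<Rightarrow> (nat \<Rightarrow> 'a) set \<Rightarrow> ((nat \<Rightarrow> 'a) \<times> (nat \<Rightarrow> 'a)) set"
    where "j x = (\<lambda>_. map_prod (\<lambda>a _. a) (\<lambda>a _. a) ` x)" for x
  have "inj (map_prod (\<lambda>a (_::nat). a) (\<lambda>a (_::nat). a) :: 'a \<times> 'a \<Rightarrow> _)"
    by (intro prod.inj_map injI) (auto dest: fun_cong)
  then have j: "inj_on j X'" for X' by (auto simp: j_def inj_on_def fun_eq_iff inj_image_eq_iff)
  let ?K' = "image_ring j ?K"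
  have fK': "field ?K'" by (rule L.inj_imp_image_ring_is_field[OF j])
  have jh: "j \<in> ring_hom ?K ?K'" using inj_imp_image_ring_iso[OF j, of ?K] by (simp add: ring_iso_def)
  interpret rees A ?K' "j \<circ> ?e" I
    by (intro rees.intro rees_axioms.intro embedded_ideal.intro embedded_ideal_axioms.intro A fK' I
        ring_hom_trans[OF dom(2) jh] comp_inj_on[OF dom(3) j])
  obtain m where m: "\<one>\<^bsub>?K'\<^esub> \<in> ideal_prod ?K' ((j \<circ> ?e) ` I) (colon ?K' (Rm m) ((j \<circ> ?e) ` I))"
    by (rule conductor_condition_imp_Rm[OF cc])
  have "\<forall>r\<in>Rm m. \<forall>k\<in>J m. r \<otimes>\<^bsub>?K'\<^esub> k \<in> J m" by (simp add: Rm_iff)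
  from blow_up_iso_Spec[OF Rm_subring A_sub_Rm this m] show ?thesis
    unfolding is_affine_def using K.subring_of_embedding[OF Rm_subring] by blast
qed

theorem isomorphic_Spec_imp_conductor_condition:
  assumes A: "noetherian_domain A" and I: "ideal I A" "I \<noteq> {\<zero>\<^bsub>A\<^esub>}"
    and D: "cring D" and iso: "isomorphic_ringed_spaces (blow_up A I) (Spec D)"
  shows "conductor_condition A I"
proof -
  interpret A: noetherian_domain A by (rule A)
  interpret rees A "fraction_field A" "to_fraction_field A" I
    by (intro rees.intro rees_axioms.intro embedded_ideal.intro embedded_ideal_axioms.intro A.domain_axioms
        A.field_fraction_field A.to_fraction_field_hom A.to_fraction_field_inj I)
  obtain f F where "ringed_space_iso (blow_up A I) (Spec D) f F" using iso unfolding isomorphic_ringed_spaces_def by blast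
  then show ?thesis by (rule blow_up_iso_Spec_imp_conductor_condition[OF D _ A.noetherian_ring_axioms])
qed

(* (3) and (4) quantify over rings B and R of arbitrary size, but a HOL formula can only quantify
   over the rings on a given type. Hence the equivalence of (1)-(4) is stated with the rings on the
   type of the fraction field of A. It is supplemented by the assertion that a ring on any type
   'b, 'c, 'd as in (3), (4), (1) also implies these conditions. *)
theorem mainTheorem7:
  fixes A :: "('a, 'm) ring_scheme" and I :: "'a set"
  assumes "noetherian_domain A" and "ideal I A" and "I \<noteq> {\<zero>\<^bsub>A\<^esub>}"
  shows
    "let cond1 = is_affine (blow_up A I);
         cond2 = invertible_ideal (normalization A)
                   (extended_ideal (normalization A) (to_fraction_field A) I);
         cond3 = (\<exists>(B :: ('a \<times> 'a) set ring) \<phi>.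
                    domain B \<and> integral_extension A B \<phi> \<and>
                    invertible_ideal B (extended_ideal B \<phi> I));
         cond4 = (\<exists>(R :: ('a \<times> 'a) set ring) \<phi>.
                    domain R \<and> finite_extension A R \<phi> \<and>
                    invertible_ideal R (extended_ideal R \<phi> I))
     in (cond1 \<longleftrightarrow> cond2) \<and> (cond2 \<longleftrightarrow> cond3) \<and> (cond3 \<longleftrightarrow> cond4) \<and>
        (\<forall>(B :: 'b ring) \<phi>.
           domain B \<and> integral_extension A B \<phi> \<and>
           invertible_ideal B (extended_ideal B \<phi> I) \<longrightarrow> cond3) \<and>
        (\<forall>(R :: 'c ring) \<phi>.
           domain R \<and> finite_extension A R \<phi> \<and>
           invertible_ideal R (extended_ideal R \<phi> I) \<longrightarrow> cond4) \<and>
        (\<forall>R :: 'd ring.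
           cring R \<and> isomorphic_ringed_spaces (blow_up A I) (Spec R) \<longrightarrow> cond1)"
proof -
  interpret A: noetherian_domain A by (rule assms(1))
  interpret eA: embedded_ideal A "fraction_field A" "to_fraction_field A" I
    by (intro embedded_ideal.intro embedded_ideal_axioms.intro A.domain_axioms
        A.field_fraction_field A.to_fraction_field_hom A.to_fraction_field_inj assms(2))
  let ?cc = "conductor_condition A I"
  let ?N = "normalization A" and ?e = "to_fraction_field A"
  note N = eA.integral_closure_extension[folded A.normalization_eq]
    eA.conductor_condition_imp_integral_closure[OF A.noetherian_ring_axioms assms(3), folded A.normalization_eq]
  note ext = invertible_extension_imp_conductor_condition[OF assms]
  define cond1 where "cond1 = is_affine (blow_up A I)"
  define cond2 where "cond2 = invertible_ideal ?N (extended_ideal ?N ?e I)"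
  define cond3 where "cond3 = (\<exists>(B :: ('a \<times> 'a) set ring) \<phi>.
    domain B \<and> integral_extension A B \<phi> \<and> invertible_ideal B (extended_ideal B \<phi> I))"
  define cond4 where "cond4 = (\<exists>(R :: ('a \<times> 'a) set ring) \<phi>.
    domain R \<and> finite_extension A R \<phi> \<and> invertible_ideal R (extended_ideal R \<phi> I))"
  have 1: "cond1 = ?cc"
    unfolding cond1_def
    using conductor_condition_imp_affine[OF A.domain_axioms assms(2,3)] isomorphic_Spec_imp_conductor_condition[OF assms]
    unfolding is_affine_def by blast
  have 2: "cond2 = ?cc"
    unfolding cond2_def using ext[OF N(1,2)] N(3) by (rule iffI)
  have 3: "cond3 = ?cc"
  proof
    show ?cc if cond3 using that unfolding cond3_def by (elim exE conjE) (rule ext)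
    show cond3 if ?cc unfolding cond3_def using N(1,2) N(3)[OF that] by (intro exI[of _ ?N] exI[of _ ?e] conjI)
  qed
  have 4: "cond4 = ?cc"
  proof
    show ?cc if cond4
      using that unfolding cond4_def by (elim exE conjE) (rule ext[OF _ finite_extension_integral])
    assume cc: ?cc
    obtain H where "domain ((fraction_field A)\<lparr>carrier := H\<rparr>)" "finite_extension A ((fraction_field A)\<lparr>carrier := H\<rparr>) ?e"
      "invertible_ideal ((fraction_field A)\<lparr>carrier := H\<rparr>) (extended_ideal ((fraction_field A)\<lparr>carrier := H\<rparr>) ?e I)"
      by (rule eA.conductor_condition_imp_finite[OF A.noetherian_ring_axioms assms(3) cc])
    then show cond4 unfolding cond4_def by (intro exI conjI)
  qed
  \<comment> \<open>The implication to \<open>?cc\<close> does not depend on the type of the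
    extension, so it applies to rings on other types; the way back constructs a ring on the type of
    the fraction field.\<close>
  have 5: "cond3" if "domain B \<and> integral_extension A B \<phi> \<and> invertible_ideal B (extended_ideal B \<phi> I)" for B :: "'b ring" and \<phi>
    unfolding 3 using that by (elim conjE) (rule ext)
  have 6: "cond4" if "domain R \<and> finite_extension A R \<phi> \<and> invertible_ideal R (extended_ideal R \<phi> I)" for R :: "'c ring" and \<phi>
    unfolding 4 using that by (elim conjE) (rule ext[OF _ finite_extension_integral])
  have 7: "cond1" if "cring R \<and> isomorphic_ringed_spaces (blow_up A I) (Spec R)" for R :: "'d ring"
    unfolding 1 using that by (elim conjE) (rule isomorphic_Spec_imp_conductor_condition[OF assms])
  show ?thesis
    unfolding Let_def cond1_def[symmetric] cond2_def[symmetric] cond3_def[symmetric] cond4_def[symmetric]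
  proof (intro conjI allI impI)
    show "cond1 = cond2" unfolding 1 2 by (rule refl)
    show "cond2 = cond3" unfolding 2 3 by (rule refl)
    show "cond3 = cond4" unfolding 3 4 by (rule refl)
  qed (rule 5 6 7, assumption)+
qed

end
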